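(* Let $k$ be an algebraically closed field of characteristic $p>0$, let $G$ be a nontrivial finite group and let $\phi:G\hookrightarrow\mathrm{Aut}_k(k[[z]])$ be a local $G$-action. If $\phi$ lifts to characteristic $0$, then there exists a Hurwitz tree $\mathcal{T}$ of type $(G,p)$ such that $$a_{\mathcal{T}}=a_\phi\qquad\text{and}\qquad\delta_{\mathcal{T}}=0.$$
   Context: **Local actions.** A local $G$-action is a faithful $k$-linear action $\phi:G\hookrightarrow\mathrm{Aut}_k(k[[z]])$ on a ring of formal power series in one variable. It lifts to characteristic $0$ if there are a discrete valuation ring $R$ of characteristic zero with residue field $k$ and an action $\phi_R:G\hookrightarrow\mathrm{Aut}_R(R[[z]])$ reducing to $\phi$. The Artin character $a_\phi\in R^+(G)$ is given by $a_\phi(\sigma)=-\mathrm{ord}_z(\sigma(z)-z)$ for $\sigma\ne1$ and $a_\phi(1)=-\sum_{\sigma\ne1}a_\phi(\sigma)$. **Characters.** For a finite group $G$, $R(G)$ is the Grothendieck group of finitely generated $\mathbb{C}[G]$-modules, identified with virtual characters; $R^+(G)\subset R(G)$ is the submonoid of true characters. $1_G$, $r_G$ are the unit and regular characters and $u_G=r_G-1_G$. The scalar product is $\langle\chi_1,\chi_2\rangle_G=|G|^{-1}\sum_{\sigma}\overline{\chi_1(\sigma)}\chi_2(\sigma)$. $R(G,\mathbb{Q})=R(G)\otimes\mathbb{Q}$; an element $\chi$ is viewed as a class function or as the linear form $\psi\mapsto\chi(\psi):=\langle\psi,\chi\rangle_G$ on $R(G)$. $R^+(G,\mathbb{Q})$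 consists of those $\chi\in R(G,\mathbb{Q})$ with $\chi(\psi)\ge0$ for all $\psi\in R^+(G)$. For a subgroup $H\subset G$ and $\chi$ a (virtual, $\mathbb{Q}$-valued) character of $H$, $\chi^*$ denotes the induced one on $G$. For a cyclic group $P=\langle\sigma\rangle$ of order $p^m$, $\delta_P^{\mathrm{mult}}\in R(P,\mathbb{Q})$ is the class function with $\delta_P^{\mathrm{mult}}(\sigma^a)=-p^{i+1}/(p-1)$ for $a\not\equiv0\bmod p^m$, $i=\mathrm{ord}_p(a)<m$, and $\delta_P^{\mathrm{mult}}(1)=mp^m$. **Metric trees.** A rooted tree is a finite connected tree $T$ with vertex set $V$, edge set $E$ and a distinguished vertex $v_0$ (the root) adjacent to exactly one edge $e_0$ (the trunk). Edges are oriented away from the root: for $e\in E$, the source $s(e)$ is the endpoint in the same component of $T\setminus\{e\}$ as $v_0$, and the target $t(e)$ is the other one. If $v=s(e)$, $v'=t(e)$, then $v'$ is a successor of $v$, written $v\to v'$. Write $v_1\le v_2$ if there is an oriented path from $v_1$ to $v_2$. Leaves are the maximal vertices; $B$ is the set of leaves. A metric is a map $\epsilon:E\to\mathbb{Q}_{\ge0}$, $e\mapsto\epsilon_e$, with $\epsilon_e=0$ iff $t(e)\in B$. **Hurwitz trees.** A Hurwitz tree of type $(G,p)$ is a datum $\mathcal{T}=(T,[G_v],a_e,\delta_v)$ with $T=(T,\epsilon)$ a metric tree, $[G_v]$ the conjugacy class of a subgroup $G_v\subset G$ for each vertex $v$, $a_e\in R^+(G)$ for each edge $e$, and $\delta_v\in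 R^+(G,\mathbb{Q})$ for each vertex $v$, such that: - (H1) For every vertex $v$ and successor $v'$ of $v$, $G_{v'}\subset G_v$ up to conjugation in $G$. For every non-leaf $v\neq v_0$, $\sum_{v\to v'}[G_v:G_{v'}]>1$. The root $v_0$ has exactly one successor $v'$, and $G_{v_0}=G_{v'}=G$. - (H2) $G_b$ is nontrivial and cyclic for every $b\in B$. - (H3) For all $e\in E$: $a_e=\sum_{e':\,s(e')=t(e)}a_{e'}$ if $t(e)\notin B$, and $a_e=u_{G_b}^*$ if $b=t(e)\in B$. - (H4) For all $e\in E$: $\delta_{t(e)}=\delta_{s(e)}+\epsilon_e\cdot s_e$, where $s_e:=a_e-u_{G_{t(e)}}^*$. - (H5) For $b\in B$, $\delta_b=(\delta_{P_b}^{\mathrm{mult}})^*$, where $P_b$ is the Sylow $p$-subgroup of $G_b$. Put $\delta_{\mathcal{T}}:=\delta_{v_0}$ and $a_{\mathcal{T}}:=a_{e_0}$. *)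

theory Defs
  imports
    "HOL-Computational_Algebra.Computational_Algebra"
    "HOL-Library.Nonpos_Ints"
    "HOL-Algebra.Ring_Divisibility"
    "HOL-Algebra.QuotRing"
    "HOL-Algebra.Elementary_Groups"
    "Jordan_Normal_Form.Matrix"
    "Graph_Theory.Digraph_Component"
begin

section \<open>Local actions and their lifts\<close>

definition type_ring :: "'a::comm_ring_1 itself \<Rightarrow> 'a ring" where
  "type_ring _ = \<lparr>carrier = UNIV, mult = (*), one = 1, zero = 0, add = (+)\<rparr>"

text \<open>The group of \<open>A\<close>-algebra automorphisms of \<open>A[[z]]\<close>, under composition.\<close>

definition fps_Aut :: "('a::comm_ring_1 fps \<Rightarrow> 'a fps) monoid" where
  "fps_Aut = \<lparr>carrier = {f \<in> ring_iso (type_ring TYPE('a fps)) (type_ring TYPE('a fps)).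
                          \<forall>c x. f (fps_const c * x) = fps_const c * f x},
              mult = (\<circ>), one = id\<rparr>"

definition faithful_fps_action ::
    "('g, 'm) monoid_scheme \<Rightarrow> ('g \<Rightarrow> 'a::comm_ring_1 fps \<Rightarrow> 'a fps) \<Rightarrow> bool" where
  "faithful_fps_action G \<phi> \<longleftrightarrow> \<phi> \<in> hom G fps_Aut \<and> inj_on \<phi> (carrier G)"

abbreviation local_action ::
    "('g, 'm) monoid_scheme \<Rightarrow> ('g \<Rightarrow> 'k::field fps \<Rightarrow> 'k fps) \<Rightarrow> bool" where
  "local_action \<equiv> faithful_fps_action"

definition discrete_valuation_ring :: "('a, 'm) ring_scheme \<Rightarrow> bool" where
  "discrete_valuation_ring R \<longleftrightarrow>
     principal_domain R \<and> (\<exists>!P. primeideal P R \<and> P \<noteq> {\<zero>\<^bsub>R\<^esub>})"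

text \<open>
  The coefficient ring \<open>R\<close> of the lift is the type \<open>'r\<close>; HOL cannot quantify over types inside a
  formula, so \<open>\<phi>\<close> lifts to characteristic 0 iff this predicate holds for some \<open>'r\<close>.
  The map \<open>\<rho>\<close> is the reduction map onto the residue field: a local ring has only one maximal
  ideal, so a surjection of \<open>R\<close> onto a field is the same as an isomorphism of its residue field
  with that field.
\<close>

definition lifts_to_char_0 ::
    "'r::comm_ring_1 itself \<Rightarrow> ('g, 'm) monoid_scheme \<Rightarrow>
     ('g \<Rightarrow> 'k::field fps \<Rightarrow> 'k fps) \<Rightarrow> bool" where
  "lifts_to_char_0 _ G \<phi> \<longleftrightarrow>
     discrete_valuation_ring (type_ring TYPE('r)) \<and> CHAR('r) = 0 \<and>
     (\<exists>\<rho> (\<phi>\<^sub>R :: 'g \<Rightarrow> 'r fps \<Rightarrow> 'r fps).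
        \<rho> \<in> Ring.ring_hom (type_ring TYPE('r)) (type_ring TYPE('k)) \<and> surj \<rho> \<and>
        faithful_fps_action G \<phi>\<^sub>R \<and>
        (\<forall>\<sigma>\<in>carrier G. \<forall>f. Abs_fps (\<rho> \<circ> fps_nth (\<phi>\<^sub>R \<sigma> f)) = \<phi> \<sigma> (Abs_fps (\<rho> \<circ> fps_nth f))))"

definition artin_char ::
    "('g, 'm) monoid_scheme \<Rightarrow> ('g \<Rightarrow> 'k::field fps \<Rightarrow> 'k fps) \<Rightarrow> 'g \<Rightarrow> complex" where
  "artin_char G \<phi> \<sigma> =
     (let a = (\<lambda>\<tau>. - of_nat (subdegree (\<phi> \<tau> fps_X - fps_X)))
      in if \<sigma> = \<one>\<^bsub>G\<^esub> then - (\<Sum>\<tau>\<in>carrier G - {\<one>\<^bsub>G\<^esub>}. a \<tau>) else a \<sigma>)"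


section \<open>Characters\<close>

text \<open>
  Finitely generated \<open>\<complex>[G]\<close>-modules are given by matrix representations, of any degree \<open>n \<ge> 0\<close>,
  and elements of \<open>R(G)\<close> and \<open>R(G,\<rat>)\<close> are given by class functions. Only the values on
  \<open>carrier G\<close> are meaningful: membership in the sets below does not constrain the other values.
\<close>

definition mat_trace :: "'a::comm_monoid_add mat \<Rightarrow> 'a" where
  "mat_trace A = (\<Sum>i<dim_row A. A $$ (i, i))"

definition true_chars :: "('g, 'm) monoid_scheme \<Rightarrow> ('g \<Rightarrow> complex) set" where
  "true_chars G = {\<chi>. \<exists>n. \<exists>\<rho> \<in> hom G (units_of (ring_mat TYPE(complex) n ())).
                         \<forall>g\<in>carrier G. \<chi> g = mat_trace (\<rho> g)}"

definition virtual_chars :: "('g, 'm) monoid_scheme \<Rightarrow> ('g \<Rightarrow> complex) set" where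
  "virtual_chars G = {\<chi>. \<exists>\<chi>\<^sub>1\<in>true_chars G. \<exists>\<chi>\<^sub>2\<in>true_chars G. \<forall>g\<in>carrier G. \<chi> g = \<chi>\<^sub>1 g - \<chi>\<^sub>2 g}"

definition char_prod ::
    "('g, 'm) monoid_scheme \<Rightarrow> ('g \<Rightarrow> complex) \<Rightarrow> ('g \<Rightarrow> complex) \<Rightarrow> complex" where
  "char_prod G \<chi>\<^sub>1 \<chi>\<^sub>2 = (\<Sum>g\<in>carrier G. cnj (\<chi>\<^sub>1 g) * \<chi>\<^sub>2 g) / of_nat (card (carrier G))"

text \<open>Every element of \<open>R(G) \<otimes> \<rat>\<close> is a pure tensor (clear denominators).\<close>

definition rat_chars :: "('g, 'm) monoid_scheme \<Rightarrow> ('g \<Rightarrow> complex) set" where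
  "rat_chars G = {\<chi>. \<exists>\<psi>\<in>virtual_chars G. \<exists>q::rat. \<forall>g\<in>carrier G. \<chi> g = of_rat q * \<psi> g}"

definition pos_rat_chars :: "('g, 'm) monoid_scheme \<Rightarrow> ('g \<Rightarrow> complex) set" where
  "pos_rat_chars G = {\<chi>\<in>rat_chars G. \<forall>\<psi>\<in>true_chars G. char_prod G \<psi> \<chi> \<in> \<real>\<^sub>\<ge>\<^sub>0}"

text \<open>\<open>u\<^sub>H = r\<^sub>H - 1\<^sub>H\<close>; only its values on \<open>H\<close> matter.\<close>

definition aug_char :: "('g, 'm) monoid_scheme \<Rightarrow> 'g set \<Rightarrow> 'g \<Rightarrow> complex" where
  "aug_char G H g = (if g = \<one>\<^bsub>G\<^esub> then of_nat (card H) else 0) - 1"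

text \<open>The induced class function: \<open>\<chi>\<close> is extended by 0 outside \<open>H\<close> and averaged over conjugation.\<close>

definition ind_char ::
    "('g, 'm) monoid_scheme \<Rightarrow> 'g set \<Rightarrow> ('g \<Rightarrow> complex) \<Rightarrow> 'g \<Rightarrow> complex" where
  "ind_char G H \<chi> g =
     (\<Sum>x | x \<in> carrier G \<and> inv\<^bsub>G\<^esub> x \<otimes>\<^bsub>G\<^esub> g \<otimes>\<^bsub>G\<^esub> x \<in> H. \<chi> (inv\<^bsub>G\<^esub> x \<otimes>\<^bsub>G\<^esub> g \<otimes>\<^bsub>G\<^esub> x))
       / of_nat (card H)"

text \<open>
  The function \<open>\<delta>\<^sub>P\<close> for a cyclic subgroup \<open>P\<close> of order \<open>p\<^sup>m\<close>; the value depends neither on the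
  chosen generator \<open>\<sigma>\<close> nor on the chosen exponent \<open>a\<close>.
\<close>

definition delta_mult :: "nat \<Rightarrow> ('g, 'm) monoid_scheme \<Rightarrow> 'g set \<Rightarrow> 'g \<Rightarrow> complex" where
  "delta_mult p G P x =
     (let m = multiplicity p (card P);
          \<sigma> = (SOME \<sigma>. \<sigma> \<in> P \<and> generate G {\<sigma>} = P);
          a = (SOME a::nat. x = \<sigma> [^]\<^bsub>G\<^esub> a);
          i = multiplicity p a
      in if x = \<one>\<^bsub>G\<^esub> then of_nat (m * p ^ m) else - of_nat (p ^ (i + 1)) / of_nat (p - 1))"


section \<open>Rooted trees\<close>

text \<open>
  An undirected simple graph is a symmetric digraph (\<open>pair_graph\<close>), and its undirected edges are
  the two-element sets of end points. The predicate \<open>tree\<close> of Graph_Theory excludes directed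
  cycles, and in a symmetric digraph every edge, traversed back and forth, is a directed cycle of
  length 2; the cycles of the undirected graph are those of length at least 3.
\<close>

definition edges :: "'v pair_pre_digraph \<Rightarrow> 'v set set" where
  "edges T = {{u, v} | u v. (u, v) \<in> parcs T}"

definition undirected_tree :: "'v pair_pre_digraph \<Rightarrow> bool" where
  "undirected_tree T \<longleftrightarrow> pair_graph T \<and> Digraph_Component.connected (with_proj T) \<and>
     \<not> (\<exists>c. pre_digraph.cycle (with_proj T) c \<and> length c \<ge> 3)"

definition rooted_tree :: "'v pair_pre_digraph \<Rightarrow> 'v \<Rightarrow> bool" where
  "rooted_tree T r \<longleftrightarrow> undirected_tree T \<and>
     r \<in> pverts T \<and> (\<exists>!e. e \<in> edges T \<and> r \<in> e)"

definition trunk :: "'v pair_pre_digraph \<Rightarrow> 'v \<Rightarrow> 'v set" where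
  "trunk T r = (THE e. e \<in> edges T \<and> r \<in> e)"

definition remove_edge :: "'v pair_pre_digraph \<Rightarrow> 'v set \<Rightarrow> 'v pair_pre_digraph" where
  "remove_edge T e = T\<lparr>parcs := {(u, v) \<in> parcs T. {u, v} \<noteq> e}\<rparr>"

definition source :: "'v pair_pre_digraph \<Rightarrow> 'v \<Rightarrow> 'v set \<Rightarrow> 'v" where
  "source T r e = (THE v. v \<in> e \<and> r \<rightarrow>\<^sup>*\<^bsub>with_proj (remove_edge T e)\<^esub> v)"

definition target :: "'v pair_pre_digraph \<Rightarrow> 'v \<Rightarrow> 'v set \<Rightarrow> 'v" where
  "target T r e = (THE v. v \<in> e \<and> v \<noteq> source T r e)"

definition successor :: "'v pair_pre_digraph \<Rightarrow> 'v \<Rightarrow> 'v \<Rightarrow> 'v \<Rightarrow> bool" where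
  "successor T r v v' \<longleftrightarrow> (\<exists>e\<in>edges T. source T r e = v \<and> target T r e = v')"

definition leaves :: "'v pair_pre_digraph \<Rightarrow> 'v \<Rightarrow> 'v set" where
  "leaves T r = {v \<in> pverts T. \<forall>w\<in>pverts T. (successor T r)\<^sup>*\<^sup>* v w \<longrightarrow> w = v}"

definition metric_tree :: "'v pair_pre_digraph \<Rightarrow> 'v \<Rightarrow> ('v set \<Rightarrow> rat) \<Rightarrow> bool" where
  "metric_tree T r \<epsilon> \<longleftrightarrow> rooted_tree T r \<and>
     (\<forall>e\<in>edges T. \<epsilon> e \<ge> 0 \<and> (\<epsilon> e = 0 \<longleftrightarrow> target T r e \<in> leaves T r))"


section \<open>Hurwitz trees\<close>

definition conj_set :: "('g, 'm) monoid_scheme \<Rightarrow> 'g \<Rightarrow> 'g set \<Rightarrow> 'g set" where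
  "conj_set G g H = (\<lambda>h. g \<otimes>\<^bsub>G\<^esub> h \<otimes>\<^bsub>G\<^esub> inv\<^bsub>G\<^esub> g) ` H"

definition conj_class :: "('g, 'm) monoid_scheme \<Rightarrow> 'g set \<Rightarrow> 'g set set" where
  "conj_class G H = {conj_set G g H | g. g \<in> carrier G}"

definition sylow_subgroup :: "nat \<Rightarrow> ('g, 'm) monoid_scheme \<Rightarrow> 'g set \<Rightarrow> 'g set \<Rightarrow> bool" where
  "sylow_subgroup p G H P \<longleftrightarrow>
     subgroup P (G\<lparr>carrier := H\<rparr>) \<and> card P = p ^ multiplicity p (card H)"

record ('v, 'g) hurwitz_datum =
  tree_of :: "'v pair_pre_digraph"
  root :: "'v"
  eps :: "'v set \<Rightarrow> rat"
  vclass :: "'v \<Rightarrow> 'g set set"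
  echar :: "'v set \<Rightarrow> 'g \<Rightarrow> complex"
  vchar :: "'v \<Rightarrow> 'g \<Rightarrow> complex"

text \<open>
  A representative \<open>G\<^sub>v\<close> of the conjugacy class \<open>[G\<^sub>v]\<close>; the conditions on Hurwitz trees do not
  depend on the choice.
\<close>

definition vgroup :: "('v, 'g) hurwitz_datum \<Rightarrow> 'v \<Rightarrow> 'g set" where
  "vgroup \<T> v = (SOME H. H \<in> vclass \<T> v)"

text \<open>
  For a successor \<open>v'\<close> of \<open>v\<close>, a conjugate of the group of \<open>v'\<close> lies in that of \<open>v\<close>, so by Lagrange
  the quotient of the orders is exact and is the index. The group of a leaf is cyclic, so it has
  exactly one Sylow \<open>p\<close>-subgroup \<open>P\<close>.
\<close>

definition hurwitz_tree ::
    "('g, 'm) monoid_scheme \<Rightarrow> nat \<Rightarrow> ('v, 'g) hurwitz_datum \<Rightarrow> bool" where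
  "hurwitz_tree G p \<T> \<longleftrightarrow>
    (let T = tree_of \<T>; v\<^sub>0 = root \<T>; \<epsilon> = eps \<T>; a = echar \<T>; \<delta> = vchar \<T>;
         V = pverts T; E = edges T; B = leaves T v\<^sub>0;
         s = source T v\<^sub>0; t = target T v\<^sub>0; succ = successor T v\<^sub>0;
         Gr = vgroup \<T>
     in
       metric_tree T v\<^sub>0 \<epsilon> \<and>
       (\<forall>v\<in>V. \<exists>H. subgroup H G \<and> vclass \<T> v = conj_class G H) \<and>
       (\<forall>e\<in>E. a e \<in> true_chars G) \<and>
       (\<forall>v\<in>V. \<delta> v \<in> pos_rat_chars G) \<and>
       (\<forall>v\<in>V. \<forall>v'\<in>V. succ v v' \<longrightarrow> (\<exists>g\<in>carrier G. conj_set G g (Gr v') \<subseteq> Gr v)) \<and>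
       (\<forall>v\<in>V - B - {v\<^sub>0}. (\<Sum>v' | v' \<in> V \<and> succ v v'. card (Gr v) div card (Gr v')) > 1) \<and>
       (\<exists>!v'. v' \<in> V \<and> succ v\<^sub>0 v') \<and> Gr v\<^sub>0 = carrier G \<and>
       (\<forall>v'\<in>V. succ v\<^sub>0 v' \<longrightarrow> Gr v' = carrier G) \<and>
       (\<forall>b\<in>B. Gr b \<noteq> {\<one>\<^bsub>G\<^esub>} \<and> cyclic_group (G\<lparr>carrier := Gr b\<rparr>)) \<and>
       (\<forall>e\<in>E. \<forall>g\<in>carrier G.
          a e g = (if t e \<in> B then ind_char G (Gr (t e)) (aug_char G (Gr (t e))) g
                   else (\<Sum>e' | e' \<in> E \<and> s e' = t e. a e' g))) \<and>
       (\<forall>e\<in>E. \<forall>g\<in>carrier G.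
          \<delta> (t e) g = \<delta> (s e) g
            + of_rat (\<epsilon> e) * (a e g - ind_char G (Gr (t e)) (aug_char G (Gr (t e))) g)) \<and>
       (\<forall>b\<in>B. \<forall>g\<in>carrier G. \<forall>P. sylow_subgroup p G (Gr b) P \<longrightarrow>
          \<delta> b g = ind_char G P (delta_mult p G P) g))"

definition tree_artin :: "('v, 'g) hurwitz_datum \<Rightarrow> 'g \<Rightarrow> complex" where
  "tree_artin \<T> = echar \<T> (trunk (tree_of \<T>) (root \<T>))"

definition tree_depth :: "('v, 'g) hurwitz_datum \<Rightarrow> 'g \<Rightarrow> complex" where
  "tree_depth \<T> = vchar \<T> (root \<T>)"

end

theory Submission
  imports Defs "HOL-Algebra.Algebraic_Closure_Type" "HOL-Number_Theory.Number_Theory"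
    "Jordan_Normal_Form.Schur_Decomposition" "HOL-Computational_Algebra.Fraction_Field"
    "HOL-Algebra.Multiplicative_Group"
begin

text \<open>
  Complete the coefficient ring, embed it into an algebraically closed valued field, and let \<open>G\<close> act on the
  open unit disc of that field through the lifted power series. By Weierstrass preparation \<open>\<sigma> \<noteq> 1\<close> has as
  many fixed points, all simple, as the order of \<open>\<sigma>(z) - z\<close> in the reduction; the vertices of the tree are the
  orbits of the clusters of the finite set of all fixed points in the valuation metric, and the vertex groups
  are the stabilizers.

  The depth at a cluster \<open>D\<close> of radius \<open>\<rho>\<close> around \<open>b\<close> is induced from the stabilizer of \<open>D\<close>, where it has the value
  \<open>- |Stab D| m(\<sigma>)\<close> with \<open>m(\<sigma>) = (\<Sum>x\<in>Fix \<sigma>. min \<rho> (v (b - x))) - \<rho>\<close>. Evaluated at a generic point \<open>y\<close> of the disc this is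
  \<open>v (\<sigma> y - y) - \<rho>\<close>, so \<open>m\<close> is a filtration function: its superlevel sets are subgroups, which makes the depth a
  nonnegative rational combination of induced augmentation characters. Positive depth at \<open>D\<close> forces \<open>\<sigma>\<close> to fix every
  child of \<open>D\<close>, which yields the linear variation of the depth along the edges. At a leaf the stabilizer acts
  faithfully on the tangent space at the fixed point, hence is cyclic, and the depth is computed from the
  valuations of \<open>1 - \<zeta>\<close> for roots of unity \<open>\<zeta>\<close>.
\<close>

section \<open>Trees given by parent functions\<close>

text \<open>The ring of the lift need not be complete, and neither need the large field that
  supplies the fixed points. Completing the ring makes Weierstrass division available. Convergence
  in the large field is avoided altogether: every point of the disc is a root of a distinguished
  polynomial, and the value of a series there is the value of its remainder modulo that polynomial.
  Characteristic 0 enters twice. It makes the fixed points simple, since multiplier 1 at a fixed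
  point would force the order of \<open>G\<close> to have arbitrarily large valuation. It also makes
  the valuation of \<open>p\<close> a finite positive number; dividing by it gives \<open>p\<close>
  the value 1, which is the normalisation behind the constants of \<open>delta_mult\<close>. Class
  functions are compared only off the identity: Artin characters, induced augmentation characters
  and depths all have sum 0 over \<open>G\<close>, so their value at the identity is forced. The
  root is an extra vertex above the set of all fixed points. It stands for radius 0, where every
  truncated sum of valuations is 0, and this is the origin of the vanishing depth at the
  root.\<close>

locale parent_tree =
  fixes V :: "'v set" and r :: 'v and par :: "'v \<Rightarrow> 'v" and level :: "'v \<Rightarrow> nat"
  assumes finV: "finite V" and rV: "r \<in> V"
    and par_in: "v \<in> V \<Longrightarrow> v \<noteq> r \<Longrightarrow> par v \<in> V"
    and level_par: "v \<in> V \<Longrightarrow> v \<noteq> r \<Longrightarrow> level (par v) < level v"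
begin

definition T :: "'v pair_pre_digraph" where
  "T = \<lparr>pverts = V, parcs = (\<lambda>v. (v, par v)) ` (V - {r}) \<union> (\<lambda>v. (par v, v)) ` (V - {r})\<rparr>"

lemma pverts_T [simp]: "pverts T = V"
  by (simp add: T_def)

lemma parcs_T_iff: "(u, v) \<in> parcs T \<longleftrightarrow>
    (u \<in> V \<and> u \<noteq> r \<and> v = par u) \<or> (v \<in> V \<and> v \<noteq> r \<and> u = par v)"
  by (auto simp: T_def)

lemma edges_T: "edges T = (\<lambda>v. {v, par v}) ` (V - {r})"
  unfolding edges_def by (auto simp: parcs_T_iff insert_commute)

lemma edge_in: "v \<in> V \<Longrightarrow> v \<noteq> r \<Longrightarrow> {v, par v} \<in> edges T"
  by (auto simp: edges_T)

lemma par_neq: "v \<in> V \<Longrightarrow> v \<noteq> r \<Longrightarrow> par v \<noteq> v"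
  using level_par by (metis less_irrefl)

lemma edge_eq_iff:
  assumes "u \<in> V" "u \<noteq> r" "v \<in> V" "v \<noteq> r"
  shows "{u, par u} = {v, par v} \<longleftrightarrow> u = v"
proof
  assume "{u, par u} = {v, par v}"
  then have "u = v \<or> (u = par v \<and> v = par u)"
    by (auto simp: doubleton_eq_iff)
  moreover have "\<not> (u = par v \<and> v = par u)"
    using level_par[of u] level_par[of v] assms by auto
  ultimately show "u = v" by blast
qed simp

lemma pair_graph_T: "pair_graph T"
proof
  show "finite (pverts T)" by (simp add: finV)
  show "finite (parcs T)" by (simp add: T_def finV)
  show "symmetric (with_proj T)"
    by (auto simp: symmetric_def sym_def arcs_ends_def arc_to_ends_def parcs_T_iff image_iff)
qed (use par_neq in \<open>auto simp: parcs_T_iff par_in, metis+\<close>)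

abbreviation anc :: "('v \<times> 'v) set" where "anc \<equiv> {(u, par u) | u. u \<in> V \<and> u \<noteq> r}"

lemma reachable_mono_set:
  assumes "pverts T' = V" "A \<subseteq> parcs T'"
    "(a, b) \<in> A\<^sup>*" "A \<subseteq> V \<times> V" "a \<in> V"
  shows "a \<rightarrow>\<^sup>*\<^bsub>with_proj T'\<^esub> b"
  using assms(3)
proof (induction rule: rtrancl_induct)
  case base
  then show ?case using assms by (simp add: reachable_def)
next
  case (step y z)
  have "(y, z) \<in> arcs_ends (with_proj T')"
    using step assms(2) by (auto simp: arcs_ends_def arc_to_ends_def image_iff)
  moreover have "y \<in> V" "z \<in> V" using step assms(4) by auto
  ultimately show ?case using step.IH assms(1)
    by (auto simp: reachable_def intro: rtrancl_on_into_rtrancl_on)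
qed

lemma anc_root: "v \<in> V \<Longrightarrow> (v, r) \<in> anc\<^sup>*"
proof (induction "level v" arbitrary: v rule: less_induct)
  case less
  show ?case
  proof (cases "v = r")
    case False
    then have "(par v, r) \<in> anc\<^sup>*" using less level_par par_in by blast
    moreover have "(v, par v) \<in> anc" using less False by blast
    ultimately show ?thesis by (rule converse_rtrancl_into_rtrancl[rotated])
  qed simp
qed

lemma connected_T: "Digraph_Component.connected (with_proj T)"
proof -
  have sym: "mk_symmetric (with_proj T) = T"
  proof -
    have "(\<Union>e\<in>parcs T. {(fst e, snd e), (snd e, fst e)}) = parcs T"
      by (auto simp: parcs_T_iff; force simp: parcs_T_iff)
    then show ?thesis by (simp add: mk_symmetric_def)
  qed
  have A: "anc \<union> anc\<inverse> \<subseteq> parcs T" "anc \<union> anc\<inverse> \<subseteq> V \<times> V"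
    by (auto simp: parcs_T_iff par_in)
  have "u \<rightarrow>\<^sup>*\<^bsub>with_proj T\<^esub> v" if "u \<in> V" "v \<in> V" for u v
  proof (rule reachable_mono_set[OF _ A(1) _ A(2)])
    have "(u, r) \<in> (anc \<union> anc\<inverse>)\<^sup>*" using anc_root[OF that(1)] by (meson Un_upper1 rtrancl_mono subsetD)
    moreover have "(r, v) \<in> (anc\<inverse>)\<^sup>*" using rtrancl_converseI[OF anc_root[OF that(2)]] .
    then have "(r, v) \<in> (anc \<union> anc\<inverse>)\<^sup>*" by (meson Un_upper2 rtrancl_mono subsetD)
    ultimately show "(u, v) \<in> (anc \<union> anc\<inverse>)\<^sup>*" by (rule rtrancl_trans)
  qed (use that in auto)
  then show ?thesis
    unfolding connected_def sym strongly_connected_def using rV by auto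
qed

lemma cas_nth:
  "pre_digraph.cas (with_proj T) u p v \<Longrightarrow> p \<noteq> [] \<Longrightarrow>
     fst (p ! 0) = u \<and> snd (last p) = v \<and> (\<forall>i. Suc i < length p \<longrightarrow> fst (p ! Suc i) = snd (p ! i))"
proof (induction p arbitrary: u)
  case (Cons e p)
  have c: "fst e = u" "pre_digraph.cas (with_proj T) (snd e) p v"
    using Cons.prems by (auto simp: pre_digraph.cas.simps)
  show ?case
  proof (cases "p = []")
    case True
    then show ?thesis using c by (auto simp: pre_digraph.cas.simps)
  next
    case False
    from Cons.IH[OF c(2) this] c(1) False show ?thesis
      by (auto simp: nth_Cons split: nat.splits)
  qed
qed simp


lemma neighbour_of_max:
  assumes "(u, x) \<in> parcs T \<or> (x, u) \<in> parcs T" "level u \<le> level x"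
  shows "u = par x"
  using assms level_par[of u] by (auto simp: parcs_T_iff)

text \<open>At a vertex of maximal level on the cycle, both neighbours along the cycle must be its
  parent. They are then equal, although the vertices of a cycle are distinct and length at least 3
  keeps the two positions apart.\<close>

lemma no_cycle: "\<not> (\<exists>c. pre_digraph.cycle (with_proj T) c \<and> length c \<ge> 3)"
proof
  assume "\<exists>c. pre_digraph.cycle (with_proj T) c \<and> length c \<ge> 3"
  then obtain p u where p: "length p \<ge> 3" "pre_digraph.awalk (with_proj T) u p u"
    "distinct (tl (pre_digraph.awalk_verts (with_proj T) u p))"
    by (auto simp: pre_digraph.cycle_def)
  define n where "n = length p"
  \<comment> \<open>Heads of the arcs: the vertices of the cycle, with the repeated starting point
    counted once.\<close>
  define h where "h i = snd (p ! i)" for i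
  have cas: "pre_digraph.cas (with_proj T) u p u" and arcs: "set p \<subseteq> parcs T"
    using p(2) by (auto simp: pre_digraph.awalk_def)
  have ne: "p \<noteq> []" using p(1) by auto
  have verts: "pre_digraph.awalk_verts (with_proj T) u p = u # map snd p"
    if "pre_digraph.cas (with_proj T) u p v" for u v p
    using that by (induction p arbitrary: u) (auto simp: pre_digraph.awalk_verts.simps pre_digraph.cas.simps)
  have dist: "distinct (map snd p)" using p(3) verts[OF cas] by simp
  note nth = cas_nth[OF cas ne]
  have arc: "(h i, h (Suc i mod n)) \<in> parcs T" if "i < n" for i
  proof -
    have "fst (p ! (Suc i mod n)) = h i"
    proof (cases "Suc i < n")
      case True
      then show ?thesis using nth by (simp add: n_def h_def)
    next
      case False
      then have i: "Suc i = n" using that by simp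
      have "fst (p ! 0) = snd (p ! (n - 1))" using nth last_conv_nth[OF ne] by (simp add: n_def)
      moreover have "n - 1 = i" "Suc i mod n = 0" using i by auto
      ultimately show ?thesis by (simp only: h_def)
    qed
    moreover have "p ! (Suc i mod n) \<in> parcs T"
      using arcs p(1) by (metis n_def length_0_conv ne mod_less_divisor neq0_conv nth_mem subsetD)
    ultimately show ?thesis by (metis h_def prod.collapse)
  qed
  have n3: "n \<ge> 3" using p(1) n_def by simp
  obtain i where i: "i < n" "\<And>j. j < n \<Longrightarrow> level (h j) \<le> level (h i)"
  proof -
    have "finite ((\<lambda>j. level (h j)) ` {..<n})" "(\<lambda>j. level (h j)) ` {..<n} \<noteq> {}" using n3 by (auto simp: lessThan_empty_iff)
    then obtain i where "i < n" "level (h i) = Max ((\<lambda>j. level (h j)) ` {..<n})"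
      using Max_in by (metis (mono_tags, lifting) imageE lessThan_iff)
    then show ?thesis using that by auto
  qed
  \<comment> \<open>The cyclic successor and predecessor of the position \<open>i\<close> of maximal
    level.\<close>
  define j k where "j = Suc i mod n" and "k = (if i = 0 then n - 1 else i - 1)"
  have jk: "j < n" "k < n" "Suc k mod n = i" using i n3 by (auto simp: j_def k_def)
  have "h j = par (h i)" using arc[OF i(1)] i(2)[OF jk(1)] neighbour_of_max by (simp add: j_def)
  moreover have "h k = par (h i)" using arc[OF jk(2)] i(2)[OF jk(2)] neighbour_of_max jk(3) by simp
  ultimately have "j = k" using dist jk n_def h_def
    by (metis (no_types, lifting) distinct_conv_nth length_map nth_map)
  then show False using n3 i(1) unfolding j_def k_def
    by (cases "Suc i = n") (auto split: if_splits)
qed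

lemma undirected_tree_T: "undirected_tree T"
  unfolding undirected_tree_def using pair_graph_T connected_T no_cycle by blast

text \<open>Vertices of level below that of \<open>v\<close> are reached from the root by arcs that
  avoid the removed edge. Conversely, the removed edge is the only entrance to the subtree below
  \<open>v\<close>, so no vertex that is still reachable from the root has \<open>v\<close> as an
  ancestor.\<close>

lemma source_target:
  assumes v: "v \<in> V" "v \<noteq> r"
  shows "source T r {v, par v} = par v" "target T r {v, par v} = v"
proof -
  let ?T = "remove_edge T {v, par v}"
  have pv: "pverts ?T = V" by (simp add: remove_edge_def)
  have arcs: "(a, b) \<in> parcs ?T \<longleftrightarrow> (a, b) \<in> parcs T \<and> {a, b} \<noteq> {v, par v}" for a b
    by (simp add: remove_edge_def)
  let ?A = "{(par u, u) | u. u \<in> V \<and> u \<noteq> r \<and> u \<noteq> v}"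
  have 1: "r \<rightarrow>\<^sup>*\<^bsub>with_proj ?T\<^esub> par v"
  proof (rule reachable_mono_set[OF pv, of ?A])
    show "?A \<subseteq> parcs ?T"
      using edge_eq_iff v by (auto simp: arcs parcs_T_iff insert_commute)
    show "?A \<subseteq> V \<times> V" using par_in by auto
    have "(w, r) \<in> (?A\<inverse>)\<^sup>*" if "w \<in> V" "level w < level v" for w
      using that
    proof (induction "level w" arbitrary: w rule: less_induct)
      case less
      show ?case
      proof (cases "w = r")
        case False
        then have "(par w, r) \<in> (?A\<inverse>)\<^sup>*" using less level_par par_in
          by (meson dual_order.strict_trans)
        moreover have "(w, par w) \<in> ?A\<inverse>" using less False by blast
        ultimately show ?thesis by (rule converse_rtrancl_into_rtrancl[rotated])
      qed simp
    qed
    then have "(par v, r) \<in> (?A\<inverse>)\<^sup>*" using par_in level_par v by blast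
    then show "(r, par v) \<in> ?A\<^sup>*" by (simp add: rtrancl_converse)
  qed (rule rV)
  have 2: "(y, v) \<notin> anc\<^sup>*" if "r \<rightarrow>\<^sup>*\<^bsub>with_proj ?T\<^esub> y" for y
    using that unfolding reachable_def
  proof (induction rule: rtrancl_on_induct)
    case base
    show ?case
    proof
      assume "(r, v) \<in> anc\<^sup>*"
      then show False using v by (cases rule: converse_rtranclE) auto
    qed
  next
    case (step b c)
    from step.hyps have "(b, c) \<in> parcs T" and ne: "{b, c} \<noteq> {v, par v}"
      by (auto simp: arcs_ends_def arc_to_ends_def arcs)
    then consider "b \<in> V" "b \<noteq> r" "c = par b" | "c \<in> V" "c \<noteq> r" "b = par c"
      by (auto simp: parcs_T_iff)
    then show ?case
    proof cases
      case 1
      then have "(b, c) \<in> anc" by blast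
      then show ?thesis using step.IH by (meson converse_rtrancl_into_rtrancl)
    next
      case 2
      have "c \<noteq> v" using ne 2 by (auto simp: insert_commute)
      show ?thesis
      proof
        assume "(c, v) \<in> anc\<^sup>*"
        then show False
          using \<open>c \<noteq> v\<close> 2 step.IH by (cases rule: converse_rtranclE) auto
      qed
    qed
  qed
  show s: "source T r {v, par v} = par v"
    unfolding source_def
  proof (rule the_equality)
    fix w assume "w \<in> {v, par v} \<and> r \<rightarrow>\<^sup>*\<^bsub>with_proj ?T\<^esub> w"
    then show "w = par v" using 2 by blast
  qed (use 1 in auto)
  show "target T r {v, par v} = v"
    unfolding target_def s using par_neq[OF v] by (intro the_equality) auto
qed

lemma successor_iff: "successor T r u v \<longleftrightarrow> v \<in> V \<and> v \<noteq> r \<and> par v = u"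
  unfolding successor_def edges_T using source_target by auto

lemma leaves_eq: "leaves T r = {v \<in> V. \<forall>w\<in>V. w \<noteq> r \<longrightarrow> par w \<noteq> v}"
proof (rule Set.set_eqI, rule iffI)
  fix v assume v: "v \<in> leaves T r"
  show "v \<in> {v \<in> V. \<forall>w\<in>V. w \<noteq> r \<longrightarrow> par w \<noteq> v}"
  proof (clarsimp, intro conjI ballI impI notI)
    show "v \<in> V" using v by (simp add: leaves_def)
    fix w assume "w \<in> V" "w \<noteq> r" "par w = v"
    then have "(successor T r)\<^sup>*\<^sup>* v w" by (auto simp: successor_iff)
    then show False using v \<open>w \<in> V\<close> \<open>w \<noteq> r\<close> \<open>par w = v\<close> par_neq[of w] unfolding leaves_def by auto
  qed
next
  fix v assume v: "v \<in> {v \<in> V. \<forall>w\<in>V. w \<noteq> r \<longrightarrow> par w \<noteq> v}"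
  show "v \<in> leaves T r"
    unfolding leaves_def
  proof (clarsimp, intro conjI ballI impI)
    show "v \<in> V" using v by simp
    fix w assume "(successor T r)\<^sup>*\<^sup>* v w"
    then show "w = v" using v by (cases rule: converse_rtranclpE) (auto simp: successor_iff)
  qed
qed

lemma rooted_tree_T:
  assumes "\<exists>!v. v \<in> V \<and> v \<noteq> r \<and> par v = r"
  shows "rooted_tree T r"
  unfolding rooted_tree_def
proof (intro conjI undirected_tree_T)
  show "r \<in> pverts T" by (simp add: rV)
  obtain v where v: "v \<in> V" "v \<noteq> r" "par v = r"
      "\<And>w. w \<in> V \<Longrightarrow> w \<noteq> r \<Longrightarrow> par w = r \<Longrightarrow> w = v"
    using assms by (metis (no_types))
  show "\<exists>!e. e \<in> edges T \<and> r \<in> e"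
  proof (rule ex1I[of _ "{v, par v}"])
    show "{v, par v} \<in> edges T \<and> r \<in> {v, par v}" using v edge_in by blast
    fix e assume "e \<in> edges T \<and> r \<in> e"
    then obtain w where w: "w \<in> V" "w \<noteq> r" "e = {w, par w}" "r = par w" by (auto simp: edges_T)
    then show "e = {v, par v}" using v(4)[OF w(1,2) w(4)[symmetric]] by simp
  qed
qed

lemma trunk_eq:
  assumes "v \<in> V" "v \<noteq> r" "par v = r" "\<And>w. w \<in> V \<Longrightarrow> w \<noteq> r \<Longrightarrow> par w = r \<Longrightarrow> w = v"
  shows "trunk T r = {v, par v}"
  unfolding trunk_def
proof (rule the_equality)
  show "{v, par v} \<in> edges T \<and> r \<in> {v, par v}" using assms(1-3) edge_in by blast
  fix e assume "e \<in> edges T \<and> r \<in> e"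
  then obtain w where w: "w \<in> V" "w \<noteq> r" "e = {w, par w}" "r = par w" by (auto simp: edges_T)
  then show "e = {v, par v}" using assms(4)[OF w(1,2) w(4)[symmetric]] by simp
qed

definition leaf :: "'v \<Rightarrow> bool" where
  "leaf v \<longleftrightarrow> v \<in> V \<and> (\<forall>w\<in>V. w \<noteq> r \<longrightarrow> par w \<noteq> v)"

text \<open>Edges correspond to their lower end points, so functions on vertices become functions on
  edges by composition with \<open>child\<close>.\<close>

definition child :: "'v set \<Rightarrow> 'v" where "child e = target T r e"

lemma child_edge: "v \<in> V \<Longrightarrow> v \<noteq> r \<Longrightarrow> child {v, par v} = v"
  by (simp add: child_def source_target)

end

section \<open>Assembling a Hurwitz tree from data on the vertices\<close>

locale hurwitz_builder = parent_tree V r par level + group G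
  for V :: "'v set" and r par level and G :: "('g, 'm) monoid_scheme" (structure) +
  fixes p :: nat and v1 :: 'v and Gv :: "'v \<Rightarrow> 'g set" and \<epsilon> :: "'v \<Rightarrow> rat"
    and a \<delta> :: "'v \<Rightarrow> 'g \<Rightarrow> complex"
  assumes v1: "v1 \<in> V" "v1 \<noteq> r" "par v1 = r" "\<And>w. w \<in> V \<Longrightarrow> w \<noteq> r \<Longrightarrow> par w = r \<Longrightarrow> w = v1"
    and eps: "\<And>v. v \<in> V \<Longrightarrow> v \<noteq> r \<Longrightarrow> \<epsilon> v \<ge> 0"
      "\<And>v. v \<in> V \<Longrightarrow> v \<noteq> r \<Longrightarrow> \<epsilon> v = 0 \<longleftrightarrow> leaf v"
    and Gv: "\<And>v. v \<in> V \<Longrightarrow> subgroup (Gv v) G"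
    and a_char: "\<And>v. v \<in> V \<Longrightarrow> v \<noteq> r \<Longrightarrow> a v \<in> true_chars G"
    and d_char: "\<And>v. v \<in> V \<Longrightarrow> \<delta> v \<in> pos_rat_chars G"
    and mono: "\<And>v H H'. v \<in> V \<Longrightarrow> v \<noteq> r \<Longrightarrow> H' \<in> conj_class G (Gv v) \<Longrightarrow> H \<in> conj_class G (Gv (par v)) \<Longrightarrow>
      \<exists>g\<in>carrier G. conj_set G g H' \<subseteq> H"
    and branch: "\<And>v. v \<in> V \<Longrightarrow> v \<noteq> r \<Longrightarrow> \<not> leaf v \<Longrightarrow>
      (\<Sum>w | w \<in> V \<and> w \<noteq> r \<and> par w = v. card (Gv v) div card (Gv w)) > 1"
    and Gr: "Gv r = carrier G" and Gv1: "Gv v1 = carrier G"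
    and leaf_grp: "\<And>v H. leaf v \<Longrightarrow> H \<in> conj_class G (Gv v) \<Longrightarrow>
       H \<noteq> {\<one>} \<and> cyclic_group (G\<lparr>carrier := H\<rparr>)"
    and a_leaf: "\<And>v H g. leaf v \<Longrightarrow> v \<noteq> r \<Longrightarrow> H \<in> conj_class G (Gv v) \<Longrightarrow> g \<in> carrier G \<Longrightarrow>
       a v g = ind_char G H (aug_char G H) g"
    and a_sum: "\<And>v g. v \<in> V \<Longrightarrow> v \<noteq> r \<Longrightarrow> \<not> leaf v \<Longrightarrow> g \<in> carrier G \<Longrightarrow>
       a v g = (\<Sum>w | w \<in> V \<and> w \<noteq> r \<and> par w = v. a w g)"
    and d_step: "\<And>v H g. v \<in> V \<Longrightarrow> v \<noteq> r \<Longrightarrow> H \<in> conj_class G (Gv v) \<Longrightarrow> g \<in> carrier G \<Longrightarrow>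
       \<delta> v g = \<delta> (par v) g + of_rat (\<epsilon> v) * (a v g - ind_char G H (aug_char G H) g)"
    and d_leaf: "\<And>v H P g. leaf v \<Longrightarrow> H \<in> conj_class G (Gv v) \<Longrightarrow> sylow_subgroup p G H P \<Longrightarrow> g \<in> carrier G \<Longrightarrow>
       \<delta> v g = ind_char G P (delta_mult p G P) g"
    and finG: "finite (carrier G)"
begin

text \<open>The datum stores only conjugacy classes, and \<open>vgroup\<close> picks some
  representative; this is why the assumptions of the locale that involve the group itself range over
  all its conjugates.\<close>

definition datum :: "('v, 'g) hurwitz_datum" where
  "datum = \<lparr>tree_of = T, root = r, eps = \<epsilon> \<circ> child, vclass = (\<lambda>v. conj_class G (Gv v)),
     echar = a \<circ> child, vchar = \<delta>\<rparr>"

lemma datum_simps [simp]: "tree_of datum = T" "root datum = r" "eps datum = \<epsilon> \<circ> child"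
  "vclass datum = (\<lambda>v. conj_class G (Gv v))" "echar datum = a \<circ> child" "vchar datum = \<delta>"
  by (simp_all add: datum_def)

lemma self_conj: "v \<in> V \<Longrightarrow> Gv v \<in> conj_class G (Gv v)"
proof -
  assume v: "v \<in> V"
  have "conj_set G \<one> (Gv v) = Gv v"
    unfolding conj_set_def using subgroup.mem_carrier[OF Gv[OF v]] by force
  then show ?thesis unfolding conj_class_def by (metis (mono_tags, lifting) mem_Collect_eq one_closed)
qed

lemma vgroup_in: "v \<in> V \<Longrightarrow> vgroup datum v \<in> conj_class G (Gv v)"
  unfolding vgroup_def by (auto intro: someI self_conj)

lemma conj_carrier: "g \<in> carrier G \<Longrightarrow> conj_set G g (carrier G) = carrier G"
proof -
  assume g: "g \<in> carrier G"
  have "x \<in> conj_set G g (carrier G)" if x: "x \<in> carrier G" for x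
  proof -
    have "x = g \<otimes> (inv g \<otimes> x \<otimes> g) \<otimes> inv g"
      using g x by (simp add: m_assoc[symmetric]) (simp add: m_assoc)
    then show ?thesis unfolding conj_set_def using g x by blast
  qed
  moreover have "conj_set G g (carrier G) \<subseteq> carrier G" using g by (auto simp: conj_set_def)
  ultimately show ?thesis by blast
qed

lemma card_conj: "H \<in> conj_class G (Gv v) \<Longrightarrow> v \<in> V \<Longrightarrow> card H = card (Gv v)"
proof -
  assume H: "H \<in> conj_class G (Gv v)" and v: "v \<in> V"
  then obtain g where g: "g \<in> carrier G" "H = conj_set G g (Gv v)" by (auto simp: conj_class_def)
  have "inj_on (\<lambda>h. g \<otimes> h \<otimes> inv g) (Gv v)"
    using g subgroup.mem_carrier[OF Gv[OF v]] by (intro inj_onI) simp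
  then show ?thesis using g by (simp add: conj_set_def card_image)
qed

lemma vgroup_whole: "v \<in> V \<Longrightarrow> Gv v = carrier G \<Longrightarrow> vgroup datum v = carrier G"
  using vgroup_in[of v] conj_carrier by (auto simp: conj_class_def)

lemma leaves_leaf: "leaves T r = {v. leaf v}"
  by (auto simp: leaves_eq leaf_def)

lemma hurwitz_datum: "hurwitz_tree G p datum"
proof -
  have root: "\<not> leaf r" using v1(1-3) rV by (auto simp: leaf_def)
  have lV: "leaf v \<Longrightarrow> v \<in> V" for v by (simp add: leaf_def)
  have sums: "(\<Sum>e' | e' \<in> edges T \<and> source T r e' = v. a (child e') g) =
     (\<Sum>w | w \<in> V \<and> w \<noteq> r \<and> par w = v. a w g)" for v g
  proof (rule sum.reindex_bij_witness[of _ "\<lambda>w. {w, par w}" child])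
  qed (auto simp: edges_T source_target child_edge)
  show ?thesis
    unfolding hurwitz_tree_def Let_def
  proof (intro conjI)
    show "metric_tree (tree_of datum) (root datum) (eps datum)"
      unfolding metric_tree_def
    proof (intro conjI)
      show "rooted_tree (tree_of datum) (root datum)"
        unfolding datum_simps
        by (intro rooted_tree_T ex1I[of _ v1]) (use v1 in \<open>blast+\<close>)
    qed (use eps in \<open>auto simp: edges_T child_edge source_target leaves_leaf\<close>)
    show "\<forall>v\<in>pverts (tree_of datum). \<exists>H. subgroup H G \<and> vclass datum v = conj_class G H"
      using Gv by auto
    show "\<forall>e\<in>edges (tree_of datum). echar datum e \<in> true_chars G"
      using a_char by (auto simp: edges_T child_edge)
    show "\<forall>v\<in>pverts (tree_of datum). vchar datum v \<in> pos_rat_chars G"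
      using d_char by auto
    show "\<forall>v\<in>pverts (tree_of datum). \<forall>v'\<in>pverts (tree_of datum).
       successor (tree_of datum) (root datum) v v' \<longrightarrow>
       (\<exists>g\<in>carrier G. conj_set G g (vgroup datum v') \<subseteq> vgroup datum v)"
    proof (intro ballI impI)
      fix v v' assume "v' \<in> pverts (tree_of datum)" "successor (tree_of datum) (root datum) v v'"
      then have v': "v' \<in> V" "v' \<noteq> r" "par v' = v" by (auto simp: successor_iff)
      show "\<exists>g\<in>carrier G. conj_set G g (vgroup datum v') \<subseteq> vgroup datum v"
        using mono[OF v'(1,2) vgroup_in[OF v'(1)] vgroup_in[OF par_in[OF v'(1,2)]]] v'(3) by simp
    qed
    show "\<forall>v\<in>pverts (tree_of datum) - leaves (tree_of datum) (root datum) - {root datum}.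
       1 < (\<Sum>v' | v' \<in> pverts (tree_of datum) \<and> successor (tree_of datum) (root datum) v v'.
              card (vgroup datum v) div card (vgroup datum v'))"
    proof
      fix v assume v: "v \<in> pverts (tree_of datum) - leaves (tree_of datum) (root datum) - {root datum}"
      then have v': "v \<in> V" "v \<noteq> r" "\<not> leaf v" by (auto simp: leaves_leaf)
      have "(\<Sum>w | w \<in> V \<and> w \<noteq> r \<and> par w = v. card (Gv v) div card (Gv w)) =
        (\<Sum>v' | v' \<in> pverts (tree_of datum) \<and> successor (tree_of datum) (root datum) v v'.
              card (vgroup datum v) div card (vgroup datum v'))"
        using v' by (intro sum.cong) (auto simp: successor_iff card_conj[OF vgroup_in])
      then show "1 < (\<Sum>v' | v' \<in> pverts (tree_of datum) \<and> successor (tree_of datum) (root datum) v v'.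
              card (vgroup datum v) div card (vgroup datum v'))"
        using branch[OF v'] by simp
    qed
    show "\<exists>!v'. v' \<in> pverts (tree_of datum) \<and> successor (tree_of datum) (root datum) (root datum) v'"
    proof (rule ex1I[of _ v1])
      show "v1 \<in> pverts (tree_of datum) \<and> successor (tree_of datum) (root datum) (root datum) v1"
        using v1(1-3) by (simp add: successor_iff)
      fix w assume "w \<in> pverts (tree_of datum) \<and> successor (tree_of datum) (root datum) (root datum) w"
      then show "w = v1" by (intro v1(4)) (auto simp: successor_iff)
    qed
    show "vgroup datum (root datum) = carrier G"
      using vgroup_whole[OF rV Gr] by simp
    show "\<forall>v'\<in>pverts (tree_of datum). successor (tree_of datum) (root datum) (root datum) v' \<longrightarrow>
       vgroup datum v' = carrier G"
    proof (intro ballI impI)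
      fix w assume "successor (tree_of datum) (root datum) (root datum) w"
      then have "w = v1" by (intro v1(4)) (auto simp: successor_iff)
      then show "vgroup datum w = carrier G" using vgroup_whole[OF v1(1) Gv1] by simp
    qed
    show "\<forall>b\<in>leaves (tree_of datum) (root datum). vgroup datum b \<noteq> {\<one>} \<and>
       cyclic_group (G\<lparr>carrier := vgroup datum b\<rparr>)"
      unfolding datum_simps leaves_leaf using leaf_grp vgroup_in lV by blast
    show "\<forall>e\<in>edges (tree_of datum). \<forall>g\<in>carrier G. echar datum e g =
        (if target (tree_of datum) (root datum) e \<in> leaves (tree_of datum) (root datum)
         then ind_char G (vgroup datum (target (tree_of datum) (root datum) e))
               (aug_char G (vgroup datum (target (tree_of datum) (root datum) e))) g
         else (\<Sum>e' | e' \<in> edges (tree_of datum) \<and>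
             source (tree_of datum) (root datum) e' = target (tree_of datum) (root datum) e.
             echar datum e' g))"
    proof (intro ballI)
      fix e g assume e: "e \<in> edges (tree_of datum)" and g: "g \<in> carrier G"
      then obtain v where v: "v \<in> V" "v \<noteq> r" "e = {v, par v}" by (auto simp: edges_T)
      show "echar datum e g =
        (if target (tree_of datum) (root datum) e \<in> leaves (tree_of datum) (root datum)
         then ind_char G (vgroup datum (target (tree_of datum) (root datum) e))
               (aug_char G (vgroup datum (target (tree_of datum) (root datum) e))) g
         else (\<Sum>e' | e' \<in> edges (tree_of datum) \<and>
             source (tree_of datum) (root datum) e' = target (tree_of datum) (root datum) e.
             echar datum e' g))"
      proof (cases "leaf v")
        case True
        then show ?thesis using a_leaf[OF True v(2) vgroup_in[OF v(1)] g] v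
          by (simp add: leaves_leaf source_target child_edge)
      next
        case False
        then show ?thesis using a_sum[OF v(1,2) False g] v
          by (simp add: leaves_leaf source_target child_edge sums)
      qed
    qed
    show "\<forall>e\<in>edges (tree_of datum). \<forall>g\<in>carrier G.
        vchar datum (target (tree_of datum) (root datum) e) g =
        vchar datum (source (tree_of datum) (root datum) e) g +
        of_rat (eps datum e) * (echar datum e g -
          ind_char G (vgroup datum (target (tree_of datum) (root datum) e))
           (aug_char G (vgroup datum (target (tree_of datum) (root datum) e))) g)"
    proof (intro ballI)
      fix e g assume e: "e \<in> edges (tree_of datum)" and g: "g \<in> carrier G"
      then obtain v where v: "v \<in> V" "v \<noteq> r" "e = {v, par v}" by (auto simp: edges_T)
      show "vchar datum (target (tree_of datum) (root datum) e) g =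
        vchar datum (source (tree_of datum) (root datum) e) g +
        of_rat (eps datum e) * (echar datum e g -
          ind_char G (vgroup datum (target (tree_of datum) (root datum) e))
           (aug_char G (vgroup datum (target (tree_of datum) (root datum) e))) g)"
        using d_step[OF v(1,2) vgroup_in[OF v(1)] g] v
        by (simp add: source_target child_edge)
    qed
    show "\<forall>b\<in>leaves (tree_of datum) (root datum). \<forall>g\<in>carrier G. \<forall>P.
       sylow_subgroup p G (vgroup datum b) P \<longrightarrow> vchar datum b g = ind_char G P (delta_mult p G P) g"
      unfolding datum_simps leaves_leaf using d_leaf vgroup_in lV by blast
  qed
qed

lemma tree_artin_datum: "tree_artin datum = a v1"
proof -
  have "trunk T r = {v1, par v1}" by (rule trunk_eq) (use v1 in blast)+
  then show ?thesis by (simp only: tree_artin_def datum_simps o_def child_edge[OF v1(1,2)])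
qed

lemma tree_depth_datum: "tree_depth datum = \<delta> r"
  by (simp add: tree_depth_def)

end

section \<open>True characters and matrix representations\<close>

lemma (in group) true_charsI:
  assumes M: "\<And>x. x \<in> carrier G \<Longrightarrow> M x \<in> carrier_mat n n"
    "\<And>x y. x \<in> carrier G \<Longrightarrow> y \<in> carrier G \<Longrightarrow> M (x \<otimes> y) = M x * M y"
    "M \<one> = 1\<^sub>m n" "\<And>x. x \<in> carrier G \<Longrightarrow> \<chi> x = mat_trace (M x)"
  shows "\<chi> \<in> true_chars G"
proof -
  have U: "M x \<in> Units (ring_mat TYPE(complex) n ())" if x: "x \<in> carrier G" for x
  proof -
    have "M x * M (inv x) = 1\<^sub>m n" "M (inv x) * M x = 1\<^sub>m n"
      using M(2)[of x "inv x"] M(2)[of "inv x" x] M(3) x by simp_all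
    then show ?thesis unfolding Units_def using M(1) x by (auto simp: ring_mat_def)
  qed
  have "M \<in> hom G (units_of (ring_mat TYPE(complex) n ()))"
    unfolding hom_def using U M(2) by (auto simp: units_of_def ring_mat_def)
  then show ?thesis unfolding true_chars_def using M(4) by blast
qed

lemma (in group) true_charsE:
  assumes "\<chi> \<in> true_chars G"
  obtains n M where "\<And>x. x \<in> carrier G \<Longrightarrow> M x \<in> carrier_mat n n"
    "\<And>x y. x \<in> carrier G \<Longrightarrow> y \<in> carrier G \<Longrightarrow> M (x \<otimes> y) = M x * M y"
    "M \<one> = 1\<^sub>m n" "\<And>x. x \<in> carrier G \<Longrightarrow> \<chi> x = mat_trace (M x :: complex mat)"
proof -
  from assms obtain n \<rho> where r: "\<rho> \<in> hom G (units_of (ring_mat TYPE(complex) n ()))"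
    and tr: "\<And>g. g \<in> carrier G \<Longrightarrow> \<chi> g = mat_trace (\<rho> g)"
    by (auto simp: true_chars_def)
  interpret R: ring "ring_mat TYPE(complex) n ()" by (rule ring_mat)
  have U: "\<rho> x \<in> Units (ring_mat TYPE(complex) n ())" if "x \<in> carrier G" for x
    using r that by (auto simp: hom_def units_of_def)
  have 1: "\<rho> x \<in> carrier_mat n n" if "x \<in> carrier G" for x
    using R.Units_closed[OF U[OF that]] by (simp add: ring_mat_def)
  have 2: "\<rho> (x \<otimes> y) = \<rho> x * \<rho> y" if "x \<in> carrier G" "y \<in> carrier G" for x y
    using r that by (auto simp: hom_def units_of_def ring_mat_def)
  have "\<rho> \<one> = one (units_of (ring_mat TYPE(complex) n ()))"
    using hom_one[OF r group_axioms R.units_group] .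
  then have 3: "\<rho> \<one> = 1\<^sub>m n" by (simp add: units_of_def ring_mat_def)
  show ?thesis by (rule that[OF 1 2 3 tr])
qed

lemma sum_lessThan_add:
  "sum f {..<n + m} = sum f {..<n} + (\<Sum>i<m. f (n + i :: nat) :: 'a::comm_monoid_add)"
  by (induction m) (simp_all add: add.assoc)

lemma mat_trace_four_block:
  assumes "A \<in> carrier_mat n n" "D \<in> carrier_mat m m"
  shows "mat_trace (four_block_mat A B C D) = mat_trace A + mat_trace (D :: complex mat)"
proof -
  have "mat_trace (four_block_mat A B C D) =
      (\<Sum>i<n + m. four_block_mat A B C D $$ (i, i))"
    using assms by (simp add: mat_trace_def)
  also have "\<dots> = (\<Sum>i<n. four_block_mat A B C D $$ (i, i)) + (\<Sum>i<m. four_block_mat A B C D $$ (n + i, n + i))"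
    by (rule sum_lessThan_add)
  also have "(\<Sum>i<n. four_block_mat A B C D $$ (i, i)) = mat_trace A"
    unfolding mat_trace_def using assms by (intro sum.cong) auto
  also have "(\<Sum>i<m. four_block_mat A B C D $$ (n + i, n + i)) = mat_trace D"
    unfolding mat_trace_def using assms by (intro sum.cong) auto
  finally show ?thesis .
qed

text \<open>Block diagonal matrices afford the direct sum.\<close>

lemma (in group) true_chars_add:
  assumes "\<chi> \<in> true_chars G" "\<psi> \<in> true_chars G"
  shows "(\<lambda>g. \<chi> g + \<psi> g) \<in> true_chars G"
proof -
  obtain n M where M: "\<And>x. x \<in> carrier G \<Longrightarrow> M x \<in> carrier_mat n n"
    "\<And>x y. x \<in> carrier G \<Longrightarrow> y \<in> carrier G \<Longrightarrow> M (x \<otimes> y) = M x * M y"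
    "M \<one> = 1\<^sub>m n" "\<And>x. x \<in> carrier G \<Longrightarrow> \<chi> x = mat_trace (M x :: complex mat)"
    by (rule true_charsE[OF assms(1)], rule that; assumption)
  obtain m N where N: "\<And>x. x \<in> carrier G \<Longrightarrow> N x \<in> carrier_mat m m"
    "\<And>x y. x \<in> carrier G \<Longrightarrow> y \<in> carrier G \<Longrightarrow> N (x \<otimes> y) = N x * N y"
    "N \<one> = 1\<^sub>m m" "\<And>x. x \<in> carrier G \<Longrightarrow> \<psi> x = mat_trace (N x :: complex mat)"
    by (rule true_charsE[OF assms(2)], rule that; assumption)
  let ?F = "\<lambda>x. four_block_mat (M x) (0\<^sub>m n m) (0\<^sub>m m n) (N x)"
  show ?thesis
  proof (rule true_charsI[of ?F "n + m"])
    fix x y assume xy: "x \<in> carrier G" "y \<in> carrier G"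
    have "?F x * ?F y = four_block_mat (M x * M y + 0\<^sub>m n m * 0\<^sub>m m n) (M x * 0\<^sub>m n m + 0\<^sub>m n m * N y)
       (0\<^sub>m m n * M y + N x * 0\<^sub>m m n) (0\<^sub>m m n * 0\<^sub>m n m + N x * N y)"
      by (rule mult_four_block_mat[OF M(1)[OF xy(1)] _ _ N(1)[OF xy(1)] M(1)[OF xy(2)] _ _ N(1)[OF xy(2)]])
        simp_all
    also have "M x * M y + 0\<^sub>m n m * 0\<^sub>m m n = M (x \<otimes> y)"
      using M(1)[of "x \<otimes> y"] M(2)[OF xy] xy by simp
    also have "M x * 0\<^sub>m n m + 0\<^sub>m n m * N y = 0\<^sub>m n m"
      using M(1)[OF xy(1)] N(1)[OF xy(2)] by simp
    also have "0\<^sub>m m n * M y + N x * 0\<^sub>m m n = 0\<^sub>m m n"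
      using M(1)[OF xy(2)] N(1)[OF xy(1)] by simp
    also have "0\<^sub>m m n * 0\<^sub>m n m + N x * N y = N (x \<otimes> y)"
      using N(1)[of "x \<otimes> y"] N(2)[OF xy] xy by simp
    finally show "?F (x \<otimes> y) = ?F x * ?F y" by simp
  next
    fix x assume x: "x \<in> carrier G"
    show "?F x \<in> carrier_mat (n + m) (n + m)" using M(1)[OF x] N(1)[OF x] by auto
    show "\<chi> x + \<psi> x = mat_trace (?F x)"
      using mat_trace_four_block[OF M(1)[OF x] N(1)[OF x]] M(4)[OF x] N(4)[OF x] by simp
  next
    show "?F \<one> = 1\<^sub>m (n + m)" unfolding M(3) N(3) by (rule four_block_one_mat)
  qed
qed

lemma (in group) true_chars_zero: "(\<lambda>g. 0) \<in> true_chars G"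
  by (rule true_charsI[of "\<lambda>_. 1\<^sub>m 0" 0]) (auto simp: mat_trace_def)

lemma (in group) true_chars_sum:
  "finite I \<Longrightarrow> (\<And>i. i \<in> I \<Longrightarrow> \<chi> i \<in> true_chars G) \<Longrightarrow> (\<lambda>g. \<Sum>i\<in>I. \<chi> i g) \<in> true_chars G"
  by (induction I rule: finite_induct) (auto intro: true_chars_zero true_chars_add)

lemma (in group) true_chars_mult_nat:
  "\<chi> \<in> true_chars G \<Longrightarrow> (\<lambda>g. of_nat n * \<chi> g) \<in> true_chars G"
  using true_chars_sum[of "{..<n}" "\<lambda>_. \<chi>"] by simp

lemma true_chars_cong:
  "\<chi> \<in> true_chars G \<Longrightarrow> (\<And>g. g \<in> carrier G \<Longrightarrow> \<chi> g = \<psi> g) \<Longrightarrow> \<psi> \<in> true_chars G"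
  unfolding true_chars_def by (auto; metis)

lemma mat_trace_comm:
  assumes "A \<in> carrier_mat n m" "B \<in> carrier_mat m n"
  shows "mat_trace (A * B) = mat_trace (B * A :: complex mat)"
proof -
  have "mat_trace (A * B) = (\<Sum>i<n. \<Sum>j<m. A $$ (i, j) * B $$ (j, i))"
    unfolding mat_trace_def
    using carrier_matD[OF assms(1)] carrier_matD[OF assms(2)]
    by (intro sum.cong) (simp_all add: scalar_prod_def atLeast0LessThan)
  also have "\<dots> = (\<Sum>j<m. \<Sum>i<n. B $$ (j, i) * A $$ (i, j))"
    by (subst sum.swap, intro sum.cong refl mult.commute)
  also have "\<dots> = mat_trace (B * A)"
    unfolding mat_trace_def
    using carrier_matD[OF assms(1)] carrier_matD[OF assms(2)]
    by (intro sum.cong) (simp_all add: scalar_prod_def atLeast0LessThan)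
  finally show ?thesis .
qed

lemma sum_in_nonneg:
  "(\<And>i. i \<in> I \<Longrightarrow> f i \<in> \<real>\<^sub>\<ge>\<^sub>0) \<Longrightarrow> (\<Sum>i\<in>I. f i :: complex) \<in> \<real>\<^sub>\<ge>\<^sub>0"
  by (induction I rule: infinite_finite_induct) (auto intro: nonneg_Reals_add_I)

text \<open>By Schur triangularisation an idempotent matrix is similar to a triangular one, whose
  diagonal entries are idempotents of the field, hence 0 or 1; the difference counts the zeros among
  them. It will be applied to the projection onto the invariants of a subgroup.\<close>

lemma trace_idempotent:
  assumes E: "E \<in> carrier_mat n n" "E * E = (E :: complex mat)"
  shows "of_nat n - mat_trace E \<in> \<real>\<^sub>\<ge>\<^sub>0"
proof -
  obtain es where "char_poly E = (\<Prod>a\<leftarrow>es. [:- a, 1:])"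
    using char_poly_factorized[OF E(1)] by blast
  then obtain B where B: "B \<in> carrier_mat n n" "upper_triangular B" "similar_mat E B"
    using schur_upper_triangular[OF E(1)] by blast
  then obtain P Q where PQ: "P \<in> carrier_mat n n" "Q \<in> carrier_mat n n" "P * Q = 1\<^sub>m n" "Q * P = 1\<^sub>m n"
    "E = P * B * Q"
    using E(1) unfolding similar_mat_def similar_mat_wit_def by (auto simp: Let_def)
  have BE: "B = Q * E * P"
  proof -
    have "Q * E * P = (Q * P) * B * (Q * P)"
      using PQ(1,2) B(1) by (simp add: PQ(5) assoc_mult_mat[of _ n n _ n _ n] mult_carrier_mat[of _ n n])
    then show ?thesis using PQ B(1) by simp
  qed
  have "B * B = Q * E * (P * Q) * E * P"
    using PQ(1,2) E(1) by (simp add: BE assoc_mult_mat[of _ n n _ n _ n])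
  also have "\<dots> = Q * (E * E) * P"
    using PQ E(1) by (simp add: assoc_mult_mat[of _ n n _ n _ n])
  finally have BB: "B * B = B" using E(2) BE by simp
  have diag: "B $$ (i, i) \<in> {0, 1}" if i: "i < n" for i
  proof -
    have "(B * B) $$ (i, i) = (\<Sum>j = 0..<n. B $$ (i, j) * B $$ (j, i))"
      using B(1) i by (auto simp: scalar_prod_def)
    \<comment> \<open>Of the two factors with indices \<open>(i, j)\<close> and
      \<open>(j, i)\<close>, where \<open>j \<noteq> i\<close>, one lies below the diagonal.\<close>
    also have "\<dots> = (\<Sum>j\<in>{i}. B $$ (i, j) * B $$ (j, i))"
    proof (rule sum.mono_neutral_right)
      show "\<forall>j\<in>{0..<n} - {i}. B $$ (i, j) * B $$ (j, i) = 0"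
      proof
        fix j assume j: "j \<in> {0..<n} - {i}"
        then have "B $$ (i, j) = 0 \<or> B $$ (j, i) = 0"
          using B(1,2) i by (cases "j < i") (auto simp: upper_triangular_def)
        then show "B $$ (i, j) * B $$ (j, i) = 0" by auto
      qed
    qed (use i in auto)
    finally have "B $$ (i, i) * B $$ (i, i) = B $$ (i, i)" using BB by simp
    then show ?thesis by (simp add: mult_cancel_left1)
  qed
  have "mat_trace E = mat_trace (P * (B * Q))"
    using PQ B(1) by (simp add: assoc_mult_mat[of _ n n _ n _ n])
  also have "\<dots> = mat_trace ((B * Q) * P)" using PQ B(1) by (intro mat_trace_comm) auto
  also have "(B * Q) * P = B" using PQ B(1) by (simp add: assoc_mult_mat[of _ n n _ n _ n])
  finally have "of_nat n - mat_trace E = (\<Sum>i<n. 1 - B $$ (i, i))"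
    using B(1) by (simp add: mat_trace_def sum_subtractf)
  also have "\<dots> \<in> \<real>\<^sub>\<ge>\<^sub>0"
    
  proof (rule sum_in_nonneg)
    fix i assume "i \<in> {..<n}"
    then show "1 - B $$ (i, i) \<in> \<real>\<^sub>\<ge>\<^sub>0" using diag[of i] by auto
  qed
  finally show ?thesis .
qed

section \<open>Induced augmentation characters\<close>

locale finite_group = group G for G :: "('g, 'm) monoid_scheme" (structure) +
  assumes fin: "finite (carrier G)"
begin

lemma sum_conj:
  assumes "x \<in> carrier G"
  shows "(\<Sum>g\<in>carrier G. f (inv x \<otimes> g \<otimes> x)) = (\<Sum>g\<in>carrier G. f g)"
proof (rule sum.reindex_bij_witness[of _ "\<lambda>g. x \<otimes> g \<otimes> inv x" "\<lambda>g. inv x \<otimes> g \<otimes> x"])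
  show "x \<otimes> (inv x \<otimes> a \<otimes> x) \<otimes> inv x = a" if "a \<in> carrier G" for a
    using that assms by (simp add: m_assoc) (simp add: m_assoc[symmetric])
  show "inv x \<otimes> (x \<otimes> a \<otimes> inv x) \<otimes> x = a" if "a \<in> carrier G" for a
    using that assms by (simp add: m_assoc) (simp add: m_assoc[symmetric])
qed (use assms in auto)

lemma ind_char_alt:
  "ind_char G H \<chi> g = (\<Sum>x\<in>carrier G. if inv x \<otimes> g \<otimes> x \<in> H then \<chi> (inv x \<otimes> g \<otimes> x) else 0) / of_nat (card H)"
  unfolding ind_char_def by (subst sum.inter_filter[symmetric]) (use fin in auto)

lemma card_pos: "card (carrier G) > 0"
  using fin by (metis card_gt_0_iff empty_iff one_closed)

lemma subgroup_card_pos: "subgroup H G \<Longrightarrow> card H > 0"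
  using fin by (metis card_gt_0_iff empty_iff finite_subset subgroup.one_closed subgroup.subset)

text \<open>Once the sums are exchanged, conjugation by a fixed element merely permutes
  \<open>G\<close>, so every conjugator contributes the same sum over \<open>H\<close>.\<close>

lemma sum_ind_char:
  assumes H: "subgroup H G"
  shows "(\<Sum>g\<in>carrier G. ind_char G H \<chi> g) =
    of_nat (card (carrier G)) / of_nat (card H) * (\<Sum>h\<in>H. \<chi> h)"
proof -
  have "(\<Sum>g\<in>carrier G. ind_char G H \<chi> g) =
    (\<Sum>x\<in>carrier G. \<Sum>g\<in>carrier G. if inv x \<otimes> g \<otimes> x \<in> H then \<chi> (inv x \<otimes> g \<otimes> x) else 0) / of_nat (card H)"
    unfolding ind_char_alt by (subst sum.swap) (simp add: sum_divide_distrib)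
  also have "(\<Sum>x\<in>carrier G. \<Sum>g\<in>carrier G. if inv x \<otimes> g \<otimes> x \<in> H then \<chi> (inv x \<otimes> g \<otimes> x) else 0) =
    (\<Sum>x\<in>carrier G. \<Sum>g\<in>carrier G. if g \<in> H then \<chi> g else 0)"
    by (rule sum.cong[OF refl]) (rule sum_conj[where f = "\<lambda>h. if h \<in> H then \<chi> h else 0"])
  also have "(\<Sum>g\<in>carrier G. if g \<in> H then \<chi> g else 0) = (\<Sum>h\<in>H. \<chi> h)"
    using subgroup.subset[OF H] fin by (simp add: sum.If_cases Int_absorb1)
  finally show ?thesis by simp
qed

lemma sum_aug_char:
  assumes H: "subgroup H G"
  shows "(\<Sum>h\<in>H. aug_char G H h) = 0"
proof -
  have "finite H" using subgroup.subset[OF H] fin finite_subset by blast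
  then show ?thesis
    using subgroup.one_closed[OF H] by (simp add: aug_char_def sum_subtractf sum.delta)
qed

lemma sum_ind_aug:
  "subgroup H G \<Longrightarrow> (\<Sum>g\<in>carrier G. ind_char G H (aug_char G H) g) = 0"
  by (simp add: sum_ind_char sum_aug_char)

lemma conj_one_iff:
  "x \<in> carrier G \<Longrightarrow> g \<in> carrier G \<Longrightarrow> inv x \<otimes> g \<otimes> x = \<one> \<longleftrightarrow> g = \<one>"
proof
  assume x: "x \<in> carrier G" "g \<in> carrier G" and e: "inv x \<otimes> g \<otimes> x = \<one>"
  have "g = x \<otimes> (inv x \<otimes> g \<otimes> x) \<otimes> inv x" using x by (simp add: m_assoc) (simp add: m_assoc[symmetric])
  then show "g = \<one>" using e x by simp
qed simp

lemma ind_aug_nonid: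
  assumes "g \<in> carrier G" "g \<noteq> \<one>"
  shows "ind_char G H (aug_char G H) g =
    - of_nat (card {x \<in> carrier G. inv x \<otimes> g \<otimes> x \<in> H}) / of_nat (card H)"
proof -
  have "(\<Sum>x | x \<in> carrier G \<and> inv x \<otimes> g \<otimes> x \<in> H. aug_char G H (inv x \<otimes> g \<otimes> x)) =
     (\<Sum>x | x \<in> carrier G \<and> inv x \<otimes> g \<otimes> x \<in> H. - 1)"
    using assms conj_one_iff by (intro sum.cong) (auto simp: aug_char_def)
  then show ?thesis unfolding ind_char_def by simp
qed

text \<open>The tool for all identities between class functions below: with sum 0 over
  \<open>G\<close>, the value at the identity is determined by the other values, where the formulas
  are simple counts.\<close>

lemma zero_sum_eqI:
  fixes \<chi> \<psi> :: "'g \<Rightarrow> complex"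
  assumes "(\<Sum>g\<in>carrier G. \<chi> g) = 0" "(\<Sum>g\<in>carrier G. \<psi> g) = 0"
    "\<And>g. g \<in> carrier G \<Longrightarrow> g \<noteq> \<one> \<Longrightarrow> \<chi> g = \<psi> g" "g \<in> carrier G"
  shows "\<chi> g = \<psi> g"
proof (cases "g = \<one>")
  case True
  have s: "(\<Sum>g\<in>carrier G. f g) = f \<one> + (\<Sum>g\<in>carrier G - {\<one>}. f g)" for f :: "'g \<Rightarrow> complex"
    using fin by (simp add: sum.remove)
  have "(\<Sum>g\<in>carrier G - {\<one>}. \<chi> g) = (\<Sum>g\<in>carrier G - {\<one>}. \<psi> g)"
    using assms(3) by (intro sum.cong) auto
  then show ?thesis using assms(1,2) s[of \<chi>] s[of \<psi>] True by (metis add_right_cancel)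
qed (use assms in auto)

end

locale coset_section = finite_group G + subgroup K G for G :: "('g, 'm) monoid_scheme" (structure) and K
begin

text \<open>A section of the projection from \<open>G\<close> to the left cosets of
  \<open>K\<close>: a representative that depends only on the coset.\<close>

definition s :: "'g \<Rightarrow> 'g" where "s g = (SOME h. h \<in> g <# K)"

lemma s_in: "g \<in> carrier G \<Longrightarrow> s g \<in> g <# K"
  unfolding s_def by (rule someI_ex) (use one_closed in \<open>auto simp: l_coset_def intro!: exI[of _ g] bexI[of _ \<one>]\<close>)

lemma coset_eq:
  assumes "g \<in> carrier G" "h \<in> g <# K"
  shows "h <# K = g <# K"
proof -
  obtain k where k: "k \<in> K" "h = g \<otimes> k" using assms by (auto simp: l_coset_def)
  have "h \<otimes> l \<in> g <# K" if l: "l \<in> K" for l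
    unfolding l_coset_def using k l assms(1) by (auto simp: m_assoc intro!: bexI[of _ "k \<otimes> l"])
  moreover have "g \<otimes> l \<in> h <# K" if l: "l \<in> K" for l
  proof -
    have "g \<otimes> l = h \<otimes> (inv k \<otimes> l)"
      using k l assms(1) by (simp add: m_assoc) (simp add: m_assoc[symmetric])
    then show ?thesis unfolding l_coset_def using k l by blast
  qed
  ultimately show ?thesis by (auto simp: l_coset_def)
qed

lemma s_eq: "g \<in> carrier G \<Longrightarrow> h \<in> g <# K \<Longrightarrow> s h = s g"
  using coset_eq by (simp add: s_def)

lemma s_closed: "g \<in> carrier G \<Longrightarrow> s g \<in> carrier G"
  using s_in by (fastforce simp: l_coset_def)

lemma s_s: "g \<in> carrier G \<Longrightarrow> s (s g) = s g"
  using s_eq s_in by blast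

lemma s_mult_eq:
  assumes "x \<in> carrier G" "g \<in> carrier G"
  shows "s (x \<otimes> s g) = s (x \<otimes> g)"
proof (rule s_eq)
  obtain k where "k \<in> K" "s g = g \<otimes> k" using s_in[OF assms(2)] by (auto simp: l_coset_def)
  then show "x \<otimes> s g \<in> (x \<otimes> g) <# K" using assms by (auto simp: l_coset_def m_assoc)
qed (use assms in auto)

definition N :: "'g set" where "N = {g \<in> carrier G. s g \<noteq> g}"

text \<open>Matrix entries of left translation by \<open>x\<close> in the basis of the vectors
  \<open>h - s h\<close> with \<open>h\<close> in \<open>N\<close>. Such a vector goes to the
  difference of \<open>x \<otimes> h\<close> and \<open>x \<otimes> s h\<close>, and its coordinate
  at the basis vector of \<open>g\<close> is the coefficient of the group element \<open>g\<close>,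
  which lies outside the section.\<close>

definition F :: "'g \<Rightarrow> 'g \<Rightarrow> 'g \<Rightarrow> complex" where
  "F x g h = of_bool (g = x \<otimes> h) - of_bool (g = x \<otimes> s h)"

lemma F_mult:
  assumes "x \<in> carrier G" "y \<in> carrier G" "g \<in> carrier G" "h \<in> carrier G"
  shows "(\<Sum>l\<in>N. F x g l * F y l h) = F (x \<otimes> y) g h"
proof -
  \<comment> \<open>For \<open>l\<close> in the section \<open>s l = l\<close>, so the two terms of
    \<open>F x g l\<close> cancel.\<close>
  have "(\<Sum>l\<in>N. F x g l * F y l h) = (\<Sum>l\<in>carrier G. F x g l * F y l h)"
    by (rule sum.mono_neutral_left) (use fin in \<open>auto simp: N_def F_def\<close>)
  also have "\<dots> = (\<Sum>l\<in>carrier G. (if l = y \<otimes> h then F x g l else 0) - (if l = y \<otimes> s h then F x g l else 0))"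
    by (intro sum.cong) (auto simp: F_def[of y])
  also have "\<dots> = F x g (y \<otimes> h) - F x g (y \<otimes> s h)"
    using assms s_closed fin by (simp add: sum_subtractf)
  also have "\<dots> = F (x \<otimes> y) g h"
    using assms s_closed[OF assms(4)] s_mult_eq[of y h] by (simp add: F_def m_assoc)
  finally show ?thesis .
qed

text \<open>Such a set is a union of left cosets, and each coset contains exactly one element fixed
  by \<open>s\<close>.\<close>

lemma card_stable:
  assumes U: "U \<subseteq> carrier G" "\<And>u k. u \<in> U \<Longrightarrow> k \<in> K \<Longrightarrow> u \<otimes> k \<in> U"
  shows "card U = card {u \<in> U. s u = u} * card K"
proof -
  have "bij_betw (\<lambda>(u, k). u \<otimes> k) ({u \<in> U. s u = u} \<times> K) U"
  proof (rule bij_betwI')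
    fix a b assume ab: "a \<in> {u \<in> U. s u = u} \<times> K" "b \<in> {u \<in> U. s u = u} \<times> K"
    obtain u k v l where uv: "a = (u, k)" "b = (v, l)" by (cases a, cases b)
    have c: "u \<in> carrier G" "v \<in> carrier G" "k \<in> carrier G" "l \<in> carrier G" "k \<in> K" "l \<in> K" "s u = u" "s v = v"
      using ab uv U(1) by auto
    show "(case a of (u, k) \<Rightarrow> u \<otimes> k) = (case b of (u, k) \<Rightarrow> u \<otimes> k) \<longleftrightarrow> a = b"
    proof
      assume "(case a of (u, k) \<Rightarrow> u \<otimes> k) = (case b of (u, k) \<Rightarrow> u \<otimes> k)"
      then have e: "u \<otimes> k = v \<otimes> l" by (simp add: uv)
      have "s (u \<otimes> k) = s u" by (rule s_eq) (use c in \<open>auto simp: l_coset_def\<close>)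
      moreover have "s (v \<otimes> l) = s v" by (rule s_eq) (use c in \<open>auto simp: l_coset_def\<close>)
      ultimately have "u = v" using e c by simp
      then show "a = b" using e c uv by simp
    qed simp
  next
    fix a assume "a \<in> {u \<in> U. s u = u} \<times> K"
    then show "(case a of (u, k) \<Rightarrow> u \<otimes> k) \<in> U" using U(2) by auto
  next
    fix u assume u: "u \<in> U"
    then have uc: "u \<in> carrier G" using U(1) by auto
    obtain k where k: "k \<in> K" "s u = u \<otimes> k" using s_in[OF uc] by (auto simp: l_coset_def)
    have "s u \<in> U" "s (s u) = s u" using U(2)[OF u k(1)] k s_s[OF uc] by auto
    moreover have "u = s u \<otimes> inv k" using k uc by (simp add: m_assoc)
    ultimately show "\<exists>a\<in>{u \<in> U. s u = u} \<times> K. u = (case a of (u, k) \<Rightarrow> u \<otimes> k)"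
      using k(1) by (intro bexI[of _ "(s u, inv k)"]) auto
  qed
  from bij_betw_same_card[OF this] show ?thesis by (simp add: card_cartesian_product)
qed

text \<open>The induced augmentation character is afforded by the kernel of \<open>\<complex>[G] \<rightarrow> \<complex>[G/K]\<close>,
  in the basis \<open>g - s(g)\<close> for \<open>g\<close> outside the section \<open>s\<close>.\<close>

lemma ind_aug_true_char: "ind_char G K (aug_char G K) \<in> true_chars G"
proof -
  have finN: "finite N" using fin by (simp add: N_def)
  obtain e where e: "bij_betw e {..<card N} N" using ex_bij_betw_nat_finite[OF finN] by (auto simp: atLeast0LessThan)
  have eN: "e i \<in> N" "e i \<in> carrier G" if "i < card N" for i using e that by (auto simp: bij_betw_def N_def)
  have inj: "e i = e j \<longleftrightarrow> i = j" if "i < card N" "j < card N" for i j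
    using e that by (auto simp: bij_betw_def inj_on_def)
  define M where "M x = mat (card N) (card N) (\<lambda>(i, j). F x (e i) (e j))" for x
  show ?thesis
  proof (rule true_charsI[of M "card N"])
    fix x y assume xy: "x \<in> carrier G" "y \<in> carrier G"
    show "M (x \<otimes> y) = M x * M y"
    proof (rule eq_matI)
      fix i j assume "i < dim_row (M x * M y)" "j < dim_col (M x * M y)"
      then have ij: "i < card N" "j < card N" by (auto simp: M_def)
      have "(M x * M y) $$ (i, j) = (\<Sum>l<card N. F x (e i) (e l) * F y (e l) (e j))"
        using ij by (simp add: M_def scalar_prod_def atLeast0LessThan)
      also have "\<dots> = (\<Sum>l\<in>N. F x (e i) l * F y l (e j))"
        by (rule sum.reindex_bij_betw[OF e])
      finally show "M (x \<otimes> y) $$ (i, j) = (M x * M y) $$ (i, j)"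
        using F_mult[OF xy eN(2)[OF ij(1)] eN(2)[OF ij(2)]] ij by (simp add: M_def)
    qed (auto simp: M_def)
  next
    show "M \<one> = 1\<^sub>m (card N)"
    proof (rule eq_matI)
      fix i j assume ij: "i < dim_row (1\<^sub>m (card N) :: complex mat)" "j < dim_col (1\<^sub>m (card N) :: complex mat)"
      then have "e i \<noteq> s (e j)"
        using eN[of i] eN[of j] s_s[of "e j"] by (auto simp: N_def)
      then show "M \<one> $$ (i, j) = 1\<^sub>m (card N) $$ (i, j)"
        using ij eN s_closed by (simp add: M_def F_def inj)
    qed (auto simp: M_def)
  next
    fix x assume x: "x \<in> carrier G"
    have tr: "mat_trace (M x) = (\<Sum>g\<in>N. F x g g)"
      using sum.reindex_bij_betw[OF e, of "\<lambda>g. F x g g"] by (simp add: M_def mat_trace_def)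
    let ?U = "{y \<in> carrier G. inv y \<otimes> x \<otimes> y \<in> K}"
    have cardK: "card K > 0" using subgroup_card_pos subgroup_axioms by blast
    show "ind_char G K (aug_char G K) x = mat_trace (M x)"
    proof (cases "x = \<one>")
      case True
      have "(\<Sum>g\<in>N. F x g g) = (\<Sum>g\<in>N. 1)"
        using True s_closed by (intro sum.cong) (auto simp: F_def N_def)
      then have 1: "mat_trace (M x) = of_nat (card N)" using tr by simp
      have "carrier G = N \<union> {u \<in> carrier G. s u = u}" by (auto simp: N_def)
      then have "card (carrier G) = card N + card {u \<in> carrier G. s u = u}"
        using fin by (subst card_Un_disjoint[symmetric]) (auto simp: N_def)
      moreover have "card (carrier G) = card {u \<in> carrier G. s u = u} * card K"
        by (rule card_stable) auto
      ultimately have "of_nat (card (carrier G)) = (of_nat (card N) + of_nat (card {u \<in> carrier G. s u = u}) :: complex)"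
        "of_nat (card (carrier G)) = (of_nat (card {u \<in> carrier G. s u = u}) * of_nat (card K) :: complex)"
        by (simp_all flip: of_nat_add of_nat_mult)
      then have "of_nat (card N) * of_nat (card K) = (of_nat (card (carrier G)) * (of_nat (card K) - 1) :: complex)"
        by (simp add: algebra_simps)
      moreover have "ind_char G K (aug_char G K) x = of_nat (card (carrier G)) * (of_nat (card K) - 1) / of_nat (card K)"
        using True by (simp add: ind_char_alt aug_char_def)
      ultimately have "ind_char G K (aug_char G K) x * of_nat (card K) = mat_trace (M x) * of_nat (card K)"
        using 1 cardK by simp
      then show ?thesis using cardK by simp
    next
      case False
      \<comment> \<open>As \<open>x\<close> is not the identity, \<open>g = x \<otimes> g\<close>
        never happens, and only the subtracted term of \<open>F\<close> survives.\<close>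
      have "(\<Sum>g\<in>N. F x g g) = (\<Sum>g\<in>N. - of_bool (g = x \<otimes> s g))"
        using False x by (intro sum.cong) (auto simp: F_def N_def)
      also have "\<dots> = - of_nat (card {g \<in> N. g = x \<otimes> s g})"
        using finN by (simp add: sum_negf Collect_conj_eq)
      \<comment> \<open>Diagonal contributions match the cosets fixed by \<open>x\<close>:
        \<open>g\<close> goes to its representative, and \<open>u\<close> comes from
        \<open>x \<otimes> u\<close>, which lies outside the section because it differs from
        \<open>u\<close> but shares its coset.\<close>
      also have "card {g \<in> N. g = x \<otimes> s g} = card {u \<in> ?U. s u = u}"
      proof (rule bij_betw_same_card[of s], rule bij_betwI[of s _ _ "\<lambda>u. x \<otimes> u"])
        show "s \<in> {g \<in> N. g = x \<otimes> s g} \<rightarrow> {u \<in> ?U. s u = u}"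
        proof
          fix g assume g: "g \<in> {g \<in> N. g = x \<otimes> s g}"
          then have gc: "g \<in> carrier G" by (simp add: N_def)
          obtain k where k: "k \<in> K" "s g = g \<otimes> k" using s_in[OF gc] by (auto simp: l_coset_def)
          have "inv (s g) \<otimes> x \<otimes> s g = inv (s g) \<otimes> g" using g gc x s_closed by (simp add: m_assoc)
          also have "\<dots> = inv k" using k gc by (simp add: inv_mult_group m_assoc)
          finally show "s g \<in> {u \<in> ?U. s u = u}" using k s_s[OF gc] s_closed[OF gc] by simp
        qed
        show "(\<lambda>u. x \<otimes> u) \<in> {u \<in> ?U. s u = u} \<rightarrow> {g \<in> N. g = x \<otimes> s g}"
        proof
          fix u assume "u \<in> {u \<in> ?U. s u = u}"
          then have u: "u \<in> carrier G" "inv u \<otimes> x \<otimes> u \<in> K" "s u = u" by auto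
          have "s (x \<otimes> u) = s u"
            by (rule s_eq[OF u(1)])
              (use u x in \<open>auto simp: l_coset_def m_assoc[symmetric] intro!: bexI[of _ "inv u \<otimes> x \<otimes> u"]\<close>)
          moreover have "x \<otimes> u \<noteq> u" using False u x by (metis r_cancel_one)
          ultimately show "x \<otimes> u \<in> {g \<in> N. g = x \<otimes> s g}" using u x by (simp add: N_def)
        qed
        show "x \<otimes> s g = g" if "g \<in> {g \<in> N. g = x \<otimes> s g}" for g using that by auto
        show "s (x \<otimes> u) = u" if "u \<in> {u \<in> ?U. s u = u}" for u
        proof -
          have u: "u \<in> carrier G" "inv u \<otimes> x \<otimes> u \<in> K" "s u = u" using that by auto
          have "s (x \<otimes> u) = s u"
            by (rule s_eq[OF u(1)])
              (use u x in \<open>auto simp: l_coset_def m_assoc[symmetric] intro!: bexI[of _ "inv u \<otimes> x \<otimes> u"]\<close>)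
          then show ?thesis using u by simp
        qed
      qed
      finally have 1: "mat_trace (M x) = - of_nat (card {u \<in> ?U. s u = u})" using tr by simp
      have "card ?U = card {u \<in> ?U. s u = u} * card K"
      proof (rule card_stable)
        fix u k assume u: "u \<in> ?U" and k: "k \<in> K"
        have "inv (u \<otimes> k) \<otimes> x \<otimes> (u \<otimes> k) = inv k \<otimes> (inv u \<otimes> x \<otimes> u) \<otimes> k"
          using u k x by (simp add: inv_mult_group m_assoc)
        then show "u \<otimes> k \<in> ?U" using u k by auto
      qed auto
      then show ?thesis using 1 cardK ind_aug_nonid[OF x False] by simp
    qed
  qed (auto simp: M_def)
qed

end

context finite_group
begin

text \<open>Frobenius reciprocity reduces the product to a sum over \<open>K\<close>. There, pairing
  with the regular minus the unit character gives the degree minus the trace of the projection onto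
  the \<open>K\<close>-invariants, up to complex conjugation.\<close>

lemma char_prod_ind_aug:
  assumes K: "subgroup K G" and psi: "\<psi> \<in> true_chars G"
  shows "char_prod G \<psi> (ind_char G K (aug_char G K)) \<in> \<real>\<^sub>\<ge>\<^sub>0"
proof -
  obtain n M where M: "\<And>x. x \<in> carrier G \<Longrightarrow> M x \<in> carrier_mat n n"
    "\<And>x y. x \<in> carrier G \<Longrightarrow> y \<in> carrier G \<Longrightarrow> M (x \<otimes> y) = M x * M y"
    "M \<one> = 1\<^sub>m n" "\<And>x. x \<in> carrier G \<Longrightarrow> \<psi> x = mat_trace (M x :: complex mat)"
    by (rule true_charsE[OF psi], rule that; assumption)
  have finK: "finite K" using subgroup.subset[OF K] fin finite_subset by blast
  have Kc: "k \<in> carrier G" if "k \<in> K" for k using subgroup.mem_carrier[OF K that] .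
  have cK: "card K > 0" using subgroup_card_pos[OF K] .
  have cls: "\<psi> (inv x \<otimes> g \<otimes> x) = \<psi> g" if "x \<in> carrier G" "g \<in> carrier G" for x g
  proof -
    have "\<psi> (inv x \<otimes> g \<otimes> x) = mat_trace (M (inv x \<otimes> g) * M x)" using that M by simp
    also have "\<dots> = mat_trace (M x * M (inv x \<otimes> g))"
      by (rule mat_trace_comm[of _ n n]) (use that M(1) in auto)
    also have "M x * M (inv x \<otimes> g) = M g"
      using that M(2)[of x "inv x \<otimes> g"] by (simp add: m_assoc[symmetric])
    finally show ?thesis using M(4) that by simp
  qed
  \<comment> \<open>The average of the representation over \<open>K\<close>; it is idempotent
    because translation by an element of \<open>K\<close> permutes the summands.\<close>
  define E where "E = mat n n (\<lambda>(i, j). (\<Sum>k\<in>K. M k $$ (i, j)) / of_nat (card K))"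
  have Ec: "E \<in> carrier_mat n n" by (simp add: E_def)
  have MM: "(\<Sum>m<n. M k $$ (i, m) * M l $$ (m, j)) = M (k \<otimes> l) $$ (i, j)" if "k \<in> K" "l \<in> K" "i < n" "j < n" for k l i j
    using M(1)[OF Kc[OF that(1)]] M(1)[OF Kc[OF that(2)]] that M(2)[OF Kc Kc, of k l]
    by (simp add: scalar_prod_def atLeast0LessThan)
  have EE: "E * E = E"
  proof (rule eq_matI)
    fix i j assume "i < dim_row E" "j < dim_col E"
    then have ij: "i < n" "j < n" by (auto simp: E_def)
    have "(E * E) $$ (i, j) = (\<Sum>m<n. (\<Sum>k\<in>K. M k $$ (i, m)) / of_nat (card K) * ((\<Sum>l\<in>K. M l $$ (m, j)) / of_nat (card K)))"
      using ij by (simp add: E_def scalar_prod_def atLeast0LessThan)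
    also have "\<dots> = (\<Sum>m<n. \<Sum>k\<in>K. \<Sum>l\<in>K. M k $$ (i, m) * M l $$ (m, j)) / (of_nat (card K))^2"
      by (simp add: sum_product sum_divide_distrib power2_eq_square)
    also have "(\<Sum>m<n. \<Sum>k\<in>K. \<Sum>l\<in>K. M k $$ (i, m) * M l $$ (m, j)) = (\<Sum>k\<in>K. \<Sum>l\<in>K. \<Sum>m<n. M k $$ (i, m) * M l $$ (m, j))"
      by (simp only: sum.swap[of _ K "{..<n}"])
    also have "\<dots> = (\<Sum>k\<in>K. \<Sum>l\<in>K. M (k \<otimes> l) $$ (i, j))"
      using MM ij by (intro sum.cong) auto
    also have "\<dots> = (\<Sum>k\<in>K. \<Sum>l\<in>K. M l $$ (i, j))"
    proof (rule sum.cong[OF refl])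
      fix k assume k: "k \<in> K"
      show "(\<Sum>l\<in>K. M (k \<otimes> l) $$ (i, j)) = (\<Sum>l\<in>K. M l $$ (i, j))"
        by (rule sum.reindex_bij_witness[of _ "\<lambda>l. inv k \<otimes> l" "\<lambda>l. k \<otimes> l"])
          (use k K Kc in \<open>auto simp: m_assoc[symmetric] subgroup.m_closed subgroup.m_inv_closed\<close>)
    qed
    also have "\<dots> = of_nat (card K) * (\<Sum>l\<in>K. M l $$ (i, j))" by simp
    finally show "(E * E) $$ (i, j) = E $$ (i, j)"
      using ij cK by (simp add: E_def power2_eq_square)
  qed (auto simp: E_def)
  have trE: "mat_trace E = (\<Sum>k\<in>K. \<psi> k) / of_nat (card K)"
  proof -
    have "mat_trace E = (\<Sum>i<n. \<Sum>k\<in>K. M k $$ (i, i)) / of_nat (card K)"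
      by (simp add: mat_trace_def E_def sum_divide_distrib)
    also have "(\<Sum>i<n. \<Sum>k\<in>K. M k $$ (i, i)) = (\<Sum>k\<in>K. \<Sum>i<n. M k $$ (i, i))" by (rule sum.swap)
    also have "\<dots> = (\<Sum>k\<in>K. \<psi> k)"
      using M(1,4) Kc by (intro sum.cong) (auto simp: mat_trace_def)
    finally show ?thesis .
  qed
  have one: "\<psi> \<one> = of_nat n" using M(3,4) by (simp add: mat_trace_def)
  let ?u = "aug_char G K"
  have "(\<Sum>g\<in>carrier G. cnj (\<psi> g) * ind_char G K ?u g) =
    (\<Sum>g\<in>carrier G. ind_char G K (\<lambda>k. cnj (\<psi> k) * ?u k) g)"
  proof (intro sum.cong refl)
    fix g assume g: "g \<in> carrier G"
    show "cnj (\<psi> g) * ind_char G K ?u g = ind_char G K (\<lambda>k. cnj (\<psi> k) * ?u k) g"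
      unfolding ind_char_def using cls[OF _ g]
      by (simp add: sum_distrib_left)
  qed
  also have "\<dots> = of_nat (card (carrier G)) / of_nat (card K) * (\<Sum>k\<in>K. cnj (\<psi> k) * ?u k)"
    by (rule sum_ind_char[OF K])
  finally have "char_prod G \<psi> (ind_char G K ?u) = (\<Sum>k\<in>K. cnj (\<psi> k) * ?u k) / of_nat (card K)"
    using card_pos by (simp add: char_prod_def)
  also have "(\<Sum>k\<in>K. cnj (\<psi> k) * ?u k) = (\<Sum>k\<in>K. (if k = \<one> then of_nat (card K) * cnj (\<psi> k) else 0) - cnj (\<psi> k))"
    by (intro sum.cong) (auto simp: aug_char_def algebra_simps)
  also have "\<dots> = of_nat (card K) * of_nat n - (\<Sum>k\<in>K. cnj (\<psi> k))"
    using finK subgroup.one_closed[OF K] one by (simp add: sum_subtractf)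
  also have "\<dots> / of_nat (card K) = of_nat n - cnj (mat_trace E)"
    using cK by (simp add: trE field_simps)
  also have "\<dots> = cnj (of_nat n - mat_trace E)" by simp
  also have "\<dots> \<in> \<real>\<^sub>\<ge>\<^sub>0"
  proof -
    obtain r where "r \<ge> 0" "of_nat n - mat_trace E = of_real r"
      using trace_idempotent[OF Ec EE] by (rule nonneg_Reals_cases)
    then show ?thesis by (simp only: complex_cnj_complex_of_real nonneg_Reals_of_real_iff)
  qed
  finally show ?thesis .
qed

text \<open>The product with a true character is a nonnegative combination of nonnegative numbers.
  Membership in \<open>rat_chars\<close> asks for a single virtual character and a single rational
  factor, hence for a common denominator.\<close>

lemma pos_rat_chars_combination:
  fixes q :: "'i \<Rightarrow> rat"
  assumes "finite I" "\<And>i. i \<in> I \<Longrightarrow> subgroup (K i) G" "\<And>i. i \<in> I \<Longrightarrow> q i \<ge> 0"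
    "\<And>g. g \<in> carrier G \<Longrightarrow> \<chi> g = (\<Sum>i\<in>I. of_rat (q i) * ind_char G (K i) (aug_char G (K i)) g)"
  shows "\<chi> \<in> pos_rat_chars G"
proof -
  let ?u = "\<lambda>i. ind_char G (K i) (aug_char G (K i))"
  \<comment> \<open>The common denominator is built by induction; nonnegative coefficients keep the
    numerator a true character.\<close>
  have "\<exists>\<psi>\<in>true_chars G. \<exists>d::nat. d > 0 \<and> (\<forall>g\<in>carrier G. (\<Sum>i\<in>I. of_rat (q i) * ?u i g) = \<psi> g / of_nat d)"
    using assms(1-3)
  proof (induction I rule: finite_induct)
    case empty
    then show ?case using true_chars_zero by (intro bexI[of _ "\<lambda>_. 0"] exI[of _ 1]) auto
  next
    case (insert i I)
    then obtain \<psi> d where psi: "\<psi> \<in> true_chars G" "d > 0"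
      "\<And>g. g \<in> carrier G \<Longrightarrow> (\<Sum>i\<in>I. of_rat (q i) * ?u i g) = \<psi> g / of_nat d" by auto
    obtain a b where ab: "q i = of_nat a / of_nat b" "b > 0"
    proof -
      obtain m n where mn: "quotient_of (q i) = (m, n)" by (cases "quotient_of (q i)")
      have n0: "n > 0" using quotient_of_denom_pos[OF mn] .
      have "q i = of_int m / of_int n" using quotient_of_div[OF mn] .
      moreover have "m \<ge> 0"
        using insert.prems(2)[of i] calculation n0 by (simp add: zero_le_divide_iff)
      ultimately have "q i = of_nat (nat m) / of_nat (nat n)" using n0 by simp
      then show ?thesis using that[of "nat m" "nat n"] n0 by simp
    qed
    have qi: "of_rat (q i) = (of_nat a / of_nat b :: complex)" using ab(1) by (simp add: of_rat_divide)
    interpret C: coset_section G "K i"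
      using insert.prems(1)[of i] by (simp add: coset_section_def finite_group_axioms)
    let ?\<psi> = "\<lambda>g. of_nat (a * d) * ?u i g + of_nat b * \<psi> g"
    show ?case
    proof (rule bexI[of _ ?\<psi>], rule exI[of _ "b * d"], intro conjI ballI)
      show "?\<psi> \<in> true_chars G"
        by (intro true_chars_add true_chars_mult_nat C.ind_aug_true_char psi)
      show "b * d > 0" using ab(2) psi(2) by simp
      fix g assume g: "g \<in> carrier G"
      have "(\<Sum>j\<in>insert i I. of_rat (q j) * ?u j g) = of_nat a / of_nat b * ?u i g + \<psi> g / of_nat d"
        using insert.hyps psi(3)[OF g] qi by simp
      also have "\<dots> = ?\<psi> g / of_nat (b * d)"
        using psi(2) ab(2) by (simp add: add_divide_distrib)
      finally show "(\<Sum>j\<in>insert i I. of_rat (q j) * ?u j g) = ?\<psi> g / of_nat (b * d)" .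
    qed
  qed
  then obtain \<psi> d where psi': "\<psi> \<in> true_chars G" "d > 0"
      "\<forall>g\<in>carrier G. (\<Sum>i\<in>I. of_rat (q i) * ?u i g) = \<psi> g / of_nat d" by blast
  then have psi: "\<psi> \<in> true_chars G" "d > 0" "\<And>g. g \<in> carrier G \<Longrightarrow> \<chi> g = \<psi> g / of_nat d"
    using assms(4) by auto
  have "\<psi> \<in> virtual_chars G"
    unfolding virtual_chars_def
    by (rule CollectI, rule bexI[OF _ psi(1)], rule bexI[OF _ true_chars_zero]) simp
  then have rat: "\<chi> \<in> rat_chars G"
    unfolding rat_chars_def
    by - (intro CollectI, rule bexI[of _ \<psi>], rule exI[of _ "1 / of_nat d"], simp_all add: of_rat_divide psi(3))
  have "char_prod G \<eta> \<chi> \<in> \<real>\<^sub>\<ge>\<^sub>0" if eta: "\<eta> \<in> true_chars G" for \<eta>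
  proof -
    have "char_prod G \<eta> \<chi> = (\<Sum>g\<in>carrier G. \<Sum>i\<in>I. cnj (\<eta> g) * (of_rat (q i) * ?u i g)) / of_nat (card (carrier G))"
      by (simp add: char_prod_def assms(4) sum_distrib_left)
    also have "\<dots> = (\<Sum>i\<in>I. of_rat (q i) * char_prod G \<eta> (?u i))"
      by (subst sum.swap) (simp add: char_prod_def sum_distrib_left sum_divide_distrib mult_ac)
    also have "\<dots> \<in> \<real>\<^sub>\<ge>\<^sub>0"
    proof (rule sum_in_nonneg)
      fix i assume i: "i \<in> I"
      have "(of_rat (q i) :: complex) = of_real (of_rat (q i))"
        by (cases "q i") (simp add: of_rat_rat)
      then have "(of_rat (q i) :: complex) \<in> \<real>\<^sub>\<ge>\<^sub>0" using assms(3)[OF i] by simp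
      then show "of_rat (q i) * char_prod G \<eta> (?u i) \<in> \<real>\<^sub>\<ge>\<^sub>0"
        using char_prod_ind_aug[OF assms(2)[OF i] eta] by (rule nonneg_Reals_mult_I)
    qed
    finally show ?thesis .
  qed
  then show ?thesis using rat by (simp add: pos_rat_chars_def)
qed

text \<open>\<open>c t\<close> is the gap between \<open>t\<close> and the preceding element of
  \<open>T\<close>, or \<open>t\<close> itself if there is none.\<close>

lemma layer_cake:
  assumes "finite T" "\<And>t. t \<in> T \<Longrightarrow> t \<ge> (0::rat)"
  shows "\<exists>c. (\<forall>t\<in>T. c t \<ge> 0) \<and> (\<forall>x\<in>T. x = (\<Sum>t | t \<in> T \<and> t \<le> x. c t))"
  using assms
proof (induction T rule: finite_linorder_max_induct)
  case (insert b A)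
  then have "\<exists>c. (\<forall>t\<in>A. c t \<ge> 0) \<and> (\<forall>x\<in>A. x = (\<Sum>t | t \<in> A \<and> t \<le> x. c t))" by simp
  then obtain c where c': "\<forall>t\<in>A. c t \<ge> 0" "\<forall>x\<in>A. x = (\<Sum>t | t \<in> A \<and> t \<le> x. c t)" by blast
  note c = bspec[OF c'(1)] bspec[OF c'(2)]
  let ?c = "c(b := b - (\<Sum>t\<in>A. c t))"
  have le: "(\<Sum>t\<in>A. c t) \<le> b"
  proof (cases "A = {}")
    case False
    then have m: "Max A \<in> A" using insert.hyps by simp
    have "{t. t \<in> A \<and> t \<le> Max A} = A" using insert.hyps by auto
    then have "Max A = (\<Sum>t\<in>A. c t)" using c(2)[OF m] by simp
    then show ?thesis using insert.hyps m by force
  qed (use insert.prems in auto)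
  have b: "b \<notin> A" using insert.hyps by auto
  have 1: "(\<Sum>t | t \<in> insert b A \<and> t \<le> x. ?c t) = (\<Sum>t | t \<in> A \<and> t \<le> x. c t)" if "x \<in> A" for x
    using that insert.hyps b by (intro sum.cong) (auto simp: not_le)
  have "{t. t \<in> insert b A \<and> t \<le> b} = insert b A" using insert.hyps by auto
  moreover have "(\<Sum>t\<in>A. ?c t) = (\<Sum>t\<in>A. c t)" using b by (intro sum.cong) auto
  ultimately have 2: "(\<Sum>t | t \<in> insert b A \<and> t \<le> b. ?c t) = b"
    using insert.hyps b by simp
  show ?case
    using 1 2 c le by (intro exI[of _ ?c]) auto
qed simp

text \<open>The superlevel sets of \<open>d\<close> filter \<open>H\<close> by subgroups, in the
  manner of a ramification filtration. Writing \<open>d\<close> as the sum of the gaps between its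
  levels turns \<open>\<delta>\<close> into a combination of the induced augmentation characters of
  these subgroups; the weight \<open>card (K t)\<close> cancels the denominator of
  induction.\<close>

lemma pos_rat_chars_filtration:
  fixes d :: "'g \<Rightarrow> rat"
  assumes H: "subgroup H G"
    and d0: "\<And>\<sigma>. \<sigma> \<in> H \<Longrightarrow> \<sigma> \<noteq> \<one> \<Longrightarrow> d \<sigma> \<ge> 0"
    and dinv: "\<And>\<sigma>. \<sigma> \<in> H \<Longrightarrow> \<sigma> \<noteq> \<one> \<Longrightarrow> d (inv \<sigma>) = d \<sigma>"
    and dmult: "\<And>\<sigma> \<tau>. \<sigma> \<in> H \<Longrightarrow> \<tau> \<in> H \<Longrightarrow> \<sigma> \<noteq> \<one> \<Longrightarrow> \<tau> \<noteq> \<one> \<Longrightarrow> \<sigma> \<otimes> \<tau> \<noteq> \<one> \<Longrightarrow>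
      d (\<sigma> \<otimes> \<tau>) \<ge> min (d \<sigma>) (d \<tau>)"
    and val: "\<And>\<sigma>. \<sigma> \<in> carrier G \<Longrightarrow> \<sigma> \<noteq> \<one> \<Longrightarrow>
      \<delta> \<sigma> = - (\<Sum>y | y \<in> carrier G \<and> inv y \<otimes> \<sigma> \<otimes> y \<in> H. of_rat (d (inv y \<otimes> \<sigma> \<otimes> y)))"
    and zero: "(\<Sum>\<sigma>\<in>carrier G. \<delta> \<sigma>) = 0"
  shows "\<delta> \<in> pos_rat_chars G"
proof -
  have finH: "finite H" using subgroup.subset[OF H] fin finite_subset by blast
  define T where "T = d ` (H - {\<one>})"
  have "finite T" "\<And>t. t \<in> T \<Longrightarrow> t \<ge> 0" using finH d0 by (auto simp: T_def)
  from layer_cake[OF this] obtain c where c': "\<forall>t\<in>T. c t \<ge> 0"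
    "\<forall>x\<in>T. x = (\<Sum>t | t \<in> T \<and> t \<le> x. c t)" by blast
  note c = bspec[OF c'(1)] bspec[OF c'(2)]
  \<comment> \<open>The identity is put into every level by hand, since the assumptions do not
    control \<open>d\<close> there.\<close>
  define K where "K t = {\<sigma> \<in> H. \<sigma> = \<one> \<or> d \<sigma> \<ge> t}" for t
  have K: "subgroup (K t) G" for t
  proof (rule subgroupI)
    show "K t \<subseteq> carrier G" using subgroup.subset[OF H] by (auto simp: K_def)
    show "K t \<noteq> {}" using subgroup.one_closed[OF H] by (auto simp: K_def)
    fix a assume a: "a \<in> K t"
    show "inv a \<in> K t"
      using a dinv[of a] subgroup.m_inv_closed[OF H, of a] by (cases "a = \<one>") (auto simp: K_def)
    fix b assume b: "b \<in> K t"
    have ab: "a \<in> H" "b \<in> H" "a \<otimes> b \<in> H" using a b subgroup.m_closed[OF H] by (auto simp: K_def)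
    have cc: "a \<in> carrier G" "b \<in> carrier G" using ab subgroup.mem_carrier[OF H] by auto
    show "a \<otimes> b \<in> K t"
      using a b ab cc dmult[OF ab(1,2)] by (cases "a = \<one> \<or> b = \<one> \<or> a \<otimes> b = \<one>") (auto simp: K_def)
  qed
  let ?u = "\<lambda>t. ind_char G (K t) (aug_char G (K t))"
  define \<eta> where "\<eta> g = (\<Sum>t\<in>T. of_rat (c t * of_nat (card (K t))) * ?u t g)" for g
  have "\<delta> g = \<eta> g" if g: "g \<in> carrier G" for g
  proof (rule zero_sum_eqI[OF zero _ _ g])
    have "(\<Sum>g\<in>carrier G. \<eta> g) = (\<Sum>t\<in>T. of_rat (c t * of_nat (card (K t))) * (\<Sum>g\<in>carrier G. ?u t g))"
      unfolding \<eta>_def by (subst sum.swap) (simp add: sum_distrib_left)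
    then show "(\<Sum>g\<in>carrier G. \<eta> g) = 0" using sum_ind_aug[OF K] by simp
    fix g assume g: "g \<in> carrier G" "g \<noteq> \<one>"
    let ?Y = "{y \<in> carrier G. inv y \<otimes> g \<otimes> y \<in> H}"
    have finY: "finite ?Y" using fin by simp
    have dT: "d (inv y \<otimes> g \<otimes> y) \<in> T" if "y \<in> ?Y" for y
      using that g conj_one_iff by (auto simp: T_def)
    have "\<eta> g = (\<Sum>t\<in>T. - of_rat (c t) * of_nat (card {y \<in> carrier G. inv y \<otimes> g \<otimes> y \<in> K t}))"
      unfolding \<eta>_def
    proof (rule sum.cong[OF refl])
      fix t
      have "card (K t) \<noteq> 0" using subgroup_card_pos[OF K[of t]] by simp
      then show "of_rat (c t * of_nat (card (K t))) * ?u t g =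
        - of_rat (c t) * of_nat (card {y \<in> carrier G. inv y \<otimes> g \<otimes> y \<in> K t})"
        using g by (simp add: ind_aug_nonid of_rat_mult)
    qed
    also have "\<dots> = (\<Sum>t\<in>T. - (\<Sum>y\<in>?Y. if t \<le> d (inv y \<otimes> g \<otimes> y) then of_rat (c t) else 0))"
    proof (intro sum.cong refl)
      fix t
      have "{y \<in> carrier G. inv y \<otimes> g \<otimes> y \<in> K t} = {y \<in> ?Y. t \<le> d (inv y \<otimes> g \<otimes> y)}"
        using g conj_one_iff by (auto simp: K_def)
      then show "- of_rat (c t) * of_nat (card {y \<in> carrier G. inv y \<otimes> g \<otimes> y \<in> K t}) =
        - (\<Sum>y\<in>?Y. if t \<le> d (inv y \<otimes> g \<otimes> y) then of_rat (c t) else 0 :: complex)"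
        using finY by (simp add: sum.inter_filter[symmetric])
    qed
    also have "\<dots> = - (\<Sum>y\<in>?Y. \<Sum>t\<in>T. if t \<le> d (inv y \<otimes> g \<otimes> y) then of_rat (c t) else 0)"
      by (simp add: sum_negf sum.swap[of _ T])
    also have "\<dots> = - (\<Sum>y\<in>?Y. of_rat (d (inv y \<otimes> g \<otimes> y)))"
    proof (intro arg_cong[where f = uminus] sum.cong refl)
      fix y assume y: "y \<in> ?Y"
      have "(of_rat (d (inv y \<otimes> g \<otimes> y)) :: complex) = of_rat (\<Sum>t | t \<in> T \<and> t \<le> d (inv y \<otimes> g \<otimes> y). c t)"
        using c(2)[OF dT[OF y]] by simp
      then show "(\<Sum>t\<in>T. if t \<le> d (inv y \<otimes> g \<otimes> y) then of_rat (c t) else 0) = (of_rat (d (inv y \<otimes> g \<otimes> y)) :: complex)"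
        using \<open>finite T\<close> by (simp add: sum.inter_filter[symmetric] of_rat_sum)
    qed
    also have "\<dots> = \<delta> g" using val[OF g] by simp
    finally show "\<delta> g = \<eta> g" by simp
  qed
  then show ?thesis
    by (intro pos_rat_chars_combination[of T K "\<lambda>t. c t * of_nat (card (K t))"])
      (use c K \<open>finite T\<close> in \<open>auto simp: \<eta>_def\<close>)
qed

end

section \<open>Clusters of a finite ultrametric space with a group action\<close>

text \<open>\<open>w b c\<close> is modelled on the valuation of a difference: large values mean
  close points. At \<open>b = c\<close> it would be infinite, so positivity and the ultrametric
  inequality concern distinct points only, and later definitions treat coincidence
  separately.\<close>

locale ultrametric_action = finite_group G for G :: "('g, 'm) monoid_scheme" (structure) +
  fixes B :: "'y set" and act :: "'g \<Rightarrow> 'y \<Rightarrow> 'y" and w :: "'y \<Rightarrow> 'y \<Rightarrow> rat"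
  assumes finB: "finite B" and B_ne: "B \<noteq> {}"
    and act_B: "\<And>\<sigma> b. \<sigma> \<in> carrier G \<Longrightarrow> b \<in> B \<Longrightarrow> act \<sigma> b \<in> B"
    and act_one: "\<And>b. b \<in> B \<Longrightarrow> act \<one> b = b"
    and act_mult: "\<And>\<sigma> \<tau> b. \<sigma> \<in> carrier G \<Longrightarrow> \<tau> \<in> carrier G \<Longrightarrow> b \<in> B \<Longrightarrow> act (\<sigma> \<otimes> \<tau>) b = act \<sigma> (act \<tau> b)"
    and w_pos: "\<And>b c. b \<in> B \<Longrightarrow> c \<in> B \<Longrightarrow> b \<noteq> c \<Longrightarrow> w b c > 0"
    and w_sym: "\<And>b c. w b c = w c b"
    and w_ultra: "\<And>a b c. a \<in> B \<Longrightarrow> b \<in> B \<Longrightarrow> c \<in> B \<Longrightarrow> a \<noteq> b \<Longrightarrow> b \<noteq> c \<Longrightarrow> a \<noteq> c \<Longrightarrow> min (w a b) (w b c) \<le> w a c"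
    and w_act: "\<And>\<sigma> b c. \<sigma> \<in> carrier G \<Longrightarrow> b \<in> B \<Longrightarrow> c \<in> B \<Longrightarrow> w (act \<sigma> b) (act \<sigma> c) = w b c"
begin

lemma act_inv: "\<sigma> \<in> carrier G \<Longrightarrow> b \<in> B \<Longrightarrow> act (inv \<sigma>) (act \<sigma> b) = b"
  using act_mult[of "inv \<sigma>" \<sigma> b] act_one by simp

lemma act_inv': "\<sigma> \<in> carrier G \<Longrightarrow> b \<in> B \<Longrightarrow> act \<sigma> (act (inv \<sigma>) b) = b"
  using act_mult[of \<sigma> "inv \<sigma>" b] act_one by simp

lemma inj_act: "\<sigma> \<in> carrier G \<Longrightarrow> inj_on (act \<sigma>) B"
  by (metis act_inv inj_onI)

definition img :: "'g \<Rightarrow> 'y set \<Rightarrow> 'y set" where "img \<sigma> D = act \<sigma> ` D"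

lemma img_sub: "\<sigma> \<in> carrier G \<Longrightarrow> D \<subseteq> B \<Longrightarrow> img \<sigma> D \<subseteq> B"
  using act_B by (auto simp: img_def)

lemma img_one: "D \<subseteq> B \<Longrightarrow> img \<one> D = D"
  using act_one by (force simp: img_def)

lemma img_mult: "\<sigma> \<in> carrier G \<Longrightarrow> \<tau> \<in> carrier G \<Longrightarrow> D \<subseteq> B \<Longrightarrow> img (\<sigma> \<otimes> \<tau>) D = img \<sigma> (img \<tau> D)"
  unfolding img_def image_image using act_mult by (intro image_cong) auto

lemma img_inv: "\<sigma> \<in> carrier G \<Longrightarrow> D \<subseteq> B \<Longrightarrow> img (inv \<sigma>) (img \<sigma> D) = D"
  using img_mult[of "inv \<sigma>" \<sigma> D] img_one by simp

lemma img_inv': "\<sigma> \<in> carrier G \<Longrightarrow> D \<subseteq> B \<Longrightarrow> img \<sigma> (img (inv \<sigma>) D) = D"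
  using img_mult[of \<sigma> "inv \<sigma>" D] img_one by simp

lemma card_img: "\<sigma> \<in> carrier G \<Longrightarrow> D \<subseteq> B \<Longrightarrow> card (img \<sigma> D) = card D"
  unfolding img_def by (rule card_image) (meson inj_act inj_on_subset)

lemma img_B: "\<sigma> \<in> carrier G \<Longrightarrow> img \<sigma> B = B"
  using img_sub[of \<sigma> B] card_img[of \<sigma> B] finB by (simp add: card_subset_eq)

lemma img_mono: "D \<subseteq> E \<Longrightarrow> img \<sigma> D \<subseteq> img \<sigma> E" by (auto simp: img_def)

definition ball :: "'y \<Rightarrow> rat \<Rightarrow> 'y set" where "ball b \<rho> = {x \<in> B. x = b \<or> w b x \<ge> \<rho>}"

text \<open>A set of the second kind is the smallest ball that contains both \<open>b\<close> and
  \<open>c\<close>.\<close>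

definition clusters :: "'y set set" where
  "clusters = {{b} | b. b \<in> B} \<union> {ball b (w b c) | b c. b \<in> B \<and> c \<in> B \<and> b \<noteq> c}"

lemma ball_center: "b \<in> B \<Longrightarrow> x \<in> ball b \<rho> \<Longrightarrow> ball x \<rho> = ball b \<rho>"
proof -
  have sub: "ball b \<rho> \<subseteq> ball x \<rho>" if b: "b \<in> B" and x: "x \<in> ball b \<rho>" for b x
  proof
    fix y assume y: "y \<in> ball b \<rho>"
    have xB: "x \<in> B" "y \<in> B" using x y by (auto simp: ball_def)
    show "y \<in> ball x \<rho>"
    proof (cases "x = b \<or> y = b \<or> x = y")
      case True
      then show ?thesis using x y b w_sym[of b x] by (auto simp: ball_def)
    next
      case False
      then have "w x b \<ge> \<rho>" "w b y \<ge> \<rho>" using x y w_sym[of b x] by (auto simp: ball_def)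
      then show ?thesis using w_ultra[of x b y] False b xB by (auto simp: ball_def)
    qed
  qed
  assume b: "b \<in> B" and x: "x \<in> ball b \<rho>"
  have "b \<in> ball x \<rho>" using x b w_sym[of b x] by (auto simp: ball_def)
  then show ?thesis using sub[OF b x] sub[of x b] x by (auto simp: ball_def)
qed

lemma cluster_sub: "D \<in> clusters \<Longrightarrow> D \<subseteq> B"
  by (auto simp: clusters_def ball_def)

lemma cluster_ne: "D \<in> clusters \<Longrightarrow> D \<noteq> {}"
  by (auto simp: clusters_def ball_def)

lemma cluster_fin: "D \<in> clusters \<Longrightarrow> finite D"
  using cluster_sub finB finite_subset by blast

lemma fin_clusters: "finite clusters"
  by (rule finite_subset[of _ "Pow B"]) (use cluster_sub finB in auto)

lemma singleton_cluster: "b \<in> B \<Longrightarrow> {b} \<in> clusters"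
  by (auto simp: clusters_def)

lemma ball_cluster: "b \<in> B \<Longrightarrow> c \<in> B \<Longrightarrow> b \<noteq> c \<Longrightarrow> ball b (w b c) \<in> clusters"
  by (auto simp: clusters_def)

text \<open>Every point of a ball is a centre, so both clusters are balls around the common point
  \<open>x\<close>, or \<open>{x}\<close> itself, and balls with the same centre are ordered by
  their radii.\<close>

lemma nested:
  assumes D: "D \<in> clusters" and E: "E \<in> clusters" and x: "x \<in> D" "x \<in> E"
  shows "D \<subseteq> E \<or> E \<subseteq> D"
proof -
  have form: "(\<exists>\<rho>. D = ball x \<rho>) \<or> D = {x}" if D: "D \<in> clusters" "x \<in> D" for D
  proof -
    consider b where "D = {b}" | b c where "D = ball b (w b c)" "b \<in> B"
      using D(1) unfolding clusters_def by blast
    then show ?thesis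
    proof cases
      case 1
      then show ?thesis using D(2) by simp
    next
      case 2
      have "D = ball x (w b c)" using ball_center[of b x "w b c"] 2 D(2) by simp
      then show ?thesis by blast
    qed
  qed
  consider "D = {x}" | "E = {x}" | \<rho> \<rho>' where "D = ball x \<rho>" "E = ball x \<rho>'"
    using form[OF D x(1)] form[OF E x(2)] by blast
  then show ?thesis
  proof cases
    case 3
    then show ?thesis by (cases "\<rho> \<le> \<rho>'") (auto simp: ball_def)
  qed (use x in auto)
qed

text \<open>A minimum of closeness, hence the diameter; meaningful for clusters with at least two
  points.\<close>

definition rad :: "'y set \<Rightarrow> rat" where "rad D = Min {w x y | x y. x \<in> D \<and> y \<in> D \<and> x \<noteq> y}"

lemma rad_props:
  assumes D: "D \<in> clusters" "card D \<ge> 2"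
  shows "\<And>x y. x \<in> D \<Longrightarrow> y \<in> D \<Longrightarrow> x \<noteq> y \<Longrightarrow> rad D \<le> w x y"
    and "\<And>x. x \<in> D \<Longrightarrow> D = ball x (rad D)"
    and "\<And>x. x \<in> D \<Longrightarrow> \<exists>c\<in>D. c \<noteq> x \<and> rad D = w x c"
    and "rad D > 0"
proof -
  have "\<not> (\<exists>b. D = {b})" using D(2) by auto
  then obtain b c where bc: "b \<in> B" "c \<in> B" "b \<noteq> c" "D = ball b (w b c)"
    using D(1) unfolding clusters_def by blast
  have cD: "b \<in> D" "c \<in> D" using bc by (auto simp: ball_def)
  let ?W = "{w x y | x y. x \<in> D \<and> y \<in> D \<and> x \<noteq> y}"
  have "?W \<subseteq> (\<lambda>(x, y). w x y) ` (D \<times> D)" by auto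
  then have finW: "finite ?W" using cluster_fin[OF D(1)] finite_subset by blast
  have low: "w b c \<le> w x y" if xy: "x \<in> D" "y \<in> D" "x \<noteq> y" for x y
  proof -
    have "D = ball x (w b c)" using ball_center[of b x "w b c"] bc xy(1) by simp
    then show ?thesis using xy by (auto simp: ball_def)
  qed
  have r: "rad D = w b c"
    unfolding rad_def
  proof (rule Min_eqI[OF finW])
    show "w b c \<in> ?W" using cD bc(3) by blast
    show "w b c \<le> y" if "y \<in> ?W" for y using that low by blast
  qed
  show "rad D \<le> w x y" if "x \<in> D" "y \<in> D" "x \<noteq> y" for x y using low[OF that] r by simp
  show ball: "D = ball x (rad D)" if "x \<in> D" for x using ball_center[of b x "w b c"] bc that r by simp
  show "rad D > 0" using r w_pos bc by simp
  show "\<exists>c\<in>D. c \<noteq> x \<and> rad D = w x c" if x: "x \<in> D" for x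
  proof (cases "x = b \<or> x = c")
    case True
    then show ?thesis using r cD bc(3) w_sym[of b c] by auto
  next
    case False
    have sub: "D \<subseteq> B" using cluster_sub D(1) by blast
    \<comment> \<open>The radius is attained from every point: \<open>x\<close> cannot be closer
      than the radius to both \<open>b\<close> and \<open>c\<close>.\<close>
    have "min (w b x) (w x c) \<le> w b c" using w_ultra[of b x c] False bc x sub by auto
    then consider "w b x \<le> w b c" | "w x c \<le> w b c" by linarith
    then show ?thesis
    proof cases
      case 1
      then have "w x b = rad D" using low[of x b] r cD x False w_sym[of b x] by auto
      then show ?thesis using cD False by auto
    next
      case 2
      then have "w x c = rad D" using low[of x c] r cD x False by auto
      then show ?thesis using cD False by auto
    qed
  qed
qed

lemma B_cluster: "B \<in> clusters"
proof (cases "card B \<ge> 2")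
  case False
  moreover have "card B > 0" using finB B_ne by (simp add: card_gt_0_iff)
  ultimately have "card B = 1" by linarith
  then obtain b where "B = {b}" by (rule card_1_singletonE)
  then show ?thesis using singleton_cluster[of b] by simp
next
  case True
  obtain b where b: "b \<in> B" using B_ne by blast
  have "\<not> B \<subseteq> {b}"
  proof
    assume "B \<subseteq> {b}"
    then have "card B \<le> 1" using card_mono[of "{b}" B] by simp
    then show False using True by simp
  qed
  then have ne: "w b ` (B - {b}) \<noteq> {}" by auto
  have fin: "finite (w b ` (B - {b}))" using finB by simp
  have "Min (w b ` (B - {b})) \<in> w b ` (B - {b})" by (rule Min_in[OF fin ne])
  then obtain c where c: "c \<in> B - {b}" "w b c = Min (w b ` (B - {b}))" by (metis imageE)
  have "ball b (w b c) = B"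
    using b c Min_le[OF fin] by (auto simp: ball_def)
  then show ?thesis using ball_cluster[of b c] b c by auto
qed

lemma img_cluster: "\<sigma> \<in> carrier G \<Longrightarrow> D \<in> clusters \<Longrightarrow> img \<sigma> D \<in> clusters"
proof -
  assume s: "\<sigma> \<in> carrier G" and D: "D \<in> clusters"
  consider b where "D = {b}" "b \<in> B" | b c where "D = ball b (w b c)" "b \<in> B" "c \<in> B" "b \<noteq> c"
    using D unfolding clusters_def by blast
  then show ?thesis
  proof cases
    case 1
    then show ?thesis using act_B[OF s] singleton_cluster by (simp add: img_def)
  next
    case 2
    have "img \<sigma> D = ball (act \<sigma> b) (w (act \<sigma> b) (act \<sigma> c))"
    proof
      show "img \<sigma> D \<subseteq> ball (act \<sigma> b) (w (act \<sigma> b) (act \<sigma> c))"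
        using 2 act_B[OF s] w_act[OF s] by (auto simp: img_def ball_def)
      show "ball (act \<sigma> b) (w (act \<sigma> b) (act \<sigma> c)) \<subseteq> img \<sigma> D"
      proof
        fix y assume y: "y \<in> ball (act \<sigma> b) (w (act \<sigma> b) (act \<sigma> c))"
        define x where "x = act (inv \<sigma>) y"
        have x: "x \<in> B" "act \<sigma> x = y" using y act_B[of "inv \<sigma>" y] act_inv'[OF s] s by (auto simp: x_def ball_def)
        have "x \<in> D" using y x 2 w_act[OF s] inj_onD[OF inj_act[OF s]] by (auto simp: ball_def)
        then show "y \<in> img \<sigma> D" using x by (auto simp: img_def)
      qed
    qed
    moreover have "act \<sigma> b \<noteq> act \<sigma> c" using inj_onD[OF inj_act[OF s]] 2 by blast
    ultimately show ?thesis using ball_cluster[of "act \<sigma> b" "act \<sigma> c"] act_B[OF s] 2 by simp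
  qed
qed

text \<open>The clusters strictly above \<open>D\<close> form a finite chain by
  \<open>nested\<close>, so for \<open>D \<noteq> B\<close> the intersection is the least of them,
  the parent of \<open>D\<close> in the tree of clusters.\<close>

definition pare :: "'y set \<Rightarrow> 'y set" where "pare D = \<Inter>{E \<in> clusters. D \<subset> E}"

lemma pare:
  assumes D: "D \<in> clusters" "D \<noteq> B"
  shows "pare D \<in> clusters" "D \<subset> pare D" "\<And>E. E \<in> clusters \<Longrightarrow> D \<subset> E \<Longrightarrow> pare D \<subseteq> E"
proof -
  let ?S = "{E \<in> clusters. D \<subset> E}"
  have "B \<in> ?S" using D B_cluster cluster_sub by auto
  then have ne: "?S \<noteq> {}" by blast
  have fi: "finite ?S" using fin_clusters by simp
  obtain M where M: "M \<in> ?S" "\<forall>E\<in>?S. E \<subseteq> M \<longrightarrow> M = E"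
    using finite_has_minimal[OF fi ne] by blast
  have min: "M \<subseteq> E" if E: "E \<in> clusters" "D \<subset> E" for E
  proof -
    obtain x where "x \<in> D" using cluster_ne[OF D(1)] by blast
    then have "M \<subseteq> E \<or> E \<subseteq> M" using nested[of M E x] M(1) E by blast
    then show ?thesis using M(2) E by blast
  qed
  have "pare D = M" unfolding pare_def using M(1) min by blast
  then show "pare D \<in> clusters" "D \<subset> pare D" "\<And>E. E \<in> clusters \<Longrightarrow> D \<subset> E \<Longrightarrow> pare D \<subseteq> E"
    using M(1) min by auto
qed

text \<open>One inclusion holds for every group element; applied to the inverse it gives the
  other.\<close>

lemma pare_img:
  assumes s: "\<sigma> \<in> carrier G" and D: "D \<in> clusters" "D \<noteq> B"
  shows "pare (img \<sigma> D) = img \<sigma> (pare D)" "img \<sigma> D \<noteq> B"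
proof -
  have nB: "img \<sigma> E \<noteq> B" if E: "E \<in> clusters" "E \<noteq> B" and s: "\<sigma> \<in> carrier G" for E \<sigma>
    using img_inv[OF s cluster_sub[OF E(1)]] img_B[of "inv \<sigma>"] s E(2) by auto
  show n: "img \<sigma> D \<noteq> B" by (rule nB[OF D s])
  have le: "pare (img \<sigma> D) \<subseteq> img \<sigma> (pare D)" if s: "\<sigma> \<in> carrier G" and D: "D \<in> clusters" "D \<noteq> B" for \<sigma> D
  proof (rule pare(3)[OF img_cluster[OF s D(1)] nB[OF D s]])
    show "img \<sigma> (pare D) \<in> clusters" using img_cluster[OF s pare(1)[OF D]] .
    have "img \<sigma> D \<subseteq> img \<sigma> (pare D)" using pare(2)[OF D] by (intro img_mono) blast
    moreover have "img \<sigma> D \<noteq> img \<sigma> (pare D)"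
    proof
      assume e: "img \<sigma> D = img \<sigma> (pare D)"
      have "D = pare D" using arg_cong[OF e, of "img (inv \<sigma>)"]
        by (simp only: img_inv[OF s cluster_sub[OF D(1)]] img_inv[OF s cluster_sub[OF pare(1)[OF D]]])
      then show False using pare(2)[OF D] by blast
    qed
    ultimately show "img \<sigma> D \<subset> img \<sigma> (pare D)" by blast
  qed
  have i: "inv \<sigma> \<in> carrier G" using s by simp
  have "pare (img (inv \<sigma>) (img \<sigma> D)) \<subseteq> img (inv \<sigma>) (pare (img \<sigma> D))"
    by (rule le[OF i img_cluster[OF s D(1)] n])
  then have "pare D \<subseteq> img (inv \<sigma>) (pare (img \<sigma> D))" by (simp only: img_inv[OF s cluster_sub[OF D(1)]])
  then have "img \<sigma> (pare D) \<subseteq> img \<sigma> (img (inv \<sigma>) (pare (img \<sigma> D)))" by (rule img_mono)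
  then have "img \<sigma> (pare D) \<subseteq> pare (img \<sigma> D)"
    by (simp only: img_inv'[OF s cluster_sub[OF pare(1)[OF img_cluster[OF s D(1)] n]]])
  then show "pare (img \<sigma> D) = img \<sigma> (pare D)" using le[OF s D] by blast
qed

lemma pare_card: "D \<in> clusters \<Longrightarrow> D \<noteq> B \<Longrightarrow> card (pare D) \<ge> 2"
proof -
  assume D: "D \<in> clusters" "D \<noteq> B"
  have "card D < card (pare D)" using psubset_card_mono[OF cluster_fin[OF pare(1)[OF D]] pare(2)[OF D]] .
  moreover have "card D > 0" using cluster_ne[OF D(1)] cluster_fin[OF D(1)] by (simp add: card_gt_0_iff)
  ultimately show ?thesis by linarith
qed

lemma eq_of_meet:
  assumes "D \<in> clusters" "E \<in> clusters" "card D = card E" "x \<in> D" "x \<in> E"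
  shows "D = E"
  using nested[OF assms(1,2,4,5)] assms(3) card_subset_eq[OF cluster_fin[OF assms(2)], of D]
    card_subset_eq[OF cluster_fin[OF assms(1)], of E] by auto

text \<open>Take a maximal cluster among those through \<open>x\<close> strictly inside
  \<open>D\<close>; the singleton shows that there are some.\<close>

lemma child_exists:
  assumes D: "D \<in> clusters" "card D \<ge> 2" and x: "x \<in> D"
  shows "\<exists>E\<in>clusters. E \<noteq> B \<and> pare E = D \<and> x \<in> E"
proof -
  have xB: "x \<in> B" using cluster_sub[OF D(1)] x by blast
  let ?S = "{E \<in> clusters. x \<in> E \<and> E \<subset> D}"
  have "{x} \<in> ?S" using singleton_cluster[OF xB] x D(2) by auto
  then have ne: "?S \<noteq> {}" by blast
  have fi: "finite ?S" using fin_clusters by simp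
  obtain M where M: "M \<in> ?S" "\<forall>E\<in>?S. M \<subseteq> E \<longrightarrow> M = E"
    using finite_has_maximal[OF fi ne] by blast
  have MB: "M \<in> clusters" "M \<noteq> B" using M(1) cluster_sub[OF D(1)] by auto
  have "pare M \<subseteq> D" using pare(3)[OF MB D(1)] M(1) by blast
  moreover have "pare M \<noteq> D \<Longrightarrow> False"
  proof -
    assume n: "pare M \<noteq> D"
    then have "pare M \<in> ?S" using \<open>pare M \<subseteq> D\<close> pare(1,2)[OF MB] M(1) by auto
    then show False using M(2) pare(2)[OF MB] by blast
  qed
  ultimately show ?thesis using MB M(1) by blast
qed

lemma child_unique:
  assumes "E \<in> clusters" "E \<noteq> B" "E' \<in> clusters" "E' \<noteq> B" "pare E = pare E'" "x \<in> E" "x \<in> E'"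
  shows "E = E'"
proof (rule ccontr)
  assume n: "E \<noteq> E'"
  consider "E \<subset> E'" | "E' \<subset> E" using nested[OF assms(1,3,6,7)] n by blast
  then show False
  proof cases
    case 1
    then show False using pare(3)[OF assms(1,2,3)] pare(2)[OF assms(3,4)] assms(5) by blast
  next
    case 2
    then show False using pare(3)[OF assms(3,4,1)] pare(2)[OF assms(1,2)] assms(5) by blast
  qed
qed

text \<open>The ball around \<open>x\<close> of radius \<open>w x y\<close> is strictly smaller than
  the parent of \<open>E\<close>. It is comparable with \<open>E\<close>, and it cannot be strictly
  larger because the parent is the least cluster above \<open>E\<close>.\<close>

lemma w_gt_child:
  assumes E: "E \<in> clusters" "E \<noteq> B" and x: "x \<in> E" and y: "y \<in> B" "y \<noteq> x" "w x y > rad (pare E)"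
  shows "y \<in> E"
proof -
  let ?D = "pare E" and ?b = "ball x (w x y)"
  note D = pare(1)[OF E] pare_card[OF E]
  have xB: "x \<in> B" using cluster_sub[OF E(1)] x by blast
  have b: "?b \<in> clusters" using ball_cluster[OF xB y(1)] y(2) by auto
  have xb: "x \<in> ?b" "y \<in> ?b" using xB y by (auto simp: ball_def)
  have "x \<in> ?D" using pare(2)[OF E] x by blast
  note Dx = rad_props(2)[OF D this] rad_props(3)[OF D this]
  have "?b \<subseteq> ball x (rad ?D)" using y(3) by (auto simp: ball_def)
  then have sub: "?b \<subseteq> ?D" using equalityD2[OF Dx(1)] by (rule order_trans)
  have "?b \<noteq> ?D"
  proof
    assume e: "?b = ?D"
    obtain c where "c \<in> ?D" "c \<noteq> x" "rad ?D = w x c" using Dx(2) by blast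
    moreover from this have "c \<in> ball x (w x y)" using equalityD2[OF e] by blast
    ultimately show False using y(3) by (auto simp: ball_def)
  qed
  then have "?b \<subset> ?D" using sub by blast
  have "?b \<subseteq> E \<or> E \<subset> ?b" using nested[OF b E(1) xb(1) x] by blast
  then show ?thesis using pare(3)[OF E b] \<open>?b \<subset> ?D\<close> xb(2) by blast
qed

lemma rad_mono: "E \<in> clusters \<Longrightarrow> E \<noteq> B \<Longrightarrow> card E \<ge> 2 \<Longrightarrow> rad (pare E) < rad E"
proof -
  assume E: "E \<in> clusters" "E \<noteq> B" "card E \<ge> 2"
  note D = pare(1)[OF E(1,2)] pare_card[OF E(1,2)]
  obtain x where x: "x \<in> E" using cluster_ne[OF E(1)] by blast
  have xD: "x \<in> pare E" using pare(2)[OF E(1,2)] x by blast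
  have "\<not> rad E \<le> rad (pare E)"
  proof
    assume "rad E \<le> rad (pare E)"
    then have "ball x (rad (pare E)) \<subseteq> ball x (rad E)" by (auto simp: ball_def)
    then show False
      using equalityD2[OF rad_props(2)[OF E(1,3) x]] equalityD1[OF rad_props(2)[OF D xD]] pare(2)[OF E(1,2)] by blast
  qed
  then show ?thesis by simp
qed

lemma rad_img: "\<sigma> \<in> carrier G \<Longrightarrow> D \<in> clusters \<Longrightarrow> card D \<ge> 2 \<Longrightarrow> rad (img \<sigma> D) = rad D"
proof -
  assume s: "\<sigma> \<in> carrier G" and D: "D \<in> clusters" "card D \<ge> 2"
  have D': "img \<sigma> D \<in> clusters" "card (img \<sigma> D) \<ge> 2" using img_cluster[OF s D(1)] card_img[OF s cluster_sub[OF D(1)]] D(2) by auto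
  obtain x where x: "x \<in> D" using cluster_ne[OF D(1)] by blast
  obtain c where c: "c \<in> D" "c \<noteq> x" "rad D = w x c" using rad_props(3)[OF D x] by blast
  have B: "x \<in> B" "c \<in> B" using cluster_sub[OF D(1)] x c by auto
  have "act \<sigma> x \<in> img \<sigma> D" using x by (simp add: img_def)
  then obtain c' where c': "c' \<in> img \<sigma> D" "c' \<noteq> act \<sigma> x" "rad (img \<sigma> D) = w (act \<sigma> x) c'"
    using rad_props(3)[OF D'] by blast
  obtain d where d: "d \<in> D" "c' = act \<sigma> d" using c'(1) by (auto simp: img_def)
  have "rad D \<le> w x d" using rad_props(1)[OF D x d(1)] c'(2) d(2) by auto
  also have "\<dots> = rad (img \<sigma> D)" using c'(3) d w_act[OF s B(1)] cluster_sub[OF D(1)] by auto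
  finally have 1: "rad D \<le> rad (img \<sigma> D)" .
  have "act \<sigma> x \<noteq> act \<sigma> c" using inj_onD[OF inj_act[OF s]] B c(2) by blast
  then have "rad (img \<sigma> D) \<le> w (act \<sigma> x) (act \<sigma> c)"
    using x c by (intro rad_props(1)[OF D']) (auto simp: img_def)
  then show ?thesis using 1 c(3) w_act[OF s B] by simp
qed

text \<open>A singleton inherits the radius of its parent, which will give the edges into leaves
  length 0. If \<open>B\<close> is a singleton it gets radius 0, the radius that belongs to the
  root.\<close>

definition R :: "'y set \<Rightarrow> rat" where
  "R D = (if card D \<ge> 2 then rad D else if D = B then 0 else rad (pare D))"

lemma R_img: "\<sigma> \<in> carrier G \<Longrightarrow> D \<in> clusters \<Longrightarrow> R (img \<sigma> D) = R D"
proof -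
  assume s: "\<sigma> \<in> carrier G" and D: "D \<in> clusters"
  have c: "card (img \<sigma> D) = card D" by (rule card_img[OF s cluster_sub[OF D]])
  show ?thesis
  proof (cases "card D \<ge> 2 \<or> D = B")
    case True
    then show ?thesis using rad_img[OF s D] c img_B[OF s] by (auto simp: R_def)
  next
    case False
    then show ?thesis using rad_img[OF s pare(1)[OF D] pare_card[OF D]] pare_img[OF s D] c by (simp add: R_def)
  qed
qed

text \<open>Except in the degenerate case the radius is a value \<open>w b c\<close>, which is the
  form of radius for which the conditions on \<open>m\<close> in the next locale are stated.\<close>

lemma R_choice:
  assumes D: "D \<in> clusters" and b: "b \<in> D"
  shows "(B = {b} \<and> R D = 0) \<or> (\<exists>c\<in>B. c \<noteq> b \<and> R D = w b c)"
proof -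
  have "\<exists>c\<in>B. c \<noteq> b \<and> rad E = w b c" if "E \<in> clusters" "card E \<ge> 2" "b \<in> E" for E
    using rad_props(3)[OF that] cluster_sub[OF that(1)] by blast
  note * = this
  show ?thesis
  proof (cases "card D \<ge> 2")
    case True
    then show ?thesis using *[OF D True b] by (simp add: R_def)
  next
    case False
    show ?thesis
    proof (cases "D = B")
      case True
      have R0: "R D = 0" using True False by (simp add: R_def)
      have "card D \<le> card {b}" using False by simp
      then have "D = {b}" using card_seteq[OF cluster_fin[OF D], of "{b}"] b by auto
      then show ?thesis using True R0 by blast
    next
      case dB: False
      have "b \<in> pare D" using pare(2)[OF D dB] b by blast
      then show ?thesis using *[OF pare(1)[OF D dB] pare_card[OF D dB]] False dB by (simp add: R_def)
    qed
  qed
qed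

lemma small_cluster: "D \<in> clusters \<Longrightarrow> \<not> card D \<ge> 2 \<Longrightarrow> b \<in> D \<Longrightarrow> D = {b}"
  using card_seteq[OF cluster_fin, of D "{b}"] by auto

lemma cluster_R:
  assumes D: "D \<in> clusters" and b: "b \<in> D" and x: "x \<in> D" "x \<noteq> b"
  shows "R D \<le> w b x"
proof -
  have "card D \<ge> 2" using small_cluster[OF D _ b] x by blast
  then show ?thesis using rad_props(1)[OF D _ b x(1)] x(2) by (simp add: R_def)
qed

end

section \<open>Depths of group elements on clusters\<close>

locale hurwitz_action = ultrametric_action G B act w
  for G :: "('g, 'm) monoid_scheme" (structure) and B :: "'y set" and act w +
  fixes p :: nat and fixB :: "'g \<Rightarrow> 'y set" and tr :: "rat \<Rightarrow> 'y \<Rightarrow> 'y \<Rightarrow> rat"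
    and m :: "'y \<Rightarrow> rat \<Rightarrow> 'g \<Rightarrow> rat" and stab :: "'y \<Rightarrow> 'g set"
  defines "fixB \<equiv> \<lambda>\<sigma>. {b \<in> B. act \<sigma> b = b}"
    and "tr \<equiv> \<lambda>\<rho> b y. if y = b then \<rho> else min \<rho> (w b y)"
    and "m \<equiv> \<lambda>b \<rho> \<sigma>. (\<Sum>y\<in>fixB \<sigma>. tr \<rho> b y) - \<rho>"
    and "stab \<equiv> \<lambda>b. {\<sigma> \<in> carrier G. act \<sigma> b = b}"
  assumes stab_nontriv: "\<And>b. b \<in> B \<Longrightarrow> stab b \<noteq> {\<one>}"
    and stab_cyclic: "\<And>b. b \<in> B \<Longrightarrow> cyclic_group (G\<lparr>carrier := stab b\<rparr>)"
    and m_nonneg: "\<And>b c \<sigma>. b \<in> B \<Longrightarrow> c \<in> B \<Longrightarrow> c \<noteq> b \<Longrightarrow> \<sigma> \<in> carrier G \<Longrightarrow> \<sigma> \<noteq> \<one> \<Longrightarrow>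
      act \<sigma> b = b \<or> w b (act \<sigma> b) \<ge> w b c \<Longrightarrow> m b (w b c) \<sigma> \<ge> 0"
    and m_mult: "\<And>b c \<sigma> \<tau>. b \<in> B \<Longrightarrow> c \<in> B \<Longrightarrow> c \<noteq> b \<Longrightarrow> \<sigma> \<in> carrier G \<Longrightarrow> \<tau> \<in> carrier G \<Longrightarrow>
      \<sigma> \<noteq> \<one> \<Longrightarrow> \<tau> \<noteq> \<one> \<Longrightarrow> \<sigma> \<otimes> \<tau> \<noteq> \<one> \<Longrightarrow>
      act \<sigma> b = b \<or> w b (act \<sigma> b) \<ge> w b c \<Longrightarrow> act \<tau> b = b \<or> w b (act \<tau> b) \<ge> w b c \<Longrightarrow>
      m b (w b c) (\<sigma> \<otimes> \<tau>) \<ge> min (m b (w b c) \<sigma>) (m b (w b c) \<tau>)"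
    and m_pos: "\<And>b c \<sigma>. b \<in> B \<Longrightarrow> c \<in> B \<Longrightarrow> c \<noteq> b \<Longrightarrow> \<sigma> \<in> carrier G \<Longrightarrow> \<sigma> \<noteq> \<one> \<Longrightarrow>
      m b (w b c) \<sigma> > 0 \<Longrightarrow> act \<sigma> b \<noteq> b \<Longrightarrow> w b (act \<sigma> b) > w b c"
    and delta_stab: "\<And>b P \<tau>. b \<in> B \<Longrightarrow> sylow_subgroup p G (stab b) P \<Longrightarrow> \<tau> \<in> P \<Longrightarrow> \<tau> \<noteq> \<one> \<Longrightarrow>
      delta_mult p G P \<tau> = - of_nat (card P) * of_rat (\<Sum>y\<in>fixB \<tau> - {b}. w b y)"
    and delta_sum: "\<And>b P. b \<in> B \<Longrightarrow> sylow_subgroup p G (stab b) P \<Longrightarrow> (\<Sum>\<tau>\<in>P. delta_mult p G P \<tau>) = 0"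
    and off_sylow: "\<And>b P \<tau>. b \<in> B \<Longrightarrow> sylow_subgroup p G (stab b) P \<Longrightarrow> \<tau> \<in> stab b \<Longrightarrow> \<tau> \<notin> P \<Longrightarrow>
      (\<Sum>y\<in>fixB \<tau> - {b}. w b y) = 0"
begin

lemma fin_fixB: "finite (fixB \<sigma>)" using finB by (simp add: fixB_def)

lemma fixB_inv: "\<sigma> \<in> carrier G \<Longrightarrow> fixB (inv \<sigma>) = fixB \<sigma>"
  unfolding fixB_def using act_inv[of \<sigma>] act_inv'[of \<sigma>] by (intro Collect_cong) metis

lemma fixB_conj:
  assumes y: "y \<in> carrier G" and s: "\<sigma> \<in> carrier G"
  shows "fixB \<sigma> = act y ` fixB (inv y \<otimes> \<sigma> \<otimes> y)"
proof -
  have e: "act (inv y \<otimes> \<sigma> \<otimes> y) b = act (inv y) (act \<sigma> (act y b))" if "b \<in> B" for b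
    using that y s act_mult act_B by simp
  show ?thesis
  proof (intro equalityI subsetI)
    fix x assume x: "x \<in> fixB \<sigma>"
    let ?b = "act (inv y) x"
    have b: "?b \<in> B" "act y ?b = x" using x y act_B[of "inv y" x] act_inv'[OF y] by (auto simp: fixB_def)
    then have "?b \<in> fixB (inv y \<otimes> \<sigma> \<otimes> y)" using x e[OF b(1)] by (simp add: fixB_def)
    then show "x \<in> act y ` fixB (inv y \<otimes> \<sigma> \<otimes> y)" using b(2) by (metis imageI)
  next
    fix x assume "x \<in> act y ` fixB (inv y \<otimes> \<sigma> \<otimes> y)"
    then obtain b where b: "b \<in> B" "act (inv y) (act \<sigma> (act y b)) = b" "x = act y b"
      using e by (auto simp: fixB_def)
    have xB: "x \<in> B" using b act_B y by simp
    have "act y (act (inv y) (act \<sigma> x)) = act y b" using b by simp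
    then have "act \<sigma> x = x" using act_inv'[OF y act_B[OF s xB]] b(3) by simp
    then show "x \<in> fixB \<sigma>" using xB by (simp add: fixB_def)
  qed
qed

text \<open>\<open>tr \<rho> b\<close> sees the centre only up to precision \<open>\<rho>\<close>:
  by the ultrametric inequality, moving the centre within the disc changes no truncated
  value.\<close>

lemma tr_center:
  assumes B: "b \<in> B" "c \<in> B" "y \<in> B" and bc: "b = c \<or> w b c \<ge> \<rho>"
  shows "tr \<rho> b y = tr \<rho> c y"
proof -
  have le: "tr \<rho> b y \<le> tr \<rho> c y" if B: "b \<in> B" "c \<in> B" and bc: "b = c \<or> w b c \<ge> \<rho>" for b c
  proof (cases "b = c \<or> y = b \<or> y = c")
    case True
    then show ?thesis using bc w_sym[of b c] by (auto simp: tr_def)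
  next
    case False
    then have "min (w c b) (w b y) \<le> w c y" by (intro w_ultra) (use B assms(3) in auto)
    then show ?thesis using False bc w_sym[of b c] by (auto simp: tr_def)
  qed
  show ?thesis using le[OF B(1,2) bc] le[OF B(2,1)] bc w_sym[of b c] by auto
qed

text \<open>The depth at the disc spanned by \<open>D\<close>, read from some point of
  \<open>D\<close>; by \<open>dd_eq\<close> the choice of the point does not matter.\<close>

definition dd :: "'y set \<Rightarrow> 'g \<Rightarrow> rat" where "dd D \<sigma> = m (SOME c. c \<in> D) (R D) \<sigma>"

lemma dd_eq:
  assumes D: "D \<in> clusters" and b: "b \<in> D"
  shows "dd D \<sigma> = m b (R D) \<sigma>"
proof -
  let ?c = "SOME c. c \<in> D"
  have c: "?c \<in> D" using b by (rule someI)
  have "?c = b \<or> w ?c b \<ge> R D" using cluster_R[OF D c b] by auto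
  then have "tr (R D) ?c y = tr (R D) b y" if "y \<in> fixB \<sigma>" for y
    using tr_center[of ?c b y] cluster_sub[OF D] c b that by (auto simp: fixB_def)
  then show ?thesis unfolding dd_def m_def by simp
qed

lemma dd_inv: "\<sigma> \<in> carrier G \<Longrightarrow> dd D (inv \<sigma>) = dd D \<sigma>"
  by (simp add: dd_def m_def fixB_inv)

lemma dd_img:
  assumes D: "D \<in> clusters" and y: "y \<in> carrier G" and s: "\<sigma> \<in> carrier G"
  shows "dd (img y D) \<sigma> = dd D (inv y \<otimes> \<sigma> \<otimes> y)"
proof -
  obtain b where b: "b \<in> D" using cluster_ne[OF D] by blast
  have bB: "b \<in> B" using cluster_sub[OF D] b by blast
  have ab: "act y b \<in> img y D" using b by (simp add: img_def)
  have inj: "inj_on (act y) (fixB (inv y \<otimes> \<sigma> \<otimes> y))"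
    using inj_act[OF y] by (rule inj_on_subset) (auto simp: fixB_def)
  have e: "tr \<rho> (act y b) (act y x) = tr \<rho> b x" if "x \<in> B" for x \<rho>
    using w_act[OF y bB that] inj_onD[OF inj_act[OF y], of x b] that bB by (auto simp: tr_def)
  have "(\<Sum>x\<in>fixB \<sigma>. tr (R D) (act y b) x) = (\<Sum>x\<in>fixB (inv y \<otimes> \<sigma> \<otimes> y). tr (R D) (act y b) (act y x))"
    unfolding fixB_conj[OF y s] using inj by (simp add: sum.reindex)
  also have "\<dots> = (\<Sum>x\<in>fixB (inv y \<otimes> \<sigma> \<otimes> y). tr (R D) b x)"
    by (rule sum.cong[OF refl], rule e) (simp add: fixB_def)
  finally show ?thesis
    using dd_eq[OF img_cluster[OF y D] ab] dd_eq[OF D b] R_img[OF y D] by (simp add: m_def)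
qed

lemma R_pare:
  assumes E: "E \<in> clusters" "E \<noteq> B"
  shows "R (pare E) = rad (pare E)" "R (pare E) \<le> R E" "card E \<ge> 2 \<Longrightarrow> R (pare E) < R E"
    "\<not> card E \<ge> 2 \<Longrightarrow> R (pare E) = R E" "R (pare E) > 0"
  using rad_mono[OF E] pare_card[OF E] E rad_props(4)[OF pare(1)[OF E] pare_card[OF E]] by (auto simp: R_def)

text \<open>Raising the radius from that of the parent to that of \<open>E\<close> changes a
  truncated term only for fixed points inside \<open>E\<close>, and there by the full difference;
  fixed points outside are no closer than the radius of the parent. The \<open>- 1\<close> comes
  from the radius subtracted in \<open>m\<close>.\<close>

lemma dd_diff:
  assumes E: "E \<in> clusters" "E \<noteq> B"
  shows "dd E \<sigma> - dd (pare E) \<sigma> = (of_nat (card (E \<inter> fixB \<sigma>)) - 1) * (R E - R (pare E))"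
proof -
  obtain b where b: "b \<in> E" using cluster_ne[OF E(1)] by blast
  have bD: "b \<in> pare E" using pare(2)[OF E] b by blast
  have bB: "b \<in> B" using b cluster_sub[OF E(1)] by blast
  have "tr (R E) b y - tr (R (pare E)) b y = (if y \<in> E then R E - R (pare E) else 0)" if y: "y \<in> fixB \<sigma>" for y
  proof (cases "y \<in> E")
    case True
    then have "y \<in> pare E" using pare(2)[OF E] by blast
    then show ?thesis using True cluster_R[OF E(1) b True] cluster_R[OF pare(1)[OF E] bD, of y]
      by (auto simp: tr_def)
  next
    case False
    have "y \<in> B" using y by (simp add: fixB_def)
    moreover have "y \<noteq> b" using False b by blast
    ultimately have "\<not> w b y > rad (pare E)" using w_gt_child[OF E b] False by blast
    then show ?thesis using False R_pare(1,2)[OF E] \<open>y \<noteq> b\<close> by (auto simp: tr_def)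
  qed
  then have "(\<Sum>y\<in>fixB \<sigma>. tr (R E) b y - tr (R (pare E)) b y) = (\<Sum>y\<in>fixB \<sigma>. if y \<in> E then R E - R (pare E) else 0)"
    by (rule sum.cong[OF refl])
  also have "\<dots> = (\<Sum>y\<in>fixB \<sigma> \<inter> E. R E - R (pare E))"
    by (simp only: sum.inter_restrict[OF fin_fixB])
  finally have *: "(\<Sum>y\<in>fixB \<sigma>. tr (R E) b y - tr (R (pare E)) b y) = of_nat (card (E \<inter> fixB \<sigma>)) * (R E - R (pare E))"
    by (simp only: sum_constant Int_commute[of "fixB \<sigma>"])
  have "dd E \<sigma> - dd (pare E) \<sigma> = (\<Sum>y\<in>fixB \<sigma>. tr (R E) b y - tr (R (pare E)) b y) - (R E - R (pare E))"
    using dd_eq[OF E(1) b] dd_eq[OF pare(1)[OF E] bD] by (simp add: m_def sum_subtractf)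
  then show ?thesis unfolding * by (simp add: left_diff_distrib)
qed

text \<open>The same variation along the trunk, starting from radius 0 and depth 0 at the
  root.\<close>

lemma dd_B: "dd B \<sigma> = (of_nat (card (fixB \<sigma>)) - 1) * R B"
proof -
  obtain b where b: "b \<in> B" using B_ne by blast
  have "tr (R B) b y = R B" if "y \<in> fixB \<sigma>" for y
    using that cluster_R[OF B_cluster b, of y] by (auto simp: tr_def fixB_def)
  then show ?thesis using dd_eq[OF B_cluster b] by (simp add: m_def left_diff_distrib)
qed

definition SS :: "'y set \<Rightarrow> 'g set" where "SS D = {\<sigma> \<in> carrier G. img \<sigma> D = D}"

definition orb :: "'y set \<Rightarrow> 'y set set" where "orb D = {img \<sigma> D | \<sigma>. \<sigma> \<in> carrier G}"

lemma SS_subgroup: "D \<in> clusters \<Longrightarrow> subgroup (SS D) G"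
proof -
  assume D: "D \<in> clusters"
  note s = cluster_sub[OF D]
  show ?thesis
  proof (rule subgroupI)
    show "SS D \<subseteq> carrier G" by (auto simp: SS_def)
    show "SS D \<noteq> {}" using img_one[OF s] by (auto simp: SS_def)
    show "inv a \<in> SS D" if "a \<in> SS D" for a using that img_inv[of a D] s by (auto simp: SS_def)
    show "a \<otimes> b \<in> SS D" if "a \<in> SS D" "b \<in> SS D" for a b using that img_mult[of a b D] s by (auto simp: SS_def)
  qed
qed

lemma SS_singleton: "b \<in> B \<Longrightarrow> SS {b} = stab b"
  by (auto simp: SS_def stab_def img_def)

lemma near:
  assumes D: "D \<in> clusters" and b: "b \<in> D" and s: "\<sigma> \<in> SS D"
  shows "act \<sigma> b = b \<or> w b (act \<sigma> b) \<ge> R D"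
proof -
  have "act \<sigma> b \<in> D" using s b by (auto simp: SS_def img_def)
  then show ?thesis using cluster_R[OF D b] by blast
qed

lemma dd_zero: "R B = 0 \<Longrightarrow> dd B \<sigma> = 0" by (simp add: dd_B)

lemma dd_nonneg:
  assumes D: "D \<in> clusters" and s: "\<sigma> \<in> SS D" "\<sigma> \<noteq> \<one>"
  shows "dd D \<sigma> \<ge> 0"
proof -
  obtain b where b: "b \<in> D" using cluster_ne[OF D] by blast
  have bB: "b \<in> B" using b cluster_sub[OF D] by blast
  have sG: "\<sigma> \<in> carrier G" using s by (simp add: SS_def)
  show ?thesis
  proof (rule disjE[OF R_choice[OF D b]])
    assume a: "B = {b} \<and> R D = 0"
    have d: "D = B" using conjunct1[OF a] b cluster_sub[OF D] by (intro equalityI) blast+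
    have z: "R B = 0" using conjunct2[OF a] unfolding d .
    show ?thesis unfolding d dd_zero[OF z] by simp
  next
    assume "\<exists>c\<in>B. c \<noteq> b \<and> R D = w b c"
    then obtain c where c: "c \<in> B" "c \<noteq> b" "R D = w b c" by blast
    show ?thesis using m_nonneg[OF bB c(1,2) sG s(2)] near[OF D b s(1)] dd_eq[OF D b] c(3) by simp
  qed
qed

lemma dd_mult:
  assumes D: "D \<in> clusters" and s: "\<sigma> \<in> SS D" "\<tau> \<in> SS D" "\<sigma> \<noteq> \<one>" "\<tau> \<noteq> \<one>" "\<sigma> \<otimes> \<tau> \<noteq> \<one>"
  shows "dd D (\<sigma> \<otimes> \<tau>) \<ge> min (dd D \<sigma>) (dd D \<tau>)"
proof -
  obtain b where b: "b \<in> D" using cluster_ne[OF D] by blast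
  have bB: "b \<in> B" using b cluster_sub[OF D] by blast
  have sG: "\<sigma> \<in> carrier G" "\<tau> \<in> carrier G" using s by (auto simp: SS_def)
  show ?thesis
  proof (rule disjE[OF R_choice[OF D b]])
    assume a: "B = {b} \<and> R D = 0"
    have d: "D = B" using conjunct1[OF a] b cluster_sub[OF D] by (intro equalityI) blast+
    have z: "R B = 0" using conjunct2[OF a] unfolding d .
    show ?thesis unfolding d dd_zero[OF z] by simp
  next
    assume "\<exists>c\<in>B. c \<noteq> b \<and> R D = w b c"
    then obtain c where c: "c \<in> B" "c \<noteq> b" "R D = w b c" by blast
    show ?thesis
      using m_mult[OF bB c(1,2) sG s(3-5)] near[OF D b s(1)] near[OF D b s(2)] dd_eq[OF D b] c(3) by simp
  qed
qed

text \<open>By \<open>m_pos\<close> a point of \<open>E\<close> moves to a point closer than the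
  radius of the parent, so it stays in \<open>E\<close>. The image of \<open>E\<close> is then a
  cluster of the same size that meets \<open>E\<close>.\<close>

lemma dd_pos_child:
  assumes E: "E \<in> clusters" "E \<noteq> B" and s: "\<sigma> \<in> carrier G" "\<sigma> \<noteq> \<one>" and pos: "dd (pare E) \<sigma> > 0"
  shows "img \<sigma> E = E"
proof -
  obtain x where x: "x \<in> E" using cluster_ne[OF E(1)] by blast
  have xD: "x \<in> pare E" using pare(2)[OF E] x by blast
  have xB: "x \<in> B" using x cluster_sub[OF E(1)] by blast
  obtain c where c: "c \<in> pare E" "c \<noteq> x" "rad (pare E) = w x c"
    using rad_props(3)[OF pare(1)[OF E] pare_card[OF E] xD] by blast
  have cB: "c \<in> B" using c(1) cluster_sub[OF pare(1)[OF E]] by blast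
  have Rw: "R (pare E) = w x c" using R_pare(1)[OF E] c(3) by simp
  have "m x (w x c) \<sigma> > 0" using pos dd_eq[OF pare(1)[OF E] xD] Rw by simp
  from m_pos[OF xB cB c(2) s this] have "act \<sigma> x \<in> E"
    using w_gt_child[OF E x act_B[OF s(1) xB]] x c(3) by (cases "act \<sigma> x = x") auto
  moreover have "act \<sigma> x \<in> img \<sigma> E" using x by (simp add: img_def)
  ultimately show ?thesis
    using eq_of_meet[OF img_cluster[OF s(1) E(1)] E(1)] card_img[OF s(1) cluster_sub[OF E(1)]] by blast
qed

lemma orb_clusters: "D \<in> clusters \<Longrightarrow> orb D \<subseteq> clusters" using img_cluster by (auto simp: orb_def)

lemma fin_orb: "finite (orb D)" using fin by (simp add: orb_def setcompr_eq_image)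

lemma self_orb: "D \<in> clusters \<Longrightarrow> D \<in> orb D"
  unfolding orb_def using img_one[OF cluster_sub] by (metis (mono_tags, lifting) mem_Collect_eq one_closed)

lemma orb_eq: "D \<in> clusters \<Longrightarrow> D' \<in> orb D \<Longrightarrow> orb D' = orb D"
proof -
  assume D: "D \<in> clusters" and D': "D' \<in> orb D"
  then obtain y where y: "y \<in> carrier G" "D' = img y D" by (auto simp: orb_def)
  note s = cluster_sub[OF D]
  show ?thesis
  proof (intro equalityI subsetI)
    fix E assume "E \<in> orb D'"
    then obtain z where "z \<in> carrier G" "E = img z D'" by (auto simp: orb_def)
    then have "E = img (z \<otimes> y) D" "z \<otimes> y \<in> carrier G" using y img_mult[OF _ y(1) s] by auto
    then show "E \<in> orb D" unfolding orb_def by blast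
  next
    fix E assume "E \<in> orb D"
    then obtain z where z: "z \<in> carrier G" "E = img z D" by (auto simp: orb_def)
    then have "E = img (z \<otimes> inv y) D'"
      using y img_mult[OF z(1) inv_closed[OF y(1)] img_sub[OF y(1) s]] img_inv[OF y(1) s] by simp
    then show "E \<in> orb D'" using z y unfolding orb_def by blast
  qed
qed

lemma SS_img:
  assumes D: "D \<in> clusters" and y: "y \<in> carrier G"
  shows "SS (img y D) = conj_set G y (SS D)"
proof -
  note s = cluster_sub[OF D]
  have iff: "\<sigma> \<in> SS (img y D) \<longleftrightarrow> inv y \<otimes> \<sigma> \<otimes> y \<in> SS D" if "\<sigma> \<in> carrier G" for \<sigma>
  proof -
    have e: "img (inv y \<otimes> \<sigma> \<otimes> y) D = img (inv y) (img \<sigma> (img y D))"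
      using that y s img_mult img_sub by simp
    have "img (inv y) (img \<sigma> (img y D)) = D \<longleftrightarrow> img \<sigma> (img y D) = img y D"
      using img_inv[OF y s] img_inv'[OF y img_sub[OF that img_sub[OF y s]]] by metis
    then show ?thesis using e that y by (simp add: SS_def)
  qed
  show ?thesis
  proof (intro equalityI subsetI)
    fix \<sigma> assume a: "\<sigma> \<in> SS (img y D)"
    then have sG: "\<sigma> \<in> carrier G" by (simp add: SS_def)
    have "\<sigma> = y \<otimes> (inv y \<otimes> \<sigma> \<otimes> y) \<otimes> inv y" using sG y by (simp add: m_assoc) (simp add: m_assoc[symmetric])
    then show "\<sigma> \<in> conj_set G y (SS D)" using iff[OF sG] a unfolding conj_set_def by blast
  next
    fix \<sigma> assume "\<sigma> \<in> conj_set G y (SS D)"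
    then obtain h where h: "h \<in> SS D" "\<sigma> = y \<otimes> h \<otimes> inv y" by (auto simp: conj_set_def)
    have hG: "h \<in> carrier G" using h by (simp add: SS_def)
    have "inv y \<otimes> \<sigma> \<otimes> y = h" using h(2) hG y by (simp add: m_assoc inv_solve_left')
    then show "\<sigma> \<in> SS (img y D)" using iff[of \<sigma>] h hG y by simp
  qed
qed

lemma SS_conj: "D \<in> clusters \<Longrightarrow> H \<in> conj_class G (SS D) \<Longrightarrow> \<exists>D'\<in>orb D. H = SS D'"
  unfolding conj_class_def orb_def using SS_img by blast

lemma SS_conj': "D \<in> clusters \<Longrightarrow> D' \<in> orb D \<Longrightarrow> \<exists>y\<in>carrier G. D' = img y D \<and> SS D' = conj_set G y (SS D)"
  unfolding orb_def using SS_img by blast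

lemma card_fiber:
  assumes D: "D \<in> clusters" and D': "D' \<in> orb D"
  shows "card {y \<in> carrier G. img y D = D'} = card (SS D)"
proof -
  obtain z where z: "z \<in> carrier G" "D' = img z D" using D' by (auto simp: orb_def)
  note s = cluster_sub[OF D]
  have "{y \<in> carrier G. img y D = D'} = (\<lambda>h. z \<otimes> h) ` SS D"
  proof (intro equalityI subsetI)
    fix y assume y: "y \<in> {y \<in> carrier G. img y D = D'}"
    then have "inv z \<otimes> y \<in> SS D" using z img_mult[of "inv z" y D] s img_inv[OF z(1) s] by (simp add: SS_def)
    moreover have "y = z \<otimes> (inv z \<otimes> y)" using y z by (simp add: m_assoc[symmetric])
    ultimately show "y \<in> (\<lambda>h. z \<otimes> h) ` SS D" by blast
  qed (use z img_mult[OF z(1) _ s] in \<open>auto simp: SS_def\<close>)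
  moreover have "inj_on (\<lambda>h. z \<otimes> h) (SS D)" using z(1) by (intro inj_onI) (auto simp: SS_def)
  ultimately show ?thesis by (simp add: card_image)
qed

lemma card_SS:
  assumes D: "D \<in> clusters" and D': "D' \<in> orb D"
  shows "card (SS D') = card (SS D)"
proof -
  obtain y where y: "y \<in> carrier G" "SS D' = conj_set G y (SS D)" using SS_conj'[OF D D'] by blast
  have "inj_on (\<lambda>h. y \<otimes> h \<otimes> inv y) (SS D)" using y(1) by (intro inj_onI) (auto simp: SS_def)
  then show ?thesis using y(2) by (simp add: conj_set_def card_image)
qed

lemma card_SS_pos: "D \<in> clusters \<Longrightarrow> card (SS D) > 0"
  by (rule subgroup_card_pos[OF SS_subgroup])

definition fx :: "'g \<Rightarrow> 'y set set \<Rightarrow> 'y set set" where "fx \<sigma> O1 = {D \<in> O1. img \<sigma> D = D}"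

lemma fin_fx: "finite (fx \<sigma> (orb D))" using fin_orb by (simp add: fx_def)

text \<open>The condition on \<open>y\<close> says that \<open>\<sigma>\<close> stabilizes
  \<open>img y D\<close>, and each member of the orbit is hit by one coset of
  \<open>SS D\<close>.\<close>

lemma orbit_sum:
  fixes f :: "'y set \<Rightarrow> 'c::comm_semiring_1"
  assumes D: "D \<in> clusters" and s: "\<sigma> \<in> carrier G"
  shows "(\<Sum>y | y \<in> carrier G \<and> inv y \<otimes> \<sigma> \<otimes> y \<in> SS D. f (img y D)) = of_nat (card (SS D)) * (\<Sum>D'\<in>fx \<sigma> (orb D). f D')"
proof -
  note sb = cluster_sub[OF D]
  let ?S = "{y. y \<in> carrier G \<and> inv y \<otimes> \<sigma> \<otimes> y \<in> SS D}"
  have iff: "inv y \<otimes> \<sigma> \<otimes> y \<in> SS D \<longleftrightarrow> img \<sigma> (img y D) = img y D" if y: "y \<in> carrier G" for y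
  proof -
    have e: "img (inv y \<otimes> \<sigma> \<otimes> y) D = img (inv y) (img \<sigma> (img y D))"
      using s y sb img_mult img_sub by simp
    have "img (inv y) (img \<sigma> (img y D)) = D \<longleftrightarrow> img \<sigma> (img y D) = img y D"
      using img_inv[OF y sb] img_inv'[OF y img_sub[OF s img_sub[OF y sb]]] by metis
    then show ?thesis using e s y by (simp add: SS_def)
  qed
  have finS: "finite ?S" using fin by simp
  have sub: "(\<lambda>y. img y D) ` ?S \<subseteq> fx \<sigma> (orb D)" using iff by (auto simp: fx_def orb_def)
  have "(\<Sum>y\<in>?S. f (img y D)) = (\<Sum>D'\<in>fx \<sigma> (orb D). \<Sum>y\<in>{y \<in> ?S. img y D = D'}. f (img y D))"
    using sum.group[OF finS fin_fx sub, of "\<lambda>y. f (img y D)"] by simp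
  also have "\<dots> = (\<Sum>D'\<in>fx \<sigma> (orb D). of_nat (card (SS D)) * f D')"
  proof (rule sum.cong[OF refl])
    fix D' assume D': "D' \<in> fx \<sigma> (orb D)"
    have "{y \<in> ?S. img y D = D'} = {y \<in> carrier G. img y D = D'}" using D' iff by (auto simp: fx_def)
    then show "(\<Sum>y\<in>{y \<in> ?S. img y D = D'}. f (img y D)) = of_nat (card (SS D)) * f D'"
      using card_fiber[OF D, of D'] D' by (simp add: fx_def)
  qed
  finally show ?thesis by (simp add: sum_distrib_left)
qed

text \<open>Off the identity the regular part of the augmentation character contributes nothing, and
  minus the permutation character on the orbit remains.\<close>

lemma ind_aug_SS:
  assumes D: "D \<in> clusters" and s: "\<sigma> \<in> carrier G" "\<sigma> \<noteq> \<one>"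
  shows "ind_char G (SS D) (aug_char G (SS D)) \<sigma> = - of_nat (card (fx \<sigma> (orb D)))"
  using ind_aug_nonid[OF s, of "SS D"] orbit_sum[OF D s(1), of "\<lambda>_. 1::complex"] card_SS_pos[OF D] by simp

text \<open>Orbit counting for the stabilizer of the parent on those children that lie in the orbit
  of \<open>E\<close>; an element carrying one such child to another stabilizes the parent by
  itself.\<close>

lemma card_children:
  assumes E: "E \<in> clusters" "E \<noteq> B"
  shows "card (SS (pare E)) = card (SS E) * card {E' \<in> orb E. pare E' = pare E}"
proof -
  let ?K = "{E' \<in> orb E. pare E' = pare E}"
  have fK: "finite ?K" using fin_orb by simp
  have finS: "finite (SS (pare E))" using fin by (simp add: SS_def)
  have sub: "(\<lambda>y. img y E) ` SS (pare E) \<subseteq> ?K"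
    using pare_img[OF _ E] by (auto simp: SS_def orb_def)
  have "card (SS (pare E)) = (\<Sum>E'\<in>?K. card {y \<in> SS (pare E). img y E = E'})"
    using sum.group[OF finS fK sub, of "\<lambda>_. 1::nat"] by simp
  also have "\<dots> = (\<Sum>E'\<in>?K. card (SS E))"
  proof (rule sum.cong[OF refl])
    fix E' assume E': "E' \<in> ?K"
    have "{y \<in> SS (pare E). img y E = E'} = {y \<in> carrier G. img y E = E'}"
      using E' pare_img[OF _ E] by (auto simp: SS_def)
    then show "card {y \<in> SS (pare E). img y E = E'} = card (SS E)" using card_fiber[OF E(1)] E' by simp
  qed
  finally show ?thesis by simp
qed

lemma orb_nB: "E \<in> clusters \<Longrightarrow> E \<noteq> B \<Longrightarrow> E' \<in> orb E \<Longrightarrow> E' \<in> clusters \<and> E' \<noteq> B"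
  using pare_img(2) img_cluster by (auto simp: orb_def)

lemma orb_pare: "E \<in> clusters \<Longrightarrow> E \<noteq> B \<Longrightarrow> pare ` orb E = orb (pare E)"
  using pare_img(1) unfolding orb_def by (auto simp: image_iff)

text \<open>Minus the depth character at the orbit of \<open>D\<close>, off the identity. The weight
  \<open>card (SS D)\<close> makes it a plain sum over all conjugators that bring
  \<open>\<sigma>\<close> into \<open>SS D\<close>, see \<open>Dl_conj\<close>.\<close>

definition Dl :: "'y set \<Rightarrow> 'g \<Rightarrow> rat" where
  "Dl D \<sigma> = of_nat (card (SS D)) * (\<Sum>D'\<in>fx \<sigma> (orb D). dd D' \<sigma>)"

lemma Dl_conj:
  assumes D: "D \<in> clusters" and s: "\<sigma> \<in> carrier G"
  shows "Dl D \<sigma> = (\<Sum>y | y \<in> carrier G \<and> inv y \<otimes> \<sigma> \<otimes> y \<in> SS D. dd D (inv y \<otimes> \<sigma> \<otimes> y))"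
  unfolding Dl_def orbit_sum[OF D s, of "\<lambda>D'. dd D' \<sigma>", symmetric] by (rule sum.cong) (auto simp: dd_img[OF D _ s])

text \<open>Moves the depth of the parent orbit to the level of the children, where it can be
  compared term by term. A stable parent of positive depth has all its children stable, and the
  number of those in the orbit of \<open>E\<close> is the index of the stabilizers; a stable parent
  of depth 0 contributes nothing on either side.\<close>

lemma Dl_pare:
  assumes E: "E \<in> clusters" "E \<noteq> B" and s: "\<sigma> \<in> carrier G" "\<sigma> \<noteq> \<one>"
  shows "Dl (pare E) \<sigma> = of_nat (card (SS E)) * (\<Sum>E'\<in>fx \<sigma> (orb E). dd (pare E') \<sigma>)"
proof -
  have sub: "pare ` fx \<sigma> (orb E) \<subseteq> fx \<sigma> (orb (pare E))"
  proof
    fix D' assume "D' \<in> pare ` fx \<sigma> (orb E)"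
    then obtain E' where E': "E' \<in> orb E" "img \<sigma> E' = E'" "D' = pare E'" by (auto simp: fx_def)
    then show "D' \<in> fx \<sigma> (orb (pare E))"
      using orb_pare[OF E] pare_img(1)[OF s(1), of E'] orb_nB[OF E E'(1)] by (auto simp: fx_def)
  qed
  have t: "of_nat (card (SS (pare E))) * dd D' \<sigma> = of_nat (card (SS E)) * (\<Sum>E'\<in>{E' \<in> fx \<sigma> (orb E). pare E' = D'}. dd (pare E') \<sigma>)"
    if D': "D' \<in> fx \<sigma> (orb (pare E))" for D'
  proof -
    have D'o: "D' \<in> orb (pare E)" "img \<sigma> D' = D'" using D' by (auto simp: fx_def)
    then obtain F where F: "F \<in> orb E" "pare F = D'" using orb_pare[OF E] by (metis imageE)
    note Fc = orb_nB[OF E F(1)]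
    have D'c: "D' \<in> clusters" using orb_clusters[OF pare(1)[OF E]] D'o by blast
    show ?thesis
    proof (cases "dd D' \<sigma> = 0")
      case True
      then show ?thesis by simp
    next
      case False
      \<comment> \<open>Depths of stabilizing elements are nonnegative, so a nonzero depth is
        positive and \<open>dd_pos_child\<close> applies.\<close>
      then have pos: "dd D' \<sigma> > 0"
        using dd_nonneg[OF D'c _ s(2)] D'o(2) s(1) by (force simp: SS_def)
      have "{E' \<in> fx \<sigma> (orb E). pare E' = D'} = {E' \<in> orb F. pare E' = pare F}"
        using dd_pos_child[OF _ _ s] pos F orb_eq[OF E(1) F(1)] orb_nB[OF E] by (auto simp: fx_def)
      moreover have "card (SS (pare E)) = card (SS E) * card {E' \<in> orb F. pare E' = pare F}"
        using card_children[of F] Fc card_SS[OF E(1) F(1)] card_SS[OF pare(1)[OF E] D'o(1)] F(2) by simp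
      ultimately show ?thesis using F(2) by simp
    qed
  qed
  have "Dl (pare E) \<sigma> = (\<Sum>D'\<in>fx \<sigma> (orb (pare E)). of_nat (card (SS (pare E))) * dd D' \<sigma>)"
    by (simp add: Dl_def sum_distrib_left)
  also have "\<dots> = (\<Sum>D'\<in>fx \<sigma> (orb (pare E)). of_nat (card (SS E)) * (\<Sum>E'\<in>{E' \<in> fx \<sigma> (orb E). pare E' = D'}. dd (pare E') \<sigma>))"
    by (rule sum.cong[OF refl]) (rule t)
  also have "\<dots> = of_nat (card (SS E)) * (\<Sum>E'\<in>fx \<sigma> (orb E). dd (pare E') \<sigma>)"
    unfolding sum_distrib_left[symmetric] by (simp only: sum.group[OF fin_fx fin_fx sub])
  finally show ?thesis .
qed

text \<open>A fixed point forces the member of the orbit around it to be stable, and distinct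
  members are disjoint.\<close>

lemma card_fix_orb:
  assumes E: "E \<in> clusters" and s: "\<sigma> \<in> carrier G"
  shows "card (\<Union> (orb E) \<inter> fixB \<sigma>) = (\<Sum>E'\<in>fx \<sigma> (orb E). card (E' \<inter> fixB \<sigma>))"
proof -
  have "\<Union> (orb E) \<inter> fixB \<sigma> = (\<Union>E'\<in>fx \<sigma> (orb E). E' \<inter> fixB \<sigma>)"
  proof (intro equalityI subsetI)
    fix x assume "x \<in> \<Union> (orb E) \<inter> fixB \<sigma>"
    then obtain F where F: "F \<in> orb E" "x \<in> F" "x \<in> fixB \<sigma>" by blast
    have Fc: "F \<in> clusters" using orb_clusters[OF E] F(1) by blast
    have "x \<in> img \<sigma> F" using F(2,3) unfolding fixB_def img_def by force
    then have "img \<sigma> F = F"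
      using eq_of_meet[OF img_cluster[OF s Fc] Fc card_img[OF s cluster_sub[OF Fc]]] F(2) by blast
    then show "x \<in> (\<Union>E'\<in>fx \<sigma> (orb E). E' \<inter> fixB \<sigma>)" using F by (auto simp: fx_def)
  qed (auto simp: fx_def)
  moreover have "card (\<Union>E'\<in>fx \<sigma> (orb E). E' \<inter> fixB \<sigma>) = (\<Sum>E'\<in>fx \<sigma> (orb E). card (E' \<inter> fixB \<sigma>))"
  proof (rule card_UN_disjoint[OF fin_fx])
    show "\<forall>i\<in>fx \<sigma> (orb E). finite (i \<inter> fixB \<sigma>)" using fin_fixB by blast
    show "\<forall>i\<in>fx \<sigma> (orb E). \<forall>j\<in>fx \<sigma> (orb E). i \<noteq> j \<longrightarrow> i \<inter> fixB \<sigma> \<inter> (j \<inter> fixB \<sigma>) = {}"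
    proof (intro ballI impI, rule ccontr)
      fix i j assume ij: "i \<in> fx \<sigma> (orb E)" "j \<in> fx \<sigma> (orb E)" "i \<noteq> j" "i \<inter> fixB \<sigma> \<inter> (j \<inter> fixB \<sigma>) \<noteq> {}"
      then obtain x where x: "x \<in> i" "x \<in> j" by blast
      have o: "i \<in> orb E" "j \<in> orb E" using ij by (auto simp: fx_def)
      then have "card i = card E" "card j = card E" using card_img cluster_sub[OF E] by (auto simp: orb_def)
      then show False using eq_of_meet[OF _ _ _ x] orb_clusters[OF E] o ij(3) by auto
    qed
  qed
  ultimately show ?thesis by simp
qed

text \<open>This is the edge condition off the identity with all signs reversed: the factor before
  the bracket is the length of the edge, and the bracket is the induced augmentation character minus
  the Artin character.\<close>

lemma Dl_diff:
  assumes E: "E \<in> clusters" "E \<noteq> B" and s: "\<sigma> \<in> carrier G" "\<sigma> \<noteq> \<one>"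
  shows "Dl E \<sigma> - Dl (pare E) \<sigma> = of_nat (card (SS E)) * (R E - R (pare E)) *
     (of_nat (card (\<Union> (orb E) \<inter> fixB \<sigma>)) - of_nat (card (fx \<sigma> (orb E))))"
proof -
  have "Dl E \<sigma> - Dl (pare E) \<sigma> = of_nat (card (SS E)) * (\<Sum>E'\<in>fx \<sigma> (orb E). dd E' \<sigma> - dd (pare E') \<sigma>)"
    unfolding Dl_pare[OF assms] unfolding Dl_def by (simp add: sum_subtractf right_diff_distrib)
  also have "(\<Sum>E'\<in>fx \<sigma> (orb E). dd E' \<sigma> - dd (pare E') \<sigma>)
      = (\<Sum>E'\<in>fx \<sigma> (orb E). (of_nat (card (E' \<inter> fixB \<sigma>)) - 1) * (R E - R (pare E)))"
  proof (rule sum.cong[OF refl])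
    fix E' assume "E' \<in> fx \<sigma> (orb E)"
    then have o: "E' \<in> orb E" by (simp add: fx_def)
    then obtain y where y: "y \<in> carrier G" "E' = img y E" by (auto simp: orb_def)
    have "R E' = R E" "R (pare E') = R (pare E)"
      using R_img[OF y(1) E(1)] R_img[OF y(1) pare(1)[OF E]] pare_img(1)[OF y(1) E] y(2) by simp_all
    then show "dd E' \<sigma> - dd (pare E') \<sigma> = (of_nat (card (E' \<inter> fixB \<sigma>)) - 1) * (R E - R (pare E))"
      using dd_diff[of E' \<sigma>] orb_nB[OF E o] by simp
  qed
  also have "\<dots> = (of_nat (card (\<Union> (orb E) \<inter> fixB \<sigma>)) - of_nat (card (fx \<sigma> (orb E)))) * (R E - R (pare E))"
    by (simp add: card_fix_orb[OF E(1) s(1)] sum_distrib_right[symmetric] sum_subtractf)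
  finally show ?thesis by (simp add: mult_ac)
qed

lemma orb_B: "orb B = {B}" using img_B by (auto simp: orb_def)

lemma SS_B: "SS B = carrier G" using img_B by (auto simp: SS_def)

lemma Dl_B:
  assumes s: "\<sigma> \<in> carrier G"
  shows "Dl B \<sigma> = of_nat (card (SS B)) * R B * (of_nat (card (\<Union> (orb B) \<inter> fixB \<sigma>)) - of_nat (card (fx \<sigma> (orb B))))"
proof -
  have "fx \<sigma> (orb B) = {B}" using orb_B img_B[OF s] by (auto simp: fx_def)
  moreover have "B \<inter> fixB \<sigma> = fixB \<sigma>" by (auto simp: fixB_def)
  ultimately show ?thesis unfolding Dl_def orb_B by (simp add: dd_B)
qed

text \<open>No other point is closer to \<open>b\<close> than the radius of the parent, so
  truncation changes nothing, and the term at \<open>b\<close> itself cancels the subtracted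
  radius.\<close>

lemma dd_singleton:
  assumes b: "b \<in> B" and t: "\<tau> \<in> stab b"
  shows "dd {b} \<tau> = (\<Sum>y\<in>fixB \<tau> - {b}. w b y)"
proof -
  have bc: "{b} \<in> clusters" by (rule singleton_cluster[OF b])
  have bf: "b \<in> fixB \<tau>" using b t by (simp add: fixB_def stab_def)
  have "tr (R {b}) b y = w b y" if y: "y \<in> fixB \<tau> - {b}" for y
  proof -
    have nB: "{b} \<noteq> B" using y by (auto simp: fixB_def)
    have yB: "y \<in> B" "y \<noteq> b" using y by (auto simp: fixB_def)
    have "w b y \<le> rad (pare {b})" using w_gt_child[OF bc nB _ yB] yB by force
    then show ?thesis using yB nB by (simp add: tr_def R_def)
  qed
  then have "(\<Sum>y\<in>fixB \<tau> - {b}. tr (R {b}) b y) = (\<Sum>y\<in>fixB \<tau> - {b}. w b y)" by (rule sum.cong[OF refl])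
  moreover have "(\<Sum>y\<in>fixB \<tau>. tr (R {b}) b y) = R {b} + (\<Sum>y\<in>fixB \<tau> - {b}. tr (R {b}) b y)"
    using sum.remove[OF fin_fixB bf, of "tr (R {b}) b"] by (simp add: tr_def)
  ultimately show ?thesis using dd_eq[OF bc, of b \<tau>] by (simp add: m_def)
qed

end

section \<open>The tree of orbits of clusters\<close>

context hurwitz_action
begin

text \<open>The orbits receive the numbers from 1 on, and 0 is kept for the root, an extra vertex
  above the orbit of \<open>B\<close>.\<close>

definition enum :: "nat \<Rightarrow> 'y set set" where
  "enum = (SOME e. bij_betw e {1..card (orb ` clusters)} (orb ` clusters))"

definition verts :: "nat set" where "verts = {0..card (orb ` clusters)}"

definition idx :: "'y set \<Rightarrow> nat" where "idx D = inv_into (verts - {0}) enum (orb D)"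

text \<open>The root carries \<open>B\<close> as well, so that its group is \<open>G\<close> like
  that of its successor; hence \<open>rep\<close> does not separate the vertices 0 and
  \<open>idx B\<close>.\<close>

definition rep :: "nat \<Rightarrow> 'y set" where "rep v = (if v = 0 then B else SOME D. D \<in> enum v)"

definition par :: "nat \<Rightarrow> nat" where "par v = (if rep v = B then 0 else idx (pare (rep v)))"

text \<open>Cluster sizes are constant on orbits and drop strictly from parent to child; the added 1
  separates the vertex of \<open>B\<close> from the root.\<close>

definition level :: "nat \<Rightarrow> nat" where "level v = (if v = 0 then 0 else Suc (card B - card (rep v)))"

lemma enum: "bij_betw enum (verts - {0}) (orb ` clusters)"
proof -
  have "\<exists>e. bij_betw e {1..card (orb ` clusters)} (orb ` clusters)"
    by (rule ex_bij_betw_nat_finite_1) (simp add: fin_clusters)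
  then have "bij_betw enum {1..card (orb ` clusters)} (orb ` clusters)"
    unfolding enum_def by (rule someI_ex)
  moreover have "verts - {0} = {1..card (orb ` clusters)}" by (auto simp: verts_def)
  ultimately show ?thesis by simp
qed

lemma rep:
  assumes "v \<in> verts"
  shows "rep v \<in> clusters" "v \<noteq> 0 \<Longrightarrow> enum v = orb (rep v)"
proof -
  have *: "rep v \<in> clusters \<and> enum v = orb (rep v)" if "v \<noteq> 0"
  proof -
    have "enum v \<in> orb ` clusters" using bij_betwE[OF enum] assms that by blast
    then obtain D where D: "D \<in> clusters" "enum v = orb D" by blast
    have "(SOME D. D \<in> enum v) \<in> enum v" using self_orb[OF D(1)] unfolding D(2) by (rule someI)
    then have r: "rep v \<in> orb D" unfolding rep_def D(2) using that by simp
    show ?thesis unfolding D(2) using orb_clusters[OF D(1)] orb_eq[OF D(1) r] r by blast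
  qed
  show "v \<noteq> 0 \<Longrightarrow> enum v = orb (rep v)" using * by blast
  show "rep v \<in> clusters" using * B_cluster by (cases "v = 0") (auto simp: rep_def)
qed

lemma idx:
  assumes D: "D \<in> clusters"
  shows "idx D \<in> verts" "idx D \<noteq> 0" "enum (idx D) = orb D" "orb (rep (idx D)) = orb D" "rep (idx D) \<in> orb D"
proof -
  have im: "orb D \<in> enum ` (verts - {0})" using bij_betw_imp_surj_on[OF enum] D by blast
  have "idx D \<in> verts - {0}" unfolding idx_def by (rule inv_into_into[OF im])
  then show 1: "idx D \<in> verts" "idx D \<noteq> 0" by auto
  show 2: "enum (idx D) = orb D" unfolding idx_def by (rule f_inv_into_f[OF im])
  show 3: "orb (rep (idx D)) = orb D" using rep(2)[OF 1] 2 by simp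
  show "rep (idx D) \<in> orb D" using self_orb[OF rep(1)[OF 1(1)]] 3 by simp
qed

lemma idx_rep: "v \<in> verts \<Longrightarrow> v \<noteq> 0 \<Longrightarrow> idx (rep v) = v"
  unfolding idx_def using rep(2)[of v] inv_into_f_f[OF bij_betw_imp_inj_on[OF enum], of v] by simp

lemma idx_cong: "orb D = orb E \<Longrightarrow> idx D = idx E" by (simp add: idx_def)

lemma rep_idx_B: "rep (idx B) = B" using idx(5)[OF B_cluster] orb_B by simp

lemma par_idx: "E \<in> clusters \<Longrightarrow> E \<noteq> B \<Longrightarrow> par (idx E) = idx (pare E)"
proof -
  assume E: "E \<in> clusters" "E \<noteq> B"
  note r = idx(5)[OF E(1)]
  have "pare (rep (idx E)) \<in> orb (pare E)" using r orb_pare[OF E] by blast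
  from idx_cong[OF orb_eq[OF pare(1)[OF E] this]] show ?thesis using orb_nB[OF E r] unfolding par_def by simp
qed

lemma par_zero: "v \<in> verts \<Longrightarrow> par v = 0 \<longleftrightarrow> rep v = B"
  using idx(2) pare(1) rep(1)[of v] by (auto simp: par_def)

lemma card_orb: "D \<in> clusters \<Longrightarrow> D' \<in> orb D \<Longrightarrow> card D' = card D"
  using card_img cluster_sub by (auto simp: orb_def)

lemma card_le_B: "D \<in> clusters \<Longrightarrow> card D \<le> card B"
  using card_mono[OF finB cluster_sub] .

sublocale parent_tree verts 0 par level
proof
  show "finite verts" "0 \<in> verts" by (auto simp: verts_def)
  fix v assume v: "v \<in> verts" "v \<noteq> 0"
  note c = rep(1)[OF v(1)]
  show "par v \<in> verts" using idx(1)[OF pare(1)[OF c]] by (auto simp: par_def verts_def)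
  show "level (par v) < level v"
  proof (cases "rep v = B")
    case True
    then show ?thesis using v by (simp add: par_def level_def)
  next
    case False
    note p = pare(1)[OF c False]
    have "card (rep v) < card (pare (rep v))" using psubset_card_mono[OF cluster_fin[OF p] pare(2)[OF c False]] .
    moreover have "card (rep (idx (pare (rep v)))) = card (pare (rep v))" using card_orb[OF p idx(5)[OF p]] .
    ultimately show ?thesis using v False idx(2)[OF p] card_le_B[OF p] by (simp add: par_def level_def)
  qed
qed

lemma children:
  assumes v: "v \<in> verts" "v \<noteq> 0"
  shows "{w. w \<in> verts \<and> w \<noteq> 0 \<and> par w = v} = idx ` {E \<in> clusters. E \<noteq> B \<and> pare E = rep v}"
proof (intro equalityI subsetI)
  fix u assume u: "u \<in> {w. w \<in> verts \<and> w \<noteq> 0 \<and> par w = v}"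
  have uB: "rep u \<noteq> B" using u v par_zero[of u] by auto
  have uc: "rep u \<in> clusters" using u rep by blast
  have "idx (pare (rep u)) = v" using u uB by (simp add: par_def)
  then have "orb (pare (rep u)) = orb (rep v)" using idx(4)[OF pare(1)[OF uc uB]] by metis
  then have "rep v \<in> pare ` orb (rep u)" using self_orb[OF rep(1)[OF v(1)]] orb_pare[OF uc uB] by simp
  then obtain E where E: "E \<in> orb (rep u)" "pare E = rep v" by blast
  have "idx E = u" using idx_cong[OF orb_eq[OF uc E(1)]] idx_rep u by simp
  then show "u \<in> idx ` {E \<in> clusters. E \<noteq> B \<and> pare E = rep v}"
    using E orb_nB[OF uc uB E(1)] by blast
next
  fix u assume "u \<in> idx ` {E \<in> clusters. E \<noteq> B \<and> pare E = rep v}"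
  then obtain E where E: "E \<in> clusters" "E \<noteq> B" "pare E = rep v" "u = idx E" by blast
  then show "u \<in> {w. w \<in> verts \<and> w \<noteq> 0 \<and> par w = v}"
    using idx(1,2)[OF E(1)] par_idx[OF E(1,2)] idx_rep[OF v] by simp
qed

lemma leaf_iff: "leaf v \<longleftrightarrow> v \<in> verts \<and> v \<noteq> 0 \<and> card (rep v) < 2"
proof (cases "v \<in> verts")
  case v: True
  show ?thesis
  proof (cases "v = 0")
    case True
    have "par (idx B) = 0" using rep_idx_B by (simp add: par_def)
    then show ?thesis using True idx(1,2)[OF B_cluster] unfolding leaf_def by blast
  next
    case False
    note c = rep(1)[OF v]
    have "leaf v \<longleftrightarrow> {E \<in> clusters. E \<noteq> B \<and> pare E = rep v} = {}"
      using children[OF v False] v unfolding leaf_def by blast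
    also have "\<dots> \<longleftrightarrow> card (rep v) < 2"
    proof
      assume e: "{E \<in> clusters. E \<noteq> B \<and> pare E = rep v} = {}"
      obtain x where x: "x \<in> rep v" using cluster_ne[OF c] by blast
      show "card (rep v) < 2" using child_exists[OF c _ x] e by (intro not_le_imp_less notI) blast
    next
      assume "card (rep v) < 2"
      then show "{E \<in> clusters. E \<noteq> B \<and> pare E = rep v} = {}" using pare_card by fastforce
    qed
    finally show ?thesis using v False by simp
  qed
qed (simp add: leaf_def)

lemma leaf_rep: "leaf v \<Longrightarrow> \<exists>b\<in>B. rep v = {b}"
proof -
  assume "leaf v"
  then have v: "v \<in> verts" "\<not> card (rep v) \<ge> 2" using leaf_iff by auto
  obtain b where b: "b \<in> rep v" using cluster_ne[OF rep(1)[OF v(1)]] by blast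
  show ?thesis using small_cluster[OF rep(1)[OF v(1)] v(2) b] b cluster_sub[OF rep(1)[OF v(1)]] by blast
qed

text \<open>Completes values given off the identity to a function with sum 0 over \<open>G\<close>,
  as in the definition of the Artin character.\<close>

definition zext :: "('g \<Rightarrow> complex) \<Rightarrow> 'g \<Rightarrow> complex" where
  "zext f \<sigma> = (if \<sigma> = \<one> then - (\<Sum>\<tau>\<in>carrier G - {\<one>}. f \<tau>) else f \<sigma>)"

lemma zext_sum: "(\<Sum>\<sigma>\<in>carrier G. zext f \<sigma>) = 0"
proof -
  have "(\<Sum>\<sigma>\<in>carrier G. zext f \<sigma>) = zext f \<one> + (\<Sum>\<sigma>\<in>carrier G - {\<one>}. zext f \<sigma>)"
    using fin by (simp add: sum.remove[of _ \<one>])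
  also have "(\<Sum>\<sigma>\<in>carrier G - {\<one>}. zext f \<sigma>) = (\<Sum>\<sigma>\<in>carrier G - {\<one>}. f \<sigma>)"
    by (rule sum.cong) (auto simp: zext_def)
  finally show ?thesis by (simp add: zext_def)
qed

text \<open>Counts the fixed points of \<open>\<sigma>\<close> in the clusters of the orbit. At the
  vertex of \<open>B\<close> these are all its fixed points, so the trunk carries the Artin
  character of the action.\<close>

definition ac :: "nat \<Rightarrow> 'g \<Rightarrow> complex" where
  "ac v = zext (\<lambda>\<sigma>. - of_nat (card (\<Union> (orb (rep v)) \<inter> fixB \<sigma>)))"

definition dc :: "nat \<Rightarrow> 'g \<Rightarrow> complex" where
  "dc v = (if v = 0 then (\<lambda>_. 0) else zext (\<lambda>\<sigma>. - of_rat (Dl (rep v) \<sigma>)))"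

text \<open>The stabilizer order is the weight that already occurs in \<open>Dl\<close>, so that the
  depth varies linearly with the difference of the radii. The radius at the root is 0.\<close>

definition len :: "nat \<Rightarrow> rat" where
  "len v = of_nat (card (SS (rep v))) * (R (rep v) - (if rep v = B then 0 else R (pare (rep v))))"

lemma Dl_orb: "D \<in> clusters \<Longrightarrow> D' \<in> orb D \<Longrightarrow> Dl D' \<sigma> = Dl D \<sigma>"
  by (simp add: Dl_def card_SS orb_eq)

text \<open>The points of the clusters in the orbit fall into \<open>G\<close>-orbits, and each of
  these contributes the induced augmentation character of a point stabilizer, which is a true
  character.\<close>

lemma ac_char:
  assumes v: "v \<in> verts"
  shows "ac v \<in> true_chars G"
proof -
  let ?Y = "\<Union> (orb (rep v))"
  let ?L = "(\<lambda>b. orb {b}) ` ?Y"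
  \<comment> \<open>The stabilizer of some member of an orbit of singletons; another member would
    give a conjugate subgroup.\<close>
  define k where "k o1 = SS (SOME D. D \<in> o1)" for o1 :: "'y set set"
  note c = rep(1)[OF v]
  have YB: "?Y \<subseteq> B" using orb_clusters[OF c] cluster_sub by blast
  have finL: "finite ?L" using finite_subset[OF YB finB] by simp
  have kk: "\<exists>D\<in>clusters. k (orb {b}) = SS D \<and> orb D = orb {b}" if b: "b \<in> ?Y" for b
  proof -
    have bc: "{b} \<in> clusters" using singleton_cluster b YB by blast
    have "(SOME D. D \<in> orb {b}) \<in> orb {b}" using self_orb[OF bc] by (rule someI)
    then show ?thesis using orb_clusters[OF bc] orb_eq[OF bc] unfolding k_def by blast
  qed
  let ?u = "\<lambda>g. \<Sum>o1\<in>?L. ind_char G (k o1) (aug_char G (k o1)) g"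
  have sub: "subgroup (k o1) G" if "o1 \<in> ?L" for o1 using that kk SS_subgroup by force
  have "?u \<in> true_chars G"
  proof (rule true_chars_sum[OF finL])
    fix o1 assume "o1 \<in> ?L"
    then interpret coset_section G "k o1" using sub by (simp add: coset_section_def finite_group_axioms)
    show "ind_char G (k o1) (aug_char G (k o1)) \<in> true_chars G" by (rule ind_aug_true_char)
  qed
  then show ?thesis
  proof (rule true_chars_cong)
    fix g assume g: "g \<in> carrier G"
    show "?u g = ac v g"
    proof (rule zero_sum_eqI[OF _ _ _ g])
      show "(\<Sum>g\<in>carrier G. ?u g) = 0"
        by (subst sum.swap) (simp add: sum_ind_aug[OF sub])
      show "(\<Sum>g\<in>carrier G. ac v g) = 0" by (simp add: ac_def zext_sum)
      fix \<sigma> assume s: "\<sigma> \<in> carrier G" "\<sigma> \<noteq> \<one>"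
      let ?P = "?Y \<inter> fixB \<sigma>"
      have finP: "finite ?P" using fin_fixB by simp
      have im: "(\<lambda>b. orb {b}) ` ?P \<subseteq> ?L" by blast
      have one: "ind_char G (k o1) (aug_char G (k o1)) \<sigma> = - of_nat (card {b \<in> ?P. orb {b} = o1})" if o1: "o1 \<in> ?L" for o1
      proof -
        obtain b where b: "b \<in> ?Y" "o1 = orb {b}" using o1 by blast
        obtain D where D: "D \<in> clusters" "k o1 = SS D" "orb D = o1" using kk[OF b(1)] b(2) by auto
        have bB: "b \<in> B" using b YB by blast
        have "fx \<sigma> o1 = (\<lambda>y. {y}) ` {y \<in> ?P. orb {y} = o1}"
        proof (intro equalityI subsetI)
          fix F assume F: "F \<in> fx \<sigma> o1"
          then obtain y where y: "y \<in> carrier G" "F = {act y b}" using b(2) by (auto simp: fx_def orb_def img_def)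
          obtain E where E: "E \<in> orb (rep v)" "b \<in> E" using b(1) by blast
          have "img y E \<in> orb E" using y(1) by (auto simp: orb_def)
          then have "img y E \<in> orb (rep v)" using orb_eq[OF c E(1)] by simp
          moreover have "act y b \<in> img y E" using E(2) by (simp add: img_def)
          ultimately have "act y b \<in> ?Y" by blast
          moreover have "act \<sigma> (act y b) = act y b" using F y(2) by (simp add: fx_def img_def)
          moreover have "orb {act y b} = o1" using orb_eq[OF singleton_cluster[OF bB], of F] F b(2) y(2) by (simp add: fx_def)
          ultimately show "F \<in> (\<lambda>y. {y}) ` {y \<in> ?P. orb {y} = o1}"
            using y act_B bB by (auto simp: fixB_def)
        next
          fix F assume "F \<in> (\<lambda>y. {y}) ` {y \<in> ?P. orb {y} = o1}"
          then obtain y where y: "y \<in> fixB \<sigma>" "orb {y} = o1" "F = {y}" by blast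
          then have "F \<in> o1" using self_orb[OF singleton_cluster[of y]] by (simp add: fixB_def)
          then show "F \<in> fx \<sigma> o1" using y by (simp add: fx_def img_def fixB_def)
        qed
        then have "card (fx \<sigma> o1) = card {y \<in> ?P. orb {y} = o1}" by (simp add: card_image)
        then show ?thesis using ind_aug_SS[OF D(1) s] D by simp
      qed
      have "?u \<sigma> = (\<Sum>o1\<in>?L. - of_nat (card {b \<in> ?P. orb {b} = o1}))" by (rule sum.cong[OF refl one])
      also have "\<dots> = - of_nat (\<Sum>o1\<in>?L. card {b \<in> ?P. orb {b} = o1})" by (simp add: sum_negf)
      also have "(\<Sum>o1\<in>?L. card {b \<in> ?P. orb {b} = o1}) = card ?P"
        using sum.group[OF finP finL im, of "\<lambda>_. 1::nat"] by simp
      finally show "?u \<sigma> = ac v \<sigma>" using s by (simp add: ac_def zext_def)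
    qed
  qed
qed

lemma dc_char: "v \<in> verts \<Longrightarrow> dc v \<in> pos_rat_chars G"
proof (cases "v = 0")
  case True
  have "(\<lambda>_. 0) \<in> pos_rat_chars G"
    by (rule pos_rat_chars_filtration[OF subgroup_self, of "\<lambda>_. 0"]) simp_all
  then show ?thesis using True by (simp add: dc_def)
next
  case False
  assume v: "v \<in> verts"
  note c = rep(1)[OF v]
  show ?thesis
  proof (rule pos_rat_chars_filtration[OF SS_subgroup[OF c], of "dd (rep v)"])
    show "dd (rep v) \<sigma> \<ge> 0" if "\<sigma> \<in> SS (rep v)" "\<sigma> \<noteq> \<one>" for \<sigma> by (rule dd_nonneg[OF c that])
    show "dd (rep v) (inv \<sigma>) = dd (rep v) \<sigma>" if "\<sigma> \<in> SS (rep v)" for \<sigma>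
      by (rule dd_inv) (use that in \<open>simp add: SS_def\<close>)
    show "min (dd (rep v) \<sigma>) (dd (rep v) \<tau>) \<le> dd (rep v) (\<sigma> \<otimes> \<tau>)"
      if "\<sigma> \<in> SS (rep v)" "\<tau> \<in> SS (rep v)" "\<sigma> \<noteq> \<one>" "\<tau> \<noteq> \<one>" "\<sigma> \<otimes> \<tau> \<noteq> \<one>" for \<sigma> \<tau>
      by (rule dd_mult[OF c that])
    show "dc v \<sigma> = - (\<Sum>y | y \<in> carrier G \<and> inv y \<otimes> \<sigma> \<otimes> y \<in> SS (rep v). of_rat (dd (rep v) (inv y \<otimes> \<sigma> \<otimes> y)))"
      if "\<sigma> \<in> carrier G" "\<sigma> \<noteq> \<one>" for \<sigma>
      using False that(2) by (simp add: dc_def zext_def Dl_conj[OF c that(1)] of_rat_sum)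
    show "(\<Sum>\<sigma>\<in>carrier G. dc v \<sigma>) = 0" using False by (simp add: dc_def zext_sum)
  qed
qed

lemma SS_pare: "E \<in> clusters \<Longrightarrow> E \<noteq> B \<Longrightarrow> SS E \<subseteq> SS (pare E)"
  unfolding SS_def using pare_img(1)[of _ E] by fastforce

lemma conj_rep: "v \<in> verts \<Longrightarrow> H \<in> conj_class G (SS (rep v)) \<Longrightarrow> \<exists>D\<in>orb (rep v). D \<in> clusters \<and> orb D = orb (rep v) \<and> H = SS D"
  using SS_conj[OF rep(1)] orb_clusters[OF rep(1)] orb_eq[OF rep(1)] by blast

lemma ac_leaf:
  assumes l: "leaf v" and H: "H \<in> conj_class G (SS (rep v))" and g: "g \<in> carrier G"
  shows "ac v g = ind_char G H (aug_char G H) g"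
proof -
  have v: "v \<in> verts" using l by (simp add: leaf_def)
  obtain D where D: "D \<in> clusters" "orb D = orb (rep v)" "H = SS D" using conj_rep[OF v H] by blast
  obtain b where b: "b \<in> B" "rep v = {b}" using leaf_rep[OF l] by blast
  show ?thesis
  proof (rule zero_sum_eqI[OF _ _ _ g])
    show "(\<Sum>g\<in>carrier G. ac v g) = 0" by (simp add: ac_def zext_sum)
    show "(\<Sum>g\<in>carrier G. ind_char G H (aug_char G H) g) = 0"
      using sum_ind_aug SS_subgroup D by blast
    fix \<sigma> assume s: "\<sigma> \<in> carrier G" "\<sigma> \<noteq> \<one>"
    have "card (E' \<inter> fixB \<sigma>) = 1" if E': "E' \<in> fx \<sigma> (orb {b})" for E'
    proof -
      obtain y where "y \<in> carrier G" "E' = {act y b}" using E' by (auto simp: fx_def orb_def img_def)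
      moreover from this have "act y b \<in> fixB \<sigma>" using E' act_B[of y b] b by (auto simp: fixB_def fx_def img_def)
      ultimately show ?thesis by simp
    qed
    then have "card (\<Union> (orb {b}) \<inter> fixB \<sigma>) = card (fx \<sigma> (orb {b}))"
      using card_fix_orb[OF singleton_cluster[OF b(1)] s(1)] by simp
    then show "ac v \<sigma> = ind_char G H (aug_char G H) \<sigma>"
      using ind_aug_SS[OF D(1) s] D b s by (simp add: ac_def zext_def)
  qed
qed

text \<open>The point sets of the child orbits partition that of \<open>v\<close>. Through every
  point passes a child; two children with a common point have parents of equal size that meet, so
  the parents agree and then the children do.\<close>

lemma ac_sum:
  assumes v: "v \<in> verts" "v \<noteq> 0" "\<not> leaf v" and g: "g \<in> carrier G"
  shows "ac v g = (\<Sum>u | u \<in> verts \<and> u \<noteq> 0 \<and> par u = v. ac u g)"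
proof -
  let ?C = "{u. u \<in> verts \<and> u \<noteq> 0 \<and> par u = v}"
  let ?Y = "\<lambda>u. \<Union> (orb (rep u))"
  note c = rep(1)[OF v(1)]
  have finC: "finite ?C" using finV by simp
  have card2: "card (rep v) \<ge> 2" using v leaf_iff by auto
  have up: "rep u \<in> clusters \<and> rep u \<noteq> B \<and> orb (pare (rep u)) = orb (rep v)" if u: "u \<in> ?C" for u
  proof -
    have uB: "rep u \<noteq> B" using u v par_zero[of u] by auto
    have uc: "rep u \<in> clusters" using u rep by blast
    have "idx (pare (rep u)) = v" using u uB by (simp add: par_def)
    then show ?thesis using idx(4)[OF pare(1)[OF uc uB]] uB uc by metis
  qed
  have un: "?Y v = (\<Union>u\<in>?C. ?Y u)"
  proof (intro equalityI subsetI)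
    fix x assume "x \<in> ?Y v"
    then obtain D where D: "D \<in> orb (rep v)" "x \<in> D" by blast
    have Dc: "D \<in> clusters" using orb_clusters[OF c] D by blast
    have "card D \<ge> 2" using card_orb[OF c D(1)] card2 by simp
    then obtain E where E: "E \<in> clusters" "E \<noteq> B" "pare E = D" "x \<in> E" using child_exists[OF Dc _ D(2)] by blast
    have "par (idx E) = v" using par_idx[OF E(1,2)] E(3) idx_cong[OF orb_eq[OF c D(1)]] idx_rep[OF v(1,2)] by simp
    then have "idx E \<in> ?C" using idx(1,2)[OF E(1)] by simp
    moreover have "x \<in> ?Y (idx E)" using idx(4)[OF E(1)] self_orb[OF E(1)] E(4) by blast
    ultimately show "x \<in> (\<Union>u\<in>?C. ?Y u)" by blast
  next
    fix x assume "x \<in> (\<Union>u\<in>?C. ?Y u)"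
    then obtain u F where u: "u \<in> ?C" "F \<in> orb (rep u)" "x \<in> F" by blast
    have "pare F \<in> orb (rep v)" using up[OF u(1)] orb_pare[of "rep u"] u(2) by blast
    moreover have "x \<in> pare F" using pare(2)[of F] orb_nB[of "rep u" F] up[OF u(1)] u by blast
    ultimately show "x \<in> ?Y v" by blast
  qed
  have disj: "?Y u \<inter> ?Y u' = {}" if u: "u \<in> ?C" "u' \<in> ?C" "u \<noteq> u'" for u u'
  proof (rule ccontr)
    assume "?Y u \<inter> ?Y u' \<noteq> {}"
    then obtain x F F' where F: "F \<in> orb (rep u)" "F' \<in> orb (rep u')" "x \<in> F" "x \<in> F'" by blast
    have Fc: "F \<in> clusters" "F \<noteq> B" "F' \<in> clusters" "F' \<noteq> B"
      using orb_nB[of "rep u" F] orb_nB[of "rep u'" F'] up[OF u(1)] up[OF u(2)] F by auto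
    have po: "pare F \<in> orb (rep v)" "pare F' \<in> orb (rep v)"
      using up[OF u(1)] up[OF u(2)] orb_pare[of "rep u"] orb_pare[of "rep u'"] F by blast+
    have "pare F = pare F'"
      using eq_of_meet[OF pare(1)[OF Fc(1,2)] pare(1)[OF Fc(3,4)], of x] card_orb[OF c po(1)] card_orb[OF c po(2)]
        pare(2)[OF Fc(1,2)] pare(2)[OF Fc(3,4)] F by auto
    then have "F = F'" using child_unique[OF Fc] F by blast
    then have "orb (rep u) = orb (rep u')" using orb_eq[of "rep u" F] orb_eq[of "rep u'" F'] F up[OF u(1)] up[OF u(2)] by simp
    then show False using idx_cong idx_rep u by (metis (mono_tags, lifting) mem_Collect_eq)
  qed
  show ?thesis
  proof (rule zero_sum_eqI[OF _ _ _ g])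
    show "(\<Sum>g\<in>carrier G. ac v g) = 0" by (simp add: ac_def zext_sum)
    show "(\<Sum>g\<in>carrier G. \<Sum>u\<in>?C. ac u g) = 0" by (subst sum.swap) (simp add: ac_def zext_sum)
    fix \<sigma> assume s: "\<sigma> \<in> carrier G" "\<sigma> \<noteq> \<one>"
    have "card (?Y v \<inter> fixB \<sigma>) = card (\<Union>u\<in>?C. ?Y u \<inter> fixB \<sigma>)" unfolding un by (rule arg_cong[of _ _ card]) blast
    also have "\<dots> = (\<Sum>u\<in>?C. card (?Y u \<inter> fixB \<sigma>))"
    proof (rule card_UN_disjoint[OF finC])
      show "\<forall>i\<in>?C. finite (?Y i \<inter> fixB \<sigma>)" using fin_fixB by blast
      show "\<forall>i\<in>?C. \<forall>j\<in>?C. i \<noteq> j \<longrightarrow> ?Y i \<inter> fixB \<sigma> \<inter> (?Y j \<inter> fixB \<sigma>) = {}"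
      proof (intro ballI impI)
        fix i j assume "i \<in> ?C" "j \<in> ?C" "i \<noteq> j"
        from disj[OF this] show "?Y i \<inter> fixB \<sigma> \<inter> (?Y j \<inter> fixB \<sigma>) = {}" by blast
      qed
    qed
    finally show "ac v \<sigma> = (\<Sum>u\<in>?C. ac u \<sigma>)" using s by (simp add: ac_def zext_def sum_negf)
  qed
qed

lemma dc_step:
  assumes v: "v \<in> verts" "v \<noteq> 0" and H: "H \<in> conj_class G (SS (rep v))" and g: "g \<in> carrier G"
  shows "dc v g = dc (par v) g + of_rat (len v) * (ac v g - ind_char G H (aug_char G H) g)"
proof -
  note c = rep(1)[OF v(1)]
  obtain D where D: "D \<in> clusters" "orb D = orb (rep v)" "H = SS D" using conj_rep[OF v(1) H] by blast
  show ?thesis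
  proof (rule zero_sum_eqI[OF _ _ _ g])
    have dz: "(\<Sum>g\<in>carrier G. dc u g) = 0" for u by (simp add: dc_def zext_sum)
    show "(\<Sum>g\<in>carrier G. dc v g) = 0" by (rule dz)
    have "(\<Sum>g\<in>carrier G. ind_char G H (aug_char G H) g) = 0"
      using sum_ind_aug SS_subgroup D by blast
    moreover have "(\<Sum>g\<in>carrier G. ac v g) = 0" by (simp add: ac_def zext_sum)
    ultimately show "(\<Sum>g\<in>carrier G. dc (par v) g + of_rat (len v) * (ac v g - ind_char G H (aug_char G H) g)) = 0"
      by (simp add: sum.distrib dz sum_distrib_left[symmetric] sum_subtractf)
    fix \<sigma> assume s: "\<sigma> \<in> carrier G" "\<sigma> \<noteq> \<one>"
    let ?d = "of_nat (card (\<Union> (orb (rep v)) \<inter> fixB \<sigma>)) - of_nat (card (fx \<sigma> (orb (rep v)))) :: rat"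
    have d: "ac v \<sigma> - ind_char G H (aug_char G H) \<sigma> = - of_rat ?d"
      using s ind_aug_SS[OF D(1) s] D by (simp add: ac_def zext_def of_rat_diff)
    have dv: "dc v \<sigma> = - of_rat (Dl (rep v) \<sigma>)" using s v by (simp add: dc_def zext_def)
    show "dc v \<sigma> = dc (par v) \<sigma> + of_rat (len v) * (ac v \<sigma> - ind_char G H (aug_char G H) \<sigma>)"
    proof (cases "rep v = B")
      case True
      \<comment> \<open>Only the trunk ends at \<open>B\<close>; its source is the root, where the
        depth is 0.\<close>
      have "Dl (rep v) \<sigma> = len v * ?d" using Dl_B[OF s(1)] True by (simp add: len_def)
      then show ?thesis unfolding d dv using True by (simp add: par_def dc_def of_rat_mult)
    next
      case False
      note p = pare(1)[OF c False]
      have "dc (par v) \<sigma> = - of_rat (Dl (pare (rep v)) \<sigma>)"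
        using False idx(2)[OF p] s Dl_orb[OF p idx(5)[OF p]] by (simp add: par_def dc_def zext_def)
      moreover have "Dl (rep v) \<sigma> = Dl (pare (rep v)) \<sigma> + len v * ?d"
        using Dl_diff[OF c False s] False by (simp add: len_def algebra_simps)
      ultimately show ?thesis unfolding d dv by (simp add: of_rat_add of_rat_mult)
    qed
  qed
qed

text \<open>Induction from \<open>P\<close> gives a sum over conjugates in the Sylow subgroup, the
  depth a sum over conjugates in the whole stabilizer; the additional terms vanish by
  \<open>off_sylow\<close>.\<close>

lemma dc_leaf:
  assumes l: "leaf v" and H: "H \<in> conj_class G (SS (rep v))" and P: "sylow_subgroup p G H P" and g: "g \<in> carrier G"
  shows "dc v g = ind_char G P (delta_mult p G P) g"
proof -
  have v: "v \<in> verts" "v \<noteq> 0" using l leaf_iff by auto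
  obtain D where D: "D \<in> orb (rep v)" "D \<in> clusters" "orb D = orb (rep v)" "H = SS D" using conj_rep[OF v(1) H] by blast
  have "\<not> card D \<ge> 2" using l leaf_iff card_orb[OF rep(1)[OF v(1)] D(1)] by simp
  moreover obtain b where b: "b \<in> D" using cluster_ne[OF D(2)] by blast
  ultimately have Db: "D = {b}" by (rule small_cluster[OF D(2)])
  have bB: "b \<in> B" using cluster_sub[OF D(2)] b by blast
  have Hs: "H = stab b" using D(4) Db SS_singleton[OF bB] by simp
  note P' = P[unfolded Hs]
  have HG: "subgroup H G" using SS_subgroup D by blast
  have PG: "subgroup P G" using P incl_subgroup[OF HG] by (simp add: sylow_subgroup_def)
  have PH: "P \<subseteq> stab b" using P subgroup.subset[of P "G\<lparr>carrier := H\<rparr>"] Hs by (auto simp: sylow_subgroup_def)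
  have cP: "(of_nat (card P) :: complex) \<noteq> 0" using subgroup_card_pos[OF PG] by simp
  show ?thesis
  proof (rule zero_sum_eqI[OF _ _ _ g])
    show "(\<Sum>g\<in>carrier G. dc v g) = 0" by (simp add: dc_def zext_sum)
    show "(\<Sum>g\<in>carrier G. ind_char G P (delta_mult p G P) g) = 0"
      by (simp add: sum_ind_char[OF PG] delta_sum[OF bB P'])
    fix \<sigma> assume s: "\<sigma> \<in> carrier G" "\<sigma> \<noteq> \<one>"
    let ?c = "\<lambda>y. inv y \<otimes> \<sigma> \<otimes> y"
    let ?s = "\<lambda>\<tau>. (\<Sum>y\<in>fixB \<tau> - {b}. w b y)"
    have n1: "?c y \<noteq> \<one>" if "y \<in> carrier G" for y using conj_one_iff[OF that s(1)] s(2) by simp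
    have "ind_char G P (delta_mult p G P) \<sigma> = (\<Sum>y | y \<in> carrier G \<and> ?c y \<in> P. - of_nat (card P) * of_rat (?s (?c y))) / of_nat (card P)"
      unfolding ind_char_def using n1 delta_stab[OF bB P'] by (auto intro!: arg_cong[of _ _ "\<lambda>x. x / _"] sum.cong)
    also have "\<dots> = - (\<Sum>y | y \<in> carrier G \<and> ?c y \<in> P. of_rat (?s (?c y)))"
      using cP by (simp add: sum_distrib_left[symmetric] sum_negf)
    also have "(\<Sum>y | y \<in> carrier G \<and> ?c y \<in> P. of_rat (?s (?c y)) :: complex) = (\<Sum>y | y \<in> carrier G \<and> ?c y \<in> stab b. of_rat (?s (?c y)))"
      by (rule sum.mono_neutral_left) (use PH off_sylow[OF bB P'] fin in auto)
    also have "\<dots> = (\<Sum>y | y \<in> carrier G \<and> ?c y \<in> SS D. of_rat (dd D (?c y)))"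
      by (rule sum.cong) (auto simp: Db SS_singleton[OF bB] dd_singleton[OF bB])
    also have "\<dots> = of_rat (Dl D \<sigma>)" by (simp add: Dl_conj[OF D(2) s(1)] of_rat_sum)
    also have "Dl D \<sigma> = Dl (rep v) \<sigma>" by (rule Dl_orb[OF rep(1)[OF v(1)] D(1)])
    finally show "dc v \<sigma> = ind_char G P (delta_mult p G P) \<sigma>" using s v by (simp add: dc_def zext_def)
  qed
qed

text \<open>Each summand is the number of children of \<open>rep v\<close> in one orbit. A cluster
  with two points has two different children, which either share an orbit and make one summand at
  least 2, or lie in different orbits and give two summands.\<close>

lemma branching:
  assumes v: "v \<in> verts" "v \<noteq> 0" "\<not> leaf v"
  shows "(\<Sum>u | u \<in> verts \<and> u \<noteq> 0 \<and> par u = v. card (SS (rep v)) div card (SS (rep u))) > 1"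
proof -
  let ?C = "{u. u \<in> verts \<and> u \<noteq> 0 \<and> par u = v}"
  let ?q = "\<lambda>u. card (SS (rep v)) div card (SS (rep u))"
  note c = rep(1)[OF v(1)]
  have finC: "finite ?C" using finV by simp
  have card2: "card (rep v) \<ge> 2" using v leaf_iff by auto
  obtain x where x: "x \<in> rep v" using cluster_ne[OF c] by blast
  obtain E where E: "E \<in> clusters" "E \<noteq> B" "pare E = rep v" "x \<in> E" using child_exists[OF c card2 x] by blast
  obtain x' where x': "x' \<in> rep v" "x' \<notin> E" using pare(2)[OF E(1,2)] E(3) by blast
  obtain F where F: "F \<in> clusters" "F \<noteq> B" "pare F = rep v" "x' \<in> F" using child_exists[OF c card2 x'(1)] by blast
  have EF: "E \<noteq> F" using x' F by blast
  have k: "?q (idx D) = card {D' \<in> orb D. pare D' = rep v} \<and> idx D \<in> ?C" if D: "D \<in> clusters" "D \<noteq> B" "pare D = rep v" for D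
  proof -
    have "card (SS (rep (idx D))) = card (SS D)" using card_SS[OF D(1) idx(5)[OF D(1)]] .
    moreover have "card (SS (rep v)) = card (SS D) * card {D' \<in> orb D. pare D' = rep v}" using card_children[OF D(1,2)] D(3) by simp
    ultimately show ?thesis using card_SS_pos[OF D(1)] par_idx[OF D(1,2)] idx(1,2)[OF D(1)] idx_rep[OF v(1,2)] D(3) by simp
  qed
  have finK: "finite {D' \<in> orb D. pare D' = rep v}" for D using fin_orb by simp
  show ?thesis
  proof (cases "idx E = idx F")
    case True
    then have "orb E = orb F" using idx(3)[OF E(1)] idx(3)[OF F(1)] by simp
    then have "{E, F} \<subseteq> {D' \<in> orb E. pare D' = rep v}" using self_orb[OF E(1)] self_orb[OF F(1)] E F by auto
    then have "card {E, F} \<le> card {D' \<in> orb E. pare D' = rep v}" by (rule card_mono[OF finK])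
    moreover have "?q (idx E) \<le> (\<Sum>u\<in>?C. ?q u)"
      by (rule member_le_sum[OF conjunct2[OF k[OF E(1-3)]] _ finC]) simp
    moreover have "card {E, F} = 2" using EF by simp
    ultimately show ?thesis using conjunct1[OF k[OF E(1-3)]] by linarith
  next
    case False
    have one: "1 \<le> ?q (idx D)" if D: "D \<in> clusters" "D \<noteq> B" "pare D = rep v" for D
    proof -
      have "D \<in> {D' \<in> orb D. pare D' = rep v}" using self_orb[OF D(1)] D(3) by simp
      then have "card {D' \<in> orb D. pare D' = rep v} > 0" using finK card_gt_0_iff by blast
      then show ?thesis unfolding conjunct1[OF k[OF D]] by linarith
    qed
    have "{idx E, idx F} \<subseteq> ?C" using conjunct2[OF k[OF E(1-3)]] conjunct2[OF k[OF F(1-3)]] by blast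
    then have "(\<Sum>u\<in>{idx E, idx F}. ?q u) \<le> (\<Sum>u\<in>?C. ?q u)" by (rule sum_mono2[OF finC]) simp
    moreover have "(\<Sum>u\<in>{idx E, idx F}. ?q u) = ?q (idx E) + ?q (idx F)" using False by simp
    ultimately show ?thesis using one[OF E(1-3)] one[OF F(1-3)] by linarith
  qed
qed

sublocale hurwitz_builder verts 0 par level G p "idx B" "\<lambda>v. SS (rep v)" len ac dc
proof
  show "idx B \<in> verts" "idx B \<noteq> 0" using idx[OF B_cluster] by auto
  show "par (idx B) = 0" using rep_idx_B by (simp add: par_def)
  show "u = idx B" if "u \<in> verts" "u \<noteq> 0" "par u = 0" for u using par_zero[OF that(1)] that idx_rep by metis
  show "SS (rep 0) = carrier G" "SS (rep (idx B)) = carrier G" unfolding rep_idx_B by (simp_all add: rep_def SS_B)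
  show "finite (carrier G)" by (rule fin)
  fix v assume v: "v \<in> verts"
  note c = rep(1)[OF v]
  note sg = SS_subgroup[OF c]
  show "SS (rep v) \<subseteq> carrier G" by (rule subgroup.subset[OF sg])
  show "\<one> \<in> SS (rep v)" by (rule subgroup.one_closed[OF sg])
  show "x \<otimes> y \<in> SS (rep v)" if "x \<in> SS (rep v)" "y \<in> SS (rep v)" for x y by (rule subgroup.m_closed[OF sg that])
  show "inv x \<in> SS (rep v)" if "x \<in> SS (rep v)" for x by (rule subgroup.m_inv_closed[OF sg that])
  show "dc v \<in> pos_rat_chars G" by (rule dc_char[OF v])
  assume v0: "v \<noteq> 0"
  show "ac v \<in> true_chars G" by (rule ac_char[OF v])
  \<comment> \<open>The length vanishes exactly at singletons: there \<open>R\<close> repeats the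
    radius of the parent, or is 0 if \<open>B\<close> is a singleton.\<close>
  have nn: "len v \<ge> 0 \<and> (len v = 0 \<longleftrightarrow> \<not> card (rep v) \<ge> 2)"
  proof (cases "rep v = B")
    case True
    have "R B \<ge> 0 \<and> (R B = 0 \<longleftrightarrow> \<not> card B \<ge> 2)"
      using rad_props(4)[OF B_cluster] by (auto simp: R_def)
    then show ?thesis using True card_SS_pos[OF c] by (simp add: len_def zero_le_mult_iff)
  next
    case False
    then show ?thesis using R_pare[OF c False] card_SS_pos[OF c]
      by (cases "card (rep v) \<ge> 2") (auto simp: len_def zero_le_mult_iff)
  qed
  then show "len v \<ge> 0" by simp
  show "len v = 0 \<longleftrightarrow> leaf v" using nn v v0 by (auto simp: leaf_iff)
next
  fix v H H' assume v: "v \<in> verts" "v \<noteq> 0" and H': "H' \<in> conj_class G (SS (rep v))"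
    and H: "H \<in> conj_class G (SS (rep (par v)))"
  note c = rep(1)[OF v(1)]
  obtain E where E: "E \<in> orb (rep v)" "E \<in> clusters" "orb E = orb (rep v)" "H' = SS E" using conj_rep[OF v(1) H'] by blast
  obtain D where D: "D \<in> orb (rep (par v))" "D \<in> clusters" "H = SS D" using conj_rep[OF par_in[OF v] H] by blast
  show "\<exists>g\<in>carrier G. conj_set G g H' \<subseteq> H"
  proof (cases "rep v = B")
    case True
    then have "rep (par v) = B" by (simp add: par_def rep_def)
    then have "H = carrier G" using D orb_B SS_B by simp
    moreover have "conj_set G \<one> H' \<subseteq> carrier G" using E(4) by (auto simp: conj_set_def SS_def)
    ultimately show ?thesis by blast
  next
    case False
    note EB = orb_nB[OF c False E(1)]
    note p = pare(1)[OF c False]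
    have "orb (pare E) = orb (pare (rep v))" using orb_pare[OF c False] orb_pare[of E] EB E(3) by simp
    moreover have "D \<in> orb (pare (rep v))" using D(1) idx(4)[OF p] False by (simp add: par_def)
    ultimately have "D \<in> orb (pare E)" by simp
    then obtain g where g: "g \<in> carrier G" "D = img g (pare E)" by (auto simp: orb_def)
    have gE: "img g E \<in> clusters" "img g E \<noteq> B" "pare (img g E) = D"
      using img_cluster[OF g(1)] pare_img[OF g(1)] EB g(2) by auto
    have "conj_set G g H' = SS (img g E)" using SS_img[OF E(2) g(1)] E(4) by simp
    also have "\<dots> \<subseteq> H" using SS_pare[OF gE(1,2)] gE(3) D(3) by simp
    finally show ?thesis using g(1) by blast
  qed
next
  fix v H assume l: "leaf v" and H: "H \<in> conj_class G (SS (rep v))"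
  have v: "v \<in> verts" using l by (simp add: leaf_def)
  obtain D where D: "D \<in> orb (rep v)" "D \<in> clusters" "H = SS D" using conj_rep[OF v H] by blast
  have "\<not> card D \<ge> 2" using l leaf_iff card_orb[OF rep(1)[OF v] D(1)] by simp
  moreover obtain b where b: "b \<in> D" using cluster_ne[OF D(2)] by blast
  ultimately have Db: "D = {b}" by (rule small_cluster[OF D(2)])
  have bB: "b \<in> B" using cluster_sub[OF D(2)] b by blast
  have "H = stab b" using D(3) Db SS_singleton[OF bB] by simp
  then show "H \<noteq> {\<one>} \<and> cyclic_group (G\<lparr>carrier := H\<rparr>)" using stab_nontriv[OF bB] stab_cyclic[OF bB] by simp
qed (rule ac_leaf ac_sum dc_step dc_leaf branching; assumption)+

theorem hurwitz_tree_exists: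
  "\<exists>\<T> :: (nat, 'g) hurwitz_datum. hurwitz_tree G p \<T> \<and>
     tree_artin \<T> = zext (\<lambda>\<sigma>. - of_nat (card (fixB \<sigma>))) \<and> tree_depth \<T> = (\<lambda>_. 0)"
proof (intro exI conjI)
  show "hurwitz_tree G p datum" by (rule hurwitz_datum)
  have "\<Union> (orb (rep (idx B))) \<inter> fixB \<sigma> = fixB \<sigma>" for \<sigma> unfolding rep_idx_B orb_B by (auto simp: fixB_def)
  then show "tree_artin datum = zext (\<lambda>\<sigma>. - of_nat (card (fixB \<sigma>)))"
    unfolding tree_artin_datum by (simp add: ac_def)
  show "tree_depth datum = (\<lambda>_. 0)" unfolding tree_depth_datum by (simp add: dc_def)
qed

end

section \<open>Rational valuations on algebraic extensions\<close>

hide_const (open) up_ring.coeff up_ring.monom Polynomials.degree Polynomials.lead_coeff module.smult Coset.order Divisibility.prime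

text \<open>A subring that is maximal among those containing \<open>R\<close> but not the inverse of
  \<open>\<pi>\<close> is a valuation ring; this is Chevalley's extension argument.\<close>

locale dominating_ring =
  fixes R :: "'a::field set" and \<pi> :: 'a
  assumes R: "0 \<in> R" "1 \<in> R" "\<And>a b. a \<in> R \<Longrightarrow> b \<in> R \<Longrightarrow> a + b \<in> R"
    "\<And>a b. a \<in> R \<Longrightarrow> b \<in> R \<Longrightarrow> a * b \<in> R" "\<And>a. a \<in> R \<Longrightarrow> - a \<in> R"
    and pi: "\<pi> \<in> R" "inverse \<pi> \<notin> R"
begin

definition good :: "'a set \<Rightarrow> bool" where
  "good A \<longleftrightarrow> R \<subseteq> A \<and> inverse \<pi> \<notin> A \<and> (\<forall>a\<in>A. \<forall>b\<in>A. a + b \<in> A) \<and>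
     (\<forall>a\<in>A. \<forall>b\<in>A. a * b \<in> A) \<and> (\<forall>a\<in>A. - a \<in> A)"

lemma pi0: "\<pi> \<noteq> 0"
  using pi R(1) by auto

lemma good_R: "good R"
  using R pi by (auto simp: good_def)

lemma maximal_good: "\<exists>M. good M \<and> (\<forall>Y. good Y \<and> M \<subseteq> Y \<longrightarrow> Y = M)"
proof -
  have "\<exists>M\<in>{A. good A}. \<forall>Y\<in>{A. good A}. M \<subseteq> Y \<longrightarrow> Y = M"
  proof (rule subset_Zorn_nonempty)
    show "{A. good A} \<noteq> {}" using good_R by blast
    fix C assume C: "C \<noteq> {}" "subset.chain {A. good A} C"
    have g: "good A" if "A \<in> C" for A using C(2) that by (auto simp: subset.chain_def)
    have two: "\<exists>Y\<in>C. a \<in> Y \<and> b \<in> Y" if ab: "a \<in> \<Union>C" "b \<in> \<Union>C" for a b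
    proof -
      obtain Y where Y: "Y \<in> C" "a \<in> Y" using ab(1) by blast
      obtain Z where Z: "Z \<in> C" "b \<in> Z" using ab(2) by blast
      have "Y \<subseteq> Z \<or> Z \<subseteq> Y" using C(2) Y(1) Z(1) unfolding subset_chain_def by blast
      then show ?thesis using Y Z by blast
    qed
    have "good (\<Union>C)"
      unfolding good_def
    proof (intro conjI ballI)
      show "R \<subseteq> \<Union>C" using C(1) g unfolding good_def by blast
      show "inverse \<pi> \<notin> \<Union>C" using g by (auto simp: good_def)
      fix a b assume ab: "a \<in> \<Union>C" "b \<in> \<Union>C"
      obtain Y where Y: "Y \<in> C" "a \<in> Y" "b \<in> Y" using two[OF ab] by blast
      have "a + b \<in> Y" "a * b \<in> Y" using g[OF Y(1)] Y(2,3) by (auto simp: good_def)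
      then show "a + b \<in> \<Union>C" "a * b \<in> \<Union>C" using Y(1) by blast+
    next
      fix a assume "a \<in> \<Union>C"
      then show "- a \<in> \<Union>C" using g unfolding good_def by blast
    qed
    then show "\<Union>C \<in> {A. good A}" by simp
  qed
  then show ?thesis by blast
qed

definition A :: "'a set" where "A = (SOME M. good M \<and> (\<forall>Y. good Y \<and> M \<subseteq> Y \<longrightarrow> Y = M))"

lemma A: "good A" "\<And>Y. good Y \<Longrightarrow> A \<subseteq> Y \<Longrightarrow> Y = A"
  using someI_ex[OF maximal_good] unfolding A_def by auto

lemma A_add [intro]: "a \<in> A \<Longrightarrow> b \<in> A \<Longrightarrow> a + b \<in> A"
  and A_mult [intro]: "a \<in> A \<Longrightarrow> b \<in> A \<Longrightarrow> a * b \<in> A"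
  and A_uminus [intro]: "a \<in> A \<Longrightarrow> - a \<in> A"
  and R_A: "a \<in> R \<Longrightarrow> a \<in> A" and pi_A: "inverse \<pi> \<notin> A"
  using A(1) by (auto simp: good_def)

lemma A_0 [simp, intro]: "0 \<in> A" and A_1 [simp, intro]: "1 \<in> A" and A_pi [simp, intro]: "\<pi> \<in> A"
  using R pi R_A by auto

lemma A_diff [intro]: "a \<in> A \<Longrightarrow> b \<in> A \<Longrightarrow> a - b \<in> A"
  using A_add[of a "- b"] by auto

lemma A_power [intro]: "a \<in> A \<Longrightarrow> a ^ n \<in> A"
  by (induction n) auto

lemma A_sum: "(\<And>i. i \<in> I \<Longrightarrow> f i \<in> A) \<Longrightarrow> sum f I \<in> A"
  by (induction I rule: infinite_finite_induct) auto

definition adj :: "'a \<Rightarrow> 'a set" where "adj x = {poly p x | p. \<forall>i. coeff p i \<in> A}"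

text \<open>The set \<open>adj x\<close> is the ring generated by \<open>x\<close> over
  \<open>A\<close>. By maximality it is not \<open>good\<close>, and the only condition that it can
  violate is the one on the inverse of \<open>\<pi>\<close>.\<close>

lemma adj_eq: "x \<notin> A \<Longrightarrow> inverse \<pi> \<in> adj x"
proof (rule ccontr)
  assume x: "x \<notin> A" and n: "inverse \<pi> \<notin> adj x"
  have sub: "A \<subseteq> adj x"
  proof
    fix a assume "a \<in> A"
    then have "\<forall>i. coeff [:a:] i \<in> A" by (auto simp: coeff_pCons split: nat.splits)
    moreover have "a = poly [:a:] x" by simp
    ultimately show "a \<in> adj x" unfolding adj_def by blast
  qed
  have "x \<in> adj x"
  proof -
    have "\<forall>i. coeff [:0, 1:] i \<in> A" by (auto simp: coeff_pCons split: nat.splits)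
    moreover have "x = poly [:0, 1:] x" by simp
    ultimately show ?thesis unfolding adj_def by blast
  qed
  have "good (adj x)"
    unfolding good_def
  proof (intro conjI ballI n)
    show "R \<subseteq> adj x" using sub R_A by blast
    fix a b assume "a \<in> adj x" "b \<in> adj x"
    then obtain p q where pq: "a = poly p x" "b = poly q x" "\<And>i. coeff p i \<in> A" "\<And>i. coeff q i \<in> A"
      unfolding adj_def by blast
    have "\<forall>i. coeff (p + q) i \<in> A" "a + b = poly (p + q) x" using pq by auto
    then show "a + b \<in> adj x" unfolding adj_def by blast
    have "\<forall>i. coeff (p * q) i \<in> A" "a * b = poly (p * q) x"
      using pq by (auto simp: coeff_mult intro!: A_sum)
    then show "a * b \<in> adj x" unfolding adj_def by blast
  next
    fix a assume "a \<in> adj x"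
    then obtain p where "a = poly p x" "\<And>i. coeff p i \<in> A"
      unfolding adj_def by blast
    then have "\<forall>i. coeff (- p) i \<in> A" "- a = poly (- p) x" by auto
    then show "- a \<in> adj x" unfolding adj_def by blast
  qed
  then show False using A(2)[OF _ sub] \<open>x \<in> adj x\<close> x by blast
qed

lemma one_minus: "b \<in> A \<Longrightarrow> \<exists>c\<in>A. (1 - \<pi> * b) ^ n = 1 - \<pi> * c"
proof (induction n)
  case 0
  then show ?case by (intro bexI[of _ 0]) auto
next
  case (Suc n)
  then obtain c where c: "c \<in> A" "(1 - \<pi> * b) ^ n = 1 - \<pi> * c" by blast
  have "(1 - \<pi> * b) ^ Suc n = 1 - \<pi> * (b + c - \<pi> * b * c)" by (simp add: c algebra_simps)
  moreover have "b + c - \<pi> * b * c \<in> A" using c Suc.prems by auto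
  ultimately show ?case by blast
qed

lemma not_unit_pi: "b \<in> A \<Longrightarrow> \<pi> * b \<noteq> 1"
  using pi_A by (metis inverse_unique)

text \<open>Puts \<open>\<pi>\<close> into the Jacobson radical of \<open>A\<close>. Otherwise the
  inverse of \<open>\<pi>\<close> is a polynomial in the inverse of \<open>1 - \<pi> * b\<close>;
  multiplication by a power of \<open>1 - \<pi> * b\<close>, which again has the form
  \<open>1 - \<pi> * c\<close>, clears the denominators and brings it into \<open>A\<close>.\<close>

lemma inverse_one_minus: "b \<in> A \<Longrightarrow> inverse (1 - \<pi> * b) \<in> A"
proof (rule ccontr)
  assume b: "b \<in> A" and n: "inverse (1 - \<pi> * b) \<notin> A"
  let ?u = "1 - \<pi> * b"
  have u: "?u \<noteq> 0" "?u \<in> A" using not_unit_pi[OF b] b by auto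
  from adj_eq[OF n] obtain p where p: "inverse \<pi> = poly p (inverse ?u)" "\<And>i. coeff p i \<in> A"
    unfolding adj_def by blast
  obtain c where c: "c \<in> A" "?u ^ degree p = 1 - \<pi> * c" using one_minus[OF b] by blast
  have "poly p (inverse ?u) * ?u ^ degree p = (\<Sum>i\<le>degree p. coeff p i * ?u ^ (degree p - i))"
    unfolding poly_altdef sum_distrib_right
  proof (rule sum.cong[OF refl])
    fix i assume "i \<in> {..degree p}"
    then have "?u ^ degree p = ?u ^ i * ?u ^ (degree p - i)" by (simp flip: power_add)
    then show "coeff p i * inverse ?u ^ i * ?u ^ degree p = coeff p i * ?u ^ (degree p - i)"
      using u by (simp add: power_inverse)
  qed
  also have "\<dots> \<in> A" using p(2) u by (intro A_sum) auto
  finally have "inverse \<pi> * (1 - \<pi> * c) \<in> A" using p(1) c(2) by simp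
  then have "inverse \<pi> * (1 - \<pi> * c) + c \<in> A" using c(1) by auto
  moreover have "inverse \<pi> * (1 - \<pi> * c) + c = inverse \<pi>" using pi0 by (simp add: field_simps)
  ultimately show False using pi_A by simp
qed

text \<open>In the relation for \<open>inverse x\<close> the constant term can be absorbed, because
  \<open>1 - \<pi> * coeff q 0\<close> is a unit of \<open>A\<close>. Solved for 1 and multiplied by
  \<open>x ^ degree p\<close>, the relation expresses the top power of \<open>x\<close> by lower
  ones, and this replaces the leading term of \<open>p\<close>.\<close>

lemma reduce_degree:
  assumes x: "x \<noteq> 0" and p: "inverse \<pi> = poly p x" "\<And>i. coeff p i \<in> A" and q: "inverse \<pi> = poly q (inverse x)" "\<And>i. coeff q i \<in> A"
    and le: "degree q \<le> degree p"
  shows "\<exists>p'. inverse \<pi> = poly p' x \<and> (\<forall>i. coeff p' i \<in> A) \<and> degree p' < degree p"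
proof -
  let ?n = "degree p" and ?m = "degree q"
  have n0: "?n > 0"
  proof (rule ccontr)
    assume "\<not> ?n > 0"
    then obtain a where "p = [:a:]" by (metis degree_eq_zeroE neq0_conv)
    then show False using p(1) p(2)[of 0] pi_A by simp
  qed
  have m0: "?m > 0"
  proof (rule ccontr)
    assume "\<not> ?m > 0"
    then obtain a where "q = [:a:]" by (metis degree_eq_zeroE neq0_conv)
    then show False using q(1) q(2)[of 0] pi_A by simp
  qed
  define c where "c = inverse (1 - \<pi> * coeff q 0)"
  have c: "c \<in> A" "c * (1 - \<pi> * coeff q 0) = 1"
    using inverse_one_minus[OF q(2)] not_unit_pi[OF q(2)] by (auto simp: c_def)
  \<comment> \<open>The polynomial of lower degree whose value at \<open>x\<close> is
    \<open>x ^ degree p\<close>.\<close>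
  define r where "r = (\<Sum>j = 1..?m. monom (\<pi> * c * coeff q j) (?n - j))"
  have rA: "coeff r i \<in> A" for i
    unfolding r_def coeff_sum using c q by (intro A_sum) (auto simp: coeff_monom)
  have degr: "degree r < ?n"
    unfolding r_def using n0 m0 by (intro degree_sum_less) (auto intro: le_less_trans[OF degree_monom_le])
  have "1 = \<pi> * poly q (inverse x)" using q(1) pi0 by (metis right_inverse)
  also have "poly q (inverse x) = coeff q 0 + (\<Sum>j = 1..?m. coeff q j * inverse x ^ j)"
    unfolding poly_altdef atMost_atLeast0 by (subst sum.atLeast_Suc_atMost) simp_all
  finally have "1 - \<pi> * coeff q 0 = \<pi> * (\<Sum>j = 1..?m. coeff q j * inverse x ^ j)" by (simp add: algebra_simps)
  then have "1 = \<pi> * c * (\<Sum>j = 1..?m. coeff q j * inverse x ^ j)" using c(2) by (metis mult.assoc mult.commute)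
  then have "x ^ ?n = \<pi> * c * (\<Sum>j = 1..?m. coeff q j * inverse x ^ j) * x ^ ?n" by simp
  also have "\<dots> = (\<Sum>j = 1..?m. \<pi> * c * coeff q j * x ^ (?n - j))"
    unfolding sum_distrib_left sum_distrib_right
  proof (rule sum.cong[OF refl])
    fix j assume "j \<in> {1..?m}"
    then have "x ^ ?n = x ^ j * x ^ (?n - j)" using le by (simp flip: power_add)
    then show "\<pi> * c * (coeff q j * inverse x ^ j) * x ^ ?n = \<pi> * c * coeff q j * x ^ (?n - j)"
      using x by (simp add: power_inverse)
  qed
  also have "\<dots> = poly r x" unfolding r_def by (simp add: poly_sum poly_monom)
  finally have xn: "x ^ ?n = poly r x" .
  define p' where "p' = p - monom (lead_coeff p) ?n + smult (lead_coeff p) r"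
  have "poly p' x = inverse \<pi>" using p(1) xn by (simp add: p'_def poly_monom)
  moreover have "coeff p' i \<in> A" for i using p(2) rA by (auto simp: p'_def coeff_monom)
  moreover have "degree p' < ?n"
  proof -
    have "degree (p - monom (lead_coeff p) ?n) < ?n"
      using n0 by (intro degree_lessI) (auto simp: coeff_monom coeff_eq_0)
    then show ?thesis unfolding p'_def using degr by (intro degree_add_less) (auto intro: le_less_trans[OF degree_smult_le])
  qed
  ultimately show ?thesis by (metis (no_types, lifting))
qed

text \<open>Relations of least degree for \<open>x\<close> and for \<open>inverse x\<close> cannot
  coexist: the one of larger degree could be shortened with the help of the other.\<close>

lemma A_or_inverse: "x \<in> A \<or> inverse x \<in> A"
proof (rule ccontr)
  assume n: "\<not> (x \<in> A \<or> inverse x \<in> A)"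
  then have x: "x \<noteq> 0" by auto
  let ?P = "\<lambda>x p. inverse \<pi> = poly p x \<and> (\<forall>i. coeff p i \<in> A)"
  have ex: "\<exists>p. ?P x p" if "x \<notin> A" for x
    using adj_eq[OF that] unfolding adj_def by blast
  have arg: "\<exists>p. ?P x p \<and> (\<forall>p'. ?P x p' \<longrightarrow> degree p \<le> degree p')" if "x \<notin> A" for x
    using ex[OF that] ex_has_least_nat[of "?P x" _ degree] by (metis (no_types, lifting))
  obtain p where p: "?P x p" "\<forall>p'. ?P x p' \<longrightarrow> degree p \<le> degree p'"
    using arg[of x] n by (metis (no_types, lifting))
  obtain q where q: "?P (inverse x) q" "\<forall>p'. ?P (inverse x) p' \<longrightarrow> degree q \<le> degree p'"
    using arg[of "inverse x"] n by (metis (no_types, lifting))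
  show False
  proof (cases "degree q \<le> degree p")
    case True
    then show False using reduce_degree[of x p q] x p q by (metis (no_types, lifting) not_le)
  next
    case False
    then have "degree p \<le> degree q" by simp
    then show False using reduce_degree[of "inverse x" q p] x p q
      by (metis (no_types, lifting) inverse_inverse_eq inverse_nonzero_iff_nonzero not_le)
  qed
qed

definition U :: "'a set" where "U = {u \<in> A. u \<noteq> 0 \<and> inverse u \<in> A}"

lemma U_1 [simp]: "1 \<in> U" by (simp add: U_def)
lemma U_mult: "u \<in> U \<Longrightarrow> w \<in> U \<Longrightarrow> u * w \<in> U" by (auto simp: U_def)
lemma U_inverse: "u \<in> U \<Longrightarrow> inverse u \<in> U" by (auto simp: U_def)
lemma U_divide: "u \<in> U \<Longrightarrow> w \<in> U \<Longrightarrow> u / w \<in> U"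
  by (simp add: divide_inverse U_mult U_inverse)
lemma U_power: "u \<in> U \<Longrightarrow> u ^ n \<in> U" by (induction n) (auto intro: U_mult)
lemma U_nonzero: "u \<in> U \<Longrightarrow> u \<noteq> 0" by (simp add: U_def)

text \<open>Of two nonzero elements of \<open>A\<close> one divides the other, which makes
  \<open>A\<close> a local ring.\<close>

lemma nonunit_add: "a \<in> A - U \<Longrightarrow> b \<in> A - U \<Longrightarrow> a + b \<in> A - U"
proof
  assume a: "a \<in> A - U" and b: "b \<in> A - U"
  then show "a + b \<in> A" by auto
  show "a + b \<notin> U"
  proof
    assume ab: "a + b \<in> U"
    have *: False if a: "a \<in> A - U" and b: "b \<in> A - U" "b \<noteq> 0" and ab: "a + b \<in> U" and q: "a / b \<in> A" for a b
    proof -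
      have "inverse b = (1 + a / b) * inverse (a + b)"
        using b(2) U_nonzero[OF ab] by (simp add: field_simps)
      moreover have "(1 + a / b) * inverse (a + b) \<in> A" using q U_inverse[OF ab] by (auto simp: U_def)
      ultimately show False using b by (auto simp: U_def)
    qed
    show False
    proof (cases "a = 0 \<or> b = 0")
      case True
      then show False using ab a b by auto
    next
      case False
      then show False using A_or_inverse[of "a / b"] *[OF a b _ ab] *[OF b a] ab by (auto simp: add.commute)
    qed
  qed
qed

lemma nonunit_sum: "finite I \<Longrightarrow> (\<And>i. i \<in> I \<Longrightarrow> f i \<in> A - U) \<Longrightarrow> sum f I \<in> A - U"
  by (induction I rule: finite_induct) (use nonunit_add in \<open>auto simp: U_def\<close>)

text \<open>Divisibility in \<open>A\<close> is total; \<open>t i\<close> is a term of least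
  valuation.\<close>

lemma max_exists:
  "finite I \<Longrightarrow> I \<noteq> {} \<Longrightarrow> (\<And>i. i \<in> I \<Longrightarrow> t i \<noteq> 0) \<Longrightarrow> \<exists>i\<in>I. \<forall>j\<in>I. t j / t i \<in> A"
proof (induction I rule: finite_ne_induct)
  case (insert k I)
  then obtain i where i: "i \<in> I" "\<forall>j\<in>I. t j / t i \<in> A" by blast
  have nz: "t k \<noteq> 0" "t i \<noteq> 0" using insert.prems i by auto
  show ?case
  proof (cases "t k / t i \<in> A")
    case True
    then show ?thesis using i by blast
  next
    case False
    then have 1: "t i / t k \<in> A" using A_or_inverse[of "t k / t i"] by simp
    have "t j / t k \<in> A" if "j \<in> I" for j
    proof -
      have "t j / t k = (t j / t i) * (t i / t k)" using nz by simp
      moreover have "t j / t i \<in> A" using i(2) that by blast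
      ultimately show ?thesis using A_mult[OF _ 1] by metis
    qed
    then show ?thesis using nz by (intro bexI[of _ k]) auto
  qed
qed (auto)

end

context dominating_ring
begin

text \<open>Encodes that \<open>x ^ n\<close> is a unit times \<open>\<pi> powi k\<close>, so that a
  valuation with value 1 at \<open>\<pi>\<close> must be \<open>k / n\<close> at
  \<open>x\<close>.\<close>

definition vrel :: "'a \<Rightarrow> nat \<Rightarrow> int \<Rightarrow> bool" where
  "vrel x n k \<longleftrightarrow> n > 0 \<and> x \<noteq> 0 \<and> x ^ n / \<pi> powi k \<in> U"

definition val :: "'a \<Rightarrow> rat" where
  "val x = (THE q. \<exists>n k. vrel x n k \<and> q = of_int k / of_nat n)"

lemma U_powi_pi: "\<pi> powi k \<in> U \<Longrightarrow> k = 0"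
proof (rule ccontr)
  assume u: "\<pi> powi k \<in> U" and k: "k \<noteq> 0"
  have "\<pi> powi (int (nat \<bar>k\<bar>)) \<in> U"
  proof (cases "k \<ge> 0")
    case False
    then show ?thesis using U_inverse[OF u] by (simp add: power_int_minus[symmetric])
  qed (use u in simp)
  then have "\<pi> ^ nat \<bar>k\<bar> \<in> U" by (simp add: power_int_def)
  moreover obtain m where "nat \<bar>k\<bar> = Suc m" using k by (metis gr0_implies_Suc zero_less_abs_iff zero_less_nat_eq)
  ultimately have "inverse (\<pi> ^ Suc m) \<in> A" by (simp add: U_def)
  then have "\<pi> ^ m * inverse (\<pi> ^ Suc m) \<in> A" by blast
  moreover have "\<pi> ^ m * inverse (\<pi> ^ Suc m) = inverse \<pi>" using pi0 by (simp add: field_simps)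
  ultimately show False using pi_A by metis
qed

text \<open>Raised to a common exponent, two such relations leave a power of \<open>\<pi>\<close>
  that is a unit, and only the exponent 0 allows that.\<close>

lemma vrel_unique:
  assumes "vrel x n k" "vrel x m l"
  shows "of_int k / of_nat n = (of_int l / of_nat m :: rat)"
proof -
  have x: "x \<noteq> 0" and nm: "n > 0" "m > 0" using assms by (auto simp: vrel_def)
  have "(x ^ m / \<pi> powi l) ^ n \<in> U" "(x ^ n / \<pi> powi k) ^ m \<in> U"
    using assms U_power by (auto simp: vrel_def)
  then have "(x ^ m / \<pi> powi l) ^ n / (x ^ n / \<pi> powi k) ^ m \<in> U" by (rule U_divide)
  also have "(x ^ m / \<pi> powi l) ^ n / (x ^ n / \<pi> powi k) ^ m = \<pi> powi (k * int m - l * int n)"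
    using x pi0 by (simp add: power_divide power_int_diff power_int_mult power_mult[symmetric] mult.commute)
  finally have "k * int m = l * int n" using U_powi_pi by fastforce
  then have "of_int k * of_nat m = (of_int l * of_nat n :: rat)" by (metis of_int_mult of_int_of_nat_eq)
  then show ?thesis using nm by (simp add: frac_eq_eq)
qed

lemma val_eq: "vrel x n k \<Longrightarrow> val x = of_int k / of_nat n"
  unfolding val_def by (rule the_equality) (use vrel_unique in blast)+

lemma vrel_mult:
  assumes "vrel x n k" "vrel y m l"
  shows "vrel (x * y) (n * m) (k * int m + l * int n)"
proof -
  have "(x ^ n / \<pi> powi k) ^ m * (y ^ m / \<pi> powi l) ^ n \<in> U"
    using assms U_power U_mult by (auto simp: vrel_def)
  also have "(x ^ n / \<pi> powi k) ^ m * (y ^ m / \<pi> powi l) ^ n =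
      (x * y) ^ (n * m) / \<pi> powi (k * int m + l * int n)"
    using pi0 by (simp add: power_divide power_int_add power_int_mult power_mult[symmetric] power_mult_distrib mult.commute)
  finally show ?thesis using assms by (auto simp: vrel_def)
qed

lemma vrel_nonneg:
  assumes v: "vrel x n k"
  shows "k \<ge> 0 \<longleftrightarrow> x \<in> A"
proof
  have n: "n > 0" and x: "x \<noteq> 0" and u: "x ^ n / \<pi> powi k \<in> U" using v by (auto simp: vrel_def)
  have e: "x ^ n = (x ^ n / \<pi> powi k) * \<pi> powi k" using pi0 by simp
  show "x \<in> A" if k: "k \<ge> 0"
  proof (rule ccontr)
    assume "x \<notin> A"
    then have i: "inverse x \<in> A" using A_or_inverse by blast
    have "\<pi> powi k \<in> A" using k by (auto simp: power_int_def)
    then have "x ^ n \<in> A" using e u by (metis A_mult U_def mem_Collect_eq)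
    then have "x ^ n * inverse x ^ (n - 1) \<in> A" using i by blast
    moreover have "x ^ n * inverse x ^ (n - 1) = x"
      using n x by (cases n) (auto simp: power_inverse)
    ultimately show False using \<open>x \<notin> A\<close> by simp
  qed
  show "k \<ge> 0" if xA: "x \<in> A"
  proof (rule ccontr)
    assume k: "\<not> k \<ge> 0"
    define j where "j = nat (- k)"
    have j: "\<pi> powi k = inverse (\<pi> ^ j)" "j > 0" using k by (auto simp: j_def power_int_def power_inverse)
    have "x ^ n * \<pi> ^ j \<in> U" using u j by (simp add: divide_inverse)
    then have "inverse (x ^ n * \<pi> ^ j) \<in> A" by (simp add: U_def)
    then have "x ^ n * \<pi> ^ (j - 1) * inverse (x ^ n * \<pi> ^ j) \<in> A" using xA by blast
    moreover have "x ^ n * \<pi> ^ (j - 1) * inverse (x ^ n * \<pi> ^ j) = inverse \<pi>"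
      using x pi0 j(2) by (cases j) (auto simp: field_simps)
    ultimately show False using pi_A by simp
  qed
qed

text \<open>In a vanishing sum the term of least valuation cannot be alone, for otherwise
  \<open>- 1\<close> would be a sum of nonunits. Comparison with a second term of the same valuation
  expresses a power of \<open>x\<close> by a power of \<open>\<pi>\<close>; this is why the values
  are rational.\<close>

lemma vrel_exists:
  assumes x: "x \<noteq> 0" and S: "finite S" "S \<noteq> {}"
    and c: "\<And>i. i \<in> S \<Longrightarrow> c i \<noteq> 0" "\<And>i. i \<in> S \<Longrightarrow> \<exists>e::nat. c i / \<pi> ^ e \<in> U"
    and s: "(\<Sum>i\<in>S. c i * x ^ i) = 0"
  shows "\<exists>n k. vrel x n k"
proof -
  let ?t = "\<lambda>i. c i * x ^ i"
  have t0: "?t i \<noteq> 0" if "i \<in> S" for i using that c x by simp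
  obtain i where i: "i \<in> S" "\<forall>j\<in>S. ?t j / ?t i \<in> A"
    using max_exists[of S ?t, OF S] t0 by blast
  have "\<exists>j\<in>S - {i}. ?t j / ?t i \<in> U"
  proof (rule ccontr)
    assume nt: "\<not> (\<exists>j\<in>S - {i}. ?t j / ?t i \<in> U)"
    have "(\<Sum>j\<in>S - {i}. ?t j / ?t i) \<in> A - U"
    proof (intro nonunit_sum)
      show "finite (S - {i})" using S by simp
      show "?t j / ?t i \<in> A - U" if "j \<in> S - {i}" for j
        using that i(2) nt by blast
    qed
    moreover have "(\<Sum>j\<in>S. ?t j / ?t i) = 0" using s by (simp add: sum_divide_distrib[symmetric])
    then have "(\<Sum>j\<in>S - {i}. ?t j / ?t i) = - 1"
      using S(1) i(1) t0[OF i(1)] x by (simp add: sum.remove[of S i] eq_neg_iff_add_eq_0 add.commute)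
    ultimately have "- 1 \<notin> U" by simp
    moreover have "- 1 \<in> A" by (rule A_uminus) (rule A_1)
    ultimately show False by (simp add: U_def)
  qed
  then obtain j where j: "j \<in> S" "j \<noteq> i" "?t j / ?t i \<in> U" by blast
  have main: "\<exists>n k. vrel x n k" if ij: "i \<in> S" "j \<in> S" "i < j" "?t j / ?t i \<in> U" for i j
  proof -
    obtain e f where ef: "c i / \<pi> ^ e \<in> U" "c j / \<pi> ^ f \<in> U" using c(2)[OF ij(1)] c(2)[OF ij(2)] by blast
    have "(?t j / ?t i) * ((c i / \<pi> ^ e) / (c j / \<pi> ^ f)) \<in> U"
      by (rule U_mult[OF ij(4) U_divide[OF ef]])
    also have "(?t j / ?t i) * ((c i / \<pi> ^ e) / (c j / \<pi> ^ f)) = x ^ (j - i) / \<pi> powi (int e - int f)"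
      using c(1)[OF ij(1)] c(1)[OF ij(2)] x pi0 ij(3)
      by (simp add: power_diff power_int_diff)
    finally have "vrel x (j - i) (int e - int f)" using ij(3) x by (simp add: vrel_def)
    then show ?thesis by blast
  qed
  show ?thesis
  proof (cases "i < j")
    case True
    then show ?thesis using main i(1) j by blast
  next
    case False
    have "?t i / ?t j \<in> U" using U_inverse[OF j(3)] by simp
    then show ?thesis using main[OF j(1) i(1)] False j(2) by simp
  qed
qed

end

text \<open>The two assumptions make every nonzero element commensurable with \<open>\<pi>\<close>:
  \<open>R\<close> behaves like a discrete valuation ring with uniformizer \<open>\<pi>\<close>, and
  the field is algebraic over it.\<close>

locale valued_field = dominating_ring R \<pi> for R :: "'a::field set" and \<pi> +
  assumes R_val: "\<And>c. c \<in> R \<Longrightarrow> c \<noteq> 0 \<Longrightarrow> \<exists>e::nat. c / \<pi> ^ e \<in> R \<and> inverse (c / \<pi> ^ e) \<in> R"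
    and alg: "\<And>x. \<exists>p. p \<noteq> 0 \<and> (\<forall>i. coeff p i \<in> R) \<and> poly p x = 0"
begin

lemma vrel_ex: "x \<noteq> 0 \<Longrightarrow> \<exists>n k. vrel x n k"
proof -
  assume x: "x \<noteq> 0"
  obtain p where p: "p \<noteq> 0" "\<And>i. coeff p i \<in> R" "poly p x = 0" using alg by blast
  let ?S = "{i. i \<le> degree p \<and> coeff p i \<noteq> 0}"
  have "(\<Sum>i\<in>?S. coeff p i * x ^ i) = poly p x"
    unfolding poly_altdef by (rule sum.mono_neutral_left) auto
  moreover have "degree p \<in> ?S" using p(1) by simp
  moreover have "\<exists>e::nat. coeff p i / \<pi> ^ e \<in> U" if i: "coeff p i \<noteq> 0" for i
  proof -
    obtain e :: nat where e: "coeff p i / \<pi> ^ e \<in> R" "inverse (coeff p i / \<pi> ^ e) \<in> R" using R_val[OF p(2) i] by blast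
    then have "coeff p i / \<pi> ^ e \<in> U"
      using i pi0 R_A[OF e(1)] R_A[OF e(2)] by (simp add: U_def)
    then show ?thesis by blast
  qed
  ultimately show ?thesis using p(3) by (intro vrel_exists[OF x, of ?S "coeff p"]) auto
qed

lemma val_mult: "x \<noteq> 0 \<Longrightarrow> y \<noteq> 0 \<Longrightarrow> val (x * y) = val x + val y"
proof -
  assume xy: "x \<noteq> 0" "y \<noteq> 0"
  obtain n k where v1: "vrel x n k" using vrel_ex[OF xy(1)] by blast
  obtain m l where v2: "vrel y m l" using vrel_ex[OF xy(2)] by blast
  note v = v1 v2
  then have "n > 0" "m > 0" by (auto simp: vrel_def)
  then show ?thesis using val_eq[OF vrel_mult[OF v]] val_eq[OF v(1)] val_eq[OF v(2)]
    by (simp add: add_divide_distrib)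
qed

lemma val_nonneg: "x \<noteq> 0 \<Longrightarrow> val x \<ge> 0 \<longleftrightarrow> x \<in> A"
proof -
  assume x: "x \<noteq> 0"
  obtain n k where v: "vrel x n k" using vrel_ex[OF x] by blast
  then have "n > 0" by (auto simp: vrel_def)
  then show ?thesis using val_eq[OF v] vrel_nonneg[OF v] by (simp add: zero_le_divide_iff)
qed

lemma val_divide: "x \<noteq> 0 \<Longrightarrow> y \<noteq> 0 \<Longrightarrow> val (x / y) = val x - val y"
  using val_mult[of "x / y" y] by simp

lemma val_add:
  assumes "x \<noteq> 0" "y \<noteq> 0" "x + y \<noteq> 0"
  shows "val (x + y) \<ge> min (val x) (val y)"
proof -
  have *: "val (x + y) \<ge> val x" if xy: "x \<noteq> 0" "y \<noteq> 0" "x + y \<noteq> 0" "val x \<le> val y" for x y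
  proof -
    have "y / x \<in> A" using val_nonneg[of "y / x"] val_divide[of y x] xy by simp
    then have "1 + y / x \<in> A" by blast
    moreover have e: "1 + y / x = (x + y) / x" using xy by (simp add: add_divide_distrib)
    ultimately show ?thesis using val_nonneg[of "(x + y) / x"] val_divide[of "x + y" x] xy by simp
  qed
  show ?thesis
  proof (cases "val x \<le> val y")
    case True
    then show ?thesis using *[of x y] assms by simp
  next
    case False
    then show ?thesis using *[of y x] assms by (simp add: add.commute)
  qed
qed

lemma val_pi: "val \<pi> = 1"
proof -
  have "vrel \<pi> 1 1" using pi0 by (simp add: vrel_def)
  then show ?thesis using val_eq by fastforce
qed

lemma val_R: "c \<in> R \<Longrightarrow> c \<noteq> 0 \<Longrightarrow> val c \<ge> 0"
  using val_nonneg R_A by blast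

lemma exists_valuation:
  "\<exists>v::'a \<Rightarrow> rat. (\<forall>x y. x \<noteq> 0 \<longrightarrow> y \<noteq> 0 \<longrightarrow> v (x * y) = v x + v y) \<and>
     (\<forall>x y. x \<noteq> 0 \<longrightarrow> y \<noteq> 0 \<longrightarrow> x + y \<noteq> 0 \<longrightarrow> min (v x) (v y) \<le> v (x + y)) \<and>
     (\<forall>c\<in>R. c \<noteq> 0 \<longrightarrow> v c \<ge> 0) \<and> v \<pi> = 1"
  by (rule exI[of _ val]) (use val_mult val_add val_R val_pi in blast)

end

section \<open>Weierstrass theory over a complete discrete valuation ring\<close>

lemma fps_finite_poly:
  fixes f :: "'a::comm_monoid_add fps"
  assumes "\<And>i. i \<ge> n \<Longrightarrow> fps_nth f i = 0"
  obtains p where "fps_of_poly p = f" "\<And>i. i \<ge> n \<Longrightarrow> coeff p i = 0"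
proof -
  define p where "p = (\<Sum>i<n. monom (fps_nth f i) i)"
  have c: "coeff p i = fps_nth f i" for i
    unfolding p_def coeff_sum using assms[of i] by (cases "i < n") (auto simp: coeff_monom)
  show ?thesis
    by (rule that[of p]) (use c assms in \<open>auto simp: fps_eq_iff\<close>)
qed

locale dvr =
  fixes \<pi> :: "'r::idom"
  assumes pi0: "\<pi> \<noteq> 0" and pi_nonunit: "\<not> \<pi> dvd 1"
    and factor: "\<And>x. x \<noteq> 0 \<Longrightarrow> \<exists>u n. u dvd 1 \<and> x = u * \<pi> ^ n"
begin

lemma unit_or_dvd: "x dvd 1 \<or> \<pi> dvd x"
proof (cases "x = 0")
  case False
  then obtain u n where "u dvd 1" "x = u * \<pi> ^ n" using factor by blast
  then show ?thesis by (cases n) auto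
qed simp

lemma not_dvd_iff_unit: "\<not> \<pi> dvd x \<longleftrightarrow> x dvd 1"
  using unit_or_dvd pi_nonunit dvd_trans by blast

lemma pi_prime: "\<pi> dvd x * y \<Longrightarrow> \<pi> dvd x \<or> \<pi> dvd y"
proof (rule ccontr)
  assume xy: "\<pi> dvd x * y" and "\<not> (\<pi> dvd x \<or> \<pi> dvd y)"
  then have "x dvd 1" "y dvd 1" using unit_or_dvd by blast+
  then have "x * y dvd 1 * 1" by (rule mult_dvd_mono)
  then show False using xy not_dvd_iff_unit by auto
qed

lemma separated: "(\<And>N. \<pi> ^ N dvd x) \<Longrightarrow> x = 0"
proof (rule ccontr)
  assume d: "\<And>N. \<pi> ^ N dvd x" and "x \<noteq> 0"
  then obtain u n where u: "u dvd 1" "x = u * \<pi> ^ n" using factor by blast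
  have "\<pi> * \<pi> ^ n dvd u * \<pi> ^ n" using d[of "Suc n"] u(2) by simp
  then have "\<pi> dvd u" using pi0 by simp
  then show False using u(1) not_dvd_iff_unit by blast
qed

definition D :: "nat \<Rightarrow> 'r fps \<Rightarrow> bool" where "D N f \<longleftrightarrow> (\<forall>i. \<pi> ^ N dvd fps_nth f i)"

lemma D_add: "D N f \<Longrightarrow> D N g \<Longrightarrow> D N (f + g)"
  and D_diff: "D N f \<Longrightarrow> D N g \<Longrightarrow> D N (f - g)"
  by (auto simp: D_def)

lemma D_mult: "D N f \<Longrightarrow> D N (f * g)"
  by (auto simp: D_def fps_mult_nth intro!: dvd_sum)

lemma D_const: "D N (fps_const (\<pi> ^ N) * f)"
  by (auto simp: D_def)

lemma D_factor: "D N f \<Longrightarrow> \<exists>g. f = fps_const (\<pi> ^ N) * g"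
proof -
  assume "D N f"
  then obtain a where "\<And>i. fps_nth f i = \<pi> ^ N * a i" unfolding D_def dvd_def by metis
  then show ?thesis by (intro exI[of _ "Abs_fps a"]) (simp add: fps_eq_iff)
qed

lemma D_separated: "(\<And>N. D N f) \<Longrightarrow> f = 0"
  using separated by (auto simp: fps_eq_iff D_def)

lemma exact_power:
  assumes "f \<noteq> 0"
  obtains e g where "f = fps_const (\<pi> ^ e) * g" "\<not> D 1 g"
proof -
  obtain N where N: "\<not> D N f" using D_separated assms by blast
  obtain M where M: "\<not> D M f" "\<forall>k<M. D k f"
    using exists_least_iff[of "\<lambda>N. \<not> D N f"] N by blast
  have "M \<noteq> 0" using M(1) by (metis D_def one_dvd power_0)
  then obtain e where e: "M = Suc e" by (cases M) auto
  obtain g where g: "f = fps_const (\<pi> ^ e) * g" using D_factor[of e f] M(2) e by auto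
  have "\<not> D 1 g"
  proof
    assume "D 1 g"
    then have "D M f" using g e by (simp add: D_def mult_dvd_mono mult.commute)
    then show False using M(1) by simp
  qed
  then show ?thesis using that g by blast
qed

text \<open>Weierstrass regularity: the reduction modulo \<open>\<pi>\<close> has order exactly
  \<open>n\<close>.\<close>

definition reg :: "nat \<Rightarrow> 'r fps \<Rightarrow> bool" where
  "reg n F \<longleftrightarrow> (\<forall>i<n. \<pi> dvd fps_nth F i) \<and> fps_nth F n dvd 1"

text \<open>Distinguished polynomials in the sense of Weierstrass, which reduce to a power of the
  variable modulo \<open>\<pi>\<close>.\<close>

definition dist :: "'r poly \<Rightarrow> bool" where
  "dist P \<longleftrightarrow> lead_coeff P = 1 \<and> (\<forall>i<degree P. \<pi> dvd coeff P i)"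

lemma reg_exists: "\<not> D 1 F \<Longrightarrow> \<exists>n. reg n F"
proof -
  assume "\<not> D 1 F"
  then obtain i where i: "\<not> \<pi> dvd fps_nth F i" by (auto simp: D_def)
  obtain n where "\<not> \<pi> dvd fps_nth F n" "\<forall>k<n. \<pi> dvd fps_nth F k"
    using exists_least_iff[of "\<lambda>i. \<not> \<pi> dvd fps_nth F i"] i by blast
  then show ?thesis using not_dvd_iff_unit by (auto simp: reg_def)
qed

lemma dist_reg: "dist P \<Longrightarrow> reg (degree P) (fps_of_poly P)"
  by (auto simp: reg_def dist_def)

lemma fps_unit_iff: "f dvd 1 \<longleftrightarrow> fps_nth f 0 dvd (1 :: 'r)"
proof
  assume "f dvd 1"
  then obtain g where "1 = f * g" by (auto simp: dvd_def)
  then have "fps_nth 1 0 = fps_nth (f * g) 0" by simp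
  then have "1 = fps_nth f 0 * fps_nth g 0" by (simp add: fps_mult_nth)
  then show "fps_nth f 0 dvd 1" by (metis dvd_triv_left)
next
  assume "fps_nth f 0 dvd 1"
  then obtain y where y: "fps_nth f 0 * y = 1" by (auto simp: dvd_def)
  have "f * fps_right_inverse f y = 1" using fps_right_inverse[OF y] .
  then show "f dvd 1" by (metis dvd_triv_left)
qed

lemma reg_mult_nth:
  assumes F: "reg n F" and h: "\<forall>i<m. \<pi> dvd fps_nth h i" "\<not> \<pi> dvd fps_nth h m"
  shows "\<not> \<pi> dvd fps_nth (F * h) (n + m)"
proof -
  have "fps_nth (F * h) (n + m) = fps_nth F n * fps_nth h m + (\<Sum>i\<in>{0..n + m} - {n}. fps_nth F i * fps_nth h (n + m - i))"
    by (simp add: fps_mult_nth sum.remove[of "{0..n + m}" n])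
  moreover have "\<pi> dvd (\<Sum>i\<in>{0..n + m} - {n}. fps_nth F i * fps_nth h (n + m - i))"
  proof (rule dvd_sum)
    fix i assume i: "i \<in> {0..n + m} - {n}"
    show "\<pi> dvd fps_nth F i * fps_nth h (n + m - i)"
    proof (cases "i < n")
      case True
      then show ?thesis using F by (auto simp: reg_def)
    next
      case False
      then have "n + m - i < m" using i by auto
      then show ?thesis using h(1) by auto
    qed
  qed
  moreover have "\<not> \<pi> dvd fps_nth F n * fps_nth h m"
    using pi_prime h(2) F not_dvd_iff_unit by (auto simp: reg_def)
  ultimately show ?thesis by (simp add: dvd_add_left_iff)
qed

text \<open>The uniqueness part of Weierstrass division. After the exact power of
  \<open>\<pi>\<close> is removed from \<open>h\<close>, the orders of the reductions add, so some
  coefficient of index at least \<open>n\<close> survives modulo \<open>\<pi>\<close>.\<close>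

lemma reg_mult_low:
  assumes F: "reg n F" and h: "\<And>i. i \<ge> n \<Longrightarrow> fps_nth (F * h) i = 0"
  shows "h = 0"
proof (rule ccontr)
  assume "h \<noteq> 0"
  then obtain e g where g: "h = fps_const (\<pi> ^ e) * g" "\<not> D 1 g" by (rule exact_power)
  obtain m where m: "reg m g" using reg_exists[OF g(2)] by blast
  have "\<not> \<pi> dvd fps_nth (F * g) (n + m)"
    using reg_mult_nth[OF F, of m g] m not_dvd_iff_unit by (auto simp: reg_def)
  moreover have "fps_nth (F * h) (n + m) = \<pi> ^ e * fps_nth (F * g) (n + m)"
    unfolding g by (metis fps_mult_left_const_nth mult.left_commute)
  then have "fps_nth (F * g) (n + m) = 0" using h[of "n + m"] pi0 by auto
  ultimately show False by simp
qed

lemma poly_divide: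
  assumes P: "lead_coeff P = (1 :: 'r)"
  obtains S T where "Q = P * S + T" "\<And>i. i \<ge> degree P \<Longrightarrow> coeff T i = 0"
proof -
  obtain S T where st: "pseudo_divmod Q P = (S, T)" by (cases "pseudo_divmod Q P")
  have P0: "P \<noteq> 0" using P by auto
  have "Q = P * S + T" "T = 0 \<or> degree T < degree P"
    using pseudo_divmod[OF P0 st] P by auto
  then show ?thesis by (intro that[of S T]) (auto intro: coeff_eq_0)
qed

text \<open>Euclidean division by the monic \<open>P\<close> leaves a remainder of low degree that
  \<open>P\<close> divides as a power series; by \<open>reg_mult_low\<close> it is 0.\<close>

lemma dist_dvd_poly:
  assumes P: "dist P" and e: "fps_of_poly P * h = fps_of_poly Q"
  shows "\<exists>S. Q = P * S"
proof -
  obtain S T where st: "Q = P * S + T" "\<And>i. i \<ge> degree P \<Longrightarrow> coeff T i = 0"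
    by (rule poly_divide[of P Q]) (use P in \<open>auto simp: dist_def\<close>)
  have "fps_of_poly P * (h - fps_of_poly S) = fps_of_poly T"
    using e st(1) by (simp add: algebra_simps fps_of_poly_add fps_of_poly_mult)
  then have "h - fps_of_poly S = 0" using st(2) by (intro reg_mult_low[OF dist_reg[OF P]]) simp
  then have "fps_of_poly T = 0" using \<open>fps_of_poly P * (h - fps_of_poly S) = fps_of_poly T\<close> by simp
  then show ?thesis using st(1) by auto
qed

lemma dist_mult: "dist P \<Longrightarrow> dist Q \<Longrightarrow> dist (P * Q)"
proof -
  assume P: "dist P" and Q: "dist Q"
  have n0: "P \<noteq> 0" "Q \<noteq> 0" using P Q by (auto simp: dist_def)
  have "\<pi> dvd coeff (P * Q) i" if i: "i < degree P + degree Q" for i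
    unfolding coeff_mult
  proof (rule dvd_sum)
    fix j assume j: "j \<in> {..i}"
    then have "j < degree P \<or> i - j < degree Q" using i by auto
    then show "\<pi> dvd coeff P j * coeff Q (i - j)" using P Q by (auto simp: dist_def)
  qed
  moreover have "lead_coeff (P * Q) = 1" using P Q by (simp only: lead_coeff_mult dist_def) simp
  moreover have "degree (P * Q) = degree P + degree Q" using n0 by (rule degree_mult_eq)
  ultimately show ?thesis unfolding dist_def by simp
qed

end

text \<open>Completeness is stated as summability of \<open>\<pi>\<close>-adic series with arbitrary
  coefficients, the form in which Weierstrass division uses it.\<close>

locale complete_dvr = dvr +
  assumes complete: "\<And>a :: nat \<Rightarrow> 'a. \<exists>s. \<forall>N. \<pi> ^ N dvd (s - (\<Sum>k<N. a k * \<pi> ^ k))"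
begin

lemma fps_complete: "\<exists>f. \<forall>N. D N (f - (\<Sum>k<N. fps_const (\<pi> ^ k) * a k))"
proof -
  have "\<exists>s. \<forall>N. \<pi> ^ N dvd (s - (\<Sum>k<N. fps_nth (a k) i * \<pi> ^ k))" for i by (rule complete)
  then obtain s where s: "\<And>i N. \<pi> ^ N dvd (s i - (\<Sum>k<N. fps_nth (a k) i * \<pi> ^ k))" by metis
  then show ?thesis
    by (intro exI[of _ "Abs_fps s"]) (simp add: D_def fps_sum_nth mult.commute)
qed

text \<open>Modulo \<open>\<pi>\<close> the series \<open>F\<close> is a unit times the
  \<open>n\<close>-th power of the variable, so division with remainder works up to a multiple of
  \<open>\<pi>\<close>. The error is divided again, and the resulting \<open>\<pi>\<close>-adic
  series are summed.\<close>

lemma weierstrass_division: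
  assumes F: "reg n F"
  shows "\<exists>q r. f = q * F + fps_of_poly r \<and> (\<forall>i\<ge>n. coeff r i = 0)"
proof -
  define Fl where "Fl = Abs_fps (\<lambda>i. if i < n then fps_nth F i else 0)"
  have "D 1 Fl" using F by (auto simp: D_def Fl_def reg_def)
  then obtain A where A: "Fl = fps_const \<pi> * A" using D_factor[of 1 Fl] by auto
  define B where "B = fps_shift n F"
  have FB: "F = fps_const \<pi> * A + B * fps_X ^ n"
    unfolding A[symmetric] by (auto simp: fps_eq_iff Fl_def B_def fps_X_power_mult_right_nth)
  have "B dvd 1" using F by (simp add: fps_unit_iff B_def reg_def)
  then obtain C where C: "B * C = 1" by (auto simp: dvd_def)
  define Q where "Q g = C * fps_shift n g" for g
  define R where "R g = Abs_fps (\<lambda>i. if i < n then fps_nth g i else 0)" for g :: "'a fps"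
  define N where "N g = - (A * Q g)" for g
  \<comment> \<open>\<open>B\<close> is the unit part of \<open>F\<close> from degree
    \<open>n\<close> on, so \<open>B * Q g\<close> is the part of \<open>g\<close> from degree
    \<open>n\<close> on. Replacing \<open>B * fps_X ^ n\<close> by \<open>F\<close> costs a multiple
    of \<open>\<pi>\<close>, which \<open>N\<close> records.\<close>
  have step: "g = Q g * F + R g + fps_const \<pi> * N g" for g
  proof -
    have "g = R g + fps_shift n g * fps_X ^ n"
      by (auto simp: fps_eq_iff R_def fps_X_power_mult_right_nth)
    also have "fps_shift n g = B * Q g" using C by (simp add: Q_def mult.assoc[symmetric])
    also have "B * Q g * fps_X ^ n = Q g * F - fps_const \<pi> * A * Q g"
      by (simp add: FB algebra_simps)
    finally show ?thesis by (simp add: N_def algebra_simps)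
  qed
  define g where "g k = (N ^^ k) f" for k
  have iter: "f = (\<Sum>k<m. fps_const (\<pi> ^ k) * Q (g k)) * F + (\<Sum>k<m. fps_const (\<pi> ^ k) * R (g k)) + fps_const (\<pi> ^ m) * g m" for m
  proof (induction m)
    case 0
    then show ?case by (simp add: g_def)
  next
    case (Suc m)
    have "fps_const (\<pi> ^ m) * g m = fps_const (\<pi> ^ m) * (Q (g m) * F + R (g m) + fps_const \<pi> * g (Suc m))"
      using step[of "g m"] by (simp add: g_def)
    also have "\<dots> = fps_const (\<pi> ^ m) * Q (g m) * F + fps_const (\<pi> ^ m) * R (g m) + fps_const (\<pi> ^ Suc m) * g (Suc m)"
      by (simp add: algebra_simps flip: fps_const_mult)
    finally show ?case using Suc.IH by (simp add: algebra_simps)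
  qed
  obtain q where q: "\<And>M. D M (q - (\<Sum>k<M. fps_const (\<pi> ^ k) * Q (g k)))" using fps_complete[of "\<lambda>k. Q (g k)"] by blast
  obtain r where r: "\<And>M. D M (r - (\<Sum>k<M. fps_const (\<pi> ^ k) * R (g k)))" using fps_complete[of "\<lambda>k. R (g k)"] by blast
  have "D M (f - q * F - r)" for M
  proof -
    have e: "f - q * F - r = fps_const (\<pi> ^ M) * g M - (q - (\<Sum>k<M. fps_const (\<pi> ^ k) * Q (g k))) * F
        - (r - (\<Sum>k<M. fps_const (\<pi> ^ k) * R (g k)))"
      by (subst iter[of M]) (simp add: algebra_simps)
    show ?thesis unfolding e by (rule D_diff[OF D_diff[OF D_const D_mult[OF q]] r])
  qed
  then have "f - q * F - r = 0" by (rule D_separated)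
  then have f: "f = q * F + r" by (simp add: algebra_simps)
  have "fps_nth r i = 0" if "i \<ge> n" for i
  proof (rule separated)
    fix M
    have "\<pi> ^ M dvd fps_nth (r - (\<Sum>k<M. fps_const (\<pi> ^ k) * R (g k))) i" using r[of M] by (auto simp: D_def)
    then show "\<pi> ^ M dvd fps_nth r i" using that by (simp add: fps_sum_nth R_def)
  qed
  then obtain p where "fps_of_poly p = r" "\<forall>i\<ge>n. coeff p i = 0"
    using fps_finite_poly[of n r] by metis
  then show ?thesis using f by metis
qed

text \<open>Divide the \<open>n\<close>-th power of the variable by \<open>F\<close>. Subtracting
  the remainder gives a distinguished polynomial, since \<open>F\<close> vanishes modulo
  \<open>\<pi>\<close> below degree \<open>n\<close>, and comparing the coefficients at
  \<open>n\<close> shows that the quotient is a unit.\<close>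

lemma weierstrass_preparation:
  assumes F: "reg n F"
  obtains u P where "F = u * fps_of_poly P" "u dvd 1" "dist P" "degree P = n"
proof -
  obtain q r where qr: "fps_X ^ n = q * F + fps_of_poly r" "\<forall>i\<ge>n. coeff r i = 0"
    using weierstrass_division[OF F] by blast
  have low: "\<pi> dvd fps_nth (q * F) i" if "i < n" for i
    unfolding fps_mult_nth using F that by (intro dvd_sum) (auto simp: reg_def)
  define P where "P = monom 1 n - r"
  have P: "fps_of_poly P = q * F" using qr(1) by (simp add: P_def fps_of_poly_diff fps_of_poly_monom)
  have cn: "coeff P n = 1" "\<And>i. i > n \<Longrightarrow> coeff P i = 0" using qr(2) by (auto simp: P_def)
  then have deg: "degree P = n" by (metis le_degree degree_le le_antisym one_neq_zero)
  have "\<pi> dvd coeff P i" if "i < n" for i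
    using low[OF that] P by (metis fps_of_poly_nth)
  then have dP: "dist P" using cn deg by (simp add: dist_def)
  have "q dvd 1"
  proof -
    have "1 = fps_nth (q * F) n" using cn P by (metis fps_of_poly_nth)
    also have "\<dots> = (\<Sum>i = 0..n. fps_nth q i * fps_nth F (n - i))" by (simp add: fps_mult_nth)
    also have "\<dots> = fps_nth q 0 * fps_nth F n + (\<Sum>i = Suc 0..n. fps_nth q i * fps_nth F (n - i))"
      by (simp add: sum.atLeast_Suc_atMost)
    finally have e: "1 = fps_nth q 0 * fps_nth F n + (\<Sum>i = Suc 0..n. fps_nth q i * fps_nth F (n - i))" .
    have "\<pi> dvd (\<Sum>i = Suc 0..n. fps_nth q i * fps_nth F (n - i))"
      using F by (intro dvd_sum) (auto simp: reg_def)
    then have "\<not> \<pi> dvd fps_nth q 0" using e pi_nonunit by (metis dvd_add dvd_mult2)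
    then show ?thesis using not_dvd_iff_unit fps_unit_iff by blast
  qed
  then obtain u where u: "q * u = 1" by (auto simp: dvd_def)
  have "F = (q * u) * F" using u by simp
  also have "\<dots> = u * fps_of_poly P" unfolding P by (simp only: ac_simps)
  finally have "F = u * fps_of_poly P" .
  moreover have "u dvd 1" using u by (metis dvd_triv_right)
  ultimately show ?thesis using that dP deg by blast
qed

end

section \<open>Evaluation of power series on the open unit disc\<close>

locale open_disc = complete_dvr \<pi> + \<iota>: inj_idom_hom \<iota>
  for \<pi> :: "'r::idom" and \<iota> :: "'r \<Rightarrow> 'l::alg_closed_field" +
  fixes v :: "'l \<Rightarrow> rat"
  assumes v_mult: "\<And>x y. x \<noteq> 0 \<Longrightarrow> y \<noteq> 0 \<Longrightarrow> v (x * y) = v x + v y"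
    and v_add: "\<And>x y. x \<noteq> 0 \<Longrightarrow> y \<noteq> 0 \<Longrightarrow> x + y \<noteq> 0 \<Longrightarrow> min (v x) (v y) \<le> v (x + y)"
    and v_nonneg: "\<And>c. c \<noteq> 0 \<Longrightarrow> v (\<iota> c) \<ge> 0" and v_pi: "v (\<iota> \<pi>) = 1"
    and algebraic: "\<And>y. \<exists>p. p \<noteq> 0 \<and> poly (map_poly \<iota> p) y = 0"
begin

sublocale pm: map_poly_inj_idom_hom \<iota> ..

text \<open>Treats 0 as having infinite valuation; the number \<open>v 0\<close> itself is
  arbitrary.\<close>

definition ge :: "rat \<Rightarrow> 'l \<Rightarrow> bool" where "ge t x \<longleftrightarrow> x = 0 \<or> v x \<ge> t"

abbreviation disc :: "'l \<Rightarrow> bool" where "disc y \<equiv> y = 0 \<or> v y > 0"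

lemma v_1 [simp]: "v 1 = 0"
  using v_mult[of 1 1] by simp

lemma v_minus1: "v (- 1) = 0"
  using v_mult[of "- 1" "- 1"] by simp

lemma v_uminus: "v (- x) = v x"
proof (cases "x = 0")
  case False
  then show ?thesis using v_mult[of "- 1" x] v_minus1 by simp
qed simp

lemma v_minus_commute: "v (x - y) = v (y - x)"
  using v_uminus[of "x - y"] by simp

lemma v_prod: "(\<And>i. i \<in> I \<Longrightarrow> f i \<noteq> 0) \<Longrightarrow> v (prod f I) = (\<Sum>i\<in>I. v (f i))"
proof (induction I rule: infinite_finite_induct)
  case (insert i I)
  then show ?case using v_mult[of "f i" "prod f I"] by (cases "finite I") (auto simp: prod_zero_iff)
qed auto

lemma v_power: "x \<noteq> 0 \<Longrightarrow> v (x ^ n) = of_nat n * v x"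
  by (induction n) (auto simp: v_mult algebra_simps)

lemma v_inverse: "x \<noteq> 0 \<Longrightarrow> v (inverse x) = - v x"
  using v_mult[of x "inverse x"] by simp

lemma v_divide: "x \<noteq> 0 \<Longrightarrow> y \<noteq> 0 \<Longrightarrow> v (x / y) = v x - v y"
  by (simp add: divide_inverse v_mult v_inverse)

lemma ge_0 [simp]: "ge t 0" by (simp add: ge_def)

lemma ge_add: "ge t x \<Longrightarrow> ge t y \<Longrightarrow> ge t (x + y)"
  using v_add[of x y] by (cases "x = 0 \<or> y = 0 \<or> x + y = 0") (auto simp: ge_def)

lemma ge_uminus [simp]: "ge t (- x) \<longleftrightarrow> ge t x"
  by (auto simp: ge_def v_uminus)

lemma ge_diff: "ge t x \<Longrightarrow> ge t y \<Longrightarrow> ge t (x - y)"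
  using ge_add[of t x "- y"] by simp

lemma ge_mult: "ge s x \<Longrightarrow> ge t y \<Longrightarrow> ge (s + t) (x * y)"
  using v_mult[of x y] by (cases "x = 0 \<or> y = 0") (auto simp: ge_def)

lemma ge_mult_int: "ge 0 x \<Longrightarrow> ge t y \<Longrightarrow> ge t (x * y)"
  using ge_mult[of 0 x t y] by simp

lemma ge_mono: "ge t x \<Longrightarrow> s \<le> t \<Longrightarrow> ge s x"
  by (auto simp: ge_def)

lemma ge_iota [simp]: "ge 0 (\<iota> c)"
  using v_nonneg[of c] by (cases "c = 0") (auto simp: ge_def)

lemma ge_1 [simp]: "ge 0 1" by (simp add: ge_def)

lemma ge_power: "ge 0 x \<Longrightarrow> ge 0 (x ^ n)"
  by (induction n) (auto intro: ge_mult_int)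

lemma ge_sum: "(\<And>i. i \<in> I \<Longrightarrow> ge t (f i)) \<Longrightarrow> ge t (sum f I)"
  by (induction I rule: infinite_finite_induct) (auto intro: ge_add)

lemma disc_ge: "disc y \<Longrightarrow> ge 0 y" by (auto simp: ge_def)

lemma v_eq_of_gt:
  assumes "x \<noteq> 0" "y = 0 \<or> v y > v x"
  shows "x + y \<noteq> 0" "v (x + y) = v x"
proof -
  show n: "x + y \<noteq> 0"
  proof
    assume "x + y = 0"
    then have "y = - x" by (simp add: eq_neg_iff_add_eq_0 add.commute)
    then show False using assms v_uminus[of x] by auto
  qed
  show "v (x + y) = v x"
  proof (cases "y = 0")
    case False
    then have "v (x + y) \<ge> v x" using v_add[of x y] assms n by auto
    moreover have "min (v (x + y)) (v (- y)) \<le> v x" using v_add[of "x + y" "- y"] n False assms by simp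
    ultimately show ?thesis using assms(2) False v_uminus[of y] by auto
  qed simp
qed

lemma v_unit: "c dvd 1 \<Longrightarrow> v (\<iota> c) = 0"
proof -
  assume "c dvd 1"
  then obtain d where d: "1 = c * d" by (auto simp: dvd_def)
  then have n: "c \<noteq> 0" "d \<noteq> 0" by auto
  have "\<iota> c * \<iota> d = 1" using d by (metis \<iota>.hom_mult \<iota>.hom_one)
  then have "v (\<iota> c) + v (\<iota> d) = 0" using n v_mult[of "\<iota> c" "\<iota> d"] by simp
  then show ?thesis using v_nonneg[of c] v_nonneg[of d] n by simp
qed

lemma v_dvd_pi: "\<pi> dvd c \<Longrightarrow> ge 1 (\<iota> c)"
proof -
  assume "\<pi> dvd c"
  then obtain d where "c = \<pi> * d" by (auto simp: dvd_def)
  then have "\<iota> c = \<iota> \<pi> * \<iota> d" by (simp add: \<iota>.hom_mult)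
  moreover have "ge 1 (\<iota> \<pi>)" by (simp add: ge_def v_pi)
  ultimately show ?thesis using ge_mult[of 1 "\<iota> \<pi>" 0 "\<iota> d"] by simp
qed

definition pe :: "'r poly \<Rightarrow> 'l \<Rightarrow> 'l" where "pe r y = poly (map_poly \<iota> r) y"

lemma pe_simps [simp]: "pe 0 y = 0" "pe 1 y = 1" "pe (p + q) y = pe p y + pe q y" "pe (p - q) y = pe p y - pe q y"
  "pe (p * q) y = pe p y * pe q y" "pe (pCons a p) y = \<iota> a + y * pe p y"
proof -
  have "map_poly \<iota> (pCons a p) = pCons (\<iota> a) (map_poly \<iota> p)"
    by (intro poly_eqI) (simp add: coeff_map_poly coeff_pCons split: nat.split)
  then show "pe (pCons a p) y = \<iota> a + y * pe p y" by (simp add: pe_def)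
qed (simp_all add: pe_def pm.hom_add pm.hom_mult pm.hom_minus)

lemma pe_sum: "pe r y = (\<Sum>i\<le>degree r. \<iota> (coeff r i) * y ^ i)"
  by (simp add: pe_def poly_altdef)

lemma pe_ge: "ge 0 y \<Longrightarrow> ge 0 (pe r y)"
  unfolding pe_sum by (intro ge_sum ge_mult_int ge_power) auto

text \<open>Weierstrass preparation of an algebraic equation of \<open>y\<close>: after removal of a
  power of \<open>\<pi>\<close> it is a distinguished polynomial times a polynomial whose constant
  term is a unit. The second factor cannot vanish at \<open>y\<close>, because its constant term
  dominates there.\<close>

lemma disc_root:
  assumes y: "disc y"
  shows "\<exists>P. dist P \<and> pe P y = 0"
proof -
  obtain p where p: "p \<noteq> 0" "pe p y = 0" using algebraic[of y] by (auto simp: pe_def)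
  then have "fps_of_poly p \<noteq> 0" by simp
  then obtain e g where g: "fps_of_poly p = fps_const (\<pi> ^ e) * g" "\<not> D 1 g" by (rule exact_power)
  have "fps_nth g i = 0" if "i \<ge> Suc (degree p)" for i
  proof -
    have "\<pi> ^ e * fps_nth g i = coeff p i" using g(1) by (metis fps_mult_left_const_nth fps_of_poly_nth)
    then show ?thesis using that pi0 by (simp add: coeff_eq_0)
  qed
  then obtain q where q: "fps_of_poly q = g" using fps_finite_poly[of "Suc (degree p)" g] by metis
  have "fps_of_poly p = fps_of_poly ([:\<pi> ^ e:] * q)" using g q by (simp add: fps_of_poly_smult)
  then have "p = [:\<pi> ^ e:] * q" by (simp only: fps_of_poly_eq_iff)
  then have "pe [:\<pi> ^ e:] y * pe q y = 0" using p(2) by (metis pe_simps(5))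
  then have qy: "pe q y = 0" using pi0 by (simp add: \<iota>.hom_power)
  obtain n where "reg n g" using reg_exists[OF g(2)] by blast
  then obtain u P where uP: "g = u * fps_of_poly P" "u dvd 1" "dist P" "degree P = n"
    by (rule weierstrass_preparation)
  then obtain S where S: "q = P * S" using dist_dvd_poly[of P u q] q by (auto simp: mult.commute)
  have "fps_of_poly P * u = fps_of_poly P * fps_of_poly S"
    using uP(1) q S by (metis fps_of_poly_mult mult.commute)
  moreover have "fps_of_poly P \<noteq> 0" using uP(3) by (auto simp: dist_def)
  ultimately have "u = fps_of_poly S" by simp
  then have S0: "coeff S 0 dvd 1" using uP(2) by (simp add: fps_unit_iff)
  obtain a S' where aS: "S = pCons a S'" by (cases S)
  have a: "a dvd 1" "a \<noteq> 0" using S0 aS by auto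
  have "\<iota> a + y * pe S' y \<noteq> 0"
  proof (rule v_eq_of_gt(1))
    show "\<iota> a \<noteq> 0" using a by simp
    show "y * pe S' y = 0 \<or> v (y * pe S' y) > v (\<iota> a)"
      using y v_unit[OF a(1)] pe_ge[OF disc_ge[OF y], of S'] v_mult[of y "pe S' y"]
      by (cases "y = 0 \<or> pe S' y = 0") (auto simp: ge_def)
  qed
  moreover have "pe q y = pe P y * pe S y" unfolding S by (rule pe_simps(5))
  moreover have "pe S y = \<iota> a + y * pe S' y" unfolding aS by (rule pe_simps(6))
  ultimately have "pe P y = 0" using qy by (metis mult_eq_0_iff)
  then show ?thesis using uP(3) by blast
qed

text \<open>Some distinguished polynomial with root \<open>y\<close>; despite the name no minimality
  is asked.\<close>

definition minP :: "'l \<Rightarrow> 'r poly" where "minP y = (SOME P. dist P \<and> pe P y = 0)"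

lemma minP: "disc y \<Longrightarrow> dist (minP y) \<and> pe (minP y) y = 0"
  unfolding minP_def by (rule someI_ex) (rule disc_root)

lemma dist_divide:
  assumes "dist P"
  obtains q r where "f = q * fps_of_poly P + fps_of_poly r"
  using weierstrass_division[OF dist_reg[OF assms], of f] by blast

text \<open>The field is not assumed to be complete, so limits of partial sums are not at hand. The
  value of a series is that of its remainder on Weierstrass division by a distinguished polynomial
  that vanishes at \<open>y\<close>.\<close>

definition ev :: "'l \<Rightarrow> 'r fps \<Rightarrow> 'l" where
  "ev y f = pe (SOME r. \<exists>q. f = q * fps_of_poly (minP y) + fps_of_poly r) y"

text \<open>After \<open>a\<close> is divided by \<open>Q\<close> and \<open>b\<close> by
  \<open>P\<close>, the combination is a multiple of \<open>P * Q\<close> plus polynomial multiples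
  of \<open>P\<close> and of \<open>Q\<close>. By \<open>dist_dvd_poly\<close> the first multiple is
  polynomial too, so everything vanishes at \<open>y\<close>.\<close>

lemma ev_unique:
  assumes P: "dist P" "pe P y = 0" and Q: "dist Q" "pe Q y = 0"
    and e: "fps_of_poly T = a * fps_of_poly P + b * fps_of_poly Q"
  shows "pe T y = 0"
proof -
  obtain a' s where a: "a = a' * fps_of_poly Q + fps_of_poly s" by (rule dist_divide[OF Q(1)])
  obtain b' t where b: "b = b' * fps_of_poly P + fps_of_poly t" by (rule dist_divide[OF P(1)])
  have "fps_of_poly (P * Q) * (a' + b') = fps_of_poly (T - s * P - t * Q)"
    using e by (simp add: a b fps_of_poly_mult fps_of_poly_diff algebra_simps)
  then obtain S where "T - s * P - t * Q = (P * Q) * S"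
    using dist_dvd_poly[OF dist_mult[OF P(1) Q(1)]] by blast
  then have "T = (P * Q) * S + s * P + t * Q" by (simp add: algebra_simps)
  then show ?thesis using P(2) Q(2) by simp
qed

text \<open>Frees the value from the choice of \<open>minP y\<close>: a product of several
  distinguished polynomials lets one remainder serve several points at once.\<close>

lemma ev_eqI:
  assumes y: "disc y" and P: "dist P" "pe P y = 0" and f: "f = q * fps_of_poly P + fps_of_poly r"
  shows "ev y f = pe r y"
proof -
  define r' where "r' = (SOME r. \<exists>q. f = q * fps_of_poly (minP y) + fps_of_poly r)"
  have "\<exists>r q. f = q * fps_of_poly (minP y) + fps_of_poly r"
    using dist_divide[of "minP y" f] minP[OF y] by metis
  then have "\<exists>q. f = q * fps_of_poly (minP y) + fps_of_poly r'" unfolding r'_def by (rule someI_ex)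
  then obtain q' where q': "f = q' * fps_of_poly (minP y) + fps_of_poly r'" by blast
  have "fps_of_poly (r' - r) = (- q') * fps_of_poly (minP y) + q * fps_of_poly P"
    using f q' by (simp add: fps_of_poly_diff algebra_simps)
  then have "pe (r' - r) y = 0" using ev_unique minP[OF y] P by blast
  then show ?thesis unfolding ev_def r'_def[symmetric] by simp
qed

lemma ev_poly: "disc y \<Longrightarrow> ev y (fps_of_poly r) = pe r y"
  using minP[of y] by (intro ev_eqI[of y "minP y" _ 0]) auto

lemma ev_add: "disc y \<Longrightarrow> ev y (f + g) = ev y f + ev y g"
  and ev_mult: "disc y \<Longrightarrow> ev y (f * g) = ev y f * ev y g"
proof -
  assume y: "disc y"
  let ?P = "minP y"
  have P: "dist ?P" "pe ?P y = 0" using minP[OF y] by auto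
  obtain q r where f: "f = q * fps_of_poly ?P + fps_of_poly r" by (rule dist_divide[OF P(1)])
  obtain s t where g: "g = s * fps_of_poly ?P + fps_of_poly t" by (rule dist_divide[OF P(1)])
  have "f + g = (q + s) * fps_of_poly ?P + fps_of_poly (r + t)"
    by (simp add: f g fps_of_poly_add algebra_simps)
  from ev_eqI[OF y P this] show "ev y (f + g) = ev y f + ev y g"
    using ev_eqI[OF y P f] ev_eqI[OF y P g] by simp
  have "f * g = (q * s * fps_of_poly ?P + q * fps_of_poly t + s * fps_of_poly r) * fps_of_poly ?P + fps_of_poly (r * t)"
    by (simp add: f g fps_of_poly_mult algebra_simps)
  from ev_eqI[OF y P this] show "ev y (f * g) = ev y f * ev y g"
    using ev_eqI[OF y P f] ev_eqI[OF y P g] by simp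
qed

lemma ev_const: "disc y \<Longrightarrow> ev y (fps_const c) = \<iota> c"
  using ev_poly[of y "[:c:]"] by (simp add: fps_of_poly_const)

lemma ev_X: "disc y \<Longrightarrow> ev y fps_X = y"
  using ev_poly[of y "[:0, 1:]"] by (simp add: fps_of_poly_fps_X)

lemma ev_1: "disc y \<Longrightarrow> ev y 1 = 1"
  using ev_const[of y 1] by simp

lemma ev_diff: "disc y \<Longrightarrow> ev y (f - g) = ev y f - ev y g"
  using ev_add[of y "f - g" g] by simp

lemma ev_ge: "disc y \<Longrightarrow> ge 0 (ev y f)"
  unfolding ev_def by (intro pe_ge disc_ge)

lemma ev_unit: "disc y \<Longrightarrow> u dvd 1 \<Longrightarrow> ev y u \<noteq> 0 \<and> v (ev y u) = 0"
proof -
  assume y: "disc y" and "u dvd 1"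
  then obtain w where "1 = u * w" by (auto simp: dvd_def)
  then have e: "ev y u * ev y w = 1" using ev_mult[OF y] ev_1[OF y] by metis
  then have n: "ev y u \<noteq> 0" "ev y w \<noteq> 0" by auto
  then have "v (ev y u) + v (ev y w) = 0" using v_mult e by (metis v_1)
  then show ?thesis using ev_ge[OF y, of u] ev_ge[OF y, of w] n by (auto simp: ge_def)
qed

lemma ev_disc:
  assumes y: "disc y" and f: "\<pi> dvd fps_nth f 0"
  shows "disc (ev y f)"
proof -
  have "f = fps_const (fps_nth f 0) + fps_X * fps_shift 1 f"
    by (simp add: fps_eq_iff fps_X_mult_nth) 
  then have e: "ev y f = \<iota> (fps_nth f 0) + y * ev y (fps_shift 1 f)"
    using ev_add[OF y] ev_mult[OF y] ev_const[OF y] ev_X[OF y] by metis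
  define t where "t = (if y = 0 then 1 else min 1 (v y))"
  have t: "t > 0" "t \<le> 1" "ge t y" using y by (auto simp: t_def ge_def)
  have "ge t (\<iota> (fps_nth f 0))" using v_dvd_pi[OF f] t(2) ge_mono by blast
  moreover have "ge t (y * ev y (fps_shift 1 f))" using ge_mult[OF t(3) ev_ge[OF y]] by simp
  ultimately have "ge t (ev y f)" unfolding e by (rule ge_add)
  then show ?thesis using t(1) by (auto simp: ge_def)
qed

text \<open>A first order Taylor expansion around \<open>b\<close> whose error is uniform in
  \<open>x\<close> and \<open>y\<close>. The last conjunct carries the induction over the
  coefficients.\<close>

lemma pe_difference:
  assumes "ge 0 b" "ge 0 x" "ge 0 y" "ge t (x - b)" "ge t (y - b)" "t \<ge> 0"
  shows "\<exists>e. ge t e \<and> pe r x - pe r y = (x - y) * (pe (pderiv r) b + e) \<and> ge t (pe r x - pe r b)"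
proof (induction r)
  case 0
  then show ?case by (intro exI[of _ 0]) simp
next
  case (pCons a r)
  then obtain e where e: "ge t e" "pe r x - pe r y = (x - y) * (pe (pderiv r) b + e)" "ge t (pe r x - pe r b)" by blast
  let ?e = "(pe r x - pe r b) + (y - b) * pe (pderiv r) b + y * e"
  have "pe (pCons a r) x - pe (pCons a r) y = (x - y) * pe r x + y * (pe r x - pe r y)"
    by (simp add: algebra_simps)
  also have "\<dots> = (x - y) * (pe (pderiv (pCons a r)) b + ?e)"
    unfolding e(2) by (simp add: pderiv_pCons algebra_simps)
  finally have 1: "pe (pCons a r) x - pe (pCons a r) y = (x - y) * (pe (pderiv (pCons a r)) b + ?e)" .
  have 2: "ge t ?e"
    using e ge_mult[OF assms(5) pe_ge[OF assms(1)]] ge_mult_int[OF assms(3) e(1)]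
    by (intro ge_add) simp_all
  have "pe (pCons a r) x - pe (pCons a r) b = x * (pe r x - pe r b) + (x - b) * pe r b"
    by (simp add: algebra_simps)
  then have 3: "ge t (pe (pCons a r) x - pe (pCons a r) b)"
    using ge_mult_int[OF assms(2) e(3)] ge_mult[OF assms(4) pe_ge[OF assms(1)]] ge_add by simp
  show ?case using 1 2 3 by blast
qed

lemma fps_deriv_of_poly: "fps_deriv (fps_of_poly p) = fps_of_poly (pderiv p)"
  by (simp add: fps_eq_iff coeff_pderiv)

lemma ev_difference:
  assumes b: "disc b" and x: "disc x" and y: "disc y"
    and t: "ge t (x - b)" "ge t (y - b)" "t \<ge> 0"
  shows "\<exists>e. ge t e \<and> ev x f - ev y f = (x - y) * (ev b (fps_deriv f) + e)"
proof -
  let ?P = "minP b * minP x * minP y"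
  have P: "dist ?P" "pe ?P b = 0" "pe ?P x = 0" "pe ?P y = 0"
    using minP[OF b] minP[OF x] minP[OF y] by (auto intro: dist_mult)
  \<comment> \<open>With the square, the derivative of the quotient part is still divisible by
    \<open>?P\<close> and vanishes at \<open>b\<close>, so that \<open>pderiv r\<close> computes the
    value of the derivative.\<close>
  have PP: "dist (?P * ?P)" "pe (?P * ?P) b = 0" "pe (?P * ?P) x = 0" "pe (?P * ?P) y = 0"
    using P by (auto intro: dist_mult)
  obtain q r where f: "f = q * fps_of_poly (?P * ?P) + fps_of_poly r" by (rule dist_divide[OF PP(1)])
  have "fps_deriv f = (fps_deriv q * fps_of_poly ?P + q * fps_of_poly (pderiv ?P) + q * fps_of_poly (pderiv ?P)) * fps_of_poly ?P + fps_of_poly (pderiv r)"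
    unfolding f by (simp only: fps_deriv_add fps_deriv_mult fps_of_poly_mult fps_deriv_of_poly[symmetric]) (simp add: algebra_simps)
  then have "ev b (fps_deriv f) = pe (pderiv r) b" by (rule ev_eqI[OF b P(1,2)])
  moreover have "ev x f = pe r x" "ev y f = pe r y"
    using ev_eqI[OF x PP(1,3) f] ev_eqI[OF y PP(1,4) f] by auto
  ultimately show ?thesis
    using pe_difference[OF disc_ge[OF b] disc_ge[OF x] disc_ge[OF y] t, of r] by auto
qed

lemma ev_lipschitz:
  assumes x: "disc x" and y: "disc y"
  shows "\<exists>e. ge 0 e \<and> ev x f - ev y f = (x - y) * e"
proof -
  obtain e where "ge 0 e" "ev x f - ev y f = (x - y) * (ev x (fps_deriv f) + e)"
    using ev_difference[OF x x y, of 0 f] disc_ge[OF x] disc_ge[OF y] ge_diff by auto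
  then show ?thesis using ge_add[OF ev_ge[OF x]] by blast
qed

end

section \<open>Cyclic groups and roots of unity\<close>

lemma (in group) cyclic_of_few_roots:
  assumes fin: "finite (carrier G)"
    and roots: "\<And>d. d > 0 \<Longrightarrow> card {x \<in> carrier G. x [^] (d::nat) = \<one>} \<le> d"
  shows "\<exists>x\<in>carrier G. ord x = card (carrier G)"
proof (rule ccontr)
  assume no: "\<not> ?thesis"
  let ?N = "card (carrier G)"
  have N0: "?N > 0" using fin one_closed by (metis card_gt_0_iff empty_iff)
  \<comment> \<open>The classical count: at most \<open>totient d\<close> elements have order
    \<open>d\<close>, and these bounds add up to just \<open>?N\<close>; without an element of order
    \<open>?N\<close> the sum would fall short.\<close>
  let ?E = "\<lambda>d. {x \<in> carrier G. ord x = d}"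
  have E: "card (?E d) \<le> totient d" if d: "d dvd ?N" for d
  proof (cases "?E d = {}")
    case False
    then obtain x where x: "x \<in> carrier G" "ord x = d" by blast
    have d0: "d > 0" using d N0 by (metis dvd_pos_nat)
    have inj: "inj_on (\<lambda>k. x [^] k) {0..d - 1}" using ord_inj[OF x(1)] x(2) by simp
    let ?S = "{x \<in> carrier G. x [^] d = \<one>}"
    have sub: "(\<lambda>k. x [^] k) ` {0..d - 1} \<subseteq> ?S"
    proof clarsimp
      fix k :: nat
      have "(x [^] k) [^] d = (x [^] d) [^] k" using x(1) by (simp add: nat_pow_pow mult.commute)
      then show "x [^] k \<in> carrier G \<and> (x [^] k) [^] d = \<one>" using x by (metis nat_pow_closed nat_pow_one pow_ord_eq_1)
    qed
    have "card ((\<lambda>k. x [^] k) ` {0..d - 1}) = d" using card_image[OF inj] d0 by simp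
    then have eq: "(\<lambda>k. x [^] k) ` {0..d - 1} = ?S"
      using card_subset_eq[OF _ sub] roots[OF d0] fin card_mono[OF _ sub] by simp
    have "?E d \<subseteq> (\<lambda>k. x [^] k) ` totatives d"
    proof
      fix y assume y: "y \<in> ?E d"
      then have "y [^] d = \<one>" using pow_ord_eq_1 by auto
      then have "y \<in> (\<lambda>k. x [^] k) ` {0..d - 1}" using eq y by blast
      then obtain k where k: "k \<le> d - 1" "y = x [^] k" by auto
      show "y \<in> (\<lambda>k. x [^] k) ` totatives d"
      proof (cases "k = 0")
        case True
        then have "y = \<one>" using k by simp
        then have "d = 1" using y ord_id by simp
        then show ?thesis using \<open>y = \<one>\<close> x ord_eq_1[OF x(1)] by (intro image_eqI[of _ _ 1]) auto
      next
        case False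
        have "d = d div gcd k d" using ord_pow_gen[OF x(1), of k] y k False x(2) by (simp add: gcd.commute)
        then have "gcd k d = 1" using d0 by (metis div_eq_dividend_iff gcd_pos_nat)
        then have "coprime k d" by (simp only: coprime_iff_gcd_eq_1)
        moreover have "0 < k" "k \<le> d" using False k(1) by linarith+
        ultimately have "k \<in> totatives d" by (simp only: totatives_def mem_Collect_eq greaterThanAtMost_iff simp_thms)
        then show ?thesis using k(2) by blast
      qed
    qed
    then have "card (?E d) \<le> card ((\<lambda>k. x [^] k) ` totatives d)" by (intro card_mono) auto
    also have "\<dots> \<le> totient d" unfolding totient_def by (rule card_image_le) simp
    finally show ?thesis .
  next
    case True
    then show ?thesis by (simp only: card.empty)
  qed
  have "carrier G = (\<Union>d\<in>{d. d dvd ?N}. ?E d)"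
    using ord_dvd_group_order by (auto simp: Coset.order_def)
  then have "?N = card (\<Union>d\<in>{d. d dvd ?N}. ?E d)" by simp
  also have "\<dots> = (\<Sum>d | d dvd ?N. card (?E d))"
    using fin N0 by (intro card_UN_disjoint) auto
  also have "\<dots> < (\<Sum>d | d dvd ?N. totient d)"
  proof (rule sum_strict_mono_ex1)
    show "finite {d. d dvd ?N}" using N0 by simp
    show "\<forall>d\<in>{d. d dvd ?N}. card (?E d) \<le> totient d" using E by blast
    have "?E ?N = {}" using no by blast
    then have "card (?E ?N) < totient ?N" using N0 by (simp only: card.empty totient_gt_0_iff)
    then show "\<exists>d\<in>{d. d dvd ?N}. card (?E d) < totient d"
      by (intro bexI[of _ ?N]) simp_all
  qed
  also have "\<dots> = ?N" by (rule totient_divisor_sum)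
  finally show False by simp
qed

text \<open>The difference of the two monic polynomials has lower degree but all of \<open>S\<close>
  among its roots.\<close>

lemma monic_eq_prod_roots:
  fixes Q :: "'a::field poly"
  assumes "lead_coeff Q = 1" "finite S" "card S = degree Q" "\<And>s. s \<in> S \<Longrightarrow> poly Q s = 0"
  shows "Q = (\<Prod>s\<in>S. [:- s, 1:])"
proof -
  let ?P = "\<Prod>s\<in>S. [:- s, 1:]"
  have degP: "degree ?P = card S" by (subst degree_prod_eq_sum_degree) auto
  have lcP: "lead_coeff ?P = 1" by (simp add: lead_coeff_prod)
  have "Q - ?P = 0"
  proof (rule ccontr)
    assume nz: "Q - ?P \<noteq> 0"
    have "card {x. poly (Q - ?P) x = 0} \<le> degree (Q - ?P)" by (rule card_poly_roots_bound[OF nz])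
    moreover have "S \<subseteq> {x. poly (Q - ?P) x = 0}"
      using assms(2,4) by (auto simp: poly_prod)
    then have "card S \<le> card {x. poly (Q - ?P) x = 0}"
      using poly_roots_finite[OF nz] by (intro card_mono)
    moreover have "degree (Q - ?P) < degree Q \<or> degree Q = 0"
    proof (cases "degree Q = 0")
      case False
      have "degree (Q - ?P) < degree Q"
      proof (rule degree_lessI)
        show "Q - ?P \<noteq> 0 \<or> 0 < degree Q" using False by simp
        have "coeff (Q - ?P) k = 0" if "k \<ge> degree Q" for k
          using assms(1,3) degP lcP that by (cases "k = degree Q") (simp_all add: coeff_eq_0)
        then show "\<forall>k\<ge>degree Q. coeff (Q - ?P) k = 0" by blast
      qed
      then show ?thesis by simp
    qed simp
    moreover have "degree Q \<noteq> 0"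
    proof
      assume "degree Q = 0"
      then have "Q = 1" "S = {}" using assms by (auto elim!: degree_eq_zeroE)
      then show False using nz by simp
    qed
    ultimately show False using assms(3) by simp
  qed
  then show ?thesis by simp
qed

text \<open>The nontrivial powers of \<open>\<zeta>\<close> are the roots of
  \<open>1 + X + ... + X ^ (N - 1)\<close>, which is evaluated at 1.\<close>

lemma prod_one_minus_roots:
  fixes \<zeta> :: "'a::field"
  assumes N: "N > 0" "\<zeta> ^ N = 1" "inj_on (\<lambda>k. \<zeta> ^ k) {..<N}"
  shows "(\<Prod>k\<in>{1..<N}. 1 - \<zeta> ^ k) = of_nat N"
proof -
  define Q :: "'a poly" where "Q = (\<Sum>k<N. monom 1 k)"
  have cQ: "coeff Q i = (if i < N then 1 else 0)" for i
    by (simp add: Q_def coeff_sum)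
  have deg: "degree Q = N - 1"
  proof (rule antisym)
    show "degree Q \<le> N - 1" using N(1) by (intro degree_le) (auto simp: cQ)
    show "N - 1 \<le> degree Q" using N(1) by (intro le_degree) (auto simp: cQ)
  qed
  have evQ: "poly Q x = (\<Sum>k<N. x ^ k)" for x by (simp add: Q_def poly_sum poly_monom)
  have inj: "inj_on (\<lambda>k. \<zeta> ^ k) {1..<N}" using N(3) by (rule inj_on_subset) auto
  have "Q = (\<Prod>s\<in>(\<lambda>k. \<zeta> ^ k) ` {1..<N}. [:- s, 1:])"
  proof (rule monic_eq_prod_roots)
    show "lead_coeff Q = 1" using N(1) by (simp add: deg cQ)
    show "card ((\<lambda>k. \<zeta> ^ k) ` {1..<N}) = degree Q" using card_image[OF inj] by (simp add: deg)
    fix s assume "s \<in> (\<lambda>k. \<zeta> ^ k) ` {1..<N}"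
    then obtain k where k: "1 \<le> k" "k < N" "s = \<zeta> ^ k" by auto
    have "s \<noteq> 1"
    proof
      assume "s = 1"
      then have "\<zeta> ^ k = \<zeta> ^ 0" using k by simp
      then show False using inj_onD[OF N(3), of k 0] k by simp
    qed
    moreover have "s ^ N = 1" using k(3) N(2) by (metis mult.commute power_mult power_one)
    then have "(s - 1) * (\<Sum>k<N. s ^ k) = 0" by (simp add: power_diff_1_eq[symmetric])
    ultimately show "poly Q s = 0" by (simp add: evQ)
  qed simp
  then have "poly Q 1 = (\<Prod>s\<in>(\<lambda>k. \<zeta> ^ k) ` {1..<N}. 1 - s)" by (simp add: poly_prod)
  also have "\<dots> = (\<Prod>k\<in>{1..<N}. 1 - \<zeta> ^ k)" by (subst prod.reindex[OF inj]) simp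
  finally show ?thesis by (simp add: evQ)
qed

context open_disc
begin

text \<open>\<open>1 - \<zeta>\<close> divides \<open>1 - \<zeta> ^ k\<close>, with an integral
  quotient.\<close>

lemma v_one_minus_power:
  assumes "ge 0 \<zeta>" "\<zeta> ^ k \<noteq> 1"
  shows "v (1 - \<zeta>) \<le> v (1 - \<zeta> ^ k)"
proof -
  have e: "1 - \<zeta> ^ k = (1 - \<zeta>) * (\<Sum>i<k. \<zeta> ^ i)" by (rule one_diff_power_eq)
  have n: "1 - \<zeta> \<noteq> 0" "(\<Sum>i<k. \<zeta> ^ i) \<noteq> 0" using e assms(2) by auto
  moreover have "ge 0 (\<Sum>i<k. \<zeta> ^ i)" using assms(1) by (intro ge_sum ge_power)
  ultimately show ?thesis using e v_mult[OF n] by (simp add: ge_def)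
qed

lemma ge_root_of_unity: "N > 0 \<Longrightarrow> \<zeta> ^ N = 1 \<Longrightarrow> ge 0 \<zeta>"
proof -
  assume N: "N > 0" "\<zeta> ^ N = 1"
  then have "\<zeta> \<noteq> 0" by (auto simp: power_0_left)
  then have "of_nat N * v \<zeta> = 0" using v_power[of \<zeta> N] N by simp
  then show ?thesis using N by (simp add: ge_def)
qed

text \<open>The second equation is the valuation of \<open>prod_one_minus_roots\<close>. Subtracting
  the same equation for \<open>\<zeta> ^ p\<close> leaves the exponents prime to \<open>p\<close>,
  and for these \<open>1 - \<zeta> ^ k\<close> and \<open>1 - \<zeta>\<close> divide each
  other.\<close>

lemma v_primitive_root:
  assumes p: "prime p" and nz: "\<And>n. n > 0 \<Longrightarrow> of_nat n \<noteq> (0::'l)"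
    and z: "\<zeta> ^ (p ^ j) = 1" "inj_on (\<lambda>k. \<zeta> ^ k) {..<p ^ j}"
  shows "j > 0 \<Longrightarrow> of_nat (p ^ (j - 1) * (p - 1)) * v (1 - \<zeta>) = v (of_nat p)"
    and "(\<Sum>k\<in>{1..<p ^ j}. v (1 - \<zeta> ^ k)) = of_nat j * v (of_nat p)"
proof -
  have main: "(\<Sum>k\<in>{1..<p ^ j}. v (1 - \<zeta> ^ k)) = of_nat j * v (of_nat p)"
    if z: "\<zeta> ^ (p ^ j) = 1" "inj_on (\<lambda>k. \<zeta> ^ k) {..<p ^ j}" for \<zeta> j
  proof -
    have N: "p ^ j > 0" using p by (simp add: prime_gt_0_nat)
    have "1 - \<zeta> ^ k \<noteq> 0" if "k \<in> {1..<p ^ j}" for k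
      using inj_onD[OF z(2), of k 0] that N by auto
    then have "(\<Sum>k\<in>{1..<p ^ j}. v (1 - \<zeta> ^ k)) = v (\<Prod>k\<in>{1..<p ^ j}. 1 - \<zeta> ^ k)"
      by (subst v_prod) auto
    also have "\<dots> = v (of_nat p ^ j)" using prod_one_minus_roots[OF N z] by simp
    also have "\<dots> = of_nat j * v (of_nat p)" using nz[of p] p by (intro v_power) (auto simp: prime_gt_0_nat)
    finally show ?thesis .
  qed
  show "(\<Sum>k\<in>{1..<p ^ j}. v (1 - \<zeta> ^ k)) = of_nat j * v (of_nat p)" by (rule main[OF z])
  assume j: "j > 0"
  then obtain i where i: "j = Suc i" by (cases j) auto
  have N: "p ^ j > 0" using p by (simp add: prime_gt_0_nat)
  have g0: "ge 0 \<zeta>" using ge_root_of_unity[OF N z(1)] .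
  have p1: "p > 1" using p prime_gt_1_nat by blast
  \<comment> \<open>\<open>?A\<close> holds the exponents that belong to powers of
    \<open>\<zeta> ^ p\<close>, a root of unity of order \<open>p ^ i\<close>.\<close>
  let ?A = "(\<lambda>k. p * k) ` {1..<p ^ i}" and ?B = "{k \<in> {1..<p ^ j}. coprime k p}"
  have AB: "{1..<p ^ j} = ?A \<union> ?B" "?A \<inter> ?B = {}"
  proof -
    have "k \<in> ?A" if k: "k \<in> {1..<p ^ j}" "\<not> coprime k p" for k
    proof -
      have "p dvd k" using k(2) p by (metis coprime_commute prime_imp_coprime_nat)
      then obtain l where "k = p * l" by (auto simp: dvd_def)
      then show ?thesis using k p1 by (auto simp: i)
    qed
    moreover have "k \<in> {1..<p ^ j} \<and> \<not> coprime k p" if "k \<in> ?A" for k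
    proof -
      obtain l where l': "k = p * l" "l \<in> {1..<p ^ i}" using \<open>k \<in> ?A\<close> by blast
      then have l: "k = p * l" "1 \<le> l" "l < p ^ i" by simp_all
      have "\<not> coprime k p" using l(1) p1 by simp
      moreover have "1 \<le> k" "k < p ^ j" using l p1 by (auto simp: i)
      ultimately show ?thesis by simp
    qed
    ultimately show "{1..<p ^ j} = ?A \<union> ?B" "?A \<inter> ?B = {}" by blast+
  qed
  have zp: "(\<zeta> ^ p) ^ (p ^ i) = 1" "inj_on (\<lambda>k. (\<zeta> ^ p) ^ k) {..<p ^ i}"
  proof -
    show "(\<zeta> ^ p) ^ (p ^ i) = 1" using z(1) i by (simp add: power_mult)
    show "inj_on (\<lambda>k. (\<zeta> ^ p) ^ k) {..<p ^ i}"
    proof (rule inj_onI)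
      fix a b assume ab: "a \<in> {..<p ^ i}" "b \<in> {..<p ^ i}" "(\<zeta> ^ p) ^ a = (\<zeta> ^ p) ^ b"
      then have "\<zeta> ^ (p * a) = \<zeta> ^ (p * b)" by (simp add: power_mult)
      moreover have "p * a < p ^ j" "p * b < p ^ j" using ab p1 i by simp_all
      ultimately have "p * a = p * b" using inj_onD[OF z(2), of "p * a" "p * b"] by simp
      then show "a = b" using p1 by simp
    qed
  qed
  have injA: "inj_on (\<lambda>k. p * k) {1..<p ^ i}" using p1 by (auto simp: inj_on_def)
  have sA: "(\<Sum>k\<in>?A. v (1 - \<zeta> ^ k)) = of_nat i * v (of_nat p)"
    using main[OF zp] by (subst sum.reindex[OF injA]) (simp add: power_mult)
  \<comment> \<open>Modulo \<open>p ^ j\<close> the exponent \<open>k\<close> is invertible, so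
    \<open>\<zeta>\<close> is in turn a power of \<open>\<zeta> ^ k\<close>.\<close>
  have eq: "v (1 - \<zeta> ^ k) = v (1 - \<zeta>)" if k: "k \<in> ?B" for k
  proof -
    have nk: "\<zeta> ^ k \<noteq> 1" using inj_onD[OF z(2), of k 0] k N by auto
    have "coprime k (p ^ j)" using k by simp
    then obtain l where "[k * l = Suc 0] (mod p ^ j)" using cong_solve_coprime_nat by metis
    moreover have p1j: "(1::nat) < p ^ j" using p1 j by (rule one_less_power)
    ultimately have "k * l mod p ^ j = 1" unfolding cong_def using mod_less[OF p1j] by simp
    then have c: "k * l = 1 + p ^ j * (k * l div p ^ j)" by (metis mod_mult_div_eq)
    have "(\<zeta> ^ k) ^ l = \<zeta> ^ (1 + p ^ j * (k * l div p ^ j))" by (subst c[symmetric]) (rule power_mult[symmetric])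
    also have "\<dots> = \<zeta>" using z(1) by (simp only: power_add power_one_right power_mult power_one mult_1_right)
    finally have zk: "(\<zeta> ^ k) ^ l = \<zeta>" .
    have n1: "\<zeta> \<noteq> 1" using nk by auto
    have "v (1 - \<zeta> ^ k) \<le> v (1 - (\<zeta> ^ k) ^ l)"
      using zk n1 ge_power[OF g0] by (intro v_one_minus_power) auto
    then show ?thesis using v_one_minus_power[OF g0 nk] zk by simp
  qed
  have "card {1..<p ^ j} = card ?A + card ?B"
    using AB(2) by (subst AB(1), subst card_Un_disjoint) auto
  then have cB: "card ?B = p ^ i * (p - 1)"
  proof -
    have q: "p ^ i > 0" "p * p ^ i > 0" using p1 by simp_all
    have "card ?A = p ^ i - 1" using card_image[OF injA] by simp
    moreover have "card {1..<p ^ j} = p * p ^ i - 1" by (simp add: i)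
    ultimately have "p * p ^ i - 1 = (p ^ i - 1) + card ?B"
      using \<open>card {1..<p ^ j} = card ?A + card ?B\<close> by (simp only:)
    then have "card ?B = p * p ^ i - p ^ i" using q by linarith
    then show ?thesis by (simp add: diff_mult_distrib2 mult.commute)
  qed
  have "(\<Sum>k\<in>?A. v (1 - \<zeta> ^ k)) + (\<Sum>k\<in>?B. v (1 - \<zeta> ^ k)) = (\<Sum>k\<in>{1..<p ^ j}. v (1 - \<zeta> ^ k))"
    using AB(2) by (subst AB(1), subst sum.union_disjoint) auto
  then have "of_nat i * v (of_nat p) + of_nat (card ?B) * v (1 - \<zeta>) = of_nat j * v (of_nat p)"
    using main[OF z] sA eq by simp
  then have "of_nat (p ^ i * (p - 1)) * v (1 - \<zeta>) = of_nat j * v (of_nat p) - of_nat i * v (of_nat p)"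
    unfolding cB by linarith
  then show "of_nat (p ^ (j - 1) * (p - 1)) * v (1 - \<zeta>) = v (of_nat p)"
    by (simp add: i algebra_simps)
qed

text \<open>If \<open>1 - \<eta>\<close> had positive valuation, so would \<open>l\<close>, which is
  the sum of the \<open>1 - \<eta> ^ k\<close>; but \<open>p\<close> has positive valuation too, and
  a Bezout relation between \<open>l\<close> and \<open>p\<close> would carry this over to
  1.\<close>

lemma v_prime_to_p_root:
  assumes l: "\<eta> ^ l = 1" "\<eta> \<noteq> 1" "l > 0" "coprime l p" and p: "v (of_nat p) > 0" "of_nat p \<noteq> (0::'l)"
    and nz: "\<And>n. n > 0 \<Longrightarrow> of_nat n \<noteq> (0::'l)"
  shows "v (1 - \<eta>) = 0"
proof (rule ccontr)
  assume n: "v (1 - \<eta>) \<noteq> 0"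
  have g0: "ge 0 \<eta>" using ge_root_of_unity[OF l(3,1)] .
  have ge: "ge 0 (1 - \<eta>)" using g0 by (intro ge_diff) auto
  define t where "t = min (v (1 - \<eta>)) (v (of_nat p :: 'l))"
  have t: "t > 0" using n ge l(2) p by (auto simp: t_def ge_def)
  have nat0: "ge 0 (of_nat k :: 'l)" for k
    by (induction k) (auto intro: ge_add)
  have "(1 - \<eta>) * (\<Sum>k<l. \<eta> ^ k) = 0" using one_diff_power_eq[of \<eta> l] l(1) by simp
  then have s: "(\<Sum>k<l. \<eta> ^ k) = 0" using l(2) by simp
  have "of_nat l = (\<Sum>k<l. 1 - \<eta> ^ k)" by (simp add: sum_subtractf s)
  moreover have "ge t (\<Sum>k<l. 1 - \<eta> ^ k)"
  proof (rule ge_sum)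
    fix k
    have "1 - \<eta> ^ k = (\<Sum>i<k. \<eta> ^ i) * (1 - \<eta>)" by (simp add: one_diff_power_eq mult.commute)
    moreover have "ge t (1 - \<eta>)" by (simp add: ge_def t_def)
    ultimately show "ge t (1 - \<eta> ^ k)" using g0 by (simp only:) (intro ge_mult_int ge_sum ge_power)
  qed
  ultimately have gl: "ge t (of_nat l)" by simp
  have gp: "ge t (of_nat p :: 'l)" by (simp add: ge_def t_def)
  obtain a b where ab: "int l * a + int p * b = 1"
    using l(4) by (metis bezout_int coprime_imp_gcd_eq_1 coprime_int_iff mult.commute)
  have "(of_nat l * of_int a + of_nat p * of_int b :: 'l) = of_int (int l * a + int p * b)" by simp
  also have "\<dots> = 1" using ab by simp
  finally have e: "of_int a * of_nat l + of_int b * of_nat p = (1::'l)" by (simp add: mult.commute)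
  have int0: "ge 0 (of_int a :: 'l)" for a
    using nat0[of "nat a"] nat0[of "nat (- a)"] by (cases "a \<ge> 0") (auto simp: of_nat_nat)
  have "ge t (1::'l)"
    unfolding e[symmetric] by (intro ge_add ge_mult_int int0 gl gp)
  then show False using t by (simp add: ge_def)
qed

end

section \<open>Finite group actions on the open unit disc\<close>

text \<open>\<open>F \<sigma>\<close> is the series that \<open>\<sigma>\<close> assigns to the
  coordinate. \<open>F_red\<close> keeps the reduced action faithful, and \<open>residues\<close>
  says that the constants avoid any finite set of residue classes, which will produce generic
  points.\<close>

locale disc_action = open_disc \<pi> \<iota> v + G: group G
  for \<pi> :: "'r::idom" and \<iota> :: "'r \<Rightarrow> 'l::alg_closed_field" and v and G :: "('g, 'm) monoid_scheme" (structure) +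
  fixes F :: "'g \<Rightarrow> 'r fps"
  assumes fin: "finite (carrier G)"
    and F_0: "\<And>\<sigma>. \<sigma> \<in> carrier G \<Longrightarrow> \<pi> dvd fps_nth (F \<sigma>) 0"
    and F_one: "F \<one> = fps_X"
    and F_mult: "\<And>\<sigma> \<tau> y. \<sigma> \<in> carrier G \<Longrightarrow> \<tau> \<in> carrier G \<Longrightarrow> disc y \<Longrightarrow> ev y (F (\<sigma> \<otimes> \<tau>)) = ev (ev y (F \<sigma>)) (F \<tau>)"
    and F_red: "\<And>\<sigma>. \<sigma> \<in> carrier G \<Longrightarrow> \<sigma> \<noteq> \<one> \<Longrightarrow> \<not> D 1 (F \<sigma> - fps_X)"
    and of_nat_nz: "\<And>n. n > 0 \<Longrightarrow> of_nat n \<noteq> (0::'l)"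
    and residues: "\<And>Z. finite Z \<Longrightarrow> (\<And>z. z \<in> Z \<Longrightarrow> ge 0 z) \<Longrightarrow> \<exists>a. \<forall>z\<in>Z. \<iota> a - z \<noteq> 0 \<and> v (\<iota> a - z) = 0"
begin

definition act :: "'g \<Rightarrow> 'l \<Rightarrow> 'l" where "act \<sigma> y = ev y (F (inv \<sigma>))"

lemma act_disc: "\<sigma> \<in> carrier G \<Longrightarrow> disc y \<Longrightarrow> disc (act \<sigma> y)"
  unfolding act_def by (intro ev_disc F_0) auto

lemma act_one: "disc y \<Longrightarrow> act \<one> y = y"
  by (simp add: act_def F_one ev_X)

lemma act_mult: "\<sigma> \<in> carrier G \<Longrightarrow> \<tau> \<in> carrier G \<Longrightarrow> disc y \<Longrightarrow> act (\<sigma> \<otimes> \<tau>) y = act \<sigma> (act \<tau> y)"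
  by (simp add: act_def G.inv_mult_group F_mult)

lemma act_inv: "\<sigma> \<in> carrier G \<Longrightarrow> disc y \<Longrightarrow> act (inv \<sigma>) (act \<sigma> y) = y"
  using act_mult[of "inv \<sigma>" \<sigma> y] act_one by simp

lemma act_inv': "\<sigma> \<in> carrier G \<Longrightarrow> disc y \<Longrightarrow> act \<sigma> (act (inv \<sigma>) y) = y"
  using act_mult[of \<sigma> "inv \<sigma>" y] act_one by simp

lemma ge_act:
  assumes s: "\<sigma> \<in> carrier G" and x: "disc x" and y: "disc y" and t: "ge t (x - y)"
  shows "ge t (act \<sigma> x - act \<sigma> y)"
proof -
  obtain e where "ge 0 e" "ev x (F (inv \<sigma>)) - ev y (F (inv \<sigma>)) = (x - y) * e"
    using ev_lipschitz[OF x y] by blast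
  then show ?thesis unfolding act_def using ge_mult[OF t, of 0 e] by simp
qed

lemma act_eq_iff:
  "\<sigma> \<in> carrier G \<Longrightarrow> disc x \<Longrightarrow> disc y \<Longrightarrow> act \<sigma> x = act \<sigma> y \<longleftrightarrow> x = y"
  by (metis act_inv)

lemma v_act:
  assumes s: "\<sigma> \<in> carrier G" and x: "disc x" and y: "disc y" and n: "x \<noteq> y"
  shows "v (act \<sigma> x - act \<sigma> y) = v (x - y)"
proof -
  have n': "act \<sigma> x - act \<sigma> y \<noteq> 0" using act_eq_iff[OF s x y] n by simp
  have "ge (v (x - y)) (act \<sigma> x - act \<sigma> y)"
    by (rule ge_act[OF s x y]) (simp add: ge_def)
  moreover have "ge (v (act \<sigma> x - act \<sigma> y)) (act (inv \<sigma>) (act \<sigma> x) - act (inv \<sigma>) (act \<sigma> y))"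
    by (rule ge_act[OF G.inv_closed[OF s] act_disc[OF s x] act_disc[OF s y]]) (simp add: ge_def)
  then have "ge (v (act \<sigma> x - act \<sigma> y)) (x - y)" by (simp only: act_inv[OF s x] act_inv[OF s y])
  moreover have "x - y \<noteq> 0" using n by simp
  ultimately show ?thesis using n' unfolding ge_def by (metis order_antisym)
qed

definition Fix :: "'g \<Rightarrow> 'l set" where "Fix \<sigma> = {y. disc y \<and> act \<sigma> y = y}"

lemma Fix_disc: "y \<in> Fix \<sigma> \<Longrightarrow> disc y" by (simp add: Fix_def)

lemma Fix_inv: "\<sigma> \<in> carrier G \<Longrightarrow> Fix (inv \<sigma>) = Fix \<sigma>"
  unfolding Fix_def using act_inv act_inv' by (metis (no_types, lifting))

text \<open>The fixed points are the zeros in the disc of the series minus the coordinate. The unit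
  factor of this difference has none there, and every root of its distinguished factor lies in the
  disc.\<close>

lemma preparation:
  assumes s: "\<sigma> \<in> carrier G" "\<sigma> \<noteq> \<one>" and N: "reg N (F (inv \<sigma>) - fps_X)"
  obtains u P where "F (inv \<sigma>) - fps_X = u * fps_of_poly P" "u dvd 1" "dist P" "degree P = N"
    "Fix \<sigma> = {y. pe P y = 0}" "finite (Fix \<sigma>)"
proof -
  obtain u P where uP: "F (inv \<sigma>) - fps_X = u * fps_of_poly P" "u dvd 1" "dist P" "degree P = N"
    by (rule weierstrass_preparation[OF N])
  have e: "act \<sigma> y - y = ev y u * pe P y" if y: "disc y" for y
  proof -
    have "act \<sigma> y - y = ev y (F (inv \<sigma>) - fps_X)" using y by (simp add: act_def ev_diff ev_X)
    also have "\<dots> = ev y u * pe P y" unfolding uP(1) using y by (simp add: ev_mult ev_poly)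
    finally show ?thesis .
  qed
  \<comment> \<open>If \<open>v y \<le> 0\<close>, the leading power of \<open>y\<close> strictly
    dominates, as all other coefficients are divisible by \<open>\<pi>\<close>.\<close>
  have rd: "disc y" if "pe P y = 0" for y
  proof (rule ccontr)
    assume nd: "\<not> disc y"
    then have y0: "y \<noteq> 0" "v y \<le> 0" by auto
    let ?n = "degree P"
    have "pe P y = y ^ ?n + (\<Sum>i<?n. \<iota> (coeff P i) * y ^ i)"
      using uP(3) by (simp add: pe_sum dist_def lessThan_Suc_atMost[symmetric] add.commute)
    moreover have "(\<Sum>i<?n. \<iota> (coeff P i) * y ^ i) = 0 \<or> v (\<Sum>i<?n. \<iota> (coeff P i) * y ^ i) > v (y ^ ?n)"
    proof -
      have "ge (1 + v (y ^ ?n)) (\<Sum>i<?n. \<iota> (coeff P i) * y ^ i)"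
      proof (rule ge_sum)
        fix i assume i: "i \<in> {..<?n}"
        have "v (y ^ ?n) \<le> v (y ^ i)"
          using i y0 by (auto simp: v_power intro: mult_right_mono_neg)
        then have "ge (v (y ^ ?n)) (y ^ i)" by (simp add: ge_def)
        moreover have "ge 1 (\<iota> (coeff P i))" using uP(3) i by (intro v_dvd_pi) (auto simp: dist_def)
        ultimately show "ge (1 + v (y ^ ?n)) (\<iota> (coeff P i) * y ^ i)" using ge_mult by blast
      qed
      then show ?thesis by (auto simp: ge_def)
    qed
    ultimately show False using v_eq_of_gt(1)[of "y ^ ?n" "\<Sum>i<?n. \<iota> (coeff P i) * y ^ i"] y0 that by simp
  qed
  have F: "Fix \<sigma> = {y. pe P y = 0}"
  proof (rule Set.set_eqI)
    fix y show "y \<in> Fix \<sigma> \<longleftrightarrow> y \<in> {y. pe P y = 0}"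
      using e[of y] rd[of y] ev_unit[OF _ uP(2), of y] by (auto simp: Fix_def)
  qed
  have "map_poly \<iota> P \<noteq> 0" using uP(3) by (auto simp: dist_def)
  then have "finite (Fix \<sigma>)" unfolding F pe_def by (rule poly_roots_finite)
  then show ?thesis using that uP F by blast
qed

lemma reg_ex: "\<sigma> \<in> carrier G \<Longrightarrow> \<sigma> \<noteq> \<one> \<Longrightarrow> \<exists>N. reg N (F (inv \<sigma>) - fps_X)"
  using reg_exists F_red[of "inv \<sigma>"] by (simp add: G.inv_eq_1_iff)

lemma finite_Fix: "\<sigma> \<in> carrier G \<Longrightarrow> \<sigma> \<noteq> \<one> \<Longrightarrow> finite (Fix \<sigma>)"
  using reg_ex preparation by metis

lemma ge_all: "(\<And>n. ge (of_nat n) x) \<Longrightarrow> x = 0"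
proof (rule ccontr)
  assume g: "\<And>n. ge (of_nat n) x" and x: "x \<noteq> 0"
  obtain n :: nat where "v x < of_nat n" using reals_Archimedean2 by blast
  then show False using g[of n] x by (simp add: ge_def)
qed

text \<open>At a fixed point \<open>b\<close> this is the multiplier, the derivative of the action
  on the tangent line.\<close>

definition lam :: "'g \<Rightarrow> 'l \<Rightarrow> 'l" where "lam \<sigma> b = ev b (fps_deriv (F (inv \<sigma>)))"

lemma act_difference:
  assumes "disc b" "disc x" "disc y" "ge t (x - b)" "ge t (y - b)" "t \<ge> 0"
  shows "\<exists>e. ge t e \<and> act \<sigma> x - act \<sigma> y = (x - y) * (lam \<sigma> b + e)"
  unfolding act_def lam_def by (rule ev_difference[OF assms])

lemma v_pi_power: "v (\<iota> \<pi> ^ n) = of_nat n" "\<iota> \<pi> ^ n \<noteq> 0"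
  using v_power[of "\<iota> \<pi>" n] v_pi pi0 by auto

lemma disc_add_pi: "disc b \<Longrightarrow> n > 0 \<Longrightarrow> disc (b + \<iota> \<pi> ^ n)"
proof -
  assume b: "disc b" and n: "n > 0"
  define t where "t = (if b = 0 then 1 else min 1 (v b))"
  have "t > 0" "ge t b" using b by (auto simp: t_def ge_def)
  moreover have "ge t (\<iota> \<pi> ^ n)" using n v_pi_power by (auto simp: ge_def t_def min_le_iff_disj)
  ultimately have "ge t (b + \<iota> \<pi> ^ n)" "t > 0" using ge_add by auto
  then show ?thesis by (auto simp: ge_def)
qed

text \<open>The chain rule at a common fixed point, obtained from difference quotients at
  \<open>b + \<iota> \<pi> ^ Suc n\<close>: the two sides agree up to arbitrarily high
  valuation.\<close>

lemma lam_mult: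
  assumes s: "\<sigma> \<in> carrier G" "\<tau> \<in> carrier G" and b: "b \<in> Fix \<sigma>" "b \<in> Fix \<tau>"
  shows "lam (\<sigma> \<otimes> \<tau>) b = lam \<sigma> b * lam \<tau> b"
proof -
  have d: "disc b" using b Fix_disc by blast
  have fx: "act \<sigma> b = b" "act \<tau> b = b" "act (\<sigma> \<otimes> \<tau>) b = b" using b act_mult[OF s d] by (auto simp: Fix_def)
  have g0: "ge 0 (lam \<sigma> b)" for \<sigma> unfolding lam_def by (rule ev_ge[OF d])
  have "ge (of_nat n) (lam (\<sigma> \<otimes> \<tau>) b - lam \<sigma> b * lam \<tau> b)" for n
  proof -
    let ?t = "\<iota> \<pi> ^ Suc n" and ?n = "of_nat (Suc n) :: rat"
    have t: "?t \<noteq> 0" "ge ?n ?t" using v_pi_power[of "Suc n"] by (auto simp: ge_def simp del: of_nat_Suc power_Suc)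
    define x where "x = b + ?t"
    have x: "disc x" "ge ?n (x - b)" using disc_add_pi[OF d, of "Suc n"] t by (simp_all add: x_def del: of_nat_Suc power_Suc)
    have n0: "?n \<ge> 0" by simp
    have bb: "ge ?n (b - b)" by simp
    obtain e1 where e1: "ge ?n e1" "act \<tau> x - b = ?t * (lam \<tau> b + e1)"
      using act_difference[OF d x(1) d x(2) bb n0, of \<tau>] fx by (auto simp: x_def)
    have x': "disc (act \<tau> x)" "ge ?n (act \<tau> x - b)"
      using act_disc[OF s(2) x(1)] ge_act[OF s(2) x(1) d x(2)] fx by auto
    obtain e2 where e2: "ge ?n e2" "act \<sigma> (act \<tau> x) - b = (act \<tau> x - b) * (lam \<sigma> b + e2)"
      using act_difference[OF d x'(1) d x'(2) bb n0, of \<sigma>] fx by auto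
    obtain e3 where e3: "ge ?n e3" "act (\<sigma> \<otimes> \<tau>) x - b = ?t * (lam (\<sigma> \<otimes> \<tau>) b + e3)"
      using act_difference[OF d x(1) d x(2) bb n0, of "\<sigma> \<otimes> \<tau>"] fx by (auto simp: x_def)
    have "?t * (lam (\<sigma> \<otimes> \<tau>) b + e3) = ?t * ((lam \<tau> b + e1) * (lam \<sigma> b + e2))"
      by (simp only: e3(2)[symmetric] act_mult[OF s x(1)] e2(2) e1(2) mult.assoc)
    then have "lam (\<sigma> \<otimes> \<tau>) b + e3 = (lam \<tau> b + e1) * (lam \<sigma> b + e2)" using t(1) by (metis mult_left_cancel)
    then have "lam (\<sigma> \<otimes> \<tau>) b - lam \<sigma> b * lam \<tau> b = lam \<tau> b * e2 + lam \<sigma> b * e1 + e1 * e2 - e3"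
      by (simp add: algebra_simps)
    moreover have "ge ?n (lam \<tau> b * e2 + lam \<sigma> b * e1 + e1 * e2 - e3)"
      using ge_mult_int[OF g0 e2(1)] ge_mult_int[OF g0 e1(1)] ge_mult_int[OF ge_mono[OF e1(1) n0] e2(1)] e3(1)
      by (intro ge_diff ge_add)
    ultimately show ?thesis using ge_mono[of ?n _ "of_nat n"] by simp
  qed
  then show ?thesis using ge_all by fastforce
qed

lemma lam_one: "disc b \<Longrightarrow> lam \<one> b = 1"
  by (simp add: lam_def F_one ev_1)

lemma act_pow: "\<sigma> \<in> carrier G \<Longrightarrow> disc y \<Longrightarrow> act (\<sigma> [^] Suc k) y = act \<sigma> (act (\<sigma> [^] k) y)"
  by (subst G.nat_pow_Suc2) (auto simp: act_mult)

text \<open>With multiplier 1, all steps in the orbit of a point near \<open>b\<close> agree with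
  the first step up to a factor close to 1. After \<open>n = card (carrier G)\<close> steps they add
  up to 0, so \<open>n\<close> would have at least the valuation of the distance from the point to
  \<open>b\<close>, which can be made as large as desired. In characteristic 0 this is
  impossible.\<close>

lemma lam_neq_1:
  assumes s: "\<sigma> \<in> carrier G" "\<sigma> \<noteq> \<one>" and b: "b \<in> Fix \<sigma>"
  shows "lam \<sigma> b \<noteq> 1"
proof
  assume l1: "lam \<sigma> b = 1"
  have d: "disc b" and fx: "act \<sigma> b = b" using b by (auto simp: Fix_def)
  define n where "n = card (carrier G)"
  have n: "n > 0" "\<sigma> [^] n = \<one>" using fin G.pow_order_eq_1[OF s(1)] G.one_closed by (auto simp: n_def Coset.order_def card_gt_0_iff)
  obtain m0 :: nat where m0: "v (of_nat n) < of_nat m0" using reals_Archimedean2 by blast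
  have "infinite ((\<lambda>m. b + \<iota> \<pi> ^ m) ` {Suc m0..})"
  proof -
    have "inj_on (\<lambda>m. b + \<iota> \<pi> ^ m) {Suc m0..}"
    proof (rule inj_onI)
      fix i j assume "b + \<iota> \<pi> ^ i = b + \<iota> \<pi> ^ j"
      then have "v (\<iota> \<pi> ^ i) = v (\<iota> \<pi> ^ j)" by simp
      then show "i = j" using v_pi_power(1) by simp
    qed
    then show ?thesis using finite_imageD infinite_Ici by blast
  qed
  \<comment> \<open>Infinitely many of these points lie close to \<open>b\<close> and
    \<open>\<sigma>\<close> fixes only finitely many points; the bound on \<open>m\<close> exceeds
    the valuation of \<open>n\<close>.\<close>
  then obtain m where m: "m \<ge> Suc m0" "b + \<iota> \<pi> ^ m \<notin> Fix \<sigma>"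
    using finite_Fix[OF s] by (metis (no_types, lifting) atLeast_iff finite_subset image_subset_iff)
  let ?t = "of_nat m :: rat"
  define y where "y = b + \<iota> \<pi> ^ m"
  have y: "disc y" "y \<notin> Fix \<sigma>" "ge ?t (y - b)"
    using disc_add_pi[OF d, of m] m v_pi_power[of m] by (auto simp: y_def ge_def)
  define z where "z k = act (\<sigma> [^] k) y" for k :: nat
  have z: "z 0 = y" "\<And>k. z (Suc k) = act \<sigma> (z k)" "\<And>k. disc (z k)" "z n = y"
    using y(1) s(1) n(2) act_one act_pow act_disc by (auto simp: z_def)
  have zb: "ge ?t (z k - b)" for k
  proof (induction k)
    case (Suc k)
    then show ?case using ge_act[OF s(1) z(3) d Suc.IH] z(2) fx by simp
  qed (use y z in simp)
  define w where "w = z 1 - z 0"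
  have w: "w \<noteq> 0" using y(1,2) z by (auto simp: w_def Fix_def)
  have step: "\<exists>e. ge ?t e \<and> z (Suc k) - z k = w * (1 + e)" for k
  proof (induction k)
    case 0
    then show ?case by (intro exI[of _ 0]) (simp add: w_def)
  next
    case (Suc k)
    then obtain e where e: "ge ?t e" "z (Suc k) - z k = w * (1 + e)" by blast
    obtain e' where e': "ge ?t e'" "act \<sigma> (z (Suc k)) - act \<sigma> (z k) = (z (Suc k) - z k) * (lam \<sigma> b + e')"
      using act_difference[OF d z(3) z(3) zb zb, of \<sigma>] by auto
    have "z (Suc (Suc k)) - z (Suc k) = w * (1 + (e + e' + e * e'))"
      using e'(2) e(2) l1 z(2) by (simp add: algebra_simps)
    moreover have "ge ?t (e + e' + e * e')"
      using e(1) e'(1) ge_mult_int[OF ge_mono[OF e(1)], of ?t e'] by (intro ge_add) auto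
    ultimately show ?case by blast
  qed
  then obtain e where e: "\<And>k. ge ?t (e k)" "\<And>k. z (Suc k) - z k = w * (1 + e k)" by metis
  have "(\<Sum>k<n. z (Suc k) - z k) = z n - z 0" by (rule sum_lessThan_telescope)
  moreover have "(\<Sum>k<n. z (Suc k) - z k) = w * (\<Sum>k<n. 1 + e k)" by (simp only: e(2) sum_distrib_left)
  ultimately have "w * (\<Sum>k<n. 1 + e k) = 0" using z(1,4) by simp
  then have "(\<Sum>k<n. 1 + e k) = 0" using w by simp
  then have "of_nat n = - (\<Sum>k<n. e k)" by (simp add: sum.distrib eq_neg_iff_add_eq_0)
  moreover have "ge ?t (\<Sum>k<n. e k)" using e(1) by (intro ge_sum)
  ultimately have "ge ?t (of_nat n :: 'l)" by simp
  then have "v (of_nat n) \<ge> ?t" using of_nat_nz[OF n(1)] by (simp add: ge_def)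
  moreover have "(of_nat m0 :: rat) < ?t" using m(1) by simp
  ultimately show False using m0 by simp
qed

text \<open>The displacement is a unit times the product of the \<open>y - b\<close> over the roots
  of the distinguished polynomial. A double root would make the multiplier 1, so the roots are
  distinct and their number is the degree \<open>N\<close>, the order of the reduction.\<close>

lemma fixed_point_formula:
  assumes s: "\<sigma> \<in> carrier G" "\<sigma> \<noteq> \<one>" and N: "reg N (F (inv \<sigma>) - fps_X)"
  shows "card (Fix \<sigma>) = N"
    and "disc y \<Longrightarrow> y \<notin> Fix \<sigma> \<Longrightarrow> v (act \<sigma> y - y) = (\<Sum>b\<in>Fix \<sigma>. v (y - b))"
    and "b \<in> Fix \<sigma> \<Longrightarrow> v (lam \<sigma> b - 1) = (\<Sum>b'\<in>Fix \<sigma> - {b}. v (b - b'))"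
proof -
  obtain u P where uP: "F (inv \<sigma>) - fps_X = u * fps_of_poly P" "u dvd 1" "dist P" "degree P = N"
    "Fix \<sigma> = {y. pe P y = 0}" "finite (Fix \<sigma>)" by (rule preparation[OF s N])
  let ?P = "map_poly \<iota> P"
  have lc: "lead_coeff ?P = 1" "degree ?P = N" using uP(3,4) by (auto simp: dist_def)
  have der: "lam \<sigma> b - 1 = ev b u * poly (pderiv ?P) b" if b: "b \<in> Fix \<sigma>" for b
  proof -
    have d: "disc b" using b Fix_disc by blast
    have Pb: "pe P b = 0" using b uP(5) by simp
    have "lam \<sigma> b - 1 = ev b (fps_deriv (F (inv \<sigma>) - fps_X))" using d by (simp add: lam_def ev_diff ev_1)
    also have "\<dots> = ev b u * pe (pderiv P) b"
      unfolding uP(1) using d Pb by (simp add: ev_add ev_mult ev_poly fps_deriv_of_poly)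
    finally show ?thesis by (simp add: pe_def \<iota>.map_poly_pderiv)
  qed
  obtain A where A: "size A = degree ?P" "?P = smult (lead_coeff ?P) (\<Prod>x\<in>#A. [:- x, 1:])"
    using alg_closed_imp_factorization[of ?P] lc by fastforce
  have A': "?P = (\<Prod>x\<in>#A. [:- x, 1:])" using A(2) by (simp only: lc(1) smult_1_left)
  have cnt: "count A x \<le> 1" for x
  proof (rule ccontr)
    assume "\<not> count A x \<le> 1"
    then have "count A x \<ge> 2" by simp
    then have "{#x, x#} \<subseteq># A" by (auto simp: subseteq_mset_def)
    then obtain A1 where "A = {#x, x#} + A1" by (metis subset_mset.le_iff_add)
    then have e: "?P = [:- x, 1:] * ([:- x, 1:] * (\<Prod>x\<in>#A1. [:- x, 1:]))" using A' by simp
    then have "poly ?P x = 0" by simp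
    then have xF: "x \<in> Fix \<sigma>" using uP(5) by (simp add: pe_def)
    have "poly (pderiv ?P) x = 0" unfolding e by (simp add: pderiv_mult del: mult_pCons_left)
    then show False using der[OF xF] lam_neq_1[OF s xF] by simp
  qed
  have FA: "Fix \<sigma> = set_mset A"
    unfolding uP(5) pe_def A' by (auto simp: poly_prod_mset prod_mset_zero_iff)
  have "A = mset_set (set_mset A)"
  proof (rule multiset_eqI)
    fix x show "count A x = count (mset_set (set_mset A)) x"
    proof (cases "x \<in># A")
      case True
      then have "count A x \<ge> 1" by (simp add: Suc_le_eq)
      then have "count A x = 1" using cnt[of x] by linarith
      then show ?thesis using True by simp
    next
      case False
      then show ?thesis by (simp add: not_in_iff)
    qed
  qed
  then have AF: "A = mset_set (Fix \<sigma>)" using FA by simp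
  then show "card (Fix \<sigma>) = N" using A(1) lc(2) by (metis size_mset_set)
  have PF: "?P = (\<Prod>x\<in>Fix \<sigma>. [:- x, 1:])" using A' AF by (simp add: prod_unfold_prod_mset)
  show "v (act \<sigma> y - y) = (\<Sum>b\<in>Fix \<sigma>. v (y - b))" if y: "disc y" "y \<notin> Fix \<sigma>"
  proof -
    have "act \<sigma> y - y = ev y (F (inv \<sigma>) - fps_X)" using y by (simp add: act_def ev_diff ev_X)
    also have "\<dots> = ev y u * (\<Prod>b\<in>Fix \<sigma>. y - b)"
      unfolding uP(1) using y by (simp add: ev_mult ev_poly pe_def PF poly_prod)
    finally have e: "act \<sigma> y - y = ev y u * (\<Prod>b\<in>Fix \<sigma>. y - b)" .
    have nz: "y - b \<noteq> 0" if "b \<in> Fix \<sigma>" for b using that y(2) by auto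
    then have "(\<Prod>b\<in>Fix \<sigma>. y - b) \<noteq> 0" using uP(6) by simp
    then show ?thesis unfolding e using ev_unit[OF y(1) uP(2)] v_prod[of "Fix \<sigma>" "\<lambda>b. y - b"] nz
      by (subst v_mult) auto
  qed
  show "v (lam \<sigma> b - 1) = (\<Sum>b'\<in>Fix \<sigma> - {b}. v (b - b'))" if b: "b \<in> Fix \<sigma>"
  proof -
    have d: "disc b" using b Fix_disc by blast
    have "?P = [:- b, 1:] * (\<Prod>x\<in>Fix \<sigma> - {b}. [:- x, 1:])"
      unfolding PF using uP(6) b by (rule prod.remove)
    then have "poly (pderiv ?P) b = (\<Prod>x\<in>Fix \<sigma> - {b}. b - x)"
      by (simp add: pderiv_mult poly_prod pderiv_pCons del: mult_pCons_left)
    then have e: "lam \<sigma> b - 1 = ev b u * (\<Prod>x\<in>Fix \<sigma> - {b}. b - x)" using der[OF b] by simp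
    have "(\<Prod>x\<in>Fix \<sigma> - {b}. b - x) \<noteq> 0" using uP(6) by simp
    then show ?thesis unfolding e using ev_unit[OF d uP(2)] v_prod[of "Fix \<sigma> - {b}" "\<lambda>x. b - x"]
      by (subst v_mult) auto
  qed
qed

end

section \<open>Generic points and the filtration by displacement\<close>

context disc_action
begin

definition B :: "'l set" where "B = (\<Union>\<sigma>\<in>carrier G - {\<one>}. Fix \<sigma>)"

lemma B_disc: "b \<in> B \<Longrightarrow> disc b"
  using Fix_disc by (auto simp: B_def)

lemma finite_B: "finite B"
  unfolding B_def using fin finite_Fix by auto

lemma Fix_B: "\<sigma> \<in> carrier G \<Longrightarrow> \<sigma> \<noteq> \<one> \<Longrightarrow> Fix \<sigma> = {b \<in> B. act \<sigma> b = b}"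
  using B_disc by (auto simp: Fix_def B_def)

lemma act_B: "\<tau> \<in> carrier G \<Longrightarrow> b \<in> B \<Longrightarrow> act \<tau> b \<in> B"
proof -
  assume t: "\<tau> \<in> carrier G" and b: "b \<in> B"
  then obtain \<sigma> where s: "\<sigma> \<in> carrier G" "\<sigma> \<noteq> \<one>" "b \<in> Fix \<sigma>" by (auto simp: B_def)
  have d: "disc b" using b B_disc by blast
  have sb: "act \<sigma> b = b" using s(3) by (simp add: Fix_def)
  let ?c = "\<tau> \<otimes> \<sigma> \<otimes> inv \<tau>"
  have c1: "?c \<noteq> \<one>"
  proof
    assume c: "?c = \<one>"
    have "\<sigma> = inv \<tau> \<otimes> ?c \<otimes> \<tau>" using s t by (simp add: G.m_assoc) (simp add: G.m_assoc[symmetric])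
    then show False using s t c by simp
  qed
  have "act ?c (act \<tau> b) = act \<tau> (act \<sigma> (act (inv \<tau>) (act \<tau> b)))"
    using s t act_disc[OF t d] by (simp add: act_mult act_disc)
  also have "\<dots> = act \<tau> b" using sb act_inv[OF t d] by simp
  finally have "act \<tau> b \<in> Fix ?c" using act_disc[OF t d] by (simp add: Fix_def)
  then show ?thesis using c1 s t by (auto simp: B_def)
qed

definition cap :: "rat \<Rightarrow> 'l \<Rightarrow> rat" where "cap \<rho> x = (if x = 0 then \<rho> else min \<rho> (v x))"

lemma cap_cong: "ge \<rho> (x - y) \<Longrightarrow> cap \<rho> x = cap \<rho> y"
proof -
  have *: "cap \<rho> x \<le> cap \<rho> y" if g: "ge \<rho> (x - y)" for x y
  proof -
    have "ge (cap \<rho> x) x" by (auto simp: ge_def cap_def)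
    moreover have "ge (cap \<rho> x) (x - y)" using g by (rule ge_mono) (auto simp: cap_def)
    ultimately have "ge (cap \<rho> x) (x - (x - y))" by (rule ge_diff)
    then show ?thesis by (auto simp: ge_def cap_def)
  qed
  assume g: "ge \<rho> (x - y)"
  have "ge \<rho> (y - x)" using g ge_uminus[of \<rho> "x - y"] by simp
  then show ?thesis using *[OF g] *[of y x] by simp
qed

text \<open>The point \<open>y\<close> is as far from every element of \<open>B\<close> as the disc
  allows, so it imitates the Gauss norm of the disc at an actual point.\<close>

definition generic :: "'l \<Rightarrow> rat \<Rightarrow> 'l \<Rightarrow> bool" where
  "generic b \<rho> y \<longleftrightarrow> disc y \<and> ge \<rho> (y - b) \<and> (\<forall>x\<in>B. y \<noteq> x \<and> v (y - x) = cap \<rho> (b - x))"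

text \<open>A generic point of the disc of radius \<open>\<rho> = v (b - c)\<close> around \<open>b\<close> is \<open>b + (c - b) a\<close> where the residue class
  of \<open>a\<close> differs from those of finitely many points.\<close>

lemma generic_exists:
  assumes b: "b \<in> B" and c: "c \<in> B" "c \<noteq> b"
  shows "\<exists>y. generic b (v (b - c)) y"
proof -
  let ?\<rho> = "v (b - c)"
  have cb: "c - b \<noteq> 0" "v (c - b) = ?\<rho>" using c v_minus_commute by auto
  have db: "disc b" "disc c" using b c B_disc by auto
  have \<rho>0: "?\<rho> > 0"
  proof -
    define t where "t = min (if b = 0 then 1 else v b) (if c = 0 then 1 else v c)"
    have "t > 0" "ge t b" "ge t c" using db by (auto simp: t_def ge_def)
    then have "ge t (b - c)" "t > 0" using ge_diff by auto
    then show ?thesis using c by (auto simp: ge_def)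
  qed
  define Z where "Z = (\<lambda>x. (x - b) / (c - b)) ` {x \<in> B. ge ?\<rho> (b - x)}"
  have "finite Z" unfolding Z_def using finite_B by auto
  moreover have "ge 0 z" if "z \<in> Z" for z
  proof -
    obtain x where x: "ge ?\<rho> (b - x)" "z = (x - b) / (c - b)" using \<open>z \<in> Z\<close> by (auto simp: Z_def)
    have "ge ?\<rho> (x - b)" using x(1) ge_uminus[of _ "b - x"] by simp
    then show ?thesis using x(2) cb v_divide[of "x - b" "c - b"] by (cases "x = b") (auto simp: ge_def)
  qed
  ultimately obtain a where a: "\<And>z. z \<in> Z \<Longrightarrow> \<iota> a - z \<noteq> 0 \<and> v (\<iota> a - z) = 0" using residues by metis
  define y where "y = b + (c - b) * \<iota> a"
  have gy: "ge ?\<rho> (y - b)"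
  proof -
    have "ge ?\<rho> (c - b)" using cb by (simp add: ge_def)
    then show ?thesis using ge_mult[of ?\<rho> "c - b" 0 "\<iota> a"] by (simp add: y_def)
  qed
  have dy: "disc y"
  proof -
    define t where "t = min ?\<rho> (if b = 0 then ?\<rho> else v b)"
    have "ge t b" "ge t (y - b)" "t > 0" using db \<rho>0 ge_mono[OF gy] by (auto simp: t_def ge_def)
    then have "ge t (b + (y - b))" "t > 0" using ge_add by blast+
    then show ?thesis by (auto simp: ge_def)
  qed
  have "y \<noteq> x \<and> v (y - x) = cap ?\<rho> (b - x)" if x: "x \<in> B" for x
  proof (cases "ge ?\<rho> (b - x)")
    case True
    then have "(x - b) / (c - b) \<in> Z" using x by (auto simp: Z_def)
    then have ax: "\<iota> a - (x - b) / (c - b) \<noteq> 0" "v (\<iota> a - (x - b) / (c - b)) = 0" using a by auto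
    have "(c - b) * ((x - b) / (c - b)) = x - b" using cb(1) by simp
    then have e: "y - x = (c - b) * (\<iota> a - (x - b) / (c - b))"
      by (simp only: y_def right_diff_distrib[of "c - b" "\<iota> a"]) simp
    have "y - x \<noteq> 0" unfolding e using cb ax by simp
    moreover have "v (y - x) = ?\<rho>" unfolding e using cb ax v_mult by simp
    moreover have "cap ?\<rho> (b - x) = ?\<rho>" using True by (auto simp: cap_def ge_def)
    ultimately show ?thesis by auto
  next
    case False
    then have bx: "b - x \<noteq> 0" "v (b - x) < ?\<rho>" by (auto simp: ge_def)
    have g: "y - b = 0 \<or> v (y - b) > v (b - x)" using gy bx(2) by (auto simp: ge_def)
    have e: "b - x + (y - b) = y - x" by simp
    have "y - x \<noteq> 0" "v (y - x) = v (b - x)" using v_eq_of_gt[OF bx(1) g] unfolding e by blast+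
    then show ?thesis using bx by (auto simp: cap_def)
  qed
  then show ?thesis using dy gy by (auto simp: generic_def)
qed

text \<open>\<open>\<sigma>\<close> permutes \<open>B\<close>, preserves distances and moves the
  centre \<open>b\<close> only within the disc, so the truncated distances are unchanged.\<close>

lemma generic_act:
  assumes y: "generic b \<rho> y" and s: "\<sigma> \<in> carrier G" and b: "b \<in> B" and sb: "ge \<rho> (act \<sigma> b - b)"
  shows "generic b \<rho> (act \<sigma> y)"
proof -
  have dy: "disc y" and db: "disc b" using y b B_disc by (auto simp: generic_def)
  have "ge \<rho> (act \<sigma> y - act \<sigma> b)" using y by (intro ge_act[OF s dy db]) (auto simp: generic_def)
  then have "ge \<rho> ((act \<sigma> y - act \<sigma> b) + (act \<sigma> b - b))" using sb by (rule ge_add)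
  then have 1: "ge \<rho> (act \<sigma> y - b)" by simp
  have "act \<sigma> y \<noteq> x \<and> v (act \<sigma> y - x) = cap \<rho> (b - x)" if x: "x \<in> B" for x
  proof -
    define x' where "x' = act (inv \<sigma>) x"
    have x': "x' \<in> B" "disc x'" "act \<sigma> x' = x" using act_B[of "inv \<sigma>" x] s x B_disc act_inv'[OF s] by (auto simp: x'_def)
    have yx: "y \<noteq> x'" "v (y - x') = cap \<rho> (b - x')" using y x'(1) by (auto simp: generic_def)
    have "act \<sigma> y \<noteq> x" using yx(1) act_eq_iff[OF s dy x'(2)] x'(3) by auto
    moreover have "v (act \<sigma> y - x) = cap \<rho> (b - x')" using v_act[OF s dy x'(2) yx(1)] yx(2) x'(3) by simp
    moreover have "cap \<rho> (b - x') = cap \<rho> (act \<sigma> b - x)"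
      using v_act[OF s db x'(2)] act_eq_iff[OF s db x'(2)] x'(3) by (auto simp: cap_def)
    moreover have "cap \<rho> (act \<sigma> b - x) = cap \<rho> (b - x)" using sb by (intro cap_cong) simp
    ultimately show ?thesis by simp
  qed
  then show ?thesis using 1 act_disc[OF s dy] by (auto simp: generic_def)
qed

definition m :: "'l \<Rightarrow> rat \<Rightarrow> 'g \<Rightarrow> rat" where
  "m b \<rho> \<sigma> = (\<Sum>x\<in>Fix \<sigma>. cap \<rho> (b - x)) - \<rho>"

lemma m_generic:
  assumes s: "\<sigma> \<in> carrier G" "\<sigma> \<noteq> \<one>" and y: "generic b \<rho> y"
  shows "act \<sigma> y \<noteq> y" "v (act \<sigma> y - y) = m b \<rho> \<sigma> + \<rho>"
proof -
  obtain N where N: "reg N (F (inv \<sigma>) - fps_X)" using reg_ex[OF s] by blast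
  have dy: "disc y" and ny: "y \<notin> Fix \<sigma>" using y Fix_B[OF s] by (auto simp: generic_def)
  then show "act \<sigma> y \<noteq> y" by (simp add: Fix_def)
  have "v (act \<sigma> y - y) = (\<Sum>x\<in>Fix \<sigma>. v (y - x))" by (rule fixed_point_formula(2)[OF s N dy ny])
  also have "\<dots> = (\<Sum>x\<in>Fix \<sigma>. cap \<rho> (b - x))"
    using y Fix_B[OF s] by (intro sum.cong) (auto simp: generic_def)
  finally show "v (act \<sigma> y - y) = m b \<rho> \<sigma> + \<rho>" by (simp add: m_def)
qed

text \<open>A generic point and its image both lie in the disc, so the valuation of the displacement
  is at least the radius.\<close>

lemma m_nonneg:
  assumes b: "b \<in> B" "c \<in> B" "c \<noteq> b" and s: "\<sigma> \<in> carrier G" "\<sigma> \<noteq> \<one>" and sb: "ge (v (b - c)) (act \<sigma> b - b)"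
  shows "m b (v (b - c)) \<sigma> \<ge> 0"
proof -
  obtain y where y: "generic b (v (b - c)) y" using generic_exists[OF b] by blast
  have "generic b (v (b - c)) (act \<sigma> y)" by (rule generic_act[OF y s(1) b(1) sb])
  then have "ge (v (b - c)) ((act \<sigma> y - b) - (y - b))" using y by - (rule ge_diff, auto simp: generic_def)
  then have "ge (v (b - c)) (act \<sigma> y - y)" by simp
  then show ?thesis using m_generic[OF s y] by (auto simp: ge_def)
qed

text \<open>The displacement of \<open>y\<close> under the product is the displacement of
  \<open>act \<tau> y\<close> under \<open>\<sigma>\<close> plus that of \<open>y\<close> under
  \<open>\<tau>\<close>, and \<open>act \<tau> y\<close> is generic again.\<close>

lemma m_mult:
  assumes b: "b \<in> B" "c \<in> B" "c \<noteq> b" and s: "\<sigma> \<in> carrier G" "\<sigma> \<noteq> \<one>" "\<tau> \<in> carrier G" "\<tau> \<noteq> \<one>" "\<sigma> \<otimes> \<tau> \<noteq> \<one>"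
    and tb: "ge (v (b - c)) (act \<tau> b - b)"
  shows "min (m b (v (b - c)) \<sigma>) (m b (v (b - c)) \<tau>) \<le> m b (v (b - c)) (\<sigma> \<otimes> \<tau>)"
proof -
  let ?\<rho> = "v (b - c)"
  obtain y where y: "generic b ?\<rho> y" using generic_exists[OF b] by blast
  have dy: "disc y" using y by (simp add: generic_def)
  have ty: "generic b ?\<rho> (act \<tau> y)" by (rule generic_act[OF y s(3) b(1) tb])
  have "ge (min (m b ?\<rho> \<sigma>) (m b ?\<rho> \<tau>) + ?\<rho>) ((act \<sigma> (act \<tau> y) - act \<tau> y) + (act \<tau> y - y))"
  proof (rule ge_add)
    show "ge (min (m b ?\<rho> \<sigma>) (m b ?\<rho> \<tau>) + ?\<rho>) (act \<sigma> (act \<tau> y) - act \<tau> y)"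
      using m_generic[OF s(1,2) ty] by (auto simp: ge_def)
    show "ge (min (m b ?\<rho> \<sigma>) (m b ?\<rho> \<tau>) + ?\<rho>) (act \<tau> y - y)"
      using m_generic[OF s(3,4) y] by (auto simp: ge_def)
  qed
  then have "ge (min (m b ?\<rho> \<sigma>) (m b ?\<rho> \<tau>) + ?\<rho>) (act (\<sigma> \<otimes> \<tau>) y - y)"
    using act_mult[OF s(1,3) dy] by simp
  then show ?thesis using m_generic[OF _ s(5) y] s by (auto simp: ge_def)
qed

text \<open>At a point \<open>x\<close> of the disc the untruncated valuations are at least the
  truncated ones, so the displacement of \<open>x\<close> has at least the generic valuation
  \<open>m b \<rho> \<sigma> + \<rho>\<close>.\<close>

lemma m_pos:
  assumes b: "b \<in> B" and x: "x \<in> B" "ge \<rho> (b - x)" and s: "\<sigma> \<in> carrier G" "\<sigma> \<noteq> \<one>" and pos: "m b \<rho> \<sigma> > 0" and n: "act \<sigma> x \<noteq> x"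
  shows "v (act \<sigma> x - x) > \<rho>"
proof -
  obtain N where N: "reg N (F (inv \<sigma>) - fps_X)" using reg_ex[OF s] by blast
  have dx: "disc x" using x B_disc by blast
  have nx: "x \<notin> Fix \<sigma>" using n by (simp add: Fix_def)
  have "m b \<rho> \<sigma> + \<rho> = (\<Sum>y\<in>Fix \<sigma>. cap \<rho> (b - y))" by (simp add: m_def)
  also have "\<dots> \<le> (\<Sum>y\<in>Fix \<sigma>. v (x - y))"
  proof (rule sum_mono)
    fix y assume y: "y \<in> Fix \<sigma>"
    have "cap \<rho> (b - y) = cap \<rho> (x - y)" using x(2) by (intro cap_cong) simp
    also have "\<dots> \<le> v (x - y)" using y nx by (auto simp: cap_def)
    finally show "cap \<rho> (b - y) \<le> v (x - y)" .
  qed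
  also have "\<dots> = v (act \<sigma> x - x)" by (rule fixed_point_formula(2)[OF s N dx nx, symmetric])
  finally show ?thesis using pos by simp
qed

definition Stab :: "'l \<Rightarrow> 'g set" where "Stab b = {\<sigma> \<in> carrier G. act \<sigma> b = b}"

lemma Stab_subgroup: "b \<in> B \<Longrightarrow> subgroup (Stab b) G"
proof (rule G.subgroupI)
  assume b: "b \<in> B"
  then have d: "disc b" using B_disc by blast
  show "Stab b \<subseteq> carrier G" by (auto simp: Stab_def)
  show "Stab b \<noteq> {}" using act_one[OF d] by (auto simp: Stab_def)
  fix \<sigma> assume s: "\<sigma> \<in> Stab b"
  then show "inv \<sigma> \<in> Stab b" using act_inv[of \<sigma> b] d by (simp add: Stab_def)
  fix \<tau> assume "\<tau> \<in> Stab b"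
  then show "\<sigma> \<otimes> \<tau> \<in> Stab b" using s d by (simp add: Stab_def act_mult)
qed

lemma Stab_Fix: "b \<in> B \<Longrightarrow> \<sigma> \<in> Stab b \<Longrightarrow> \<sigma> \<in> carrier G \<and> b \<in> Fix \<sigma>"
  using B_disc by (auto simp: Stab_def Fix_def)

context
  fixes b assumes b: "b \<in> B"
begin

lemma lam_hom: "\<sigma> \<in> Stab b \<Longrightarrow> \<tau> \<in> Stab b \<Longrightarrow> lam (\<sigma> \<otimes> \<tau>) b = lam \<sigma> b * lam \<tau> b"
  using Stab_Fix[OF b] lam_mult by blast

lemma lam_pow: "\<sigma> \<in> Stab b \<Longrightarrow> lam (\<sigma> [^] (k::nat)) b = lam \<sigma> b ^ k"
proof (induction k)
  case 0
  then show ?case using lam_one B_disc[OF b] by simp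
next
  case (Suc k)
  interpret S: subgroup "Stab b" G by (rule Stab_subgroup[OF b])
  have "\<sigma> [^] k \<in> Stab b" using Suc.prems by (induction k) auto
  then show ?case using Suc lam_hom by simp
qed

text \<open>From \<open>lam_neq_1\<close>: only the identity has multiplier 1.\<close>

lemma lam_inj: "\<sigma> \<in> Stab b \<Longrightarrow> \<tau> \<in> Stab b \<Longrightarrow> lam \<sigma> b = lam \<tau> b \<Longrightarrow> \<sigma> = \<tau>"
proof -
  assume s: "\<sigma> \<in> Stab b" and t: "\<tau> \<in> Stab b" and e: "lam \<sigma> b = lam \<tau> b"
  interpret S: subgroup "Stab b" G by (rule Stab_subgroup[OF b])
  have i: "inv \<tau> \<in> Stab b" using t by simp
  have "lam (\<sigma> \<otimes> inv \<tau>) b = lam (\<tau> \<otimes> inv \<tau>) b" by (simp only: lam_hom[OF s i] lam_hom[OF t i] e)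
  also have "\<dots> = 1" using S.mem_carrier[OF t] lam_one B_disc[OF b] by simp
  finally have l: "lam (\<sigma> \<otimes> inv \<tau>) b = 1" .
  have "\<sigma> \<otimes> inv \<tau> \<in> Stab b" using s i by simp
  then have "\<sigma> \<otimes> inv \<tau> = \<one>" using l lam_neq_1 Stab_Fix[OF b] by blast
  then show "\<sigma> = \<tau>" using S.mem_carrier s t
    by (metis G.inv_equality G.inv_inv G.inv_closed)
qed

text \<open>The faithful character \<open>lam\<close> sends these elements to roots of
  \<open>X ^ d - 1\<close> in a field.\<close>

lemma card_Stab_roots: "d > 0 \<Longrightarrow> card {x \<in> Stab b. x [^] (d::nat) = \<one>} \<le> d"
proof -
  assume d: "d > 0"
  have "monom (1::'l) d - 1 \<noteq> 0"
  proof
    assume "monom (1::'l) d - 1 = 0"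
    then have "coeff (monom (1::'l) d - 1) d = 0" by simp
    then show False using d by simp
  qed
  then have fr: "finite {x. poly (monom (1::'l) d - 1) x = 0}" "card {x. poly (monom (1::'l) d - 1) x = 0} \<le> degree (monom (1::'l) d - 1)"
    by (rule poly_roots_finite, rule card_poly_roots_bound)
  have "(\<lambda>x. lam x b) ` {x \<in> Stab b. x [^] d = \<one>} \<subseteq> {x. poly (monom (1::'l) d - 1) x = 0}"
  proof clarsimp
    fix x assume x: "x \<in> Stab b" "x [^] d = \<one>"
    then have "lam x b ^ d = 1" using lam_pow[OF x(1), of d] lam_one B_disc[OF b] by simp
    then show "poly (monom (1::'l) d) (lam x b) = 1" by (simp add: poly_monom)
  qed
  then have "card ((\<lambda>x. lam x b) ` {x \<in> Stab b. x [^] d = \<one>}) \<le> card {x. poly (monom (1::'l) d - 1) x = 0}"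
    using fr(1) by (intro card_mono)
  also have "\<dots> \<le> degree (monom (1::'l) d - 1)" by (rule fr(2))
  also have "\<dots> \<le> d" by (intro degree_le) (auto simp: coeff_1)
  finally have "card ((\<lambda>x. lam x b) ` {x \<in> Stab b. x [^] d = \<one>}) \<le> d" .
  moreover have "inj_on (\<lambda>x. lam x b) {x \<in> Stab b. x [^] d = \<one>}" using lam_inj by (auto simp: inj_on_def)
  ultimately show ?thesis by (simp add: card_image)
qed

text \<open>Subgroups inherit the bound on roots, so \<open>cyclic_of_few_roots\<close> applies to
  each; it will serve for the whole stabilizer and for its Sylow subgroup.\<close>

lemma Stab_generator: 
  assumes P: "subgroup P G" "P \<subseteq> Stab b"
  shows "\<exists>x\<in>P. P = (\<lambda>k::nat. x [^] k) ` {..<card P} \<and> inj_on (\<lambda>k::nat. x [^] k) {..<card P} \<and> x [^] card P = \<one> \<and> generate G {x} = P"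
proof -
  interpret P: subgroup P G by (rule P)
  interpret H: group "G\<lparr>carrier := P\<rparr>" by (rule G.subgroup_imp_group[OF P(1)])
  have finP: "finite P" using P.subset fin finite_subset by blast
  have pw: "x [^]\<^bsub>G\<lparr>carrier := P\<rparr>\<^esub> (k::nat) = x [^] k" for x k
    by (rule G.nat_pow_consistent[symmetric])
  have "\<exists>x\<in>carrier (G\<lparr>carrier := P\<rparr>). H.ord x = card (carrier (G\<lparr>carrier := P\<rparr>))"
  proof (rule H.cyclic_of_few_roots)
    fix d :: nat assume d: "d > 0"
    have "{x \<in> P. x [^] d = \<one>} \<subseteq> {x \<in> Stab b. x [^] d = \<one>}" using P(2) by blast
    moreover have "finite (Stab b)" using fin by (simp add: Stab_def)
    ultimately have "card {x \<in> P. x [^] d = \<one>} \<le> card {x \<in> Stab b. x [^] d = \<one>}" by (intro card_mono) auto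
    then show "card {x \<in> carrier (G\<lparr>carrier := P\<rparr>). x [^]\<^bsub>G\<lparr>carrier := P\<rparr>\<^esub> d = \<one>\<^bsub>G\<lparr>carrier := P\<rparr>\<^esub>} \<le> d"
      using card_Stab_roots[OF d] by (simp add: pw)
  qed (use finP in simp)
  then obtain x where x: "x \<in> P" "H.ord x = card P" by auto
  have cP: "card P > 0" using finP P.one_closed by (metis card_gt_0_iff empty_iff)
  have "inj_on (\<lambda>k. x [^]\<^bsub>G\<lparr>carrier := P\<rparr>\<^esub> k) {0..H.ord x - 1}" using H.ord_inj[of x] x(1) by simp
  moreover have "{0..H.ord x - 1} = {..<card P}" using cP x(2) by auto
  ultimately have inj: "inj_on (\<lambda>k::nat. x [^] k) {..<card P}" by (simp add: pw)
  have xk: "x [^] (k::nat) \<in> P" for k using x(1) by (induction k) auto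
  have img: "(\<lambda>k::nat. x [^] k) ` {..<card P} = P"
    by (rule card_subset_eq[OF finP]) (use xk card_image[OF inj] in auto)
  have "x [^]\<^bsub>G\<lparr>carrier := P\<rparr>\<^esub> H.ord x = \<one>\<^bsub>G\<lparr>carrier := P\<rparr>\<^esub>" using x(1) by (intro H.pow_ord_eq_1) simp
  then have one: "x [^] card P = \<one>" using x(2) by (simp add: pw)
  have "generate G {x} = P"
  proof
    show "generate G {x} \<subseteq> P" using G.generate_subgroup_incl[OF _ P(1)] x(1) by simp
    have "x [^] (k::nat) \<in> generate G {x}" for k
    proof (induction k)
      case (Suc k)
      then show ?case using generate.eng[OF Suc.IH generate.incl[of x "{x}" G]] by simp
    qed (simp add: generate.one)
    then have "(\<lambda>k::nat. x [^] k) ` {..<card P} \<subseteq> generate G {x}" by blast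
    then show "P \<subseteq> generate G {x}" by (simp only: img)
  qed
  then show ?thesis using x(1) img inj one by blast
qed

lemma Stab_cyclic:
  shows "cyclic_group (G\<lparr>carrier := Stab b\<rparr>)"
proof -
  interpret P: subgroup "Stab b" G by (rule Stab_subgroup[OF b])
  interpret H: group "G\<lparr>carrier := Stab b\<rparr>" by (rule G.subgroup_imp_group[OF Stab_subgroup[OF b]])
  obtain x where x: "x \<in> Stab b" "Stab b = (\<lambda>k::nat. x [^] k) ` {..<card (Stab b)}"
    using Stab_generator[OF Stab_subgroup[OF b]] by blast
  have "carrier (G\<lparr>carrier := Stab b\<rparr>) = range (\<lambda>n::int. x [^]\<^bsub>G\<lparr>carrier := Stab b\<rparr>\<^esub> n)"
  proof
    show "carrier (G\<lparr>carrier := Stab b\<rparr>) \<subseteq> range (\<lambda>n::int. x [^]\<^bsub>G\<lparr>carrier := Stab b\<rparr>\<^esub> n)"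
    proof
      fix y assume "y \<in> carrier (G\<lparr>carrier := Stab b\<rparr>)"
      then obtain k :: nat where "y = x [^] k" using x(2) by auto
      then have "y = x [^]\<^bsub>G\<lparr>carrier := Stab b\<rparr>\<^esub> int k" by (simp add: int_pow_int G.nat_pow_consistent)
      then show "y \<in> range (\<lambda>n::int. x [^]\<^bsub>G\<lparr>carrier := Stab b\<rparr>\<^esub> n)" by blast
    qed
    show "range (\<lambda>n::int. x [^]\<^bsub>G\<lparr>carrier := Stab b\<rparr>\<^esub> n) \<subseteq> carrier (G\<lparr>carrier := Stab b\<rparr>)"
      using H.int_pow_closed x(1) by auto
  qed
  then show ?thesis unfolding H.cyclic_group using x(1) by auto
qed

end

end

section \<open>The depth at the leaves\<close>

context disc_action
begin

definition S :: "'l \<Rightarrow> 'g \<Rightarrow> rat" where "S b \<tau> = (\<Sum>x\<in>Fix \<tau> - {b}. v (b - x))"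

text \<open>Differentiating the product formula at \<open>b\<close> leaves the factors of the other
  fixed points.\<close>

lemma S_eq:
  assumes b: "b \<in> B" and t: "\<tau> \<in> Stab b" "\<tau> \<noteq> \<one>"
  shows "S b \<tau> = v (1 - lam \<tau> b)"
proof -
  have t': "\<tau> \<in> carrier G" "b \<in> Fix \<tau>" using Stab_Fix[OF b t(1)] by auto
  obtain N where N: "reg N (F (inv \<tau>) - fps_X)" using reg_ex[OF t'(1) t(2)] by blast
  show ?thesis
    using fixed_point_formula(3)[OF t'(1) t(2) N t'(2)] v_minus_commute[of "lam \<tau> b" 1] by (simp add: S_def)
qed

context
  fixes b p P
  assumes b: "b \<in> B" and p: "prime p" and vp: "v (of_nat p) > 0" and P: "sylow_subgroup p G (Stab b) P"
begin

lemma P_sub: "subgroup P G" "P \<subseteq> Stab b" "card P = p ^ multiplicity p (card (Stab b))"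
proof -
  have s: "subgroup P (G\<lparr>carrier := Stab b\<rparr>)" using P by (simp add: sylow_subgroup_def)
  show "subgroup P G" by (rule G.incl_subgroup[OF Stab_subgroup[OF b] s])
  show "P \<subseteq> Stab b" using subgroup.subset[OF s] by simp
  show "card P = p ^ multiplicity p (card (Stab b))" using P by (simp add: sylow_subgroup_def)
qed

lemma generator_facts:
  assumes x: "\<sigma> \<in> P" "generate G {\<sigma>} = P"
  shows "inj_on (\<lambda>k::nat. \<sigma> [^] k) {..<card P}" "(\<lambda>k::nat. \<sigma> [^] k) ` {..<card P} = P"
    "\<And>k::nat. \<sigma> [^] k = \<one> \<longleftrightarrow> card P dvd k"
proof -
  interpret P: subgroup P G by (rule P_sub(1))
  have finP: "finite P" using P.subset fin finite_subset by blast
  have cP: "card P > 0" using finP P.one_closed by (metis card_gt_0_iff empty_iff)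
  have sc: "\<sigma> \<in> carrier G" using x(1) by simp
  have o: "G.ord \<sigma> = card P" using G.generate_pow_card[OF sc] x(2) by simp
  have "inj_on (\<lambda>k. \<sigma> [^] k) {0..G.ord \<sigma> - 1}" by (rule G.ord_inj[OF sc])
  moreover have "{0..G.ord \<sigma> - 1} = {..<card P}" using cP o by auto
  ultimately show inj: "inj_on (\<lambda>k::nat. \<sigma> [^] k) {..<card P}" by simp
  have xk: "\<sigma> [^] (k::nat) \<in> P" for k using x(1) by (induction k) auto
  show "(\<lambda>k::nat. \<sigma> [^] k) ` {..<card P} = P"
    by (rule card_subset_eq[OF finP]) (use xk card_image[OF inj] in auto)
  show "\<sigma> [^] k = \<one> \<longleftrightarrow> card P dvd k" for k :: nat using G.pow_eq_id[OF sc] o by simp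
qed

text \<open>A generator of \<open>P\<close> acts on the tangent line by a root of unity
  \<open>\<zeta>\<close> of order \<open>p ^ M\<close>. An exponent \<open>a\<close> with
  \<open>i = multiplicity p a\<close> gives a root of order \<open>p ^ (M - i)\<close>, for which
  the valuation of \<open>1 - \<zeta> ^ a\<close> is that of \<open>p\<close> divided by
  \<open>p ^ (M - i - 1) * (p - 1)\<close>. Multiplied by \<open>- (p ^ M)\<close> and normalised,
  this is the constant \<open>- (p ^ (i + 1)) / (p - 1)\<close>.\<close>

lemma delta_mult_Sylow:
  shows "\<tau> \<in> P \<Longrightarrow> \<tau> \<noteq> \<one> \<Longrightarrow> delta_mult p G P \<tau> = - of_nat (card P) * of_rat (S b \<tau> / v (of_nat p))"
    and "(\<Sum>\<tau>\<in>P. delta_mult p G P \<tau>) = 0"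
proof -
  define \<sigma> where "\<sigma> = (SOME \<sigma>. \<sigma> \<in> P \<and> generate G {\<sigma>} = P)"
  have "\<exists>\<sigma>. \<sigma> \<in> P \<and> generate G {\<sigma>} = P" using Stab_generator[OF b P_sub(1,2)] by blast
  then have s: "\<sigma> \<in> P" "generate G {\<sigma>} = P" unfolding \<sigma>_def by (metis (mono_tags, lifting) someI_ex)+
  note gen = generator_facts[OF s]
  interpret P: subgroup P G by (rule P_sub(1))
  have finP: "finite P" using P.subset fin finite_subset by blast
  define M where "M = multiplicity p (card (Stab b))"
  have cP: "card P = p ^ M" using P_sub(3) by (simp add: M_def)
  have p0: "p > 1" using p prime_gt_1_nat by blast
  have M: "multiplicity p (card P) = M" unfolding cP using p0 p by (intro multiplicity_same_power) auto
  have sS: "\<sigma> \<in> Stab b" using s P_sub(2) by blast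
  define \<zeta> where "\<zeta> = lam \<sigma> b"
  have z: "\<zeta> ^ k = lam (\<sigma> [^] k) b" for k :: nat using lam_pow[OF b sS] by (simp add: \<zeta>_def)
  have pS: "\<sigma> [^] k \<in> Stab b" for k :: nat using P_sub(2) s(1) by (induction k) (auto intro: subsetD[OF P_sub(2)] subgroup.m_closed[OF Stab_subgroup[OF b]] subgroup.one_closed[OF Stab_subgroup[OF b]])
  have l1: "lam \<one> b = 1" using lam_one B_disc[OF b] by blast
  have z1: "\<zeta> ^ k = 1 \<longleftrightarrow> p ^ M dvd k" for k :: nat
  proof -
    have "\<zeta> ^ k = 1 \<longleftrightarrow> lam (\<sigma> [^] k) b = lam \<one> b" by (simp add: z l1)
    also have "\<dots> \<longleftrightarrow> \<sigma> [^] k = \<one>"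
      using lam_inj[OF b pS[of k] subgroup.one_closed[OF Stab_subgroup[OF b]]] by auto
    finally show ?thesis using gen(3) cP by simp
  qed
  \<comment> \<open>Excludes an order of \<open>\<zeta> ^ a\<close> below
    \<open>p ^ (M - i)\<close>: once the factor \<open>p ^ i\<close> is split off, the remaining
    exponent is prime to \<open>p\<close>.\<close>
  have inj_root: "inj_on (\<lambda>k. (\<zeta> ^ a) ^ k) {..<p ^ (M - i)}"
    if a: "i = multiplicity p a" "i \<le> M" "a > 0" for a i
  proof -
    have "a \<noteq> 0" "\<not> is_unit p" using a(3) p0 by auto
    then obtain c where "a = p ^ multiplicity p a * c" "\<not> p dvd c" by (rule multiplicity_decompose')
    then have c: "a = p ^ i * c" "\<not> p dvd c" using a(1) by simp_all
    have cc: "coprime (p ^ (M - i)) c" using c(2) p by (simp add: prime_imp_coprime)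
    have z0: "\<zeta> \<noteq> 0" using z1[of "p ^ M"] p0 by (auto simp: power_0_left)
    have *: "k = l" if kl: "k < p ^ (M - i)" "l < p ^ (M - i)" "(\<zeta> ^ a) ^ k = (\<zeta> ^ a) ^ l" "k \<le> l" for k l
    proof -
      have "\<zeta> ^ (a * l) = \<zeta> ^ (a * k) * \<zeta> ^ (a * (l - k))"
        using kl(4) by (simp add: power_add[symmetric] diff_mult_distrib2)
      moreover have "\<zeta> ^ (a * l) = \<zeta> ^ (a * k)" using kl(3) by (simp add: power_mult)
      ultimately have "\<zeta> ^ (a * (l - k)) = 1" using z0 by simp
      then have "p ^ M dvd p ^ i * (c * (l - k))" using z1 c(1) by (simp add: mult.assoc)
      moreover have "p ^ M = p ^ i * p ^ (M - i)" using a(2) by (simp flip: power_add)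
      ultimately have "p ^ (M - i) dvd c * (l - k)" using p0 by simp
      then have "p ^ (M - i) dvd l - k" using cc by (simp add: coprime_dvd_mult_right_iff)
      then have "l - k = 0" using kl(2) by (meson dvd_imp_le less_imp_diff_less not_gr_zero not_le)
      then show "k = l" using kl(4) by simp
    qed
    show ?thesis
    proof (rule inj_onI)
      fix k l assume "k \<in> {..<p ^ (M - i)}" "l \<in> {..<p ^ (M - i)}" "(\<zeta> ^ a) ^ k = (\<zeta> ^ a) ^ l"
      then show "k = l" using *[of k l] *[of l k] by (cases "k \<le> l") auto
    qed
  qed
  have nid: "delta_mult p G P \<tau> = - of_nat (card P) * of_rat (S b \<tau> / v (of_nat p))" if t: "\<tau> \<in> P" "\<tau> \<noteq> \<one>" for \<tau>
  proof -
    define a where "a = (SOME a::nat. \<tau> = \<sigma> [^] a)"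
    have "\<exists>a::nat. \<tau> = \<sigma> [^] a" using gen(2) t(1) by blast
    then have a: "\<tau> = \<sigma> [^] a" unfolding a_def by (rule someI_ex)
    define i where "i = multiplicity p a"
    have d: "delta_mult p G P \<tau> = - of_nat (p ^ (i + 1)) / of_nat (p - 1)"
      using t(2) by (simp add: delta_mult_def Let_def \<sigma>_def[symmetric] a_def[symmetric] i_def[symmetric])
    have a0: "a > 0" using a t(2) by (cases a) auto
    have nd: "\<not> p ^ M dvd a" using a t(2) gen(3) cP by simp
    have iM: "i < M"
    proof (rule ccontr)
      assume "\<not> i < M"
      then have "p ^ M dvd p ^ i" by (intro le_imp_power_dvd) simp
      then show False using nd multiplicity_dvd[of p a] dvd_trans by (auto simp: i_def)
    qed
    have "(\<zeta> ^ a) ^ (p ^ (M - i)) = 1"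
    proof -
      have "p ^ M = p ^ i * p ^ (M - i)" using iM by (simp flip: power_add)
      moreover have "p ^ i dvd a" by (simp add: i_def multiplicity_dvd)
      ultimately have "p ^ M dvd a * p ^ (M - i)" by (simp add: mult_dvd_mono)
      then show ?thesis by (simp add: power_mult[symmetric] z1)
    qed
    then have "of_nat (p ^ (M - i - 1) * (p - 1)) * v (1 - \<zeta> ^ a) = v (of_nat p)"
      using v_primitive_root(1)[OF p of_nat_nz _ inj_root[OF i_def _ a0]] iM by simp
    moreover have "S b \<tau> = v (1 - \<zeta> ^ a)"
      using S_eq[OF b subsetD[OF P_sub(2) t(1)] t(2)] by (simp add: a z)
    moreover define Q where "Q = p ^ (M - i - 1) * (p - 1)"
    ultimately have Sv: "of_nat Q * S b \<tau> = v (of_nat p)" by simp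
    have pos: "Q > 0" using p0 by (simp add: Q_def)
    have S0: "S b \<tau> \<noteq> 0" using Sv vp by auto
    have "S b \<tau> / v (of_nat p) = 1 / of_nat Q"
      unfolding Sv[symmetric] using pos S0 by simp
    then have r: "of_rat (S b \<tau> / v (of_nat p)) = (1 / of_nat Q :: complex)"
      by (simp add: of_rat_divide)
    have "M = (i + 1) + (M - i - 1)" using iM by simp
    then have "p ^ M = p ^ (i + 1) * p ^ (M - i - 1)" by (metis power_add)
    then have "card P * (p - 1) = p ^ (i + 1) * Q" unfolding cP Q_def by simp
    then have "of_nat (card P) * of_nat (p - 1) = (of_nat (p ^ (i + 1)) * of_nat Q :: complex)"
      by (metis of_nat_mult)
    moreover have "of_nat (p - 1) \<noteq> (0::complex)" "of_nat Q \<noteq> (0::complex)" using p0 pos by simp_all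
    ultimately have "of_nat (card P) / of_nat Q = (of_nat (p ^ (i + 1)) / of_nat (p - 1) :: complex)"
      by (simp add: frac_eq_eq)
    then show ?thesis unfolding d r by simp
  qed
  then show "\<tau> \<in> P \<Longrightarrow> \<tau> \<noteq> \<one> \<Longrightarrow> delta_mult p G P \<tau> = - of_nat (card P) * of_rat (S b \<tau> / v (of_nat p))" .
  have bij: "bij_betw (\<lambda>k::nat. \<sigma> [^] k) {1..<p ^ M} (P - {\<one>})"
  proof -
    have 0: "{..<p ^ M} = insert 0 {1..<p ^ M}" using p0 by auto
    have "bij_betw (\<lambda>k::nat. \<sigma> [^] k) {..<p ^ M} P" using gen(1,2) cP by (simp add: bij_betw_def)
    then have "bij_betw (\<lambda>k::nat. \<sigma> [^] k) ({..<p ^ M} - {0}) (P - {\<sigma> [^] (0::nat)})"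
      using p0 by (intro bij_betw_DiffI) (auto simp: bij_betw_def)
    moreover have "{..<p ^ M} - {0} = {1..<p ^ M}" by auto
    ultimately show ?thesis by simp
  qed
  \<comment> \<open>Over the nontrivial elements the valuations add up to \<open>M\<close> times
    that of \<open>p\<close>, which matches the value \<open>M * p ^ M\<close> of
    \<open>delta_mult\<close> at the identity.\<close>
  have "(\<Sum>\<tau>\<in>P - {\<one>}. S b \<tau>) = (\<Sum>k\<in>{1..<p ^ M}. S b (\<sigma> [^] k))"
    by (rule sum.reindex_bij_betw[OF bij, symmetric])
  also have "\<dots> = (\<Sum>k\<in>{1..<p ^ M}. v (1 - \<zeta> ^ k))"
  proof (rule sum.cong[OF refl])
    fix k assume "k \<in> {1..<p ^ M}"
    then have "\<sigma> [^] k \<noteq> \<one>" using gen(3) cP by (auto dest: dvd_imp_le)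
    then show "S b (\<sigma> [^] k) = v (1 - \<zeta> ^ k)" using S_eq[OF b pS] z by simp
  qed
  also have "\<dots> = of_nat M * v (of_nat p)"
  proof (rule v_primitive_root(2)[OF p of_nat_nz])
    show "\<zeta> ^ p ^ M = 1" using z1 by simp
    show "inj_on (\<lambda>k. \<zeta> ^ k) {..<p ^ M}" using inj_root[of 0 1] p0 by simp
  qed
  finally have sumS: "(\<Sum>\<tau>\<in>P - {\<one>}. S b \<tau>) = of_nat M * v (of_nat p)" .
  have "(\<Sum>\<tau>\<in>P. delta_mult p G P \<tau>) = delta_mult p G P \<one> + (\<Sum>\<tau>\<in>P - {\<one>}. delta_mult p G P \<tau>)"
    using finP P.one_closed by (simp add: sum.remove)
  also have "(\<Sum>\<tau>\<in>P - {\<one>}. delta_mult p G P \<tau>) = (\<Sum>\<tau>\<in>P - {\<one>}. - of_nat (card P) * of_rat (S b \<tau> / v (of_nat p)))"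
    using nid by (intro sum.cong) auto
  also have "\<dots> = - of_nat (card P) * of_rat ((\<Sum>\<tau>\<in>P - {\<one>}. S b \<tau>) / v (of_nat p))"
    by (simp only: sum_distrib_left sum_divide_distrib of_rat_sum)
  also have "\<dots> = - of_nat (card P) * of_nat M" unfolding sumS using vp by simp
  also have "delta_mult p G P \<one> = of_nat (M * p ^ M)" by (simp add: delta_mult_def Let_def M)
  finally show "(\<Sum>\<tau>\<in>P. delta_mult p G P \<tau>) = 0" by (simp add: cP)
qed

text \<open>The power of \<open>\<tau>\<close> with exponent \<open>p ^ M\<close> is nontrivial, and
  its multiplier \<open>\<eta>\<close> is a root of unity of order prime to \<open>p\<close>, so
  \<open>1 - \<eta>\<close> has valuation 0; \<open>1 - lam \<tau> b\<close> divides it.\<close>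

lemma S_off_Sylow:
  assumes t: "\<tau> \<in> Stab b" "\<tau> \<notin> P"
  shows "S b \<tau> = 0"
proof -
  interpret St: subgroup "Stab b" G by (rule Stab_subgroup[OF b])
  interpret P: subgroup P G by (rule P_sub(1))
  have pow_card: "x [^] card H = \<one>" if "subgroup H G" "x \<in> H" for x H
    using group.pow_order_eq_1[OF G.subgroup_imp_group[OF that(1)], of x] that(2)
    by (simp add: Coset.order_def G.nat_pow_consistent[symmetric])
  have p0: "p > 1" using p prime_gt_1_nat by blast
  define M where "M = multiplicity p (card (Stab b))"
  have cP: "card P = p ^ M" unfolding M_def by (rule P_sub(3))
  have finS: "finite (Stab b)" by (rule finite_subset[OF subgroup.subset[OF Stab_subgroup[OF b]] fin])
  have cS: "card (Stab b) > 0" using finS St.one_closed unfolding card_gt_0_iff by blast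
  have "card (Stab b) \<noteq> 0" "\<not> is_unit p" using cS p0 by auto
  then obtain l where l: "card (Stab b) = p ^ M * l" "\<not> p dvd l"
    unfolding M_def by (rule multiplicity_decompose')
  have lc: "coprime l p" using l(2) p by (metis coprime_commute prime_imp_coprime)
  have powP: "x [^] (p ^ M) = \<one>" if "x \<in> P" for x
    using pow_card[OF P_sub(1) that] cP by (simp only:)
  \<comment> \<open>\<open>P\<close> lies in the set of solutions, and the bound on roots leaves no
    room for others.\<close>
  have Peq: "P = {x \<in> Stab b. x [^] (p ^ M) = \<one>}"
  proof (rule card_seteq)
    show "P \<subseteq> {x \<in> Stab b. x [^] (p ^ M) = \<one>}" using powP P_sub(2) by blast
    show "card {x \<in> Stab b. x [^] (p ^ M) = \<one>} \<le> card P"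
      using card_Stab_roots[OF b, of "p ^ M"] p0 cP by simp
  qed (use finS in simp)
  have t1: "\<tau> \<noteq> \<one>" using t P.one_closed by blast
  define \<eta> where "\<eta> = lam \<tau> b ^ (p ^ M)"
  have pw: "\<tau> [^] k \<in> Stab b" for k :: nat using t(1) by (induction k) auto
  have l1: "lam \<one> b = 1" using lam_one B_disc[OF b] by blast
  have tp: "\<tau> [^] (p ^ M) \<noteq> \<one>" using t Peq by blast
  have e1: "\<eta> \<noteq> 1"
  proof
    assume "\<eta> = 1"
    then have "lam (\<tau> [^] (p ^ M)) b = lam \<one> b" by (simp add: \<eta>_def lam_pow[OF b t(1)] l1)
    from lam_inj[OF b pw St.one_closed this] tp show False by simp
  qed
  have "\<tau> [^] card (Stab b) = \<one>" by (rule pow_card[OF Stab_subgroup[OF b] t(1)])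
  then have lS: "lam \<tau> b ^ card (Stab b) = 1" using lam_pow[OF b t(1), of "card (Stab b)"] l1 by simp
  then have el: "\<eta> ^ l = 1" by (simp add: \<eta>_def power_mult[symmetric] l(1))
  have l0: "l > 0" using cS l(1) by (cases l) auto
  have "v (1 - \<eta>) = 0"
  proof (rule v_prime_to_p_root[OF el e1 l0 lc vp])
    show "of_nat p \<noteq> (0::'l)" using of_nat_nz[of p] p0 by simp
  qed (rule of_nat_nz)
  moreover have g0: "ge 0 (lam \<tau> b)" using ge_root_of_unity[OF cS lS] .
  then have "v (1 - lam \<tau> b) \<le> v (1 - \<eta>)" unfolding \<eta>_def
    using e1 by (intro v_one_minus_power) (auto simp: \<eta>_def)
  moreover have "1 - lam \<tau> b \<noteq> 0" using lam_neq_1[OF _ t1] Stab_Fix[OF b t(1)] by auto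
  then have "v (1 - lam \<tau> b) \<ge> 0" using ge_diff[OF ge_1 g0] by (simp add: ge_def)
  ultimately show ?thesis using S_eq[OF b t(1) t1] by simp
qed

end

end

section \<open>Completion of a discrete valuation ring\<close>

definition prime_ideal_set :: "'a::comm_ring_1 set \<Rightarrow> bool" where
  "prime_ideal_set S \<longleftrightarrow> 0 \<in> S \<and> (\<forall>a\<in>S. \<forall>b\<in>S. a + b \<in> S) \<and> (\<forall>a\<in>S. \<forall>b. b * a \<in> S) \<and> 1 \<notin> S \<and>
     (\<forall>a b. a * b \<in> S \<longrightarrow> a \<in> S \<or> b \<in> S)"

text \<open>A maximal ideal from Zorn's lemma; it keeps the quotient construction total, since a
  type constructor must make sense for every commutative ring.\<close>

lemma prime_ideal_set_exists: "\<exists>S :: 'a::comm_ring_1 set. prime_ideal_set S"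
proof -
  define I where "I = {S :: 'a set. 0 \<in> S \<and> (\<forall>a\<in>S. \<forall>b\<in>S. a + b \<in> S) \<and> (\<forall>a\<in>S. \<forall>b. b * a \<in> S) \<and> 1 \<notin> S}"
  have z: "{0} \<in> I" by (simp add: I_def)
  have "\<exists>M\<in>I. \<forall>S\<in>I. M \<subseteq> S \<longrightarrow> S = M"
  proof (rule subset_Zorn_nonempty)
    show "I \<noteq> {}" using z by blast
    fix C assume C: "C \<noteq> {}" "subset.chain I C"
    have CI: "S \<in> I" if "S \<in> C" for S using C(2) that unfolding subset_chain_def by blast
    have cmp: "S \<subseteq> T \<or> T \<subseteq> S" if "S \<in> C" "T \<in> C" for S T using C(2) that unfolding subset_chain_def by blast
    have "a + b \<in> \<Union> C" if ab: "a \<in> \<Union> C" "b \<in> \<Union> C" for a b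
    proof -
      obtain S T where ST: "a \<in> S" "S \<in> C" "b \<in> T" "T \<in> C" using ab by blast
      then obtain W where "W \<in> C" "a \<in> W" "b \<in> W" using cmp[of S T] by blast
      then show ?thesis using CI[of W] unfolding I_def by blast
    qed
    moreover have "b * a \<in> \<Union> C" if "a \<in> \<Union> C" for a b using that CI unfolding I_def by blast
    moreover have "0 \<in> \<Union> C" "1 \<notin> \<Union> C" using C(1) CI unfolding I_def by blast+
    ultimately show "\<Union> C \<in> I" unfolding I_def by blast
  qed
  then obtain M where M: "M \<in> I" "\<And>S. S \<in> I \<Longrightarrow> M \<subseteq> S \<Longrightarrow> S = M" by blast
  have Mi: "0 \<in> M" "1 \<notin> M" "\<And>a b. a \<in> M \<Longrightarrow> b \<in> M \<Longrightarrow> a + b \<in> M" "\<And>a b. a \<in> M \<Longrightarrow> b * a \<in> M"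
    using M(1) unfolding I_def by blast+
  have ex: "\<exists>m\<in>M. \<exists>c. 1 = m + c * a" if a: "a \<notin> M" for a
  proof -
    let ?S = "{m + c * a | m c. m \<in> M}"
    have in_S: "m + c * a \<in> ?S" if "m \<in> M" for m c using that by blast
    have sub: "M \<subseteq> ?S" using in_S[of _ 0] by auto
    have "a \<in> ?S" using in_S[OF Mi(1), of 1] by simp
    then have "?S \<noteq> M" using a by blast
    then have "?S \<notin> I" using M(2) sub by blast
    moreover have "0 \<in> ?S" using sub Mi(1) by blast
    moreover have "x + y \<in> ?S" if xy: "x \<in> ?S" "y \<in> ?S" for x y
    proof -
      obtain m c m' c' where "x = m + c * a" "m \<in> M" "y = m' + c' * a" "m' \<in> M" using xy by blast
      then have "x + y = (m + m') + (c + c') * a" "m + m' \<in> M" using Mi(3) by (simp_all add: algebra_simps)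
      then show ?thesis by blast
    qed
    moreover have "b * x \<in> ?S" if x: "x \<in> ?S" for x b
    proof -
      obtain m c where m: "x = m + c * a" "m \<in> M" using x by blast
      have e: "b * x = b * m + (b * c) * a" unfolding m(1) by (simp add: algebra_simps)
      show ?thesis unfolding e by (rule in_S[OF Mi(4)[OF m(2)]])
    qed
    ultimately have "1 \<in> ?S" unfolding I_def by blast
    then show ?thesis by blast
  qed
  have "a \<in> M \<or> b \<in> M" if ab: "a * b \<in> M" for a b
  proof (rule ccontr)
    assume "\<not> (a \<in> M \<or> b \<in> M)"
    then obtain m c m' c' where e: "m \<in> M" "1 = m + c * a" "m' \<in> M" "1 = m' + c' * b" using ex by metis
    have "(1::'a) = (m + c * a) * (m' + c' * b)" using e by simp
    also have "\<dots> = (m' + c' * b) * m + ((c * a) * m' + (c * c') * (a * b))" by (simp add: algebra_simps)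
    also have "\<dots> \<in> M" using Mi(3,4) e ab by simp
    finally show False using Mi(2) by simp
  qed
  then have "prime_ideal_set M" using Mi unfolding prime_ideal_set_def by blast
  then show ?thesis by blast
qed

text \<open>An elementwise description of a discrete valuation ring. The type is only of class
  \<open>comm_ring_1\<close>, so the absence of zero divisors has to be an assumption.\<close>

locale dvr_ring =
  fixes \<pi> :: "'a::comm_ring_1"
  assumes no_zero_div: "\<And>a b::'a. a * b = 0 \<Longrightarrow> a = 0 \<or> b = 0"
    and pi_nz: "\<pi> \<noteq> 0" and pi_nu: "\<not> \<pi> dvd 1"
    and pi_factor: "\<And>x. x \<noteq> 0 \<Longrightarrow> \<exists>u n. u dvd 1 \<and> x = u * \<pi> ^ n"
begin

text \<open>The truncated value of \<open>f\<close> at \<open>\<pi>\<close>, meaningful modulo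
  \<open>\<pi> ^ n\<close>.\<close>

definition psum :: "'a fps \<Rightarrow> nat \<Rightarrow> 'a" where "psum f n = (\<Sum>k<n. fps_nth f k * \<pi> ^ k)"

lemma psum_simps: "psum 0 n = 0" "psum (f + g) n = psum f n + psum g n" "psum (f - g) n = psum f n - psum g n"
  "psum f 0 = 0" "psum f (Suc n) = psum f n + fps_nth f n * \<pi> ^ n"
  by (simp_all add: psum_def sum.distrib sum_subtractf algebra_simps)

lemma psum_shift: "psum f (Suc n) = fps_nth f 0 + \<pi> * psum (fps_shift 1 f) n"
  unfolding psum_def sum.lessThan_Suc_shift by (simp add: sum_distrib_left mult_ac)

lemma psum_const_mult: "psum (fps_const c * g) n = c * psum g n"
  by (simp add: psum_def sum_distrib_left mult_ac)

lemma psum_X_mult: "psum (fps_X * g) (Suc n) = \<pi> * psum g n"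
  unfolding psum_def sum.lessThan_Suc_shift by (simp add: sum_distrib_left mult_ac)

lemma fps_split: "f = fps_const (fps_nth f 0) + fps_X * fps_shift 1 (f :: 'c::comm_ring_1 fps)"
  by (simp add: fps_eq_iff fps_X_mult_nth)

text \<open>Split off the constant coefficient of \<open>f\<close>: the rest carries a factor
  \<open>\<pi>\<close> after evaluation and needs one power of \<open>\<pi>\<close> less.\<close>

lemma psum_mult: "\<pi> ^ n dvd psum (f * g) n - psum f n * psum g n"
proof (induction n arbitrary: f)
  case (Suc n)
  let ?h = "fps_shift 1 f"
  have "f * g = fps_const (fps_nth f 0) * g + fps_X * (?h * g)"
    by (subst fps_split[of f]) (simp add: algebra_simps)
  then have "psum (f * g) (Suc n) = fps_nth f 0 * psum g (Suc n) + \<pi> * psum (?h * g) n"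
    by (simp only: psum_simps(2) psum_const_mult psum_X_mult)
  then have "psum (f * g) (Suc n) - psum f (Suc n) * psum g (Suc n)
      = \<pi> * (psum (?h * g) n - psum ?h n * psum g n) - \<pi> ^ Suc n * (psum ?h n * fps_nth g n)"
    unfolding psum_shift[of f] by (simp add: psum_simps(5) algebra_simps)
  moreover have "\<pi> ^ Suc n dvd \<pi> * (psum (?h * g) n - psum ?h n * psum g n)"
    unfolding power_Suc by (rule mult_dvd_mono[OF dvd_refl Suc.IH])
  ultimately show ?case by (metis dvd_diff dvd_triv_left)
qed simp

lemma psum_mono: "n \<le> m \<Longrightarrow> \<pi> ^ n dvd psum f m - psum f n"
proof (induction m rule: dec_induct)
  case (step m)
  have d: "\<pi> ^ n dvd fps_nth f m * \<pi> ^ m" using step(1) by (intro dvd_mult le_imp_power_dvd) simp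
  have e: "psum f (Suc m) - psum f n = (psum f m - psum f n) + fps_nth f m * \<pi> ^ m" by (simp add: psum_simps(5))
  show ?case unfolding e by (rule dvd_add[OF step.IH d])
qed simp

lemma pi_pow_nz: "\<pi> ^ n \<noteq> 0"
  by (induction n) (use no_zero_div pi_nz in auto)

lemma cancel: "c \<noteq> 0 \<Longrightarrow> c * a = c * b \<Longrightarrow> a = (b::'a)"
  using no_zero_div[of c "a - b"] by (simp add: algebra_simps)

lemma unit_pow_dvd: "u dvd 1 \<Longrightarrow> \<pi> ^ a dvd u * \<pi> ^ b \<Longrightarrow> a \<le> b"
proof (rule ccontr)
  assume u: "u dvd 1" and d: "\<pi> ^ a dvd u * \<pi> ^ b" and n: "\<not> a \<le> b"
  have "\<pi> ^ Suc b dvd u * \<pi> ^ b" using d n dvd_trans[OF le_imp_power_dvd[of "Suc b" a \<pi>]] by simp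
  then obtain c where "u * \<pi> ^ b = \<pi> ^ Suc b * c" by (rule dvdE)
  then have "u = \<pi> * c" using cancel[OF pi_pow_nz[of b], of u "\<pi> * c"] by (simp add: mult_ac)
  then show False using u pi_nu dvd_trans[of \<pi> u 1] by simp
qed

lemma pi_separated: "(\<And>n. \<pi> ^ n dvd x) \<Longrightarrow> x = 0"
proof (rule ccontr)
  assume d: "\<And>n. \<pi> ^ n dvd x" and "x \<noteq> 0"
  then obtain u n where "u dvd 1" "x = u * \<pi> ^ n" using pi_factor by blast
  then show False using unit_pow_dvd[of u "Suc n" n] d[of "Suc n"] by simp
qed

text \<open>The power series vanishing at \<open>\<pi>\<close> in the completion.\<close>

definition vanishing :: "'a fps set" where "vanishing = {f. \<forall>n. \<pi> ^ n dvd psum f n}"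

text \<open>For primality: a series that fails the condition at level \<open>n\<close> has later
  partial sums with an exponent of \<open>\<pi>\<close> below \<open>n\<close>. For two such series,
  failing at \<open>n\<close> and \<open>m\<close>, the exponents add and stay below
  \<open>n + m\<close>.\<close>

lemma prime_vanishing: "prime_ideal_set vanishing"
  unfolding prime_ideal_set_def
proof (intro conjI ballI allI impI)
  show "0 \<in> vanishing" by (simp add: vanishing_def psum_simps)
  show "a + b \<in> vanishing" if "a \<in> vanishing" "b \<in> vanishing" for a b
    using that by (simp add: vanishing_def psum_simps)
  show "b * a \<in> vanishing" if a: "a \<in> vanishing" for a b
  proof -
    have "\<pi> ^ n dvd psum (b * a) n" for n
    proof -
      have "\<pi> ^ n dvd psum b n * psum a n" using a by (simp add: vanishing_def)
      then show ?thesis using dvd_add[OF psum_mult[of n b a], of "psum b n * psum a n"] by simp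
    qed
    then show ?thesis by (simp add: vanishing_def)
  qed
  show "1 \<notin> vanishing"
  proof
    assume "1 \<in> vanishing"
    then have "\<pi> ^ 1 dvd psum 1 1" unfolding vanishing_def by blast
    then show False using pi_nu by (simp add: psum_def)
  qed
  fix a b assume ab: "a * b \<in> vanishing"
  show "a \<in> vanishing \<or> b \<in> vanishing"
  proof (rule ccontr)
    assume "\<not> (a \<in> vanishing \<or> b \<in> vanishing)"
    then obtain n m where nm: "\<not> \<pi> ^ n dvd psum a n" "\<not> \<pi> ^ m dvd psum b m" unfolding vanishing_def by blast
    \<comment> \<open>Beyond level \<open>k\<close> the partial sums change only by multiples of
      \<open>\<pi> ^ k\<close>, so the failure at \<open>k\<close> persists.\<close>
    have *: "\<exists>u i. u dvd 1 \<and> psum f (n + m) = u * \<pi> ^ i \<and> i < k" if k: "\<not> \<pi> ^ k dvd psum f k" "k \<le> n + m" for f k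
    proof -
      have nd: "\<not> \<pi> ^ k dvd psum f (n + m)"
      proof
        assume "\<pi> ^ k dvd psum f (n + m)"
        from dvd_diff[OF this psum_mono[OF k(2), of f]] show False using k(1) by simp
      qed
      then have "psum f (n + m) \<noteq> 0" by (metis dvd_0_right)
      then obtain u i where ui: "u dvd 1" "psum f (n + m) = u * \<pi> ^ i" using pi_factor by blast
      moreover have "i < k" using nd ui le_imp_power_dvd[of k i \<pi>] dvd_mult by (metis not_le)
      ultimately show ?thesis by blast
    qed
    obtain u i where u: "u dvd 1" "psum a (n + m) = u * \<pi> ^ i" "i < n" using *[OF nm(1)] by auto
    obtain u' j where u': "u' dvd 1" "psum b (n + m) = u' * \<pi> ^ j" "j < m" using *[OF nm(2)] by auto
    have "\<pi> ^ (n + m) dvd psum (a * b) (n + m)" using ab unfolding vanishing_def by blast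
    from dvd_diff[OF this psum_mult[of "n + m" a b]] have "\<pi> ^ (n + m) dvd psum a (n + m) * psum b (n + m)" by simp
    moreover have "psum a (n + m) * psum b (n + m) = (u * u') * \<pi> ^ (i + j)" unfolding u u' by (simp add: power_add mult_ac)
    ultimately have "\<pi> ^ (n + m) dvd (u * u') * \<pi> ^ (i + j)" by simp
    moreover have "u * u' dvd 1" using mult_dvd_mono[OF u(1) u'(1)] by simp
    ultimately have "n + m \<le> i + j" by (intro unit_pow_dvd)
    then show False using u(3) u'(3) by simp
  qed
qed

end

text \<open>
  The completion of a discrete valuation ring \<open>'a\<close> is \<open>'a[[X]]/(X - \<pi>)\<close>. For other rings the
  prime ideal is arbitrary, so that the quotient is a domain for every type \<open>'a\<close>.
\<close>

definition unif :: "'a::comm_ring_1" where "unif = (SOME \<pi>. dvr_ring \<pi>)"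

definition null_ideal :: "'a::comm_ring_1 fps set" where
  "null_ideal = (if \<exists>\<pi>::'a. dvr_ring \<pi> then dvr_ring.vanishing unif else SOME S. prime_ideal_set S)"

lemma prime_null_ideal: "prime_ideal_set (null_ideal :: 'a::comm_ring_1 fps set)"
proof (cases "\<exists>\<pi>::'a. dvr_ring \<pi>")
  case True
  then have "dvr_ring (unif :: 'a)" unfolding unif_def by (rule someI_ex)
  then show ?thesis using dvr_ring.prime_vanishing True by (simp add: null_ideal_def)
next
  case False
  then show ?thesis using someI_ex[OF prime_ideal_set_exists] by (simp add: null_ideal_def)
qed

lemma null_ideal:
  shows "0 \<in> null_ideal" "a \<in> null_ideal \<Longrightarrow> b \<in> null_ideal \<Longrightarrow> a + b \<in> null_ideal"
    "a \<in> null_ideal \<Longrightarrow> b * a \<in> null_ideal" "1 \<notin> null_ideal" "a * b \<in> null_ideal \<Longrightarrow> a \<in> null_ideal \<or> b \<in> null_ideal"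
  using prime_null_ideal unfolding prime_ideal_set_def by blast+

lemma null_ideal_uminus: "a \<in> null_ideal \<Longrightarrow> - a \<in> null_ideal"
  using null_ideal(3)[of a "-1"] by simp

quotient_type (overloaded) 'a completion = "'a::comm_ring_1 fps" / "\<lambda>f g. f - g \<in> null_ideal"
proof (rule equivpI)
  show "reflp (\<lambda>f g :: 'a fps. f - g \<in> null_ideal)" by (simp add: reflp_def null_ideal)
  show "symp (\<lambda>f g :: 'a fps. f - g \<in> null_ideal)"
  proof (rule sympI)
    show "g - f \<in> null_ideal" if "f - g \<in> null_ideal" for f g :: "'a fps" using null_ideal_uminus[OF that] by simp
  qed
  show "transp (\<lambda>f g :: 'a fps. f - g \<in> null_ideal)"
  proof (rule transpI)
    show "f - h \<in> null_ideal" if "f - g \<in> null_ideal" "g - h \<in> null_ideal" for f g h :: "'a fps"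
      using null_ideal(2)[OF that] by simp
  qed
qed

instantiation completion :: (comm_ring_1) idom
begin

lift_definition zero_completion :: "'a completion" is 0 .
lift_definition one_completion :: "'a completion" is 1 .
lift_definition uminus_completion :: "'a completion \<Rightarrow> 'a completion" is uminus
  using null_ideal_uminus by fastforce
lift_definition plus_completion :: "'a completion \<Rightarrow> 'a completion \<Rightarrow> 'a completion" is "(+)"
  subgoal for f f' g g' using null_ideal(2)[of "f - f'" "g - g'"] by (simp add: algebra_simps)
  done
lift_definition minus_completion :: "'a completion \<Rightarrow> 'a completion \<Rightarrow> 'a completion" is "(-)"
  subgoal for f f' g g' using null_ideal(2)[OF _ null_ideal_uminus, of "f - f'" "g - g'"] by (simp add: algebra_simps)
  done
lift_definition times_completion :: "'a completion \<Rightarrow> 'a completion \<Rightarrow> 'a completion" is "(*)"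
  subgoal for f f' g g'
    using null_ideal(2)[OF null_ideal(3)[of "f - f'" g] null_ideal(3)[of "g - g'" f']] by (simp add: algebra_simps)
  done

instance
proof
  fix a b c :: "'a completion"
  show "a + b + c = a + (b + c)" by transfer (simp add: null_ideal add.assoc)
  show "a + b = b + a" by transfer (simp add: null_ideal add.commute)
  show "0 + a = a" by transfer (simp add: null_ideal)
  show "- a + a = 0" by transfer (simp add: null_ideal)
  show "a - b = a + - b" by transfer (simp add: null_ideal)
  show "a * b * c = a * (b * c)" by transfer (simp add: null_ideal mult.assoc)
  show "a * b = b * a" by transfer (simp add: null_ideal mult.commute)
  show "1 * a = a" by transfer (simp add: null_ideal)
  show "0 * a = 0" "a * 0 = 0" by (transfer, simp add: null_ideal)+
  show "a * (b + c) = a * b + a * c" by transfer (simp add: null_ideal distrib_left)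
  show "(a + b) * c = a * c + b * c" by transfer (simp add: null_ideal distrib_right)
  show "(0 :: 'a completion) \<noteq> 1" by transfer (use null_ideal(4) null_ideal_uminus in force)
  show "a \<noteq> 0 \<Longrightarrow> b \<noteq> 0 \<Longrightarrow> a * b \<noteq> 0" by transfer (use null_ideal(5) in auto)
qed

end

abbreviation cls :: "'a::comm_ring_1 fps \<Rightarrow> 'a completion" where "cls \<equiv> abs_completion"

lemma cls_simps: "cls (f + g) = cls f + cls g" "cls (f - g) = cls f - cls g" "cls (f * g) = cls f * cls g"
  "cls 0 = 0" "cls 1 = 1"
  by (simp_all add: plus_completion.abs_eq minus_completion.abs_eq times_completion.abs_eq zero_completion_def one_completion_def)

lemma cls_power: "cls (f ^ n) = cls f ^ n"
  by (induction n) (simp_all add: cls_simps)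

lemma cls_sum: "cls (\<Sum>i\<in>I. f i) = (\<Sum>i\<in>I. cls (f i))"
  by (induction I rule: infinite_finite_induct) (simp_all add: cls_simps)

lemma cls_eq: "cls f = cls g \<longleftrightarrow> f - g \<in> null_ideal"
  by (rule completion.abs_eq_iff)

lemma cls_ex: "\<exists>f. x = cls f"
  by (metis Quotient_abs_rep Quotient_completion)

locale dvr_completion = dvr_ring \<pi> for \<pi> :: "'a::comm_ring_1" +
  assumes pi_unif: "\<pi> = unif"
begin

lemma null_vanishing: "null_ideal = (vanishing :: 'a fps set)"
  using dvr_ring_axioms pi_unif by (auto simp: null_ideal_def)

lemma cls_eq_iff: "cls f = cls g \<longleftrightarrow> (\<forall>n. \<pi> ^ n dvd psum (f - g) n)" for f g :: "'a fps"
  by (simp add: cls_eq null_vanishing vanishing_def)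

lemma cls_X: "cls fps_X = cls (fps_const (\<pi> :: 'a))"
proof -
  have "\<pi> ^ n dvd psum (fps_X - fps_const \<pi>) n" for n
  proof (cases n)
    case (Suc m)
    show ?thesis
    proof (cases m)
      case (Suc k)
      have "psum (fps_X - fps_const \<pi>) (Suc (Suc k)) = 0"
        unfolding psum_shift[of _ "Suc k"] psum_shift[of _ k] by (simp add: psum_def)
      then show ?thesis using Suc \<open>n = Suc m\<close> by simp
    qed (use \<open>n = Suc m\<close> in \<open>simp add: psum_def\<close>)
  qed simp
  then show ?thesis by (simp add: cls_eq_iff)
qed

lemma cls_unit: "fps_nth f 0 dvd 1 \<Longrightarrow> cls f dvd 1" for f :: "'a fps"
proof -
  assume "fps_nth f 0 dvd 1"
  then obtain c where c: "1 = fps_nth f 0 * c" by (rule dvdE)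
  then have "f * fps_right_inverse f c = 1" by (intro fps_right_inverse) simp
  then have "cls f * cls (fps_right_inverse f c) = 1" using cls_simps(3,5) by metis
  then show ?thesis by (metis dvd_triv_left)
qed

lemma unit_or_pi: "x dvd 1 \<or> \<pi> dvd x" for x :: 'a
proof (cases "x = 0")
  case False
  then obtain u n where "u dvd 1" "x = u * \<pi> ^ n" using pi_factor by blast
  then show ?thesis by (cases n) auto
qed simp

lemma cls_dvd_X: "(\<pi> :: 'a) dvd fps_nth f 0 \<Longrightarrow> cls fps_X dvd cls f"
proof -
  assume "\<pi> dvd fps_nth f 0"
  then obtain c where c: "fps_nth f 0 = \<pi> * c" by (rule dvdE)
  have "cls f = cls (fps_const \<pi>) * cls (fps_const c) + cls fps_X * cls (fps_shift 1 f)"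
    by (subst fps_split[of f]) (simp only: c cls_simps fps_const_mult[symmetric])
  then show ?thesis unfolding cls_X[symmetric] by (metis distrib_left dvd_triv_left)
qed

text \<open>Factors \<open>cls fps_X\<close> are split off until the constant coefficient of a
  representative is a unit of the base ring, which makes the class a unit. A class divisible by all
  powers is 0, since then the \<open>n\<close>-th partial sum of a representative is divisible by
  \<open>\<pi> ^ n\<close>.\<close>

lemma completion_factor: "x = 0 \<or> (\<exists>u k. u dvd 1 \<and> x = u * cls fps_X ^ k)" for x :: "'a completion"
proof -
  have step: "(\<exists>u k. u dvd 1 \<and> x = u * cls fps_X ^ k) \<or> cls fps_X ^ n dvd x" for n
  proof (induction n)
    case (Suc n)
    then show ?case
    proof
      assume "cls fps_X ^ n dvd x"
      then obtain y where y: "x = cls fps_X ^ n * y" by (rule dvdE)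
      obtain g where g: "y = cls g" using cls_ex by blast
      show ?thesis
      proof (cases "fps_nth g 0 dvd 1")
        case True
        have "y dvd 1 \<and> x = y * cls fps_X ^ n" using cls_unit[OF True] y g by (simp add: mult.commute)
        then show ?thesis by blast
      next
        case False
        then have "cls fps_X dvd y" using cls_dvd_X unit_or_pi g by blast
        then have "cls fps_X ^ Suc n dvd x" using y by (simp add: mult.commute mult_dvd_mono)
        then show ?thesis by blast
      qed
    qed blast
  qed simp
  obtain f where f: "x = cls f" using cls_ex by blast
  have z: "x = 0" if n: "\<And>n. cls fps_X ^ n dvd x"
  proof -
    have "\<pi> ^ n dvd psum f n" for n
    proof -
      obtain y where y: "x = cls fps_X ^ n * y" using n by (rule dvdE)
      obtain g where g: "y = cls g" using cls_ex by blast
      have "cls f = cls (fps_X ^ n * g)" using f y g by (simp add: cls_simps cls_power)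
      then have "\<pi> ^ n dvd psum (f - fps_X ^ n * g) n" unfolding cls_eq_iff by blast
      moreover have "psum (fps_X ^ n * g) n = 0" unfolding psum_def by (rule sum.neutral) (simp add: fps_X_power_mult_nth)
      ultimately show ?thesis by (simp add: psum_simps)
    qed
    then have "cls f = cls 0" unfolding cls_eq_iff by simp
    then show ?thesis using f by (simp add: cls_simps)
  qed
  show ?thesis
  proof (cases "\<forall>n. cls fps_X ^ n dvd x")
    case True
    have "x = 0" by (rule z) (rule spec[OF True])
    then show ?thesis by simp
  next
    case False
    then obtain n where "\<not> cls fps_X ^ n dvd x" by auto
    then show ?thesis using step[of n] by simp
  qed
qed

sublocale cd: complete_dvr "cls fps_X :: 'a completion"
proof
  show "(cls fps_X :: 'a completion) \<noteq> 0"
  proof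
    assume "(cls fps_X :: 'a completion) = 0"
    then have "cls fps_X = cls (0 :: 'a fps)" by (simp add: cls_simps)
    then have "(\<pi> :: 'a) ^ Suc (Suc 0) dvd psum (fps_X - 0) (Suc (Suc 0))" unfolding cls_eq_iff by blast
    then have "(\<pi> :: 'a) ^ Suc (Suc 0) dvd 1 * \<pi> ^ Suc 0" by (simp add: psum_def)
    then have "Suc (Suc 0) \<le> Suc 0" by (rule unit_pow_dvd[rotated]) simp
    then show False by simp
  qed
  show "\<not> (cls fps_X :: 'a completion) dvd 1"
  proof
    assume "(cls fps_X :: 'a completion) dvd 1"
    then obtain y where y: "1 = cls fps_X * (y :: 'a completion)" by (rule dvdE)
    obtain g where g: "y = cls g" using cls_ex by blast
    have "cls 1 = cls (fps_X * g)" using y g by (simp add: cls_simps)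
    then have "\<pi> ^ 1 dvd psum (1 - fps_X * g) 1" unfolding cls_eq_iff by blast
    then show False using pi_nu by (simp add: psum_def)
  qed
  show "\<exists>u n. u dvd 1 \<and> x = u * cls fps_X ^ n" if "x \<noteq> 0" for x :: "'a completion"
    using completion_factor[of x] that by blast
  fix a :: "nat \<Rightarrow> 'a completion"
  have "\<forall>k. \<exists>f. a k = cls f" by (rule allI) (rule cls_ex)
  from choice[OF this] obtain f where f': "\<forall>k. a k = cls (f k)" by (rule exE)
  note f = spec[OF f']
  \<comment> \<open>The coefficients of the formal sum of all \<open>f k * fps_X ^ k\<close>, which
    is finite in each degree; the limit is thus taken among the representing series.\<close>
  define g where "g = Abs_fps (\<lambda>n. \<Sum>k\<le>n. fps_nth (f k) (n - k))"
  have "cls fps_X ^ N dvd cls g - (\<Sum>k<N. a k * cls fps_X ^ k)" for N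
  proof -
    let ?h = "g - (\<Sum>k<N. f k * fps_X ^ k)"
    have "fps_nth ?h n = 0" if n: "n < N" for n
    proof -
      have s: "{k \<in> {..<N}. k \<le> n} = {..n}" using n by auto
      have "(\<Sum>k<N. fps_nth (f k * fps_X ^ k) n) = (\<Sum>k<N. if k \<le> n then fps_nth (f k) (n - k) else 0)"
        by (rule sum.cong[OF refl]) (simp add: fps_X_power_mult_right_nth)
      also have "\<dots> = (\<Sum>k\<in>{..n}. fps_nth (f k) (n - k))"
        unfolding s[symmetric] by (rule sum.inter_filter[symmetric]) simp
      finally have "(\<Sum>k<N. fps_nth (f k * fps_X ^ k) n) = (\<Sum>k\<in>{..n}. fps_nth (f k) (n - k))" .
      then show ?thesis by (simp add: g_def fps_sum_nth)
    qed
    then have h: "?h = fps_X ^ N * fps_shift N ?h"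
      by (intro fps_ext) (simp add: fps_X_power_mult_nth)
    have "cls ?h = cls fps_X ^ N * cls (fps_shift N ?h)"
      using arg_cong[OF h, of cls] unfolding cls_simps(3) cls_power .
    then have "cls fps_X ^ N dvd cls ?h" by (rule dvdI)
    also have "cls ?h = cls g - (\<Sum>k<N. a k * cls fps_X ^ k)"
      unfolding f cls_simps cls_sum cls_power ..
    finally show ?thesis .
  qed
  then show "\<exists>s. \<forall>N. cls fps_X ^ N dvd s - (\<Sum>k<N. a k * cls fps_X ^ k)" by blast
qed

definition emb :: "'a \<Rightarrow> 'a completion" where "emb c = cls (fps_const c)"

lemma emb_simps: "emb (a + b) = emb a + emb b" "emb (a * b) = emb a * emb b" "emb 0 = 0" "emb 1 = 1"
  "emb (a - b) = emb a - emb b"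
  by (simp_all add: emb_def cls_simps fps_const_add[symmetric] fps_const_mult[symmetric] fps_const_sub[symmetric]
      del: fps_const_add fps_const_mult fps_const_sub)

lemma emb_eq_0: "emb c = 0 \<longleftrightarrow> c = 0"
proof
  assume "emb c = 0"
  then have "cls (fps_const c) = cls 0" by (simp add: emb_def cls_simps)
  then have d: "\<pi> ^ n dvd psum (fps_const c) n" for n unfolding cls_eq_iff by simp
  have "\<pi> ^ n dvd c" for n
  proof (cases n)
    case (Suc m)
    have "psum (fps_const c) (Suc m) = c" unfolding psum_shift by (simp add: psum_def)
    then show ?thesis using d[of n] Suc by simp
  qed simp
  then show "c = 0" by (rule pi_separated)
qed (simp add: emb_simps)

lemma emb_of_nat: "emb (of_nat n) = of_nat n"
  by (induction n) (simp_all add: emb_simps)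

text \<open>An element not divisible by \<open>\<pi>\<close> is a unit and stays one in the
  completion; hence reduction can be tested on either side.\<close>

lemma dvd_emb: "cls fps_X dvd emb c \<longleftrightarrow> (\<pi> :: 'a) dvd c"
proof
  assume "\<pi> dvd c"
  then show "cls fps_X dvd emb c" unfolding emb_def by (intro cls_dvd_X) simp
next
  assume a: "cls fps_X dvd emb c"
  show "\<pi> dvd c"
  proof (rule ccontr)
    assume "\<not> \<pi> dvd c"
    then have "emb c dvd 1" unfolding emb_def using unit_or_pi by (intro cls_unit) auto
    then show False using dvd_trans[OF a] cd.pi_nonunit by blast
  qed
qed

end

section \<open>Uniformizers of abstract discrete valuation rings\<close>

lemma type_ring_simps [simp]: "carrier (type_ring T) = UNIV" "mult (type_ring T) = (*)" "one (type_ring T) = 1"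
  "zero (type_ring T) = 0" "add (type_ring T) = (+)"
  by (simp_all add: type_ring_def)

lemma (in principal_domain) nonunit_in_prime:
  assumes "u \<in> carrier R - {\<zero>}" "u \<notin> Units R"
  shows "\<exists>b\<in>carrier R. b \<noteq> \<zero> \<and> b divides u \<and> primeideal (PIdl b) R"
proof -
  obtain b where b: "b \<in> carrier R" "ring_irreducible b" "b divides u"
    by (rule exists_irreducible_divisor[OF assms])
  then show ?thesis using maximalideal_prime[OF irreducible_imp_maximalideal[OF b(1,2)]] ring_irreducibleE(1)[OF b(1,2)] by blast
qed

lemma (in principal_domain) ring_and_integral:
  "ring R" "group (add_monoid R)" "a \<in> carrier R \<Longrightarrow> b \<in> carrier R \<Longrightarrow> a \<otimes> b = \<zero> \<Longrightarrow> a = \<zero> \<or> b = \<zero>"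
  using ring_axioms a_group integral by (simp_all add: comm_group_def)

text \<open>The generator of the unique nonzero prime ideal is the uniformizer. A nonunit has an
  irreducible divisor, which generates a nonzero prime, hence this one; and the powers of
  \<open>\<pi>\<close> have only 0 as a common multiple.\<close>

lemma dvr_ring_exists:
  assumes "discrete_valuation_ring (type_ring TYPE('r::comm_ring_1))"
  shows "\<exists>\<pi>::'r. dvr_ring \<pi>"
proof -
  let ?R = "type_ring TYPE('r)"
  have pd: "principal_domain ?R" using assms by (simp add: discrete_valuation_ring_def)
  note exists_gen = principal_domain.exists_gen[OF pd]
  obtain P where P: "primeideal P ?R" "P \<noteq> {0}" and uniq: "\<And>Q. primeideal Q ?R \<Longrightarrow> Q \<noteq> {0} \<Longrightarrow> Q = P"
    using assms unfolding discrete_valuation_ring_def by auto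
  have PI: "PIdl\<^bsub>?R\<^esub> a = {x. a dvd x}" for a
    by (auto simp: cgenideal_def dvd_def mult.commute)
  have iP: "ideal P ?R" using P(1) by (rule primeideal.axioms(1))
  obtain \<pi> where pi: "P = {x. \<pi> dvd x}" using exists_gen[OF iP] PI by auto
  have nzd: "a = 0 \<or> b = 0" if "a * b = 0" for a b :: 'r using principal_domain.ring_and_integral(3)[OF pd, of a b] that by simp
  have pi0: "\<pi> \<noteq> 0" using P(2) pi by auto
  have pinu: "\<not> \<pi> dvd 1"
  proof
    assume "\<pi> dvd 1"
    then have "P = UNIV" unfolding pi using dvd_trans[of \<pi> 1] by auto
    then show False using primeideal.I_notcarr[OF P(1)] by simp
  qed
  have unit: "u dvd 1" if u: "\<not> \<pi> dvd u" for u
  proof (rule ccontr)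
    assume n: "\<not> u dvd 1"
    have "u \<noteq> 0" using u by auto
    then have u1: "u \<in> carrier ?R - {\<zero>\<^bsub>?R\<^esub>}" by simp
    have u2: "u \<notin> Units ?R"
    proof
      assume "u \<in> Units ?R"
      then obtain w where "w * u = 1" unfolding Units_def by auto
      then show False using n dvdI[of 1 u w] by (simp add: mult.commute)
    qed
    obtain b where b: "b \<noteq> 0" "b divides\<^bsub>?R\<^esub> u" "primeideal (PIdl\<^bsub>?R\<^esub> b) ?R"
      using principal_domain.nonunit_in_prime[OF pd u1 u2] by auto
    have "b \<in> PIdl\<^bsub>?R\<^esub> b" unfolding PI by simp
    then have "PIdl\<^bsub>?R\<^esub> b \<noteq> {0}" using b(1) by blast
    with b(3) have "PIdl\<^bsub>?R\<^esub> b = P" by (rule uniq)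
    moreover have "u \<in> PIdl\<^bsub>?R\<^esub> b" using b(2) unfolding PI factor_def dvd_def by simp
    ultimately show False using u pi by blast
  qed
  \<comment> \<open>The common multiples form a principal ideal with some generator
    \<open>y\<close>. The quotient of \<open>y\<close> by \<open>\<pi>\<close> is again a common
    multiple, so \<open>y\<close> is a multiple of \<open>\<pi> * y\<close>, and
    \<open>y = 0\<close> because \<open>\<pi>\<close> is not a unit.\<close>
  have sep: "x = 0" if x: "\<And>n. \<pi> ^ n dvd x" for x
  proof -
    let ?I = "{x. \<forall>n. \<pi> ^ n dvd x}"
    have "ideal ?I ?R"
    proof (rule idealI)
      show "ring ?R" by (rule principal_domain.ring_and_integral(1)[OF pd])
      have ag: "group (add_monoid ?R)" by (rule principal_domain.ring_and_integral(2)[OF pd])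
      show "subgroup ?I (add_monoid ?R)"
      proof (rule group.subgroupI[OF ag])
        show "inv\<^bsub>add_monoid ?R\<^esub> a \<in> ?I" if a: "a \<in> ?I" for a
        proof -
          have "inv\<^bsub>add_monoid ?R\<^esub> a = - a" by (rule group.inv_equality[OF ag]) simp_all
          then show ?thesis using a by simp
        qed
      qed auto
    qed auto
    from exists_gen[OF this] obtain y where "?I = PIdl\<^bsub>?R\<^esub> y" by blast
    then have y: "?I = {x. y dvd x}" unfolding PI .
    have "y \<in> ?I" unfolding y by simp
    then have yI: "\<pi> ^ n dvd y" for n by simp
    obtain z where "y = \<pi> ^ 1 * z" using yI by (rule dvdE)
    then have z: "y = \<pi> * z" by simp
    have "\<pi> ^ n dvd z" for n
    proof -
      obtain c where c: "y = \<pi> ^ Suc n * c" using yI by (rule dvdE)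
      have "\<pi> * (z - \<pi> ^ n * c) = y - y" unfolding right_diff_distrib by (subst (2) c, subst z) (simp add: mult.assoc)
      then have "\<pi> * (z - \<pi> ^ n * c) = 0" by simp
      then have "z - \<pi> ^ n * c = 0" using nzd[of \<pi> "z - \<pi> ^ n * c"] pi0 by blast
      then have "z = \<pi> ^ n * c" by simp
      then show ?thesis by (rule dvdI)
    qed
    then have "z \<in> ?I" by simp
    then have "y dvd z" unfolding y by simp
    then obtain w where w: "z = y * w" by (rule dvdE)
    have "y * (1 - \<pi> * w) = y - \<pi> * (y * w)" by (simp add: algebra_simps)
    also have "\<dots> = 0" unfolding w[symmetric] z[symmetric] by simp
    finally have "y * (1 - \<pi> * w) = 0" .
    moreover have "1 - \<pi> * w \<noteq> 0" using pinu dvdI[of 1 \<pi> w] by auto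
    ultimately have "y = 0" using nzd[of y "1 - \<pi> * w"] by blast
    moreover have "x \<in> ?I" using x by simp
    then have "y dvd x" unfolding y by simp
    ultimately show ?thesis by simp
  qed
  have "\<exists>u n. u dvd 1 \<and> x = u * \<pi> ^ n" if x: "x \<noteq> 0" for x
  proof -
    obtain n where n: "\<not> \<pi> ^ n dvd x" using sep x by blast
    define k where "k = (LEAST n. \<not> \<pi> ^ n dvd x)"
    have k: "\<not> \<pi> ^ k dvd x" unfolding k_def using n by (rule LeastI)
    then obtain j where j: "k = Suc j" by (cases k) auto
    have "\<pi> ^ j dvd x" using not_less_Least[of j "\<lambda>n. \<not> \<pi> ^ n dvd x"] j unfolding k_def by auto
    then obtain u where u: "x = \<pi> ^ j * u" by (rule dvdE)
    have "\<not> \<pi> dvd u"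
    proof
      assume "\<pi> dvd u"
      then have "\<pi> ^ k dvd x" unfolding u j by (simp add: mult.commute mult_dvd_mono)
      then show False using k by blast
    qed
    then show ?thesis using unit[of u] u by (intro exI[of _ u] exI[of _ j]) (simp add: mult.commute)
  qed
  then have "dvr_ring \<pi>" using nzd pi0 pinu by (intro dvr_ring.intro)
  then show ?thesis by blast
qed

section \<open>Homomorphisms as evaluations, and the algebraic closure\<close>

context open_disc
begin

text \<open>Boundedness of \<open>h\<close> replaces continuity: \<open>h f - ev y f\<close> is divisible by every power of \<open>y\<close>.\<close>

lemma bounded_hom_eq_ev:
  fixes h :: "'c::comm_ring_1 fps \<Rightarrow> 'l" and e :: "'c \<Rightarrow> 'r"
  assumes y: "disc y" and h: "\<And>f g. h (f + g) = h f + h g" "\<And>f g. h (f * g) = h f * h g"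
    "\<And>c. h (fps_const c) = \<iota> (e c)" "h fps_X = y" "\<And>f. ge 0 (h f)"
  shows "h f = ev y (Abs_fps (\<lambda>i. e (fps_nth f i)))"
proof -
  let ?m = "\<lambda>f. Abs_fps (\<lambda>i. e (fps_nth f i))"
  have step: "h f - ev y (?m f) = y * (h (fps_shift 1 f) - ev y (?m (fps_shift 1 f)))" for f
  proof -
    have "h f = h (fps_const (fps_nth f 0) + fps_X * fps_shift 1 f)"
      by (rule arg_cong[of _ _ h]) (simp add: fps_eq_iff fps_X_mult_nth)
    moreover have "?m f = fps_const (e (fps_nth f 0)) + fps_X * ?m (fps_shift 1 f)"
      by (simp add: fps_eq_iff fps_X_mult_nth)
    then have "ev y (?m f) = \<iota> (e (fps_nth f 0)) + y * ev y (?m (fps_shift 1 f))"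
      by (simp only: ev_add[OF y] ev_mult[OF y] ev_const[OF y] ev_X[OF y])
    ultimately show ?thesis unfolding h(1,2,3,4) by (simp add: algebra_simps)
  qed
  have pow: "\<exists>d. ge 0 d \<and> h f - ev y (?m f) = y ^ n * d" for n f
  proof (induction n arbitrary: f)
    case 0
    show ?case using ge_diff[OF h(5) ev_ge[OF y]] by simp
  next
    case (Suc n)
    show ?case using Suc.IH[of "fps_shift 1 f"] unfolding step[of f] by (auto simp: mult.assoc)
  qed
  let ?x = "h f - ev y (?m f)"
  have "?x = 0"
  proof (rule ccontr)
    assume nz: "?x \<noteq> 0"
    have y0: "y \<noteq> 0" using pow[of f 1] nz by auto
    then have vy: "v y > 0" using y by blast
    obtain n where n: "v ?x < of_nat n * v y" using ex_less_of_nat_mult[OF vy] by blast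
    obtain d where d: "ge 0 d" "?x = y ^ n * d" using pow by blast
    have "d \<noteq> 0" using d(2) nz by auto
    then have "v ?x = of_nat n * v y + v d" unfolding d(2) using y0 by (simp add: v_mult v_power)
    then show False using n d(1) \<open>d \<noteq> 0\<close> by (simp add: ge_def)
  qed
  then show ?thesis by simp
qed

end

lemma clear_denominators:
  "\<exists>d q. d \<noteq> 0 \<and> smult (to_fract d) p = map_poly to_fract q" for p :: "'a::idom fract poly"
proof (induction p)
  case 0
  show ?case by (intro exI[of _ 1] exI[of _ 0]) simp
next
  case (pCons a p)
  obtain d q where d: "d \<noteq> 0" "smult (to_fract d) p = map_poly to_fract q" using pCons.IH by blast
  obtain n e where e: "a = Fract n e" "e \<noteq> 0" by (cases a)
  have ea: "to_fract e * a = to_fract n" using e by (simp add: to_fract_def eq_fract)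
  have "smult (to_fract (e * d)) (pCons a p) = pCons (to_fract d * (to_fract e * a)) (smult (to_fract e) (smult (to_fract d) p))"
    by (simp add: mult_ac)
  also have "\<dots> = map_poly to_fract (pCons (d * n) (smult e q))"
    unfolding d(2) ea by (intro poly_eqI) (simp add: coeff_map_poly coeff_pCons split: nat.split)
  finally show ?case using d(1) e(2) by (intro exI[of _ "e * d"] exI) auto
qed

definition \<iota>ac :: "'a::idom \<Rightarrow> 'a fract alg_closure" where "\<iota>ac c = to_ac (to_fract c)"

lemma inj_\<iota>ac: "inj_idom_hom (\<iota>ac :: 'a::idom \<Rightarrow> _)"
  by unfold_locales (simp_all add: \<iota>ac_def)

lemma algebraic_\<iota>ac: "\<exists>q. q \<noteq> 0 \<and> poly (map_poly \<iota>ac q) y = 0" for y :: "'a::idom fract alg_closure"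
proof -
  obtain p :: "'a fract poly" where p: "p \<noteq> 0" "poly (map_poly to_ac p) y = 0" by (rule alg_closure_algebraic)
  obtain d q where d: "d \<noteq> 0" "smult (to_fract d) p = map_poly to_fract q" using clear_denominators by blast
  have "map_poly \<iota>ac q = map_poly to_ac (map_poly to_fract q)"
    by (intro poly_eqI) (simp add: coeff_map_poly \<iota>ac_def)
  also have "\<dots> = smult (to_ac (to_fract d)) (map_poly to_ac p)"
    unfolding d(2)[symmetric] by (intro poly_eqI) (simp add: coeff_map_poly)
  finally have "poly (map_poly \<iota>ac q) y = 0" using p(2) by simp
  moreover have "q \<noteq> 0"
  proof
    assume "q = 0"
    then have "smult (to_fract d) p = 0" using d(2) by simp
    then show False using d(1) p(1) by simp
  qed
  ultimately show ?thesis by blast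
qed

text \<open>The valuation comes from \<open>valued_field\<close>, with the image of the ring as
  \<open>R\<close>. Uniqueness of the extension is not claimed; that the group acts by isometries
  follows from the integrality of the series instead.\<close>

lemma (in complete_dvr) open_disc_exists: "\<exists>v. open_disc \<pi> \<iota>ac v"
proof -
  interpret \<iota>: inj_idom_hom "\<iota>ac :: 'a \<Rightarrow> _" by (rule inj_\<iota>ac)
  interpret valued_field "range (\<iota>ac :: 'a \<Rightarrow> _)" "\<iota>ac \<pi>"
  proof
    have ra: "a \<in> range \<iota>ac" if "a = \<iota>ac x" for a x using that by simp
    show "0 \<in> range \<iota>ac" by (rule ra[of _ 0]) (simp add: \<iota>ac_def)
    show "1 \<in> range \<iota>ac" by (rule ra[of _ 1]) (simp add: \<iota>ac_def)
    show "a + b \<in> range \<iota>ac" if ab: "a \<in> range \<iota>ac" "b \<in> range \<iota>ac" for a b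
    proof -
      obtain x y where "a = \<iota>ac x" "b = \<iota>ac y" using ab by blast
      then show ?thesis by (intro ra[of _ "x + y"]) (simp add: \<iota>ac_def)
    qed
    show "a * b \<in> range \<iota>ac" if ab: "a \<in> range \<iota>ac" "b \<in> range \<iota>ac" for a b
    proof -
      obtain x y where "a = \<iota>ac x" "b = \<iota>ac y" using ab by blast
      then show ?thesis by (intro ra[of _ "x * y"]) (simp add: \<iota>ac_def)
    qed
    show "- a \<in> range \<iota>ac" if a: "a \<in> range \<iota>ac" for a
    proof -
      obtain x where "a = \<iota>ac x" using a by blast
      then show ?thesis by (intro ra[of _ "- x"]) (simp add: \<iota>ac_def)
    qed
    show "\<iota>ac \<pi> \<in> range \<iota>ac" by simp
    show "inverse (\<iota>ac \<pi>) \<notin> range \<iota>ac"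
    proof
      assume "inverse (\<iota>ac \<pi>) \<in> range \<iota>ac"
      then obtain c where c: "inverse (\<iota>ac \<pi>) = \<iota>ac c" by blast
      have "\<iota>ac (\<pi> * c) = \<iota>ac \<pi> * inverse (\<iota>ac \<pi>)" unfolding c by (rule \<iota>.hom_mult)
      also have "\<dots> = \<iota>ac 1" using pi0 by (simp add: \<iota>ac_def)
      finally have "\<iota>ac (\<pi> * c) = \<iota>ac 1" .
      then have "\<pi> * c = 1" by (simp only: \<iota>.eq_iff)
      then show False using pi_nonunit by (metis dvd_triv_left)
    qed
    show "\<exists>e::nat. c / \<iota>ac \<pi> ^ e \<in> range \<iota>ac \<and> inverse (c / \<iota>ac \<pi> ^ e) \<in> range \<iota>ac"
      if c: "c \<in> range \<iota>ac" "c \<noteq> 0" for c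
    proof -
      obtain x where x: "c = \<iota>ac x" "x \<noteq> 0" using c by auto
      obtain u n where u: "u dvd 1" "x = u * \<pi> ^ n" using factor[OF x(2)] by blast
      obtain u' where u': "1 = u * u'" using u(1) by (rule dvdE)
      have "\<iota>ac \<pi> ^ n \<noteq> 0" using pi0 by simp
      then have q: "c / \<iota>ac \<pi> ^ n = \<iota>ac u" using x u by (simp add: \<iota>.hom_mult \<iota>.hom_power)
      have "\<iota>ac u * \<iota>ac u' = 1" using arg_cong[OF u', of \<iota>ac] by (simp add: \<iota>ac_def)
      then have i: "inverse (\<iota>ac u) = \<iota>ac u'" by (rule inverse_unique)
      show ?thesis by (rule exI[of _ n]) (unfold q i, simp)
    qed
    show "\<exists>p. p \<noteq> 0 \<and> (\<forall>i. coeff p i \<in> range \<iota>ac) \<and> poly p x = 0" for x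
    proof -
      obtain q where q: "q \<noteq> 0" "poly (map_poly \<iota>ac q) x = 0" using algebraic_\<iota>ac by blast
      have "map_poly \<iota>ac q \<noteq> 0"
      proof
        assume z: "map_poly \<iota>ac q = 0"
        have "coeff q i = 0" for i
          using arg_cong[OF z, of "\<lambda>p. coeff p i"] by (simp add: coeff_map_poly \<iota>ac_def)
        then show False using q(1) by (simp add: poly_eq_iff)
      qed
      moreover have "coeff (map_poly \<iota>ac q) i = \<iota>ac (coeff q i)" for i
        by (rule coeff_map_poly) (simp add: \<iota>ac_def)
      then have "coeff (map_poly \<iota>ac q) i \<in> range \<iota>ac" for i by simp
      ultimately show ?thesis using q(2) by (intro exI[of _ "map_poly \<iota>ac q"]) blast
    qed
  qed
  obtain v where "\<forall>x y. x \<noteq> 0 \<longrightarrow> y \<noteq> 0 \<longrightarrow> v (x * y) = v x + v y"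
      "\<forall>x y. x \<noteq> 0 \<longrightarrow> y \<noteq> 0 \<longrightarrow> x + y \<noteq> 0 \<longrightarrow> min (v x) (v y) \<le> v (x + y)"
      "\<forall>c\<in>range \<iota>ac. c \<noteq> 0 \<longrightarrow> v c \<ge> 0" "v (\<iota>ac \<pi>) = (1::rat)"
    using exists_valuation by blast
  then have "open_disc \<pi> \<iota>ac v" using algebraic_\<iota>ac by (intro open_disc.intro open_disc_axioms.intro complete_dvr_axioms inj_\<iota>ac) blast+
  then show ?thesis by blast
qed

context disc_action
begin

text \<open>The distances are divided by \<open>e\<close>, the valuation of \<open>p\<close>,
  because the constants of \<open>delta_mult\<close> presuppose the value 1 at \<open>p\<close>,
  while \<open>v\<close> takes the value 1 at the uniformizer.\<close>

lemma hurwitz_tree_of_disc_action: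
  assumes nt: "carrier G \<noteq> {\<one>}" and p: "prime p" "v (of_nat p) > 0"
  shows "\<exists>\<T> :: (nat, 'g) hurwitz_datum. hurwitz_tree G p \<T> \<and>
     (\<forall>\<sigma>\<in>carrier G - {\<one>}. tree_artin \<T> \<sigma> = - of_nat (card (Fix \<sigma>))) \<and>
     (\<Sum>\<sigma>\<in>carrier G. tree_artin \<T> \<sigma>) = 0 \<and> tree_depth \<T> = (\<lambda>_. 0)"
proof -
  define e where "e = v (of_nat p)"
  have e: "e > 0" using p(2) by (simp add: e_def)
  define wt where "wt b c = v (b - c) / e" for b c
  have Fix_ne: "Fix \<sigma> \<noteq> {}" if s: "\<sigma> \<in> carrier G" "\<sigma> \<noteq> \<one>" for \<sigma>
  proof -
    obtain N where N: "reg N (F (inv \<sigma>) - fps_X)" using reg_ex[OF s] by blast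
    have "N \<noteq> 0"
    proof
      assume "N = 0"
      then have "fps_nth (F (inv \<sigma>)) 0 dvd 1" using N by (simp add: reg_def)
      then show False using F_0[of "inv \<sigma>"] s(1) pi_nonunit dvd_trans by blast
    qed
    then show ?thesis using fixed_point_formula(1)[OF s N] by auto
  qed
  obtain \<sigma>0 where s0: "\<sigma>0 \<in> carrier G" "\<sigma>0 \<noteq> \<one>" using nt G.one_closed by blast
  have B_ne: "B \<noteq> {}" using Fix_ne[OF s0] s0 by (auto simp: B_def)
  have wv: "wt b c \<le> wt b' c' \<longleftrightarrow> v (b - c) \<le> v (b' - c')" for b c b' c'
    using e by (simp add: wt_def divide_le_cancel)
  have ge_iff: "ge (v (b - c)) (b' - b) \<longleftrightarrow> b' = b \<or> wt b c \<le> wt b b'" for b c b'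
    unfolding wv using v_minus_commute[of b b'] by (auto simp: ge_def)
  interpret ua: ultrametric_action G B act wt
  proof
    show "finite (carrier G)" "finite B" "B \<noteq> {}" by (rule fin, rule finite_B, rule B_ne)
    show "act \<sigma> b \<in> B" if "\<sigma> \<in> carrier G" "b \<in> B" for \<sigma> b by (rule act_B[OF that])
    show "act \<one> b = b" if "b \<in> B" for b by (rule act_one[OF B_disc[OF that]])
    show "act (\<sigma> \<otimes> \<tau>) b = act \<sigma> (act \<tau> b)" if "\<sigma> \<in> carrier G" "\<tau> \<in> carrier G" "b \<in> B" for \<sigma> \<tau> b
      by (rule act_mult[OF that(1,2) B_disc[OF that(3)]])
    show "wt b c > 0" if bc: "b \<in> B" "c \<in> B" "b \<noteq> c" for b c
    proof -
      obtain t where t: "t > 0" "ge t b" "ge t c"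
      proof -
        define t where "t = min (if b = 0 then 1 else v b) (if c = 0 then 1 else v c)"
        have "t > 0" "ge t b" "ge t c" using B_disc[OF bc(1)] B_disc[OF bc(2)] by (auto simp: t_def ge_def)
        then show ?thesis by (rule that)
      qed
      have "ge t (b - c)" by (rule ge_diff[OF t(2,3)])
      then have "v (b - c) > 0" using t(1) bc(3) by (auto simp: ge_def)
      then show ?thesis using e by (simp add: wt_def)
    qed
    show "wt b c = wt c b" for b c by (simp add: wt_def v_minus_commute[of b c])
    show "min (wt a b) (wt b c) \<le> wt a c" if "a \<noteq> b" "b \<noteq> c" "a \<noteq> c" for a b c
    proof -
      have "min (v (a - b)) (v (b - c)) \<le> v (a - c)" using v_add[of "a - b" "b - c"] that by (simp add: diff_add_eq)
      then show ?thesis by (auto simp: min_def wv)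
    qed
    show "wt (act \<sigma> b) (act \<sigma> c) = wt b c" if s: "\<sigma> \<in> carrier G" "b \<in> B" "c \<in> B" for \<sigma> b c
    proof (cases "b = c")
      case True
      then show ?thesis by (simp add: wt_def)
    next
      case False
      then show ?thesis using v_act[OF s(1) B_disc[OF s(2)] B_disc[OF s(3)]] by (simp add: wt_def)
    qed
  qed
  let ?fx = "\<lambda>\<sigma>. {b \<in> B. act \<sigma> b = b}"
  let ?tr = "\<lambda>\<rho> b y. if y = b then \<rho> else min \<rho> (wt b y)"
  let ?m = "\<lambda>b \<rho> \<sigma>. (\<Sum>y\<in>?fx \<sigma>. ?tr \<rho> b y) - \<rho>"
  have m_eq: "?m b (wt b c) \<sigma> = m b (v (b - c)) \<sigma> / e" if s: "\<sigma> \<in> carrier G" "\<sigma> \<noteq> \<one>" for b c \<sigma>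
  proof -
    have "?tr (wt b c) b y = cap (v (b - c)) (b - y) / e" for y
      using e by (auto simp: cap_def wt_def min_def divide_le_cancel)
    then have t: "(\<Sum>y\<in>?fx \<sigma>. ?tr (wt b c) b y) = (\<Sum>y\<in>?fx \<sigma>. cap (v (b - c)) (b - y) / e)" by (rule sum.cong[OF refl])
    show ?thesis unfolding t m_def Fix_B[OF s] unfolding sum_divide_distrib diff_divide_distrib wt_def by (rule refl)
  qed
  have S_div: "(\<Sum>y\<in>?fx \<tau> - {b}. wt b y) = S b \<tau> / e" if "\<tau> \<in> carrier G" "\<tau> \<noteq> \<one>" for b \<tau>
    unfolding S_def Fix_B[OF that] unfolding sum_divide_distrib wt_def by (rule refl)
  let ?st = "\<lambda>b. {\<sigma> \<in> carrier G. act \<sigma> b = b}"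
  interpret ha: hurwitz_action G B act wt p ?fx ?tr ?m ?st
  proof (unfold_locales)
    show "{\<sigma> \<in> carrier G. act \<sigma> b = b} \<noteq> {\<one>}" if "b \<in> B" for b using that by (auto simp: B_def Fix_def)
    show "cyclic_group (G\<lparr>carrier := {\<sigma> \<in> carrier G. act \<sigma> b = b}\<rparr>)" if "b \<in> B" for b
      unfolding Stab_def[symmetric] by (rule Stab_cyclic[OF that])
    show "?m b (wt b c) \<sigma> \<ge> 0"
      if h: "b \<in> B" "c \<in> B" "c \<noteq> b" "\<sigma> \<in> carrier G" "\<sigma> \<noteq> \<one>" "act \<sigma> b = b \<or> wt b c \<le> wt b (act \<sigma> b)" for b c \<sigma>
    proof -
      have "ge (v (b - c)) (act \<sigma> b - b)" unfolding ge_iff by (rule h(6))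
      from m_nonneg[OF h(1-5) this] show ?thesis unfolding m_eq[OF h(4,5)] using e by simp
    qed
    show "?m b (wt b c) (\<sigma> \<otimes> \<tau>) \<ge> min (?m b (wt b c) \<sigma>) (?m b (wt b c) \<tau>)"
      if h: "b \<in> B" "c \<in> B" "c \<noteq> b" "\<sigma> \<in> carrier G" "\<tau> \<in> carrier G" "\<sigma> \<noteq> \<one>" "\<tau> \<noteq> \<one>" "\<sigma> \<otimes> \<tau> \<noteq> \<one>"
        "act \<sigma> b = b \<or> wt b c \<le> wt b (act \<sigma> b)" "act \<tau> b = b \<or> wt b c \<le> wt b (act \<tau> b)" for b c \<sigma> \<tau>
    proof -
      have st: "\<sigma> \<otimes> \<tau> \<in> carrier G" using h by simp
      have "min (m b (v (b - c)) \<sigma>) (m b (v (b - c)) \<tau>) \<le> m b (v (b - c)) (\<sigma> \<otimes> \<tau>)"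
        by (rule m_mult[OF h(1-4) h(6,5,7,8)]) (unfold ge_iff, rule h(10))
      then show ?thesis unfolding m_eq[OF h(4,6)] m_eq[OF h(5,7)] m_eq[OF st h(8)]
        using e by (auto simp: min_def divide_le_cancel)
    qed
    show "wt b (act \<sigma> b) > wt b c"
      if h: "b \<in> B" "c \<in> B" "c \<noteq> b" "\<sigma> \<in> carrier G" "\<sigma> \<noteq> \<one>" "?m b (wt b c) \<sigma> > 0" "act \<sigma> b \<noteq> b" for b c \<sigma>
    proof -
      have pos: "m b (v (b - c)) \<sigma> > 0" using h(6) e unfolding m_eq[OF h(4,5)] by (simp add: zero_less_divide_iff)
      have "v (act \<sigma> b - b) > v (b - c)" by (rule m_pos[OF h(1) h(1) _ h(4,5) pos h(7)]) simp
      then show ?thesis using e v_minus_commute[of b "act \<sigma> b"] by (simp add: wt_def divide_strict_right_mono)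
    qed
    show "delta_mult p G P \<tau> = - of_nat (card P) * of_rat (\<Sum>y\<in>?fx \<tau> - {b}. wt b y)"
      if h: "b \<in> B" "sylow_subgroup p G {\<sigma> \<in> carrier G. act \<sigma> b = b} P" "\<tau> \<in> P" "\<tau> \<noteq> \<one>" for b P \<tau>
    proof -
      have t: "\<tau> \<in> carrier G" using subgroup.mem_carrier[OF P_sub(1)[OF h(1) p h(2)[folded Stab_def]] h(3)] .
      show ?thesis unfolding S_div[OF t h(4)] e_def by (rule delta_mult_Sylow(1)[OF h(1) p h(2-4)[folded Stab_def]])
    qed
    show "(\<Sum>\<tau>\<in>P. delta_mult p G P \<tau>) = 0" if h: "b \<in> B" "sylow_subgroup p G {\<sigma> \<in> carrier G. act \<sigma> b = b} P" for b P
      by (rule delta_mult_Sylow(2)[OF h(1) p h(2)[folded Stab_def]])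
    show "(\<Sum>y\<in>?fx \<tau> - {b}. wt b y) = 0"
      if h: "b \<in> B" "sylow_subgroup p G {\<sigma> \<in> carrier G. act \<sigma> b = b} P" "\<tau> \<in> {\<sigma> \<in> carrier G. act \<sigma> b = b}" "\<tau> \<notin> P" for b P \<tau>
    proof -
      have "\<tau> \<noteq> \<one>" using subgroup.one_closed[OF P_sub(1)[OF h(1) p h(2)[folded Stab_def]]] h(4) by blast
      moreover have "\<tau> \<in> carrier G" using h(3) by simp
      ultimately show ?thesis using S_div S_off_Sylow[OF h(1) p h(2-4)[folded Stab_def]] by simp
    qed
  qed ((rule reflexive)+)?
  from ha.hurwitz_tree_exists obtain \<T> :: "(nat, 'g) hurwitz_datum" where T0: "hurwitz_tree G p \<T> \<and>
      tree_artin \<T> = ha.zext (\<lambda>\<sigma>. - of_nat (card (?fx \<sigma>))) \<and> tree_depth \<T> = (\<lambda>_. 0)"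
    by (rule exE)
  note T = conjunct1[OF T0] conjunct1[OF conjunct2[OF T0]] conjunct2[OF conjunct2[OF T0]]
  have "tree_artin \<T> \<sigma> = - of_nat (card (Fix \<sigma>))" if "\<sigma> \<in> carrier G - {\<one>}" for \<sigma>
    using T(2) Fix_B[of \<sigma>] that by (simp add: ha.zext_def)
  moreover have "(\<Sum>\<sigma>\<in>carrier G. tree_artin \<T> \<sigma>) = 0" unfolding T(2) by (rule ha.zext_sum)
  ultimately show ?thesis using T(1,3) by (intro exI[of _ \<T>] conjI ballI)
qed

end

section \<open>From a lift of the local action to an action on the disc\<close>

lemma additive_zero:
  fixes f :: "'a::comm_ring_1 \<Rightarrow> 'b::comm_ring_1"
  assumes "\<And>a b. f (a + b) = f a + f b"
  shows "f 0 = 0"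
proof -
  have "f 0 + f 0 = f 0" using assms[of 0 0] unfolding add_0_left by (rule sym)
  then have "f 0 + f 0 - f 0 = f 0 - f 0" by (rule arg_cong)
  then show ?thesis by (simp only: add_diff_cancel_right' diff_self)
qed

locale lifted_action = dvr_completion \<pi> + G: group G
  for \<pi> :: "'r::comm_ring_1" and G :: "('g, 'm) monoid_scheme" (structure) +
  fixes \<rho> :: "'r \<Rightarrow> 'k::alg_closed_field" and \<phi> :: "'g \<Rightarrow> 'k fps \<Rightarrow> 'k fps" and \<psi> :: "'g \<Rightarrow> 'r fps \<Rightarrow> 'r fps"
  assumes finG: "finite (carrier G)"
    and char0: "\<And>n. n > 0 \<Longrightarrow> of_nat n \<noteq> (0::'r)"
    and rho: "\<And>a b. \<rho> (a + b) = \<rho> a + \<rho> b" "\<And>a b. \<rho> (a * b) = \<rho> a * \<rho> b" "\<rho> 1 = 1" "surj \<rho>"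
    and rho_0: "\<And>c. \<rho> c = 0 \<longleftrightarrow> \<pi> dvd c"
    and psi: "\<And>\<sigma> f g. \<sigma> \<in> carrier G \<Longrightarrow> \<psi> \<sigma> (f + g) = \<psi> \<sigma> f + \<psi> \<sigma> g"
      "\<And>\<sigma> f g. \<sigma> \<in> carrier G \<Longrightarrow> \<psi> \<sigma> (f * g) = \<psi> \<sigma> f * \<psi> \<sigma> g"
      "\<And>\<sigma> c. \<sigma> \<in> carrier G \<Longrightarrow> \<psi> \<sigma> (fps_const c) = fps_const c"
      "\<And>\<sigma> \<tau> f. \<sigma> \<in> carrier G \<Longrightarrow> \<tau> \<in> carrier G \<Longrightarrow> \<psi> (\<sigma> \<otimes> \<tau>) f = \<psi> \<sigma> (\<psi> \<tau> f)"
      "\<And>f. \<psi> \<one> f = f"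
    and phi: "\<And>\<sigma> f g. \<sigma> \<in> carrier G \<Longrightarrow> \<phi> \<sigma> (f + g) = \<phi> \<sigma> f + \<phi> \<sigma> g"
      "\<And>\<sigma> f g. \<sigma> \<in> carrier G \<Longrightarrow> \<phi> \<sigma> (f * g) = \<phi> \<sigma> f * \<phi> \<sigma> g"
      "\<And>\<sigma> c. \<sigma> \<in> carrier G \<Longrightarrow> \<phi> \<sigma> (fps_const c) = fps_const c"
      "\<And>\<sigma> \<tau> f. \<sigma> \<in> carrier G \<Longrightarrow> \<tau> \<in> carrier G \<Longrightarrow> \<phi> (\<sigma> \<otimes> \<tau>) f = \<phi> \<sigma> (\<phi> \<tau> f)"
      "\<And>f. \<phi> \<one> f = f"
      "\<And>\<sigma>. \<sigma> \<in> carrier G \<Longrightarrow> (\<And>f. \<phi> \<sigma> f = f) \<Longrightarrow> \<sigma> = \<one>"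
    and reduction: "\<And>\<sigma> f. \<sigma> \<in> carrier G \<Longrightarrow> Abs_fps (\<rho> \<circ> fps_nth (\<psi> \<sigma> f)) = \<phi> \<sigma> (Abs_fps (\<rho> \<circ> fps_nth f))"
begin

lemma rho_simps: "\<rho> 0 = 0" "\<rho> (a - b) = \<rho> a - \<rho> b"
proof -
  show "\<rho> 0 = 0" by (rule additive_zero) (rule rho(1))
  show "\<rho> (a - b) = \<rho> a - \<rho> b" using rho(1)[of "a - b" b] by simp
qed

lemma reduction_X: "\<sigma> \<in> carrier G \<Longrightarrow> fps_nth (\<phi> \<sigma> fps_X) i = \<rho> (fps_nth (\<psi> \<sigma> fps_X) i)"
proof -
  assume s: "\<sigma> \<in> carrier G"
  have "Abs_fps (\<rho> \<circ> fps_nth fps_X) = (fps_X :: 'k fps)"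
    by (intro fps_ext) (simp add: fps_X_nth rho_simps rho)
  then show ?thesis using arg_cong[OF reduction[OF s, of fps_X], of "\<lambda>f. fps_nth f i"] by simp
qed

text \<open>Automorphisms preserve nonunits: if the image of the variable were invertible, applying
  the inverse group element would make the variable itself invertible.\<close>

lemma phi_X_0: "\<sigma> \<in> carrier G \<Longrightarrow> fps_nth (\<phi> \<sigma> fps_X) 0 = 0"
proof (rule ccontr)
  assume s: "\<sigma> \<in> carrier G" and n: "fps_nth (\<phi> \<sigma> fps_X) 0 \<noteq> 0"
  let ?i = "inverse (\<phi> \<sigma> fps_X)"
  have i: "inv \<sigma> \<in> carrier G" using s by simp
  have "?i * \<phi> \<sigma> fps_X = fps_const 1" using inverse_mult_eq_1[OF n] by simp
  then have "\<phi> (inv \<sigma>) (?i * \<phi> \<sigma> fps_X) = 1" using phi(3)[OF i, of 1] by simp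
  moreover have "\<phi> (inv \<sigma>) (\<phi> \<sigma> fps_X) = fps_X" using phi(4)[OF i s, of fps_X] phi(5)[of fps_X] s by simp
  ultimately have "\<phi> (inv \<sigma>) ?i * fps_X = 1" using phi(2)[OF i, of ?i "\<phi> \<sigma> fps_X"] by simp
  then have "fps_nth (\<phi> (inv \<sigma>) ?i * fps_X) 0 = 1" by simp
  then show False by simp
qed

text \<open>No continuity of the automorphism is assumed. Splitting off constant terms shows that
  \<open>\<phi> \<sigma> f - f\<close> is divisible by every power of the variable.\<close>

lemma phi_X_eq: "\<sigma> \<in> carrier G \<Longrightarrow> \<phi> \<sigma> fps_X = fps_X \<Longrightarrow> \<sigma> = \<one>"
proof (rule phi(6))
  assume s: "\<sigma> \<in> carrier G" and x: "\<phi> \<sigma> fps_X = fps_X"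
  fix f
  have step: "\<phi> \<sigma> f - f = fps_X * (\<phi> \<sigma> (fps_shift 1 f) - fps_shift 1 f)" for f :: "'k fps"
  proof -
    have e: "f = fps_const (fps_nth f 0) + fps_X * fps_shift 1 f" by (simp add: fps_eq_iff fps_X_mult_nth)
    have "\<phi> \<sigma> f = \<phi> \<sigma> (fps_const (fps_nth f 0) + fps_X * fps_shift 1 f)" by (rule arg_cong[OF e, of "\<phi> \<sigma>"])
    then have "\<phi> \<sigma> f = fps_const (fps_nth f 0) + fps_X * \<phi> \<sigma> (fps_shift 1 f)"
      unfolding phi(1)[OF s] phi(2)[OF s] phi(3)[OF s] x .
    then have "\<phi> \<sigma> f - (fps_const (fps_nth f 0) + fps_X * fps_shift 1 f) = fps_X * (\<phi> \<sigma> (fps_shift 1 f) - fps_shift 1 f)"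
      by (simp add: algebra_simps)
    then show ?thesis unfolding e[symmetric] .
  qed
  have "fps_nth (\<phi> \<sigma> f - f) n = 0" for n
  proof (induction n arbitrary: f)
    case 0
    show ?case unfolding step[of f] by simp
  next
    case (Suc n)
    have "fps_nth (\<phi> \<sigma> f - f) (Suc n) = fps_nth (\<phi> \<sigma> (fps_shift 1 f) - fps_shift 1 f) n" unfolding step[of f] by (simp add: fps_X_mult_nth)
    then show ?case using Suc.IH by simp
  qed
  then show "\<phi> \<sigma> f = f" by (simp add: fps_eq_iff)
qed

definition F :: "'g \<Rightarrow> 'r completion fps" where "F \<sigma> = Abs_fps (\<lambda>i. emb (fps_nth (\<psi> \<sigma> fps_X) i))"

definition val :: "'r completion fract alg_closure \<Rightarrow> rat" where "val = (SOME v. open_disc (cls fps_X) \<iota>ac v)"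

sublocale od: open_disc "cls fps_X :: 'r completion" "\<iota>ac" val
  unfolding val_def by (rule someI_ex[OF cd.open_disc_exists])

text \<open>The left side is a ring homomorphism in \<open>f\<close> with integral values, known on
  constants and on the variable, so \<open>bounded_hom_eq_ev\<close> identifies it. With the series
  of a second group element for \<open>f\<close>, this becomes the composition rule of the
  action.\<close>

lemma psi_ev:
  assumes s: "\<sigma> \<in> carrier G" and y: "od.disc y"
  shows "od.ev y (Abs_fps (\<lambda>i. emb (fps_nth (\<psi> \<sigma> f) i))) = od.ev (od.ev y (F \<sigma>)) (Abs_fps (\<lambda>i. emb (fps_nth f i)))"
proof -
  let ?e = "\<lambda>f. Abs_fps (\<lambda>i. emb (fps_nth f i))"
  have add: "?e (f + g) = ?e f + ?e g" for f g by (simp add: fps_eq_iff emb_simps)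
  have emb_sum: "emb (sum h I) = (\<Sum>i\<in>I. emb (h i))" for h :: "nat \<Rightarrow> 'r" and I
    by (induction I rule: infinite_finite_induct) (simp_all add: emb_simps)
  have mult: "?e (f * g) = ?e f * ?e g" for f g by (simp add: fps_eq_iff fps_mult_nth emb_sum emb_simps)
  have const: "?e (fps_const c) = fps_const (emb c)" for c by (simp add: fps_eq_iff emb_simps)
  have d: "od.disc (od.ev y (F \<sigma>))"
  proof (rule od.ev_disc[OF y])
    have "\<rho> (fps_nth (\<psi> \<sigma> fps_X) 0) = 0" using phi_X_0[OF s] reduction_X[OF s, of 0] by simp
    then show "cls fps_X dvd fps_nth (F \<sigma>) 0" using rho_0 dvd_emb by (simp add: F_def)
  qed
  show ?thesis
  proof (rule od.bounded_hom_eq_ev[OF d, of "\<lambda>f. od.ev y (?e (\<psi> \<sigma> f))" emb])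
    show "od.ev y (?e (\<psi> \<sigma> (f + g))) = od.ev y (?e (\<psi> \<sigma> f)) + od.ev y (?e (\<psi> \<sigma> g))" for f g
      unfolding psi(1)[OF s] add by (rule od.ev_add[OF y])
    show "od.ev y (?e (\<psi> \<sigma> (f * g))) = od.ev y (?e (\<psi> \<sigma> f)) * od.ev y (?e (\<psi> \<sigma> g))" for f g
      unfolding psi(2)[OF s] mult by (rule od.ev_mult[OF y])
    show "od.ev y (?e (\<psi> \<sigma> (fps_const c))) = \<iota>ac (emb c)" for c
      unfolding psi(3)[OF s] const by (rule od.ev_const[OF y])
    show "od.ev y (?e (\<psi> \<sigma> fps_X)) = od.ev y (F \<sigma>)" by (simp add: F_def)
    show "od.ge 0 (od.ev y (?e (\<psi> \<sigma> f)))" for f by (rule od.ev_ge[OF y])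
  qed
qed

text \<open>The uniformizer generates the kernel of the reduction, and completion keeps divisibility
  by it; so the order of the reduction can be read off the local action.\<close>

lemma reg_F: "\<sigma> \<in> carrier G \<Longrightarrow> cls fps_X dvd fps_nth (F \<sigma> - fps_X) i \<longleftrightarrow> fps_nth (\<phi> \<sigma> fps_X - fps_X) i = 0"
proof -
  assume s: "\<sigma> \<in> carrier G"
  have "fps_nth (F \<sigma> - fps_X) i = emb (fps_nth (\<psi> \<sigma> fps_X - fps_X) i)"
    by (simp add: F_def emb_simps fps_X_nth)
  then have "cls fps_X dvd fps_nth (F \<sigma> - fps_X) i \<longleftrightarrow> \<rho> (fps_nth (\<psi> \<sigma> fps_X - fps_X) i) = 0"
    by (simp only: dvd_emb rho_0)
  also have "\<rho> (fps_nth (\<psi> \<sigma> fps_X - fps_X) i) = fps_nth (\<phi> \<sigma> fps_X - fps_X) i"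
    using reduction_X[OF s, of i] by (simp add: rho_simps rho fps_X_nth)
  finally show ?thesis .
qed

lemma \<iota>ac_of_nat: "\<iota>ac (of_nat n :: 'r completion) = of_nat n"
  by (induction n) (simp_all add: \<iota>ac_def)

text \<open>Over a finite field, the product of all \<open>X - c\<close> plus 1 would have no
  root.\<close>

lemma infinite_residues: "infinite (UNIV :: 'k set)"
proof
  assume fin: "finite (UNIV :: 'k set)"
  define P :: "'k poly" where "P = (\<Prod>c\<in>UNIV. [:- c, 1:]) + 1"
  have d: "degree (\<Prod>c\<in>(UNIV::'k set). [:- c, 1:]) = card (UNIV :: 'k set)"
    by (subst degree_prod_eq_sum_degree) auto
  have c: "card (UNIV :: 'k set) > 0" using fin by (simp add: card_gt_0_iff)
  have "degree P = card (UNIV :: 'k set)" unfolding P_def using d c by (subst degree_add_eq_left) auto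
  then obtain x where x: "poly P x = 0" using alg_closed_imp_poly_has_root[of P] c by auto
  have "poly (\<Prod>c\<in>(UNIV::'k set). [:- c, 1:]) x = (\<Prod>c\<in>UNIV. x - c)" by (simp add: poly_prod)
  also have "\<dots> = 0" using fin by (auto simp: prod_zero_iff)
  finally show False using x by (simp add: P_def)
qed

sublocale da: disc_action "cls fps_X :: 'r completion" "\<iota>ac" val G F
proof
  show "finite (carrier G)" by (rule finG)
  show "cls fps_X dvd fps_nth (F \<sigma>) 0" if s: "\<sigma> \<in> carrier G" for \<sigma>
    using phi_X_0[OF s] reg_F[OF s, of 0] by simp
  show "F \<one> = fps_X" by (simp add: F_def psi fps_eq_iff fps_X_nth emb_simps)
  show "od.ev y (F (\<sigma> \<otimes> \<tau>)) = od.ev (od.ev y (F \<sigma>)) (F \<tau>)"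
    if h: "\<sigma> \<in> carrier G" "\<tau> \<in> carrier G" "od.disc y" for \<sigma> \<tau> y
    using psi_ev[OF h(1,3), of "\<psi> \<tau> fps_X"] unfolding F_def[of \<tau>] F_def[of "\<sigma> \<otimes> \<tau>"] psi(4)[OF h(1,2)] .
  show "\<not> cd.D 1 (F \<sigma> - fps_X)" if s: "\<sigma> \<in> carrier G" "\<sigma> \<noteq> \<one>" for \<sigma>
  proof
    assume "cd.D 1 (F \<sigma> - fps_X)"
    then have "cls fps_X dvd fps_nth (F \<sigma> - fps_X) i" for i unfolding cd.D_def by simp
    then have "fps_nth (\<phi> \<sigma> fps_X - fps_X) i = 0" for i using reg_F[OF s(1)] by blast
    then have "\<phi> \<sigma> fps_X = fps_X" by (simp add: fps_eq_iff)
    then show False using phi_X_eq s by blast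
  qed
  show "of_nat n \<noteq> (0 :: 'r completion fract alg_closure)" if "n > 0" for n
  proof -
    have "(of_nat n :: 'r completion) \<noteq> 0" using char0[OF that] emb_eq_0[of "of_nat n"] by (simp add: emb_of_nat)
    then have "\<iota>ac (of_nat n :: 'r completion) \<noteq> 0" by (simp add: \<iota>ac_def)
    then show ?thesis by (simp add: \<iota>ac_of_nat)
  qed
  show "\<exists>a. \<forall>z\<in>Z. \<iota>ac a - z \<noteq> 0 \<and> val (\<iota>ac a - z) = 0" if Z: "finite Z" "\<And>z. z \<in> Z \<Longrightarrow> od.ge 0 z" for Z
  proof -
    \<comment> \<open>Residue classes of constants that come too close to \<open>z\<close>. Two such
      constants differ by a nonunit, so each \<open>z\<close> excludes at most one class, and the
      infinite residue field leaves one over.\<close>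
    define bad where "bad z = {c. \<exists>a. c = \<rho> a \<and> \<not> (\<iota>ac (emb a) - z \<noteq> 0 \<and> val (\<iota>ac (emb a) - z) = 0)}" for z
    have one: "c = c'" if z: "z \<in> Z" and c: "c \<in> bad z" "c' \<in> bad z" for z c c'
    proof -
      have pos: "x = 0 \<or> val x > 0" if "od.ge 0 x" "\<not> (x \<noteq> 0 \<and> val x = 0)" for x
        using that by (auto simp: od.ge_def)
      obtain a a' where a: "c = \<rho> a" "c' = \<rho> a'" "\<not> (\<iota>ac (emb a) - z \<noteq> 0 \<and> val (\<iota>ac (emb a) - z) = 0)"
          "\<not> (\<iota>ac (emb a') - z \<noteq> 0 \<and> val (\<iota>ac (emb a') - z) = 0)" using c unfolding bad_def by blast
      let ?x = "\<iota>ac (emb a) - z" and ?y = "\<iota>ac (emb a') - z"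
      have xy: "?x = 0 \<or> val ?x > 0" "?y = 0 \<or> val ?y > 0"
        using pos[OF od.ge_diff[OF od.ge_iota Z(2)[OF z]] a(3)] pos[OF od.ge_diff[OF od.ge_iota Z(2)[OF z]] a(4)] by auto
      have e: "\<iota>ac (emb (a - a')) = ?x + - ?y" by (simp add: emb_simps \<iota>ac_def)
      have "\<not> emb (a - a') dvd 1"
      proof
        assume u: "emb (a - a') dvd 1"
        have v0: "val (?x + - ?y) = 0" using od.v_unit[OF u] e by simp
        have nz: "?x + - ?y \<noteq> 0" 
        proof
          assume "?x + - ?y = 0"
          then have "\<iota>ac (emb (a - a')) = 0" using e by simp
          then have "emb (a - a') = 0" by (simp add: \<iota>ac_def)
          then show False using u by simp
        qed
        show False
        proof (cases "?x = 0 \<or> ?y = 0")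
          case True
          then show False using v0 nz xy od.v_uminus[of ?y] by auto
        next
          case False
          then have "min (val ?x) (val (- ?y)) \<le> val (?x + - ?y)" using nz by (intro od.v_add) auto
          then show False using v0 xy False od.v_uminus[of ?y] by auto
        qed
      qed
      then have "cls fps_X dvd emb (a - a')" using cd.unit_or_dvd by blast
      then have "\<rho> (a - a') = 0" using dvd_emb rho_0 by blast
      then show ?thesis using a(1,2) by (simp add: rho_simps)
    qed
    have "finite (bad z)" if "z \<in> Z" for z
    proof (cases "bad z = {}")
      case False
      then obtain c where "c \<in> bad z" by blast
      then have "bad z \<subseteq> {c}" using one[OF that] by blast
      then show ?thesis by (rule finite_subset) simp
    qed simp
    then have "finite (\<Union>z\<in>Z. bad z)" using Z(1) by simp
    then obtain c where c: "c \<notin> (\<Union>z\<in>Z. bad z)" using infinite_residues ex_new_if_finite by blast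
    obtain a where "c = \<rho> a" using rho(4) by (metis surjD)
    then show ?thesis using c unfolding bad_def by blast
  qed
qed

text \<open>The number of fixed points of \<open>\<sigma>\<close> in the disc and the order of
  \<open>\<phi> \<sigma> fps_X - fps_X\<close> are both the degree of the same distinguished
  polynomial; this turns the character of the trunk into the Artin character.\<close>

theorem hurwitz_tree_of_lift:
  assumes nt: "carrier G \<noteq> {\<one>}" and p: "prime p" "\<rho> (of_nat p) = 0"
  shows "\<exists>\<T> :: (nat, 'g) hurwitz_datum. hurwitz_tree G p \<T> \<and>
           (\<forall>\<sigma>\<in>carrier G. tree_artin \<T> \<sigma> = artin_char G \<phi> \<sigma>) \<and>
           (\<forall>\<sigma>\<in>carrier G. tree_depth \<T> \<sigma> = 0)"
proof -
  have "cls fps_X dvd (of_nat p :: 'r completion)" using p(2) rho_0 dvd_emb[of "of_nat p"] by (simp add: emb_of_nat)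
  then have "od.ge 1 (\<iota>ac (of_nat p :: 'r completion))" by (rule od.v_dvd_pi)
  moreover have "\<iota>ac (of_nat p :: 'r completion) = of_nat p" by (rule \<iota>ac_of_nat)
  moreover have "of_nat p \<noteq> (0 :: 'r completion fract alg_closure)" using p(1) by (intro da.of_nat_nz) (simp add: prime_gt_0_nat)
  ultimately have vp: "val (of_nat p) > 0" by (simp add: od.ge_def)
  from da.hurwitz_tree_of_disc_action[OF nt p(1) vp] obtain \<T> :: "(nat, 'g) hurwitz_datum"
    where T0: "hurwitz_tree G p \<T> \<and> (\<forall>\<sigma>\<in>carrier G - {\<one>}. tree_artin \<T> \<sigma> = - of_nat (card (da.Fix \<sigma>))) \<and>
      (\<Sum>\<sigma>\<in>carrier G. tree_artin \<T> \<sigma>) = 0 \<and> tree_depth \<T> = (\<lambda>_. 0)" by (rule exE)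
  note T = conjunct1[OF T0] bspec[OF conjunct1[OF conjunct2[OF T0]]] conjunct1[OF conjunct2[OF conjunct2[OF T0]]]
    conjunct2[OF conjunct2[OF conjunct2[OF T0]]]
  have sd: "subdegree (\<phi> \<sigma> fps_X - fps_X) = card (da.Fix \<sigma>)" if s: "\<sigma> \<in> carrier G" "\<sigma> \<noteq> \<one>" for \<sigma>
  proof -
    \<comment> \<open>\<open>act\<close> is defined with the inverse, so the series of
      \<open>\<sigma>\<close> itself describes the fixed points of \<open>inv \<sigma>\<close>,
      which are those of \<open>\<sigma>\<close>.\<close>
    have i: "inv \<sigma> \<in> carrier G" "inv \<sigma> \<noteq> \<one>" using s by (simp_all add: G.inv_eq_1_iff)
    obtain N where N: "cd.reg N (F (inv (inv \<sigma>)) - fps_X)" using da.reg_ex[OF i] by blast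
    have card: "card (da.Fix \<sigma>) = N" using da.fixed_point_formula(1)[OF i N] da.Fix_inv[OF s(1)] by simp
    have N': "cd.reg N (F \<sigma> - fps_X)" using N s by simp
    have "\<not> cls fps_X dvd fps_nth (F \<sigma> - fps_X) N"
      using N' cd.pi_nonunit dvd_trans unfolding cd.reg_def by blast
    then have "fps_nth (\<phi> \<sigma> fps_X - fps_X) N \<noteq> 0" using reg_F[OF s(1)] by blast
    moreover have "fps_nth (\<phi> \<sigma> fps_X - fps_X) i = 0" if "i < N" for i
      using N' that reg_F[OF s(1)] unfolding cd.reg_def by blast
    ultimately show ?thesis unfolding card by (intro subdegreeI) auto
  qed
  have off: "tree_artin \<T> \<sigma> = - of_nat (subdegree (\<phi> \<sigma> fps_X - fps_X))" if "\<sigma> \<in> carrier G - {\<one>}" for \<sigma>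
    using T(2)[OF that] sd that by simp
  have "tree_artin \<T> \<sigma> = artin_char G \<phi> \<sigma>" if s: "\<sigma> \<in> carrier G" for \<sigma>
  proof (cases "\<sigma> = \<one>")
    case True
    have "tree_artin \<T> \<one> + (\<Sum>\<tau>\<in>carrier G - {\<one>}. tree_artin \<T> \<tau>) = 0"
      using T(3) sum.remove[OF finG G.one_closed, of "tree_artin \<T>"] by simp
    then have "tree_artin \<T> \<one> = - (\<Sum>\<tau>\<in>carrier G - {\<one>}. tree_artin \<T> \<tau>)" by (simp add: add_eq_0_iff2)
    also have "(\<Sum>\<tau>\<in>carrier G - {\<one>}. tree_artin \<T> \<tau>) = (\<Sum>\<tau>\<in>carrier G - {\<one>}. - of_nat (subdegree (\<phi> \<tau> fps_X - fps_X)))"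
      by (rule sum.cong[OF refl off])
    finally show ?thesis using True by (simp add: artin_char_def Let_def)
  next
    case False
    then show ?thesis using off s by (simp add: artin_char_def Let_def)
  qed
  then show ?thesis using T(1,4) by auto
qed

end

lemma (in group) fps_action:
  assumes f: "faithful_fps_action G \<phi>"
  shows "\<And>\<sigma> f g. \<sigma> \<in> carrier G \<Longrightarrow> \<phi> \<sigma> (f + g) = \<phi> \<sigma> f + \<phi> \<sigma> g"
    "\<And>\<sigma> f g. \<sigma> \<in> carrier G \<Longrightarrow> \<phi> \<sigma> (f * g) = \<phi> \<sigma> f * \<phi> \<sigma> g"
    "\<And>\<sigma> c. \<sigma> \<in> carrier G \<Longrightarrow> \<phi> \<sigma> (fps_const c) = fps_const c"
    "\<And>\<sigma> \<tau> f. \<sigma> \<in> carrier G \<Longrightarrow> \<tau> \<in> carrier G \<Longrightarrow> \<phi> (\<sigma> \<otimes> \<tau>) f = \<phi> \<sigma> (\<phi> \<tau> f)"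
    "\<And>f. \<phi> \<one> f = f"
    "\<And>\<sigma>. \<sigma> \<in> carrier G \<Longrightarrow> (\<And>f. \<phi> \<sigma> f = f) \<Longrightarrow> \<sigma> = \<one>"
proof -
  have h: "\<phi> \<in> hom G fps_Aut" and inj: "inj_on \<phi> (carrier G)" using f by (auto simp: faithful_fps_action_def)
  have A: "\<phi> \<sigma> \<in> carrier fps_Aut" if "\<sigma> \<in> carrier G" for \<sigma> using hom_in_carrier[OF h that] .
  have R: "\<phi> \<sigma> (x + y) = \<phi> \<sigma> x + \<phi> \<sigma> y \<and> \<phi> \<sigma> (x * y) = \<phi> \<sigma> x * \<phi> \<sigma> y \<and> \<phi> \<sigma> 1 = 1 \<and>
      \<phi> \<sigma> (fps_const c * x) = fps_const c * \<phi> \<sigma> x \<and> bij (\<phi> \<sigma>)"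
    if "\<sigma> \<in> carrier G" for \<sigma> x y c
    using A[OF that, unfolded fps_Aut_def ring_iso_def Ring.ring_hom_def, simplified] by blast
  show "\<phi> \<sigma> (f + g) = \<phi> \<sigma> f + \<phi> \<sigma> g" "\<phi> \<sigma> (f * g) = \<phi> \<sigma> f * \<phi> \<sigma> g" if "\<sigma> \<in> carrier G" for \<sigma> f g
    using R[OF that] by blast+
  show "\<phi> \<sigma> (fps_const c) = fps_const c" if "\<sigma> \<in> carrier G" for \<sigma> c
    using R[OF that, of 1 1 c] by simp
  show m: "\<phi> (\<sigma> \<otimes> \<tau>) f = \<phi> \<sigma> (\<phi> \<tau> f)" if "\<sigma> \<in> carrier G" "\<tau> \<in> carrier G" for \<sigma> \<tau> f
    using hom_mult[OF h that] by (simp add: fps_Aut_def)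
  show one: "\<phi> \<one> f = f" for f
  proof -
    have "inj (\<phi> \<one>)" using R[OF one_closed] by (blast intro: bij_is_inj)
    moreover have "\<phi> \<one> (\<phi> \<one> f) = \<phi> \<one> f" using m[of \<one> \<one> f] by simp
    ultimately show ?thesis by (rule injD)
  qed
  show "\<sigma> = \<one>" if s: "\<sigma> \<in> carrier G" "\<And>f. \<phi> \<sigma> f = f" for \<sigma>
  proof (rule inj_onD[OF inj _ s(1) one_closed])
    show "\<phi> \<sigma> = \<phi> \<one>" by (rule ext) (simp add: s(2) one)
  qed
qed

theorem theorem4p2:
  fixes G :: "('g, 'm) monoid_scheme"
    and p :: nat
    and \<phi> :: "'g \<Rightarrow> 'k::alg_closed_field fps \<Rightarrow> 'k fps"
  assumes "CHAR('k) = p" and "p > 0"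
    and "group G" and "finite (carrier G)" and "carrier G \<noteq> {\<one>\<^bsub>G\<^esub>}"
    and "local_action G \<phi>"
    and "lifts_to_char_0 TYPE('r::comm_ring_1) G \<phi>"
  shows "\<exists>\<T> :: (nat, 'g) hurwitz_datum. hurwitz_tree G p \<T> \<and>
           (\<forall>\<sigma>\<in>carrier G. tree_artin \<T> \<sigma> = artin_char G \<phi> \<sigma>) \<and>
           (\<forall>\<sigma>\<in>carrier G. tree_depth \<T> \<sigma> = 0)"
proof -
  have dv: "discrete_valuation_ring (type_ring TYPE('r))" and c0: "CHAR('r) = 0"
    using assms(7) by (auto simp: lifts_to_char_0_def)
  obtain \<rho> :: "'r \<Rightarrow> 'k" and \<psi> :: "'g \<Rightarrow> 'r fps \<Rightarrow> 'r fps" where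
      rh: "\<rho> \<in> Ring.ring_hom (type_ring TYPE('r)) (type_ring TYPE('k))" "surj \<rho>"
      and ps: "faithful_fps_action G \<psi>"
      and red: "\<And>\<sigma> f. \<sigma> \<in> carrier G \<Longrightarrow> Abs_fps (\<rho> \<circ> fps_nth (\<psi> \<sigma> f)) = \<phi> \<sigma> (Abs_fps (\<rho> \<circ> fps_nth f))"
    using assms(7) unfolding lifts_to_char_0_def by blast
  have rho: "\<rho> (a + b) = \<rho> a + \<rho> b" "\<rho> (a * b) = \<rho> a * \<rho> b" "\<rho> 1 = 1" for a b
    using rh(1) by (simp_all add: Ring.ring_hom_def)
  have "dvr_ring (unif :: 'r)" unfolding unif_def using dvr_ring_exists[OF dv] by (rule someI_ex)
  then interpret dvr_completion "unif :: 'r" by (simp add: dvr_completion_def dvr_completion_axioms_def)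
  have pr: "prime p" using assms(1,2) prime_CHAR_semidom[where ?'a = 'k] by simp
  have rho0: "\<rho> 0 = 0" by (rule additive_zero) (rule rho(1))
  have rho_nat: "\<rho> (of_nat n) = of_nat n" for n by (induction n) (simp_all add: rho0 rho)
  have rp: "\<rho> (of_nat p) = 0" using of_nat_CHAR[where ?'a = 'k] assms(1) by (simp add: rho_nat)
  have nz: "of_nat n \<noteq> (0::'r)" if "n > 0" for n using that c0 by (simp add: of_nat_eq_0_iff_char_dvd)
  have unit_nz: "\<rho> u \<noteq> 0" if u: "u dvd 1" for u
  proof
    assume z: "\<rho> u = 0"
    obtain w where "1 = u * w" using u by (rule dvdE)
    then have "\<rho> 1 = \<rho> u * \<rho> w" using rho(2) by metis
    then show False using z rho(3) by simp
  qed
  have rho_pow: "\<rho> (x ^ n) = \<rho> x ^ n" for x n by (induction n) (simp_all add: rho)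
  \<comment> \<open>In \<open>'r\<close> the number \<open>p\<close> is a unit times a power of the
    uniformizer. It vanishes in the residue field while units do not, so the uniformizer must vanish
    there as well.\<close>
  have ru: "\<rho> unif = 0"
  proof -
    obtain u n where u: "u dvd 1" "of_nat p = u * (unif :: 'r) ^ n" using pi_factor nz[OF assms(2)] by blast
    have "\<rho> u * \<rho> unif ^ n = 0" using rp unfolding u(2) rho(2) rho_pow .
    then show ?thesis using unit_nz[OF u(1)] by simp
  qed
  interpret lifted_action "unif :: 'r" G \<rho> \<phi> \<psi>
  proof (intro lifted_action.intro lifted_action_axioms.intro)
    show "dvr_completion (unif :: 'r)" by (rule dvr_completion_axioms)
    show "\<rho> c = 0 \<longleftrightarrow> unif dvd c" for c
    proof
      show "unif dvd c" if "\<rho> c = 0" using that unit_nz unit_or_pi by blast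
      show "\<rho> c = 0" if "unif dvd c" using that ru by (auto simp: rho elim!: dvdE)
    qed
  qed (fact assms(3,4) nz rho rh(2) red group.fps_action[OF assms(3) ps] group.fps_action[OF assms(3,6)])+
  show ?thesis by (rule hurwitz_tree_of_lift[OF assms(5) pr rp])
qed

end
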